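(* Let $\omega=e^{2\pi i/3}$, $E_\omega=\mathbb C/(\mathbb Z+\omega\mathbb Z)$, $X=E_\omega\times E_\omega$, $\Omega=dz_1\wedge dz_2$, and let $\widehat G=\langle r,\tau\rangle$ (of order six) act on $X$ by $r(z_1,z_2)=(\omega z_1,\omega^{-1}z_2)$ and $\tau(z_1,z_2)=(-\overline z_1,-\overline z_2)$. With orbit-sum normalization, the centralizer-invariant orientifold state space $H^*_{\mathrm{Ori}}(X,\widehat G)$ has dimension $16$, with basis $$1,\ \Theta,\ q,\quad \{U_p\}_{p\in F},\quad E,A,B,T .$$ It is an associative algebra. Apart from the unit and products forced to vanish by degree or sector support, the multiplication is $$\Theta^2=6q,\qquad U_pU_{p'}=2\delta_{p,p'}q,\qquad E^2=3(W-\Theta),$$ $$\Theta E=E\Theta=-6T,\qquad U_pE=EU_p=2T,\qquad ET=TE=3q,\qquad AB=3q,\quad BA=-3q.$$ Moreover $EA=AE=EB=BE=A^2=B^2=0$ and $\Theta U_p=\Theta A=\Theta B=\Theta T=U_pA=U_pB=U_pT=0$. The trace is determined by $\operatorname{Tr}(q)=1$ and vanishes on the remaining basis elements. The corresponding invariant pairing $\langle\alpha,\beta\rangle=\operatorname{Tr}(\alpha\beta)$ is nondegenerate, with basic nonzero values $$\langle1,q\rangle=\langle q,1\rangle=1,\quad\langle\Theta,\Theta\rangle=6,\quad\langle U_p,U_{p'}\rangle=2\delta_{p,p'},\quad\langle E,T\rangle=\langle T,E\rangle=3,\quad\langle A,B\rangle=3,\ \langle B,A\rangle=-3.$$ Thus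 the algebra is Frobenius but is not graded-commutative with respect to the shifted sector grading.
   Context: Group-labelled algebra. $X$ carries the flat Kähler form. $G=\langle r\rangle\cong\mathbb Z/3$ consists of the even elements, and $s_i=r^i\tau$ ($i=0,1,2$) are the odd elements, which are involutions. Put $L_i=X^{s_i}$ (a two-torus), oriented by $\operatorname{Re}\Omega|_{L_i}>0$; even fixed loci carry the complex orientation. The group-labelled space is, in shifted degree $k$, $\widetilde H^k=H^k(X;\mathbb R)\oplus\bigoplus_{j=1,2}H^{k-2}(X^{r^j};\mathbb R)\oplus\bigoplus_{i=0}^2H^{k-1}(L_i;\mathbb R)$. For $\alpha\in H^*(X^\gamma)$, $\beta\in H^*(X^\delta)$, with $V=X^\gamma\cap X^\delta$, inclusions $e_1,e_2$ into $X^\gamma,X^\delta$ and $m:V\hookrightarrow X^{\gamma\delta}$: if some label is odd, $\alpha\star\beta=m_*(e_1^*\alpha\wedge e_2^*\beta)$ (oriented Gysin map); if both labels are even, $\alpha\star\beta=m_*(e_1^*\alpha\wedge e_2^*\beta\wedge e(E_{\gamma,\delta}))$ is the Chen--Hu product, where $E_{\gamma,\delta}$ is the sum of the simultaneous eigenbundles of the normal bundle of $V$ in $X$ on which $\gamma,\delta$ have weights $a,b\in[0,1)$ (eigenvalues $e^{2\pi ia},e^{2\pi ib}$) with $a+b>1$. $\widehat G$ acts by transporting classes on $X^\gamma$ to $X^{k\gamma k^{-1}}$ along $k$. $H^*_{\mathrm{Ori}}(X,\widehat G)=(\widetilde H^* )^{\widehat G}$ with the induced product (written by juxtaposition); it is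 identified by orbit sums with the direct sum over conjugacy classes of the centralizer-invariant sector cohomologies. This fixes the orbit-sum normalization. Notation. $F=X^r=X^{r^2}$, a set of nine points. For $p\in F$, $u_{1,p}\in H^0(X^r)$ and $u_{2,p}\in H^0(X^{r^2})$ are the unit classes of the point $p$; $U_p=u_{1,p}+u_{2,p}$ and $W=\sum_{p\in F}U_p$. Writing $z_k=x_k+y_k\omega$ with $x_k,y_k\in\mathbb R/\mathbb Z$, let $x_1,y_1,x_2,y_2\in H^1(X;\mathbb Z)$ be the classes of $dx_1,dy_1,dx_2,dy_2$; $q=x_1y_1x_2y_2\in H^4(X)$, $\int_Xq=1$; $\Theta=-2x_1x_2+x_1y_2+y_1x_2+y_1y_2$. Let $e_i=1\in H^0(L_i)$; choose an oriented basis $a_0,b_0$ of $H^1(L_0;\mathbb Z)$ with $\int_{L_0}a_0\wedge b_0=1$ and transport it by the $\widehat G$-action to $a_i,b_i\in H^1(L_i;\mathbb Z)$; $t_i=a_i\wedge b_i$. Then $E=\sum_ie_i$, $A=\sum_ia_i$, $B=\sum_ib_i$, $T=\sum_it_i$. Shifted degrees: $|1|=0$, $|\Theta|=|U_p|=|A|=|B|=2$, $|q|=4$, $|E|=1$, $|T|=3$. *)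

theory Defs
  imports "HOL-Analysis.Analysis"
begin

section \<open>The torus and the group\<close>

type_synonym vec = "complex \<times> complex"

definition \<omega> :: complex where
  "\<omega> = cis (2 * pi / 3)"

definition \<Lambda> :: "vec set" where
  "\<Lambda> = {(of_int a + of_int b * \<omega>, of_int c + of_int d * \<omega>) | a b c d. True}"

definition lattice_rel :: "(vec \<times> vec) set" where
  "lattice_rel = {(z, w). w - z \<in> \<Lambda>}"

text \<open>Points of the torus are the lattice cosets. For a set \<open>M\<close> of points, \<open>\<Union> M\<close> is its
  preimage in the universal cover.\<close>

type_synonym point = "vec set"

definition X :: "point set" where
  "X = UNIV // lattice_rel"

definition rot :: "vec \<Rightarrow> vec" where
  "rot z = (\<omega> * fst z, inverse \<omega> * snd z)"

definition refl :: "vec \<Rightarrow> vec" where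
  "refl z = (- cnj (fst z), - cnj (snd z))"

text \<open>The group generated by \<open>rot\<close> and \<open>refl\<close>, as real-linear maps of the universal cover; both
  generators have finite order, so closing under composition suffices.\<close>

inductive_set Ghat :: "(vec \<Rightarrow> vec) set" where
  one: "id \<in> Ghat"
| rot: "g \<in> Ghat \<Longrightarrow> rot \<circ> g \<in> Ghat"
| refl: "g \<in> Ghat \<Longrightarrow> refl \<circ> g \<in> Ghat"

definition Geven :: "(vec \<Rightarrow> vec) set" where
  "Geven = {rot ^^ n | n. True}"

definition s :: "nat \<Rightarrow> vec \<Rightarrow> vec" where
  "s i = (rot ^^ i) \<circ> refl"

definition Fix :: "(vec \<Rightarrow> vec) \<Rightarrow> point set" where
  "Fix g = {P \<in> X. g ` P = P}"

section \<open>Differential forms\<close>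

text \<open>An inhomogeneous differential form on the universal cover: its degree \<open>k\<close> component at \<open>z\<close>
  is the restriction of \<open>\<alpha> z\<close> to lists of length \<open>k\<close>.\<close>

type_synonym form = "vec \<Rightarrow> vec list \<Rightarrow> real"

fun Ck :: "nat \<Rightarrow> (vec \<Rightarrow> real) \<Rightarrow> bool" where
  "Ck 0 f = continuous_on UNIV f"
| "Ck (Suc n) f = ((\<forall>z. f differentiable (at z)) \<and> (\<forall>v. Ck n (\<lambda>z. frechet_derivative f (at z) v)))"

definition smooth :: "(vec \<Rightarrow> real) \<Rightarrow> bool" where
  "smooth f \<longleftrightarrow> (\<forall>n. Ck n f)"

definition alt_multilinear :: "(vec list \<Rightarrow> real) \<Rightarrow> bool" where
  "alt_multilinear a \<longleftrightarrow>
     (\<forall>us ws. linear (\<lambda>v. a (us @ v # ws))) \<and>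
     (\<forall>us v ws xs. a (us @ v # ws @ v # xs) = 0)"

text \<open>Smooth forms on \<open>X\<close>, as lattice-periodic smooth forms on the universal cover.\<close>

definition is_form :: "form \<Rightarrow> bool" where
  "is_form \<alpha> \<longleftrightarrow> (\<forall>vs. smooth (\<lambda>z. \<alpha> z vs)) \<and> (\<forall>z. alt_multilinear (\<alpha> z)) \<and>
     (\<forall>z. \<forall>l\<in>\<Lambda>. \<alpha> (z + l) = \<alpha> z)"

definition ext_d :: "form \<Rightarrow> form" where
  "ext_d \<alpha> = (\<lambda>z vs. \<Sum>i<length vs.
     (-1) ^ i * frechet_derivative (\<lambda>w. \<alpha> w (take i vs @ drop (Suc i) vs)) (at z) (vs ! i))"

text \<open>The exterior product, in the determinant convention \<open>(a \<and> b)(v,w) = a v * b w - a w * b v\<close>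
  (the sum over shuffles), computed by the rule that contraction with a vector is an
  antiderivation.\<close>

fun alt_wedge :: "(vec list \<Rightarrow> real) \<Rightarrow> (vec list \<Rightarrow> real) \<Rightarrow> vec list \<Rightarrow> real" where
  "alt_wedge a b [] = a [] * b []"
| "alt_wedge a b (v # vs) =
     alt_wedge (\<lambda>us. a (v # us)) b vs +
     alt_wedge (\<lambda>us. (-1) ^ length us * a us) (\<lambda>us. b (v # us)) vs"

definition wedge :: "form \<Rightarrow> form \<Rightarrow> form" (infixl \<open>\<wedge>\<close> 70) where
  "\<alpha> \<wedge> \<beta> = (\<lambda>z. alt_wedge (\<alpha> z) (\<beta> z))"

definition add_form :: "form \<Rightarrow> form \<Rightarrow> form" where
  "add_form \<alpha> \<beta> = (\<lambda>z vs. \<alpha> z vs + \<beta> z vs)"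

definition scale_form :: "real \<Rightarrow> form \<Rightarrow> form" where
  "scale_form c \<alpha> = (\<lambda>z vs. c * \<alpha> z vs)"

definition zero_form :: form where
  "zero_form = (\<lambda>z vs. 0)"

definition one_form :: form where \<comment> \<open>the constant function \<open>1\<close>\<close>
  "one_form = (\<lambda>z vs. if vs = [] then 1 else 0)"

definition covec :: "(vec \<Rightarrow> real) \<Rightarrow> form" where
  "covec f = (\<lambda>z vs. case vs of [v] \<Rightarrow> f v | _ \<Rightarrow> 0)"

definition homogeneous :: "nat \<Rightarrow> form \<Rightarrow> bool" where
  "homogeneous k \<alpha> \<longleftrightarrow> (\<forall>z vs. length vs \<noteq> k \<longrightarrow> \<alpha> z vs = 0)"

definition pullback :: "(vec \<Rightarrow> vec) \<Rightarrow> form \<Rightarrow> form" where \<comment> \<open>along a real-linear map\<close>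
  "pullback g \<alpha> = (\<lambda>z vs. \<alpha> (g z) (map g vs))"

section \<open>De Rham cohomology of flat submanifolds\<close>

text \<open>Every submanifold \<open>M\<close> below is a finite disjoint union of translates of subtori, so its
  tangent vectors are the velocities of the straight segments in it. As \<open>M\<close> is closed, every
  form on \<open>M\<close> is the restriction of a form on \<open>X\<close>; the de Rham complex of \<open>M\<close> is thus
  the complex of forms on \<open>X\<close>, with two forms identified when they agree at points of \<open>M\<close> on
  vectors tangent to \<open>M\<close>. Restriction to a smaller submanifold is the identity on
  representatives.\<close>

definition tangent :: "point set \<Rightarrow> vec \<Rightarrow> vec set" where
  "tangent M z = {v. \<exists>e>0. \<forall>t::real. \<bar>t\<bar> < e \<longrightarrow> z + t *\<^sub>R v \<in> \<Union> M}"

definition eq_on :: "point set \<Rightarrow> form \<Rightarrow> form \<Rightarrow> bool" where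
  "eq_on M \<alpha> \<beta> \<longleftrightarrow> (\<forall>z \<in> \<Union> M. \<forall>vs. set vs \<subseteq> tangent M z \<longrightarrow> \<alpha> z vs = \<beta> z vs)"

definition closed_on :: "point set \<Rightarrow> form \<Rightarrow> bool" where
  "closed_on M \<alpha> \<longleftrightarrow> is_form \<alpha> \<and> eq_on M (ext_d \<alpha>) zero_form"

definition cohomologous :: "point set \<Rightarrow> form \<Rightarrow> form \<Rightarrow> bool" where
  "cohomologous M \<alpha> \<beta> \<longleftrightarrow> closed_on M \<alpha> \<and> closed_on M \<beta> \<and>
     (\<exists>\<eta>. is_form \<eta> \<and> eq_on M \<alpha> (add_form \<beta> (ext_d \<eta>)))"

lemma Ck_const: "Ck n (\<lambda>z. c)"
  by (induction n arbitrary: c) (auto simp: frechet_derivative_const)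

lemma has_derivative_lincomb:
  fixes f g :: "vec \<Rightarrow> real"
  assumes "f differentiable (at z)" "g differentiable (at z)"
  shows "((\<lambda>z. a * f z + b * g z) has_derivative
      (\<lambda>v. a * frechet_derivative f (at z) v + b * frechet_derivative g (at z) v)) (at z)"
  using assms by (intro has_derivative_add has_derivative_mult_right)
    (simp_all add: frechet_derivative_works)

lemma Ck_lincomb:
  "Ck n f \<Longrightarrow> Ck n g \<Longrightarrow> Ck n (\<lambda>z. a * f z + b * g z)"
proof (induction n arbitrary: f g)
  case 0
  then show ?case by (simp add: continuous_on_add continuous_on_mult_left)
next
  case (Suc n)
  have D: "((\<lambda>z. a * f z + b * g z) has_derivative
      (\<lambda>v. a * frechet_derivative f (at z) v + b * frechet_derivative g (at z) v)) (at z)" for z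
    using Suc.prems by (intro has_derivative_lincomb) (simp_all del: split_paired_All)
  have "Ck n (\<lambda>z. a * frechet_derivative f (at z) v + b * frechet_derivative g (at z) v)" for v
    using Suc.prems by (intro Suc.IH) (simp_all del: split_paired_All)
  moreover have "(\<lambda>z. a * f z + b * g z) differentiable (at z)" for z
    by (rule differentiableI[OF D])
  ultimately show ?case
    by (simp add: frechet_derivative_at[OF D, symmetric] del: split_paired_All)
qed

lemma is_form_zero: "is_form zero_form"
  unfolding is_form_def zero_form_def smooth_def alt_multilinear_def
  by (auto simp: Ck_const linear_zero)

lemma is_form_lincomb:
  assumes "is_form \<alpha>" "is_form \<beta>"
  shows "is_form (\<lambda>z vs. a * \<alpha> z vs + b * \<beta> z vs)"
proof -
  have lin: "linear (\<lambda>v. a * f v + b * g v)" if "linear f" "linear g" for f g :: "vec \<Rightarrow> real"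
    using linear_compose_add[OF linear_compose_scale_right linear_compose_scale_right,
        of f g a b] that by simp
  show ?thesis
    using assms unfolding is_form_def smooth_def alt_multilinear_def
    by (auto intro!: Ck_lincomb lin simp: fun_eq_iff simp del: split_paired_All)
qed

lemma ext_d_lincomb:
  assumes "is_form \<alpha>" "is_form \<beta>"
  shows "ext_d (\<lambda>z vs. a * \<alpha> z vs + b * \<beta> z vs) = (\<lambda>z vs. a * ext_d \<alpha> z vs + b * ext_d \<beta> z vs)"
proof -
  have diff: "(\<lambda>z. \<gamma> z vs) differentiable (at z)" if "is_form \<gamma>" for \<gamma> vs z
    using that unfolding is_form_def smooth_def by (metis Ck.simps(2))
  have "frechet_derivative (\<lambda>z. a * \<alpha> z vs + b * \<beta> z vs) (at z) =
      (\<lambda>v. a * frechet_derivative (\<lambda>z. \<alpha> z vs) (at z) v +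
           b * frechet_derivative (\<lambda>z. \<beta> z vs) (at z) v)" for vs z
    by (intro frechet_derivative_at[symmetric] has_derivative_lincomb diff assms)
  then show ?thesis
    by (intro ext) (simp add: ext_d_def distrib_left mult.left_commute sum.distrib sum_distrib_left)
qed

lemma ext_d_zero: "ext_d zero_form = zero_form"
  using ext_d_lincomb[OF is_form_zero is_form_zero, of 0 0] by (simp add: zero_form_def)

lemma closed_on_lincomb:
  "closed_on M \<alpha> \<Longrightarrow> closed_on M \<beta> \<Longrightarrow> closed_on M (\<lambda>z vs. a * \<alpha> z vs + b * \<beta> z vs)"
  unfolding closed_on_def eq_on_def
  by (auto simp: is_form_lincomb ext_d_lincomb zero_form_def)

lemma closed_on_zero: "closed_on M zero_form"
  by (simp add: closed_on_def is_form_zero ext_d_zero eq_on_def)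

lemma cohomologous_refl: "closed_on M \<alpha> \<Longrightarrow> cohomologous M \<alpha> \<alpha>"
  unfolding cohomologous_def
  by (intro conjI exI[of _ zero_form]) (auto simp: is_form_zero ext_d_zero eq_on_def add_form_def, simp add: zero_form_def)

lemma cohomologousI:
  assumes "closed_on M \<alpha>" "closed_on M \<beta>" "is_form \<eta>"
    "\<And>z vs. z \<in> \<Union> M \<Longrightarrow> set vs \<subseteq> tangent M z \<Longrightarrow> \<alpha> z vs = \<beta> z vs + ext_d \<eta> z vs"
  shows "cohomologous M \<alpha> \<beta>"
  unfolding cohomologous_def eq_on_def add_form_def using assms by blast

lemma cohomologousE:
  assumes "cohomologous M \<alpha> \<beta>"
  obtains \<eta> where "closed_on M \<alpha>" "closed_on M \<beta>" "is_form \<eta>"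
    "\<And>z vs. z \<in> \<Union> M \<Longrightarrow> set vs \<subseteq> tangent M z \<Longrightarrow> \<alpha> z vs = \<beta> z vs + ext_d \<eta> z vs"
  using assms unfolding cohomologous_def eq_on_def add_form_def by blast

lemma cohomologous_lincomb:
  assumes "cohomologous M \<alpha> \<alpha>'" "cohomologous M \<beta> \<beta>'"
  shows "cohomologous M (\<lambda>z vs. a * \<alpha> z vs + b * \<beta> z vs) (\<lambda>z vs. a * \<alpha>' z vs + b * \<beta>' z vs)"
proof -
  obtain \<eta> where \<eta>: "closed_on M \<alpha>" "closed_on M \<alpha>'" "is_form \<eta>"
    "\<And>z vs. z \<in> \<Union> M \<Longrightarrow> set vs \<subseteq> tangent M z \<Longrightarrow> \<alpha> z vs = \<alpha>' z vs + ext_d \<eta> z vs"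
    using assms(1) by (rule cohomologousE) blast
  obtain \<theta> where \<theta>: "closed_on M \<beta>" "closed_on M \<beta>'" "is_form \<theta>"
    "\<And>z vs. z \<in> \<Union> M \<Longrightarrow> set vs \<subseteq> tangent M z \<Longrightarrow> \<beta> z vs = \<beta>' z vs + ext_d \<theta> z vs"
    using assms(2) by (rule cohomologousE) blast
  show ?thesis
  proof (rule cohomologousI[OF closed_on_lincomb closed_on_lincomb is_form_lincomb])
    fix z vs assume "z \<in> \<Union> M" "set vs \<subseteq> tangent M z"
    then show "a * \<alpha> z vs + b * \<beta> z vs = a * \<alpha>' z vs + b * \<beta>' z vs +
        ext_d (\<lambda>z vs. a * \<eta> z vs + b * \<theta> z vs) z vs"
      by (simp add: ext_d_lincomb[OF \<eta>(3) \<theta>(3)] \<eta>(4) \<theta>(4) algebra_simps del: Union_iff)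
  qed (rule \<eta> \<theta>)+
qed

lemma cohomologous_sym:
  assumes "cohomologous M \<alpha> \<beta>" shows "cohomologous M \<beta> \<alpha>"
proof -
  obtain \<eta> where \<eta>: "closed_on M \<alpha>" "closed_on M \<beta>" "is_form \<eta>"
    "\<And>z vs. z \<in> \<Union> M \<Longrightarrow> set vs \<subseteq> tangent M z \<Longrightarrow> \<alpha> z vs = \<beta> z vs + ext_d \<eta> z vs"
    using assms by (rule cohomologousE) blast
  show ?thesis
  proof (rule cohomologousI[OF \<eta>(2,1) is_form_lincomb[OF \<eta>(3,3)]])
    fix z vs assume "z \<in> \<Union> M" "set vs \<subseteq> tangent M z"
    then show "\<beta> z vs = \<alpha> z vs + ext_d (\<lambda>z vs. (-1) * \<eta> z vs + 0 * \<eta> z vs) z vs"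
      by (simp only: ext_d_lincomb[OF \<eta>(3,3)] \<eta>(4))
  qed
qed

lemma cohomologous_trans:
  assumes "cohomologous M \<alpha> \<beta>" "cohomologous M \<beta> \<gamma>" shows "cohomologous M \<alpha> \<gamma>"
proof -
  obtain \<eta> where \<eta>: "closed_on M \<alpha>" "closed_on M \<beta>" "is_form \<eta>"
    "\<And>z vs. z \<in> \<Union> M \<Longrightarrow> set vs \<subseteq> tangent M z \<Longrightarrow> \<alpha> z vs = \<beta> z vs + ext_d \<eta> z vs"
    using assms(1) by (rule cohomologousE) blast
  obtain \<theta> where \<theta>: "closed_on M \<beta>" "closed_on M \<gamma>" "is_form \<theta>"
    "\<And>z vs. z \<in> \<Union> M \<Longrightarrow> set vs \<subseteq> tangent M z \<Longrightarrow> \<beta> z vs = \<gamma> z vs + ext_d \<theta> z vs"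
    using assms(2) by (rule cohomologousE) blast
  show ?thesis
  proof (rule cohomologousI[OF \<eta>(1) \<theta>(2) is_form_lincomb[OF \<eta>(3) \<theta>(3)]])
    fix z vs assume "z \<in> \<Union> M" "set vs \<subseteq> tangent M z"
    then show "\<alpha> z vs = \<gamma> z vs + ext_d (\<lambda>z vs. 1 * \<eta> z vs + 1 * \<theta> z vs) z vs"
      by (simp only: ext_d_lincomb[OF \<eta>(3) \<theta>(3)] \<eta>(4) \<theta>(4))
  qed
qed

section \<open>Integration and Gysin maps\<close>

text \<open>\<open>Re \<Omega>\<close> for \<open>\<Omega> = dz\<^sub>1 \<and> dz\<^sub>2\<close>.\<close>

definition Re_Omega :: "vec \<Rightarrow> vec \<Rightarrow> real" where
  "Re_Omega v w = Re (fst v * snd w - snd v * fst w)"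

text \<open>Orientations: fixed loci of odd elements have dimension two and are oriented by \<open>Re \<Omega>\<close>;
  fixed loci of even elements have dimension zero or four and carry the complex orientation.\<close>

definition pos_oriented :: "vec list \<Rightarrow> bool" where
  "pos_oriented vs \<longleftrightarrow>
     (length vs = 2 \<longrightarrow> Re_Omega (vs ! 0) (vs ! 1) > 0) \<and>
     (length vs = 4 \<longrightarrow>
        (covec (\<lambda>v. Re (fst v)) \<wedge> covec (\<lambda>v. Im (fst v)) \<wedge>
         covec (\<lambda>v. Re (snd v)) \<wedge> covec (\<lambda>v. Im (snd v))) 0 vs > 0)"

text \<open>A positively oriented integral basis of the lattice of the component of \<open>M\<close> through \<open>z\<close>.\<close>

definition oriented_frame :: "point set \<Rightarrow> vec \<Rightarrow> vec list \<Rightarrow> bool" where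
  "oriented_frame M z vs \<longleftrightarrow>
     distinct vs \<and> independent (set vs) \<and> span (set vs) = tangent M z \<and>
     {\<Sum>i<length vs. of_int (n i) *\<^sub>R vs ! i | n :: nat \<Rightarrow> int. True} = \<Lambda> \<inter> tangent M z \<and>
     pos_oriented vs"

definition component :: "point set \<Rightarrow> point \<Rightarrow> point set" where
  "component M P = {lattice_rel `` {z + v} | z v. z \<in> P \<and> v \<in> tangent M z}"

fun cell_integral :: "(vec \<Rightarrow> real) \<Rightarrow> vec \<Rightarrow> vec list \<Rightarrow> real" where
  "cell_integral f z [] = f z"
| "cell_integral f z (v # vs) = integral {0..1} (\<lambda>t::real. cell_integral f (z + t *\<^sub>R v) vs)"

definition integral_over :: "point set \<Rightarrow> form \<Rightarrow> real" where
  "integral_over M \<alpha> = (\<Sum>C \<in> component M ` M.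
     (let z = SOME z. z \<in> \<Union> C; vs = SOME vs. oriented_frame M z vs
      in cell_integral (\<lambda>w. \<alpha> w vs) z vs))"

text \<open>A representative of the Gysin image of \<open>\<alpha>\<close> under \<open>V \<hookrightarrow> Y\<close>; by Poincare duality on \<open>Y\<close>
  its cohomology class is determined.\<close>

definition gysin :: "point set \<Rightarrow> point set \<Rightarrow> form \<Rightarrow> form" where
  "gysin V Y \<alpha> = (SOME \<beta>. closed_on Y \<beta> \<and>
     (\<forall>\<kappa>. closed_on Y \<kappa> \<longrightarrow> integral_over Y (\<beta> \<wedge> \<kappa>) = integral_over V (\<alpha> \<wedge> \<kappa>)))"

section \<open>The group-labelled space\<close>

definition sector_equiv ::
    "((vec \<Rightarrow> vec) \<Rightarrow> form) \<Rightarrow> ((vec \<Rightarrow> vec) \<Rightarrow> form) \<Rightarrow> bool" where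
  "sector_equiv \<phi> \<psi> \<longleftrightarrow> (\<forall>g\<in>Ghat. cohomologous (Fix g) (\<phi> g) (\<psi> g))"

text \<open>The direct sum of the cohomologies of all fixed loci \<open>Fix g\<close>, \<open>g \<in> Ghat\<close>; values of a family
  at labels outside \<open>Ghat\<close> are irrelevant.\<close>

quotient_type labelled = "(vec \<Rightarrow> vec) \<Rightarrow> form" / partial: sector_equiv
proof (rule part_equivpI)
  show "\<exists>\<phi>. sector_equiv \<phi> \<phi>"
    by (rule exI[of _ "\<lambda>_. zero_form"])
      (simp add: sector_equiv_def cohomologous_refl closed_on_zero)
  show "symp sector_equiv"
    by (auto intro!: sympI simp: sector_equiv_def cohomologous_sym)
  show "transp sector_equiv"
    by (rule transpI) (meson sector_equiv_def cohomologous_trans)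
qed

instantiation labelled :: real_vector
begin

lift_definition zero_labelled :: labelled is "\<lambda>g z vs. 0"
  using closed_on_zero by (simp add: sector_equiv_def cohomologous_refl zero_form_def)

lift_definition plus_labelled :: "labelled \<Rightarrow> labelled \<Rightarrow> labelled"
  is "\<lambda>\<phi> \<psi> g z vs. \<phi> g z vs + \<psi> g z vs"
  unfolding sector_equiv_def using cohomologous_lincomb[where a = 1 and b = 1] by simp

lift_definition minus_labelled :: "labelled \<Rightarrow> labelled \<Rightarrow> labelled"
  is "\<lambda>\<phi> \<psi> g z vs. \<phi> g z vs - \<psi> g z vs"
  unfolding sector_equiv_def using cohomologous_lincomb[where a = 1 and b = "-1"] by simp

lift_definition uminus_labelled :: "labelled \<Rightarrow> labelled"
  is "\<lambda>\<phi> g z vs. - \<phi> g z vs"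
  unfolding sector_equiv_def
  using cohomologous_lincomb[where a = "-1" and b = 0] by fastforce

lift_definition scaleR_labelled :: "real \<Rightarrow> labelled \<Rightarrow> labelled"
  is "\<lambda>c \<phi> g z vs. c * \<phi> g z vs"
  unfolding sector_equiv_def
  subgoal for c \<phi> \<psi> using cohomologous_lincomb[where a = c and b = 0] by fastforce
  done

instance
proof
  fix x y w :: labelled
  have R: "sector_equiv \<phi> \<psi>" if "sector_equiv \<rho> \<rho>" "\<phi> = \<rho>" "\<psi> = \<rho>" for \<phi> \<psi> \<rho>
    using that by simp
  have L2: "sector_equiv (\<lambda>g z vs. a * \<phi> g z vs + b * \<psi> g z vs)
      (\<lambda>g z vs. a * \<phi> g z vs + b * \<psi> g z vs)"
    if "sector_equiv \<phi> \<phi>" "sector_equiv \<psi> \<psi>" for \<phi> \<psi> a b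
    using that unfolding sector_equiv_def by (auto intro: cohomologous_lincomb)
  have L3: "sector_equiv (\<lambda>g z vs. \<phi> g z vs + \<psi> g z vs + \<rho> g z vs)
      (\<lambda>g z vs. \<phi> g z vs + \<psi> g z vs + \<rho> g z vs)"
    if "sector_equiv \<phi> \<phi>" "sector_equiv \<psi> \<psi>" "sector_equiv \<rho> \<rho>" for \<phi> \<psi> \<rho>
    using L2[where a = 1 and b = 1, OF L2[where a = 1 and b = 1, OF that(1,2)] that(3)] by simp
  show "x + y + w = x + (y + w)"
    by transfer (erule (2) R[OF L3], simp_all add: fun_eq_iff)
  show "x + y = y + x"
    by transfer (erule (1) R[OF L2[where a = 1 and b = 1]], simp_all add: fun_eq_iff)
  show "0 + x = x"
    by transfer simp
  show "- x + x = 0"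
    by transfer (use closed_on_zero in
        \<open>simp add: sector_equiv_def cohomologous_refl zero_form_def\<close>)
  show "x - y = x + - y"
    by transfer (erule (1) R[OF L2[where a = 1 and b = "-1"]], simp_all add: fun_eq_iff)
  show "a *\<^sub>R (x + y) = a *\<^sub>R x + a *\<^sub>R y" for a
    apply transfer
    subgoal for a \<phi> \<psi>
      by (rule R[OF L2[where a = a and b = a and \<phi> = \<phi> and \<psi> = \<psi>]])
        (simp_all add: fun_eq_iff distrib_left)
    done
  show "(a + b) *\<^sub>R x = a *\<^sub>R x + b *\<^sub>R x" for a b
    apply transfer
    subgoal for a b \<phi>
      by (rule R[OF L2[where a = a and b = b and \<phi> = \<phi> and \<psi> = \<phi>]])
        (simp_all add: fun_eq_iff distrib_right)
    done
  show "a *\<^sub>R b *\<^sub>R x = (a * b) *\<^sub>R x" for a b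
    apply transfer
    subgoal for a b \<phi>
      by (rule R[OF L2[where a = "a * b" and b = 0 and \<phi> = \<phi> and \<psi> = \<phi>]])
        (simp_all add: fun_eq_iff)
    done
  show "1 *\<^sub>R x = x"
    by transfer simp
qed

end

text \<open>The class of \<open>\<alpha>\<close> placed in the sector of \<open>g\<close>.\<close>

definition in_sector :: "(vec \<Rightarrow> vec) \<Rightarrow> form \<Rightarrow> labelled" where
  "in_sector g \<alpha> = abs_labelled (\<lambda>h. if h = g then \<alpha> else zero_form)"

definition shift :: "(vec \<Rightarrow> vec) \<Rightarrow> nat" where
  "shift g = (if g = id then 0 else if g \<in> Geven then 2 else 1)"

text \<open>The part of shifted degree \<open>k\<close>.\<close>

definition Hdeg :: "nat \<Rightarrow> labelled set" where
  "Hdeg k = {abs_labelled \<phi> | \<phi>. sector_equiv \<phi> \<phi> \<and>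
     (\<forall>g\<in>Ghat. if shift g \<le> k then homogeneous (k - shift g) (\<phi> g) else \<phi> g = zero_form)}"

text \<open>Transport along \<open>k\<close>, from \<open>Fix g\<close> to \<open>Fix (k \<circ> g \<circ> inv k)\<close>.\<close>

definition transport :: "(vec \<Rightarrow> vec) \<Rightarrow> form \<Rightarrow> form" where
  "transport k = pullback (inv k)"

definition act :: "(vec \<Rightarrow> vec) \<Rightarrow> labelled \<Rightarrow> labelled" where
  "act k \<xi> = abs_labelled (\<lambda>g. transport k (rep_labelled \<xi> (inv k \<circ> g \<circ> k)))"

definition H_Ori :: "labelled set" where
  "H_Ori = {\<xi>. \<forall>k\<in>Ghat. act k \<xi> = \<xi>}"

text \<open>The fibre of \<open>E\<^bsub>g,h\<^esub>\<close>. Since \<open>g\<close> and \<open>h\<close> are linear, the tangent and normal spaces of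
  \<open>Fix g \<inter> Fix h\<close>, and the eigenspaces in the latter, are the same at all points. The normal
  space is the orthogonal complement of the tangent space in the flat metric.\<close>

definition obstruction_fibre :: "(vec \<Rightarrow> vec) \<Rightarrow> (vec \<Rightarrow> vec) \<Rightarrow> vec set" where
  "obstruction_fibre g h = span {v.
     (\<forall>w. g w = w \<and> h w = w \<longrightarrow> orthogonal v w) \<and>
     (\<exists>a\<in>{0..<1}. \<exists>b\<in>{0..<1}. a + b > 1 \<and>
        g v = (cis (2 * pi * a) * fst v, cis (2 * pi * a) * snd v) \<and>
        h v = (cis (2 * pi * b) * fst v, cis (2 * pi * b) * snd v))}"

text \<open>The Euler form (for the flat connection) of the product bundle with fibre \<open>W\<close>: it is \<open>1\<close> in
  rank zero and vanishes in positive rank.\<close>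

definition euler_product_bundle :: "vec set \<Rightarrow> form" where
  "euler_product_bundle W = (if W = {0} then one_form else zero_form)"

definition excess :: "(vec \<Rightarrow> vec) \<Rightarrow> (vec \<Rightarrow> vec) \<Rightarrow> form" where
  "excess g h = (if g \<in> Geven \<and> h \<in> Geven then euler_product_bundle (obstruction_fibre g h)
     else one_form)"

text \<open>Wedge product, transport and Gysin map descend to cohomology, so the choice of
  representatives in \<open>act\<close> and \<open>star\<close> is immaterial.\<close>

definition star :: "labelled \<Rightarrow> labelled \<Rightarrow> labelled" (infixl \<open>\<star>\<close> 70) where
  "\<xi> \<star> \<eta> = abs_labelled (\<lambda>k z vs. \<Sum>(g, h) \<in> {(g, h). g \<in> Ghat \<and> h \<in> Ghat \<and> g \<circ> h = k}.
     gysin (Fix g \<inter> Fix h) (Fix k) (rep_labelled \<xi> g \<wedge> rep_labelled \<eta> h \<wedge> excess g h) z vs)"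

section \<open>The named classes\<close>

text \<open>The covectors of the real coordinates \<open>z\<^sub>k = x\<^sub>k + y\<^sub>k \<omega>\<close>, using
  \<open>\<omega> = -1/2 + (sqrt 3 / 2) \<i>\<close>.\<close>

definition ycoord :: "complex \<Rightarrow> real" where
  "ycoord z = Im z / Im \<omega>"

definition xcoord :: "complex \<Rightarrow> real" where
  "xcoord z = Re z - ycoord z * Re \<omega>"

definition dx1 :: form where "dx1 = covec (\<lambda>v. xcoord (fst v))"
definition dy1 :: form where "dy1 = covec (\<lambda>v. ycoord (fst v))"
definition dx2 :: form where "dx2 = covec (\<lambda>v. xcoord (snd v))"
definition dy2 :: form where "dy2 = covec (\<lambda>v. ycoord (snd v))"

definition unit_cls :: labelled where
  "unit_cls = in_sector id one_form"

definition q_cls :: labelled where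
  "q_cls = in_sector id (dx1 \<wedge> dy1 \<wedge> dx2 \<wedge> dy2)"

definition Theta_cls :: labelled where
  "Theta_cls = (-2) *\<^sub>R in_sector id (dx1 \<wedge> dx2) + in_sector id (dx1 \<wedge> dy2)
     + in_sector id (dy1 \<wedge> dx2) + in_sector id (dy1 \<wedge> dy2)"

definition F :: "point set" where
  "F = Fix rot"

text \<open>An extension to \<open>X\<close> of the function on \<open>F\<close> that is \<open>1\<close> at \<open>p\<close> and \<open>0\<close> elsewhere.\<close>

definition point_fun :: "point \<Rightarrow> form" where
  "point_fun p = (SOME \<alpha>. is_form \<alpha> \<and> homogeneous 0 \<alpha> \<and>
     (\<forall>p'\<in>F. \<forall>z\<in>p'. \<alpha> z [] = (if p' = p then 1 else 0)))"

definition u_cls :: "nat \<Rightarrow> point \<Rightarrow> labelled" where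
  "u_cls j p = in_sector (rot ^^ j) (point_fun p)"

definition U_cls :: "point \<Rightarrow> labelled" where
  "U_cls p = u_cls 1 p + u_cls 2 p"

definition W_cls :: labelled where
  "W_cls = (\<Sum>p\<in>F. U_cls p)"

definition L :: "nat \<Rightarrow> point set" where
  "L i = Fix (s i)"

definition e_cls :: "nat \<Rightarrow> labelled" where
  "e_cls i = in_sector (s i) one_form"

definition E_cls :: labelled where
  "E_cls = (\<Sum>i<3. e_cls i)"

text \<open>Closed one-forms on \<open>M\<close> with integral periods; every loop in \<open>M\<close> is homotopic to a straight
  one.\<close>

definition integral_H1 :: "point set \<Rightarrow> form \<Rightarrow> bool" where
  "integral_H1 M \<alpha> \<longleftrightarrow> closed_on M \<alpha> \<and> homogeneous 1 \<alpha> \<and>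
     (\<forall>z\<in>\<Union> M. \<forall>l \<in> \<Lambda> \<inter> tangent M z. integral {0..1} (\<lambda>t::real. \<alpha> (z + t *\<^sub>R l) [l]) \<in> \<int>)"

definition oriented_H1_basis :: "point set \<Rightarrow> form \<Rightarrow> form \<Rightarrow> bool" where
  "oriented_H1_basis M a b \<longleftrightarrow> integral_H1 M a \<and> integral_H1 M b \<and>
     (\<forall>\<alpha>. integral_H1 M \<alpha> \<longrightarrow> (\<exists>!mn :: int \<times> int. cohomologous M \<alpha>
        (add_form (scale_form (of_int (fst mn)) a) (scale_form (of_int (snd mn)) b)))) \<and>
     integral_over M (a \<wedge> b) = 1"

text \<open>Transport from \<open>L 0\<close> to \<open>L i\<close>: for \<open>k = rot ^^ (2 * i)\<close> one has
  \<open>k \<circ> s 0 \<circ> inv k = s i\<close>. The only other such element is \<open>k \<circ> refl\<close>, and \<open>refl\<close> is the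
  identity on \<open>L 0\<close>.\<close>

definition to_L :: "nat \<Rightarrow> form \<Rightarrow> form" where
  "to_L i = transport (rot ^^ (2 * i))"

definition orbit_cls :: "form \<Rightarrow> labelled" where \<comment> \<open>gives \<open>A\<close> and \<open>B\<close>\<close>
  "orbit_cls a = (\<Sum>i<3. in_sector (s i) (to_L i a))"

definition T_cls :: "form \<Rightarrow> form \<Rightarrow> labelled" where
  "T_cls a b = (\<Sum>i<3. in_sector (s i) (to_L i a \<wedge> to_L i b))"

section \<open>Algebras on subspaces\<close>

definition assoc_algebra_on ::
    "labelled set \<Rightarrow> (labelled \<Rightarrow> labelled \<Rightarrow> labelled) \<Rightarrow> labelled \<Rightarrow> bool" where
  "assoc_algebra_on H m e \<longleftrightarrow> subspace H \<and> e \<in> H \<and> (\<forall>x\<in>H. \<forall>y\<in>H. m x y \<in> H) \<and>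
     (\<forall>x\<in>H. \<forall>y\<in>H. \<forall>w\<in>H. m (x + y) w = m x w + m y w \<and> m w (x + y) = m w x + m w y) \<and>
     (\<forall>c. \<forall>x\<in>H. \<forall>y\<in>H. m (c *\<^sub>R x) y = c *\<^sub>R m x y \<and> m x (c *\<^sub>R y) = c *\<^sub>R m x y) \<and>
     (\<forall>x\<in>H. \<forall>y\<in>H. \<forall>w\<in>H. m (m x y) w = m x (m y w)) \<and>
     (\<forall>x\<in>H. m e x = x \<and> m x e = x)"

definition graded_commutative_on ::
    "labelled set \<Rightarrow> (labelled \<Rightarrow> labelled \<Rightarrow> labelled) \<Rightarrow> bool" where
  "graded_commutative_on H m \<longleftrightarrow> (\<forall>k l. \<forall>x \<in> H \<inter> Hdeg k. \<forall>y \<in> H \<inter> Hdeg l.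
     m x y = (-1) ^ (k * l) *\<^sub>R m y x)"

definition nondegenerate_on :: "labelled set \<Rightarrow> (labelled \<Rightarrow> labelled \<Rightarrow> real) \<Rightarrow> bool" where
  "nondegenerate_on H p \<longleftrightarrow>
     (\<forall>x\<in>H. (\<forall>y\<in>H. p x y = 0) \<longrightarrow> x = 0) \<and> (\<forall>y\<in>H. (\<forall>x\<in>H. p x y = 0) \<longrightarrow> y = 0)"

definition invariant_on ::
    "labelled set \<Rightarrow> (labelled \<Rightarrow> labelled \<Rightarrow> labelled) \<Rightarrow> (labelled \<Rightarrow> labelled \<Rightarrow> real) \<Rightarrow> bool" where
  "invariant_on H m p \<longleftrightarrow> (\<forall>x\<in>H. \<forall>y\<in>H. \<forall>w\<in>H. p (m x y) w = p x (m y w))"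

end

theory Submission
  imports Defs
begin

text \<open>Each sector is a union of points or of flat tori. Averaging a form over translations of a torus
  is chain homotopic to the identity, so the cohomology of a sector is the space of alternating
  forms on its tangent space, and integration is evaluation on an oriented lattice frame. A Gysin map
  is then determined by integrating against constant forms: a point goes to the volume form, and the
  image from \<open>L i\<close> is the wedge product with its two conormal covectors. In these coordinates an
  invariant class is given by three numbers in the untwisted sector, its value at each of the nine
  points, and four numbers on \<open>L 0\<close>, and the product becomes an explicit polynomial formula from
  which associativity, the multiplication table and the Frobenius pairing are read off.\<close>

text \<open>Gysin images, base points, frames and representatives of classes are all Hilbert
  choices, so forms are pinned down only up to \<open>cohomologous\<close>. The proof therefore
  works with numbers that are blind to this ambiguity: averages over a torus for the torus sectors,
  values at the points of \<open>F\<close> for the rotation sectors. These numbers separate classes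
  (\<open>labelled_eqI\<close>), and every identity in the algebra is checked on them. The structure
  constants come from four facts. The conormal two-forms of the three loci \<open>L i\<close> add up
  to -3 \<Theta>. The form \<Theta> takes the value -6 on the frame of \<open>L 0\<close>. One has
  \<Theta> \<and> \<Theta> = 6 q. Each rotation is a product of exactly three ordered pairs of
  reflections, and two distinct reflection loci meet exactly in \<open>F\<close>. The integral basis
  \<open>a0\<close>, \<open>b0\<close> is arbitrary; it enters only through its matrix of periods on
  the frame of \<open>L 0\<close>, whose determinant is 1.\<close>

declare split_paired_All [simp del] split_paired_Ex [simp del]

section \<open>Smooth functions\<close>

abbreviation dd :: "(vec \<Rightarrow> real) \<Rightarrow> vec \<Rightarrow> vec \<Rightarrow> real" where
  "dd f u z \<equiv> frechet_derivative f (at z) u"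

lemma Ck_continuous: "Ck n f \<Longrightarrow> continuous_on UNIV f"
  by (cases n) (auto simp: continuous_on_eq_continuous_within differentiable_imp_continuous_within)

lemma Ck_SucD: "Ck (Suc n) f \<Longrightarrow> Ck n f"
proof (induction n arbitrary: f)
  case 0
  then show ?case using Ck_continuous[OF 0] by simp
next
  case (Suc n)
  then show ?case by simp
qed

lemma has_derivative_dd: "f differentiable (at z) \<Longrightarrow> (f has_derivative (\<lambda>u. dd f u z)) (at z)"
  by (simp add: frechet_derivative_works)

lemma dd_eqI: "(f has_derivative D) (at z) \<Longrightarrow> dd f u z = D u"
  using frechet_derivative_at[of f D z] by simp

lemma Ck_mult: "Ck n f \<Longrightarrow> Ck n g \<Longrightarrow> Ck n (\<lambda>z. f z * g z)"
proof (induction n arbitrary: f g)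
  case 0
  then show ?case by (simp add: continuous_on_mult)
next
  case (Suc n)
  have D: "((\<lambda>z. f z * g z) has_derivative (\<lambda>u. f z * dd g u z + dd f u z * g z)) (at z)" for z
    using Suc.prems by (intro has_derivative_mult has_derivative_dd) auto
  \<comment> \<open>The factors 1 give the Leibniz rule the shape of \<open>Ck_lincomb\<close>; the
    undifferentiated factor in each product is one degree smoother than required, hence
    \<open>Ck_SucD\<close>.\<close>
  have "Ck n (\<lambda>z. 1 * (f z * dd g u z) + 1 * (dd f u z * g z))" for u
    using Suc.prems by (intro Ck_lincomb Suc.IH) (auto dest: Ck_SucD simp del: Ck.simps, auto)
  then show ?case
    using differentiableI[OF D] by (simp add: dd_eqI[OF D])
qed

lemma smooth_continuous: "smooth f \<Longrightarrow> continuous_on S f"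
  unfolding smooth_def by (meson Ck_continuous continuous_on_subset subset_UNIV)

lemma smooth_differentiable: "smooth f \<Longrightarrow> f differentiable (at z)"
  unfolding smooth_def by (metis Ck.simps(2))

lemma smooth_dd: "smooth f \<Longrightarrow> smooth (dd f u)"
  unfolding smooth_def by (metis Ck.simps(2))

lemma smooth_const [simp]: "smooth (\<lambda>z. c)"
  by (simp add: smooth_def Ck_const)

lemma smooth_mult: "smooth f \<Longrightarrow> smooth g \<Longrightarrow> smooth (\<lambda>z. f z * g z)"
  by (simp add: smooth_def Ck_mult)

lemma smooth_lincomb: "smooth f \<Longrightarrow> smooth g \<Longrightarrow> smooth (\<lambda>z. a * f z + b * g z)"
  by (simp add: smooth_def Ck_lincomb)

lemma smooth_cmult: "smooth f \<Longrightarrow> smooth (\<lambda>z. a * f z)"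
  by (simp add: smooth_mult)

lemma smooth_add: "smooth f \<Longrightarrow> smooth g \<Longrightarrow> smooth (\<lambda>z. f z + g z)"
  using smooth_lincomb[of f g 1 1] by simp

lemma dd_lincomb:
  assumes "smooth f" "smooth g"
  shows "dd (\<lambda>z. a * f z + b * g z) u z = a * dd f u z + b * dd g u z"
  by (rule dd_eqI, rule has_derivative_lincomb) (simp_all add: assms smooth_differentiable)

lemma dd_cmult: "smooth f \<Longrightarrow> dd (\<lambda>z. a * f z) u z = a * dd f u z"
  using dd_lincomb[of f "\<lambda>z. 0" a 0] by simp

lemma dd_add: "smooth f \<Longrightarrow> smooth g \<Longrightarrow> dd (\<lambda>z. f z + g z) u z = dd f u z + dd g u z"
  using dd_lincomb[of f g 1 1] by simp

lemma dd_const [simp]: "dd (\<lambda>z. c) u z = 0"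
  by (simp add: frechet_derivative_const)

lemma dd_mult:
  assumes "smooth f" "smooth g"
  shows "dd (\<lambda>z. f z * g z) u z = f z * dd g u z + dd f u z * g z"
  by (rule dd_eqI, rule has_derivative_mult; rule has_derivative_dd)
    (simp_all add: assms smooth_differentiable)

lemma linear_dd: "smooth f \<Longrightarrow> linear (\<lambda>u. dd f u z)"
  using linear_frechet_derivative[OF smooth_differentiable[of f z]] by simp

lemma has_derivative_affine_compose:
  fixes f :: "vec \<Rightarrow> real" and g :: "vec \<Rightarrow> vec"
  assumes "f differentiable (at (g z + c))" "linear g"
  shows "((\<lambda>z. f (g z + c)) has_derivative (\<lambda>u. dd f (g u) (g z + c))) (at z)"
proof -
  have "(g has_derivative g) (at z)"
    using assms(2) by (simp add: bounded_linear_imp_has_derivative linear_conv_bounded_linear)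
  then have "((\<lambda>z. g z + c) has_derivative g) (at z)"
    using has_derivative_add[of g g "at z" "\<lambda>z. c" "\<lambda>z. 0"] by simp
  from has_derivative_compose[OF this has_derivative_dd[OF assms(1)]] show ?thesis by simp
qed

lemma Ck_affine_compose:
  fixes f :: "vec \<Rightarrow> real" and g :: "vec \<Rightarrow> vec"
  assumes "linear g" "Ck n f"
  shows "Ck n (\<lambda>z. f (g z + c))"
  using assms(2)
proof (induction n arbitrary: f)
  case 0
  have "continuous_on UNIV (\<lambda>z. g z + c)"
    using assms(1) by (intro continuous_intros linear_continuous_on) (simp add: linear_conv_bounded_linear)
  from continuous_on_compose2[OF _ this, of UNIV f] 0 show ?case by simp
next
  case (Suc n)
  have D: "((\<lambda>z. f (g z + c)) has_derivative (\<lambda>u. dd f (g u) (g z + c))) (at z)" for z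
    using Suc.prems by (intro has_derivative_affine_compose assms(1)) auto
  show ?case
    using Suc.prems Suc.IH[of "dd f (g u)" for u] differentiableI[OF D] by (simp add: dd_eqI[OF D])
qed

lemma smooth_affine_compose: "linear g \<Longrightarrow> smooth f \<Longrightarrow> smooth (\<lambda>z. f (g z + c))" for f :: "vec \<Rightarrow> real"
  by (simp add: smooth_def Ck_affine_compose)

lemma smooth_linear_compose: "linear g \<Longrightarrow> smooth f \<Longrightarrow> smooth (\<lambda>z. f (g z))" for f :: "vec \<Rightarrow> real"
  using smooth_affine_compose[of g f 0] by simp

lemma dd_affine_compose:
  "linear g \<Longrightarrow> smooth f \<Longrightarrow> dd (\<lambda>z. f (g z + c)) u z = dd f (g u) (g z + c)" for f :: "vec \<Rightarrow> real"
  by (rule dd_eqI) (simp add: has_derivative_affine_compose smooth_differentiable)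

lemma dd_linear_compose:
  "linear g \<Longrightarrow> smooth f \<Longrightarrow> dd (\<lambda>z. f (g z)) u z = dd f (g u) (g z)" for f :: "vec \<Rightarrow> real"
  using dd_affine_compose[of g f 0] by simp

text \<open>Differentiation shifts the phase by pi/2, so cosines with arbitrary phase form a family
  closed under it, up to constants; the induction therefore varies the phase. The point functions on
  \<open>F\<close> are built from these cosines.\<close>

lemma smooth_cos_affine:
  assumes "linear (l :: vec \<Rightarrow> real)" shows "smooth (\<lambda>z. cos (l z + c))"
proof -
  have "Ck n (\<lambda>z. cos (l z + c))" for n
  proof (induction n arbitrary: c)
    case 0
    have "continuous_on UNIV l" using assms by (simp add: linear_continuous_on linear_conv_bounded_linear)
    then show ?case by (auto intro!: continuous_intros)
  next
    case (Suc n)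
    have l: "(l has_derivative l) (at z)" for z
      using assms by (simp add: bounded_linear_imp_has_derivative linear_conv_bounded_linear)
    have D: "((\<lambda>z. cos (l z + c)) has_derivative (\<lambda>u. l u * cos (l z + (c + pi / 2)))) (at z)" for z
    proof -
      have "((\<lambda>z. cos (l z + c)) has_derivative (\<lambda>u. l u * - sin (l z + c))) (at z)"
        using has_derivative_cos[OF has_derivative_add[OF l[of z] has_derivative_const[of c]]]
        by (simp add: mult.commute)
      moreover have "cos (l z + (c + pi / 2)) = - sin (l z + c)"
        by (simp add: cos_add sin_add algebra_simps)
      ultimately show ?thesis by simp
    qed
    have "Ck n (\<lambda>z. l u * cos (l z + (c + pi / 2)) + 0 * cos (l z + (c + pi / 2)))" for u
      by (intro Ck_lincomb Suc.IH)
    then show ?case using differentiableI[OF D] by (simp add: dd_eqI[OF D])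
  qed
  then show ?thesis by (simp add: smooth_def)
qed

subsection \<open>Weighted averages along a direction\<close>

text \<open>Two weights occur: 1 gives the average along a segment, and 1 - t gives the homotopy
  operator that compares this average with the identity.\<close>

definition avint :: "(real \<Rightarrow> real) \<Rightarrow> vec \<Rightarrow> (vec \<Rightarrow> real) \<Rightarrow> vec \<Rightarrow> real" where
  "avint p v f z = integral {0..1} (\<lambda>t. p t * f (z + t *\<^sub>R v))"

lemma continuous_on_line:
  fixes f :: "vec \<Rightarrow> real"
  assumes "continuous_on UNIV f" shows "continuous_on S (\<lambda>t. f (z + t *\<^sub>R v))"
  by (rule continuous_on_compose2[OF assms]) (auto intro!: continuous_intros)

lemma avint_integrable:
  fixes f :: "vec \<Rightarrow> real"
  assumes "continuous_on {0..1} p" "continuous_on UNIV f"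
  shows "(\<lambda>t. p t * f (z + t *\<^sub>R v)) integrable_on {0..1}"
  using continuous_on_mult[OF assms(1) continuous_on_line[OF assms(2), of _ z v]]
  by (rule integrable_continuous_real)

text \<open>Differentiation under the integral sign. \<open>leibniz_rule\<close> wants the
  derivative as a jointly continuous family of bounded linear maps, so the directional derivatives
  are packaged as a \<open>blinfun\<close>, whose continuity is checked one vector at a
  time.\<close>

lemma avint_has_derivative:
  assumes p: "continuous_on {0..1} p" and f: "\<And>z. f differentiable (at z)"
    "\<And>u. continuous_on UNIV (dd f u)"
  shows "(avint p v f has_derivative (\<lambda>u. avint p v (dd f u) z)) (at z)"
proof -
  define F where "F z = Blinfun (frechet_derivative f (at z))" for z
  have F: "blinfun_apply (F z) = frechet_derivative f (at z)" for z
    unfolding F_def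
    by (rule bounded_linear_Blinfun_apply, rule linear_conv_bounded_linear[THEN iffD1], rule linear_frechet_derivative, rule f)
  have cF: "continuous_on UNIV F"
    by (rule continuous_on_blinfun_componentwise) (simp add: F f(2))
  have cf: "continuous_on UNIV f"
    by (simp add: continuous_on_eq_continuous_within differentiable_imp_continuous_within f(1))
  have D: "((\<lambda>x. integral (cbox 0 1) (\<lambda>t. p t * f (x + t *\<^sub>R v))) has_derivative
     blinfun_apply (integral (cbox 0 1) (\<lambda>t. p t *\<^sub>R F (z + t *\<^sub>R v)))) (at z within UNIV)"
  proof (rule leibniz_rule)
    fix x t
    have "((\<lambda>x. f (x + t *\<^sub>R v)) has_derivative (\<lambda>u. dd f u (x + t *\<^sub>R v))) (at x)"
      using has_derivative_affine_compose[OF f(1), of "\<lambda>z. z" "t *\<^sub>R v" x] by (simp add: linear_ident)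
    from has_derivative_mult_right[OF this, of "p t"]
    show "((\<lambda>x. p t * f (x + t *\<^sub>R v)) has_derivative blinfun_apply (p t *\<^sub>R F (x + t *\<^sub>R v))) (at x within UNIV)"
      by (simp add: scaleR_blinfun.rep_eq F)
  next
    show "(\<lambda>t. p t * f (x + t *\<^sub>R v)) integrable_on cbox 0 1" for x
      using avint_integrable[OF p cf] by simp
    have "continuous_on (UNIV \<times> cbox 0 1) (\<lambda>y. p (snd y) *\<^sub>R F (fst y + snd y *\<^sub>R v))"
      by (intro continuous_intros continuous_on_compose2[OF p] continuous_on_compose2[OF cF]) auto
    then show "continuous_on (UNIV \<times> cbox 0 1) (\<lambda>(x, t). p t *\<^sub>R F (x + t *\<^sub>R v))"
      by (simp add: case_prod_beta)
  qed auto
  have "blinfun_apply (integral (cbox 0 1) (\<lambda>t. p t *\<^sub>R F (z + t *\<^sub>R v))) u = avint p v (dd f u) z" for u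
  proof -
    have "(\<lambda>t. p t *\<^sub>R F (z + t *\<^sub>R v)) integrable_on cbox 0 1"
      by (rule integrable_continuous)
        (auto intro!: continuous_intros continuous_on_compose2[OF cF] simp: p)
    from blinfun_apply_integral[OF this] show ?thesis
      by (simp add: avint_def F scaleR_blinfun.rep_eq)
  qed
  then have "blinfun_apply (integral (cbox 0 1) (\<lambda>t. p t *\<^sub>R F (z + t *\<^sub>R v))) = (\<lambda>u. avint p v (dd f u) z)"
    by (rule ext)
  then show ?thesis using D by (simp add: avint_def[abs_def])
qed

lemma avint_smooth:
  assumes p: "continuous_on {0..1} p" and f: "smooth f"
  shows "smooth (avint p v f)" "dd (avint p v f) u z = avint p v (dd f u) z"
proof -
  have D: "(avint p v f has_derivative (\<lambda>u. avint p v (dd f u) z)) (at z)" if "smooth f" for f z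
    by (rule avint_has_derivative) (simp_all add: p that smooth_differentiable smooth_continuous smooth_dd)
  then show "dd (avint p v f) u z = avint p v (dd f u) z"
    by (intro dd_eqI) (simp add: f)
  have "Ck n (avint p v f)" for n
    using f
  proof (induction n arbitrary: f)
    case 0
    then show ?case using D[OF 0]
      by (auto intro!: differentiable_imp_continuous_within differentiableI simp: continuous_on_eq_continuous_within)
  next
    case (Suc n)
    have "dd (avint p v f) u = avint p v (dd f u)" for u
      by (rule ext, rule dd_eqI, rule D, rule Suc.prems)
    then show ?case
      using Suc.IH[OF smooth_dd[OF Suc.prems]] differentiableI[OF D[OF Suc.prems]] by simp
  qed
  then show "smooth (avint p v f)" by (simp add: smooth_def)
qed

section \<open>Alternating functions on lists of vectors\<close>

text \<open>Interior product with \<open>v\<close>. Every law of the wedge product below is proved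
  by contracting both sides with the first vector of the list.\<close>

definition ins :: "vec \<Rightarrow> (vec list \<Rightarrow> real) \<Rightarrow> vec list \<Rightarrow> real" where
  "ins v a = (\<lambda>us. a (v # us))"

text \<open>The degree involution, which carries the sign in the antiderivation rule for
  \<open>ins\<close>.\<close>

definition grade :: "(vec list \<Rightarrow> real) \<Rightarrow> vec list \<Rightarrow> real" where
  "grade a = (\<lambda>us. (-1) ^ length us * a us)"

definition lincomb :: "real \<Rightarrow> (vec list \<Rightarrow> real) \<Rightarrow> real \<Rightarrow> (vec list \<Rightarrow> real) \<Rightarrow> vec list \<Rightarrow> real" where
  "lincomb c a d b = (\<lambda>us. c * a us + d * b us)"

definition alt_one :: "vec list \<Rightarrow> real" where
  "alt_one = (\<lambda>us. if us = [] then 1 else 0)"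

definition cov :: "(vec \<Rightarrow> real) \<Rightarrow> vec list \<Rightarrow> real" where
  "cov f = (\<lambda>us. case us of [v] \<Rightarrow> f v | _ \<Rightarrow> 0)"

lemma ins_app: "ins v a us = a (v # us)"
  by (simp add: ins_def)

lemma lincomb_app: "lincomb c a d b us = c * a us + d * b us"
  by (simp add: lincomb_def)

declare alt_wedge.simps(2) [simp del]

lemma ins_lincomb: "ins v (lincomb c a d b) = lincomb c (ins v a) d (ins v b)"
  and grade_lincomb: "grade (lincomb c a d b) = lincomb c (grade a) d (grade b)"
  by (simp_all add: lincomb_def ins_def grade_def fun_eq_iff algebra_simps)

text \<open>Contraction lowers the degree by one and so anticommutes with the degree involution; the
  summand with coefficient 0 only fills the shape of \<open>lincomb\<close>.\<close>

lemma ins_grade: "ins v (grade a) = lincomb (-1) (grade (ins v a)) 0 a"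
  by (simp add: lincomb_def ins_def grade_def fun_eq_iff)

lemma grade_grade [simp]: "grade (grade a) = a"
  by (simp add: grade_def fun_eq_iff flip: power_add mult.assoc)

lemma alt_wedge_Cons: "alt_wedge a b (v # vs) = alt_wedge (ins v a) b vs + alt_wedge (grade a) (ins v b) vs"
  by (simp add: ins_def grade_def alt_wedge.simps(2))

lemma ins_wedge: "ins v (alt_wedge a b) = lincomb 1 (alt_wedge (ins v a) b) 1 (alt_wedge (grade a) (ins v b))"
  by (rule ext, simp add: ins_def[of v "alt_wedge a b"] alt_wedge_Cons lincomb_def)

lemma alt_wedge_lincomb_left:
  "alt_wedge (lincomb c a d a') b = lincomb c (alt_wedge a b) d (alt_wedge a' b)"
proof
  show "alt_wedge (lincomb c a d a') b vs = lincomb c (alt_wedge a b) d (alt_wedge a' b) vs" for vs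
  proof (induction vs arbitrary: a a' b)
    case Nil
    then show ?case by (simp add: lincomb_app algebra_simps)
  next
    case (Cons v vs)
    then show ?case
      by (simp only: alt_wedge_Cons ins_lincomb grade_lincomb Cons.IH) (simp only: lincomb_app alt_wedge_Cons algebra_simps)
  qed
qed

lemma alt_wedge_lincomb_right:
  "alt_wedge a (lincomb c b d b') = lincomb c (alt_wedge a b) d (alt_wedge a b')"
proof
  show "alt_wedge a (lincomb c b d b') vs = lincomb c (alt_wedge a b) d (alt_wedge a b') vs" for vs
  proof (induction vs arbitrary: a b b')
    case Nil
    then show ?case by (simp add: lincomb_app algebra_simps)
  next
    case (Cons v vs)
    then show ?case
      by (simp only: alt_wedge_Cons ins_lincomb grade_lincomb Cons.IH) (simp only: lincomb_app alt_wedge_Cons algebra_simps)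
  qed
qed

lemma grade_wedge: "grade (alt_wedge a b) = alt_wedge (grade a) (grade b)"
proof
  show "grade (alt_wedge a b) vs = alt_wedge (grade a) (grade b) vs" for vs
  proof (induction vs arbitrary: a b)
    case Nil
    then show ?case by (simp add: grade_def)
  next
    case (Cons v vs)
    have "grade (alt_wedge a b) (v # vs) = - grade (ins v (alt_wedge a b)) vs"
      by (simp add: grade_def ins_def)
    also have "\<dots> = - alt_wedge (grade (ins v a)) (grade b) vs - alt_wedge (grade (grade a)) (grade (ins v b)) vs"
      using Cons.IH[of "ins v a" b] Cons.IH[of "grade a" "ins v b"]
      by (simp only: ins_wedge grade_lincomb) (simp add: lincomb_app)
    also have "\<dots> = alt_wedge (grade a) (grade b) (v # vs)"
      by (simp only: alt_wedge_Cons ins_grade alt_wedge_lincomb_left alt_wedge_lincomb_right)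
        (simp add: lincomb_app)
    finally show ?case .
  qed
qed

text \<open>Contracting with the first vector gives three terms on either side, one for each factor
  it may hit, and \<open>grade_wedge\<close> makes the signs agree.\<close>

lemma alt_wedge_assoc: "alt_wedge (alt_wedge a b) c = alt_wedge a (alt_wedge b c)"
proof
  show "alt_wedge (alt_wedge a b) c vs = alt_wedge a (alt_wedge b c) vs" for vs
  proof (induction vs arbitrary: a b c)
    case Nil
    then show ?case by simp
  next
    case (Cons v vs)
    then show ?case
      by (simp only: alt_wedge_Cons ins_wedge grade_wedge alt_wedge_lincomb_left alt_wedge_lincomb_right)
        (simp add: lincomb_app)
  qed
qed

text \<open>This is how restriction to a tangent space enters: equalities that hold only on tangent
  vectors survive the wedge product. The bound on the length serves arguments by degree.\<close>

lemma alt_wedge_cong: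
  assumes "\<And>us. set us \<subseteq> set vs \<Longrightarrow> length us \<le> length vs \<Longrightarrow> a us = a' us"
    "\<And>us. set us \<subseteq> set vs \<Longrightarrow> length us \<le> length vs \<Longrightarrow> b us = b' us"
  shows "alt_wedge a b vs = alt_wedge a' b' vs"
  using assms
proof (induction vs arbitrary: a b a' b')
  case Nil
  then show ?case by simp
next
  case (Cons v vs)
  have S: "set us \<subseteq> set (v # vs) \<and> set (v # us) \<subseteq> set (v # vs)" if "set us \<subseteq> set vs" for us
    using that by auto
  have "alt_wedge (ins v a) b vs = alt_wedge (ins v a') b' vs"
    by (rule Cons.IH) (use S Cons.prems in \<open>auto simp: ins_app\<close>)
  moreover have "alt_wedge (grade a) (ins v b) vs = alt_wedge (grade a') (ins v b') vs"
    by (rule Cons.IH) (use S Cons.prems in \<open>auto simp: grade_def ins_app\<close>)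
  ultimately show ?case by (simp only: alt_wedge_Cons)
qed

lemma alt_wedge_zero_left [simp]: "alt_wedge (\<lambda>us. 0) b vs = 0"
  and alt_wedge_zero_right [simp]: "alt_wedge a (\<lambda>us. 0) vs = 0"
  using fun_cong[OF alt_wedge_lincomb_left[of 0 a 0 a b], of vs]
    fun_cong[OF alt_wedge_lincomb_right[of a 0 b 0 b], of vs] by (simp_all add: lincomb_def)

lemma alt_wedge_scale_left: "alt_wedge (\<lambda>us. c * a us) b vs = c * alt_wedge a b vs"
  and alt_wedge_scale_right: "alt_wedge a (\<lambda>us. c * b us) vs = c * alt_wedge a b vs"
  using fun_cong[OF alt_wedge_lincomb_left[of c a 0 a b], of vs]
    fun_cong[OF alt_wedge_lincomb_right[of a c b 0 b], of vs] by (simp_all add: lincomb_def)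

lemma alt_wedge_one_left [simp]: "alt_wedge alt_one b = b"
proof
  have g: "grade alt_one = alt_one" by (auto simp: grade_def alt_one_def fun_eq_iff)
  have i: "ins v alt_one = (\<lambda>us. 0)" for v by (simp add: alt_one_def ins_def)
  show "alt_wedge alt_one b vs = b vs" for vs
  proof (induction vs arbitrary: b)
    case Nil
    then show ?case by (simp add: alt_one_def)
  next
    case (Cons v vs)
    then show ?case by (simp add: alt_wedge_Cons g i) (simp add: ins_app)
  qed
qed

lemma alt_wedge_one_right [simp]: "alt_wedge a alt_one = a"
proof
  have i: "ins v alt_one = (\<lambda>us. 0)" for v by (simp add: alt_one_def ins_def)
  show "alt_wedge a alt_one vs = a vs" for vs
  proof (induction vs arbitrary: a)
    case Nil
    then show ?case by (simp add: alt_one_def)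
  next
    case (Cons v vs)
    then show ?case by (simp add: alt_wedge_Cons i) (simp add: ins_app)
  qed
qed

lemma alt_wedge_cov_Nil [simp]: "alt_wedge (cov c) b [] = 0"
  by (simp add: cov_def)

text \<open>Laplace expansion along the first vector; all explicit products of covectors are
  evaluated by it.\<close>

lemma alt_wedge_cov_Cons:
  "alt_wedge (cov c) b (v # vs) = c v * b vs - alt_wedge (cov c) (ins v b) vs"
proof -
  have g: "grade (cov c) = lincomb (-1) (cov c) 0 (cov c)"
    by (auto simp: grade_def cov_def lincomb_app fun_eq_iff split: list.split)
  have i: "ins v (cov c) = lincomb (c v) alt_one 0 (cov c)"
    by (auto simp: ins_def cov_def alt_one_def lincomb_app fun_eq_iff split: list.split)
  show ?thesis
    by (simp only: alt_wedge_Cons g i alt_wedge_lincomb_left) (simp add: lincomb_app)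
qed

lemma alt_wedge_cov_vanish:
  "(\<And>u. u \<in> set us \<Longrightarrow> c u = 0) \<Longrightarrow> alt_wedge (cov c) b us = 0"
proof (induction us arbitrary: b)
  case Nil
  then show ?case by (simp add: cov_def)
next
  case (Cons v vs)
  then show ?case by (simp add: alt_wedge_cov_Cons)
qed

text \<open>Of all shuffles only the one that hands every vector to \<open>a\<close>
  survives.\<close>

lemma alt_wedge_top:
  assumes "\<And>ws. set ws \<subseteq> set us \<Longrightarrow> length ws < length us \<Longrightarrow> a ws = 0"
  shows "alt_wedge a b us = a us * b []"
  using assms
proof (induction us arbitrary: a b)
  case Nil
  then show ?case by simp
next
  case (Cons v vs)
  have S: "set us \<subseteq> set (v # vs) \<and> set (v # us) \<subseteq> set (v # vs)" if "set us \<subseteq> set vs" for us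
    using that by auto
  have "alt_wedge (ins v a) b vs = ins v a vs * b []"
    by (rule Cons.IH) (use S Cons.prems in \<open>auto simp: ins_app\<close>)
  moreover have "alt_wedge (grade a) (ins v b) vs = alt_wedge (\<lambda>us. 0) (ins v b) vs"
    by (rule alt_wedge_cong) (use S Cons.prems in \<open>auto simp: grade_def ins_app\<close>)
  ultimately show ?case by (simp only: alt_wedge_Cons alt_wedge_zero_left) (simp add: ins_app)
qed

lemma alt_wedge_map: "alt_wedge (\<lambda>us. a (map g us)) (\<lambda>us. b (map g us)) vs = alt_wedge a b (map g vs)"
proof (induction vs arbitrary: a b)
  case Nil
  then show ?case by simp
next
  case (Cons v vs)
  have "ins v (\<lambda>us. a (map g us)) = (\<lambda>us. ins (g v) a (map g us))"
    "grade (\<lambda>us. a (map g us)) = (\<lambda>us. grade a (map g us))"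
    "ins v (\<lambda>us. b (map g us)) = (\<lambda>us. ins (g v) b (map g us))"
    by (simp_all add: ins_def grade_def)
  then show ?case
    using Cons.IH[of "ins (g v) a" b] Cons.IH[of "grade a" "ins (g v) b"]
    by (simp only: alt_wedge_Cons list.map)
qed

lemma alt_wedge_in_Ints:
  assumes "\<And>us. set us \<subseteq> S \<Longrightarrow> a us \<in> \<int>" "\<And>us. set us \<subseteq> S \<Longrightarrow> b us \<in> \<int>" "set vs \<subseteq> S"
  shows "alt_wedge a b vs \<in> \<int>"
  using assms
proof (induction vs arbitrary: a b)
  case Nil
  then show ?case by simp
next
  case (Cons v vs)
  have "alt_wedge (ins v a) b vs \<in> \<int>" by (rule Cons.IH) (use Cons.prems in \<open>auto simp: ins_app\<close>)
  moreover have "alt_wedge (grade a) (ins v b) vs \<in> \<int>"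
    by (rule Cons.IH) (use Cons.prems in \<open>auto simp: grade_def ins_app\<close>)
  ultimately show ?case by (simp only: alt_wedge_Cons Ints_add)
qed

subsection \<open>Alternation\<close>

lemma altD_linear: "alt_multilinear a \<Longrightarrow> linear (\<lambda>v. a (us @ v # ws))"
  and altD_eq: "alt_multilinear a \<Longrightarrow> a (us @ v # ws @ v # xs) = 0"
  by (simp_all add: alt_multilinear_def)

lemma alt_add: "alt_multilinear a \<Longrightarrow> a (us @ (v + w) # ws) = a (us @ v # ws) + a (us @ w # ws)"
  and alt_scale: "alt_multilinear a \<Longrightarrow> a (us @ (c *\<^sub>R v) # ws) = c * a (us @ v # ws)"
  and alt_zero: "alt_multilinear a \<Longrightarrow> a (us @ 0 # ws) = 0"
  using linear_add[OF altD_linear[of a us ws], of v w] linear_cmul[OF altD_linear[of a us ws], of c v]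
    linear_0[OF altD_linear[of a us ws]] by simp_all

lemma alt_swap: "alt_multilinear a \<Longrightarrow> a (us @ v # w # ws) = - a (us @ w # v # ws)"
proof -
  assume a: "alt_multilinear a"
  have "a (us @ (v + w) # (v + w) # ws) = 0" using altD_eq[OF a, of us "v + w" "[]" ws] by simp
  moreover have "a (us @ v # v # ws) = 0" "a (us @ w # w # ws) = 0"
    using altD_eq[OF a, of us v "[]" ws] altD_eq[OF a, of us w "[]" ws] by simp_all
  moreover have "a (us @ x # (v + w) # ws) = a (us @ x # v # ws) + a (us @ x # w # ws)" for x
    using alt_add[OF a, of "us @ [x]"] by simp
  ultimately show ?thesis by (simp add: alt_add[OF a])
qed

lemma alt_move: "alt_multilinear a \<Longrightarrow> a (ws @ v # us) = (-1) ^ length ws * a (v # ws @ us)"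
proof (induction ws arbitrary: us rule: rev_induct)
  case Nil
  then show ?case by simp
next
  case (snoc w ws)
  then show ?case using alt_swap[OF snoc.prems, of ws w v us] by simp
qed

text \<open>Vanishing on adjacent repetitions gives antisymmetry by polarization, and antisymmetry
  moves a distant repetition next to its twin.\<close>

lemma alt_multilinearI:
  assumes lin: "\<And>us ws. linear (\<lambda>v. a (us @ v # ws))" and adj: "\<And>us v ws. a (us @ v # v # ws) = 0"
  shows "alt_multilinear a"
  unfolding alt_multilinear_def
proof (intro conjI allI)
  show "linear (\<lambda>v. a (us @ v # ws))" for us ws by (rule lin)
  have swap: "a (us @ v # w # ws) = - a (us @ w # v # ws)" for us v w ws
  proof -
    have "a (us @ x # (v + w) # ws) = a (us @ x # v # ws) + a (us @ x # w # ws)" for x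
      using linear_add[OF lin[of "us @ [x]" ws], of v w] by simp
    moreover have "a (us @ (v + w) # (v + w) # ws) = a (us @ v # (v + w) # ws) + a (us @ w # (v + w) # ws)"
      using linear_add[OF lin[of us "(v + w) # ws"], of v w] by simp
    ultimately show ?thesis by (simp add: adj)
  qed
  show "a (us @ v # ws @ v # xs) = 0" for us v ws xs
  proof (induction ws arbitrary: us)
    case Nil
    then show ?case by (simp add: adj)
  next
    case (Cons w ws)
    then show ?case using swap[of us v w "ws @ v # xs"] Cons[of "us @ [w]"] by simp
  qed
qed

lemma alt_ins: "alt_multilinear a \<Longrightarrow> alt_multilinear (ins v a)"
  using altD_linear[of a "v # us" ws for us ws] altD_eq[of a "v # us" w ws xs for us w ws xs]
  by (simp add: alt_multilinear_def ins_def)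

lemma alt_lincomb: "alt_multilinear a \<Longrightarrow> alt_multilinear b \<Longrightarrow> alt_multilinear (lincomb c a d b)"
proof (rule alt_multilinearI)
  fix us ws assume ab: "alt_multilinear a" "alt_multilinear b"
  show "linear (\<lambda>v. lincomb c a d b (us @ v # ws))"
    by (rule linearI) (simp_all add: lincomb_app alt_add[OF ab(1)] alt_add[OF ab(2)]
        alt_scale[OF ab(1)] alt_scale[OF ab(2)] algebra_simps)
next
  fix us v ws assume ab: "alt_multilinear a" "alt_multilinear b"
  show "lincomb c a d b (us @ v # v # ws) = 0"
    using altD_eq[OF ab(1), of us v "[]" ws] altD_eq[OF ab(2), of us v "[]" ws] by (simp add: lincomb_app)
qed

lemma alt_scaled: "alt_multilinear a \<Longrightarrow> alt_multilinear (\<lambda>us. c * a us)"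
  using alt_lincomb[of a a c 0] by (simp add: lincomb_def)

lemma alt_grade: "alt_multilinear a \<Longrightarrow> alt_multilinear (grade a)"
proof (rule alt_multilinearI)
  fix us ws assume a: "alt_multilinear a"
  have "linear (\<lambda>v. ((-1) ^ length (us @ ws) * -1) *\<^sub>R a (us @ v # ws))"
    by (rule linear_compose_scale_right[OF altD_linear[OF a]])
  then show "linear (\<lambda>v. grade a (us @ v # ws))" by (simp add: grade_def)
qed (use altD_eq[of a _ _ "[]"] in \<open>simp add: grade_def\<close>)

lemma alt_zero_fun [simp]: "alt_multilinear (\<lambda>us. 0)"
  by (rule alt_multilinearI) (simp_all add: linear_zero)

lemma alt_alt_one [simp]: "alt_multilinear alt_one"
  by (rule alt_multilinearI) (simp_all add: alt_one_def linear_zero)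

lemma alt_cov: "linear f \<Longrightarrow> alt_multilinear (cov f)"
proof (rule alt_multilinearI)
  fix us ws assume f: "linear f"
  show "linear (\<lambda>v. cov f (us @ v # ws))"
  proof (cases us)
    case Nil
    then show ?thesis using f by (cases ws) (auto simp: cov_def linear_zero)
  next
    case (Cons u us')
    then have "(\<lambda>v. cov f (us @ v # ws)) = (\<lambda>v. 0)"
      by (cases us') (auto simp: cov_def fun_eq_iff)
    then show ?thesis by (simp add: linear_zero)
  qed
next
  fix us v ws
  show "cov f (us @ v # v # ws) = 0"
    by (cases us; cases "tl us") (auto simp: cov_def split: list.split)
qed

text \<open>For a repeated vector, two contractions that fall on the same factor vanish, and the two
  mixed terms cancel because \<open>grade\<close> anticommutes with \<open>ins\<close>.\<close>

lemma alt_wedge_alt: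
  assumes "alt_multilinear a" "alt_multilinear b"
  shows "alt_multilinear (alt_wedge a b)"
proof (rule alt_multilinearI)
  have lin2: "linear (\<lambda>v. f v + g v)" if "linear f" "linear g" for f g :: "vec \<Rightarrow> real"
    using linear_compose_add[OF that] .
  show "linear (\<lambda>v. alt_wedge a b (us @ v # ws))" for us ws
    using assms
  proof (induction us arbitrary: a b)
    case Nil
    have i: "ins (x + y) a = lincomb 1 (ins x a) 1 (ins y a)" "ins (c *\<^sub>R x) a = lincomb c (ins x a) 0 a"
      if "alt_multilinear a" for a x y c
      using alt_add[OF that, of "[]"] alt_scale[OF that, of "[]"]
      by (simp_all add: fun_eq_iff lincomb_app ins_def)
    show ?case
      by (rule linearI)
        (simp_all add: alt_wedge_Cons i Nil alt_wedge_lincomb_left alt_wedge_lincomb_right lincomb_app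
          algebra_simps)
  next
    case (Cons u us)
    then show ?case
      by (simp only: append_Cons alt_wedge_Cons) (intro lin2 Cons.IH alt_ins alt_grade)
  qed
  show "alt_wedge a b (us @ v # v # ws) = 0" for us v ws
    using assms
  proof (induction us arbitrary: a b)
    case Nil
    have z: "ins v (ins v a) = (\<lambda>us. 0)" if "alt_multilinear a" for a
      using altD_eq[OF that, of "[]" v "[]"] by (simp add: ins_def)
    show ?case
      by (simp only: append_Nil alt_wedge_Cons z Nil ins_grade alt_wedge_lincomb_left)
       (simp add: lincomb_app)
  next
    case (Cons u us)
    then show ?case
      by (simp only: append_Cons alt_wedge_Cons) (simp add: Cons.IH alt_ins alt_grade)
  qed
qed

lemma alt_map: "alt_multilinear a \<Longrightarrow> linear g \<Longrightarrow> alt_multilinear (\<lambda>us. a (map g us))" for g :: "vec \<Rightarrow> vec"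
proof (rule alt_multilinearI)
  fix us ws assume a: "alt_multilinear a" and g: "linear g"
  from linear_compose[OF g altD_linear[OF a, of "map g us" "map g ws"]]
  show "linear (\<lambda>v. a (map g (us @ v # ws)))" by (simp add: o_def)
qed (use altD_eq[of a _ _ "[]"] in simp)

text \<open>Peel off one basis vector at a time: contraction with it lowers the degree, and two
  contractions with it vanish.\<close>

lemma alt_vanish:
  assumes "alt_multilinear a" "\<And>us. us \<in> set (subseqs bs) \<Longrightarrow> a us = 0" "set us \<subseteq> span (set bs)"
  shows "a us = 0"
  using assms
proof (induction bs arbitrary: a us)
  case Nil
  then show ?case
    using altD_eq alt_zero[OF Nil(1), of "[]"] by (cases us) auto
next
  case (Cons v bs)
  have sub: "us \<in> set (subseqs (v # bs)) \<and> v # us \<in> set (subseqs (v # bs))" if "us \<in> set (subseqs bs)" for us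
    using that by (auto simp: Let_def)
  have step: "b (ws @ us) = 0"
    if b: "alt_multilinear b" "\<And>us. set us \<subseteq> span (set bs) \<Longrightarrow> b us = 0"
      and bv: "\<And>ws us. set (ws @ us) \<subseteq> span (set (v # bs)) \<Longrightarrow> b (ws @ v # us) = 0"
      and ws: "set ws \<subseteq> span (set bs)" and us: "set us \<subseteq> span (set (v # bs))" for b ws us
    using ws us
  proof (induction us arbitrary: ws)
    case Nil
    then show ?case using b(2) by simp
  next
    case (Cons u us)
    obtain c where c: "u - c *\<^sub>R v \<in> span (set bs)"
      using Cons.prems(2) by (auto simp: span_insert)
    define u' where "u' = u - c *\<^sub>R v"
    have mono: "span (set bs) \<subseteq> span (set (v # bs))" by (rule span_mono) auto
    have "b (ws @ u # us) = b (ws @ u' # us) + c * b (ws @ v # us)"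
      using alt_add[OF b(1), of ws u' "c *\<^sub>R v" us] by (simp add: u'_def alt_scale[OF b(1)])
    moreover have "b (ws @ v # us) = 0"
      by (rule bv) (use Cons.prems mono in auto)
    moreover have "b ((ws @ [u']) @ us) = 0"
      by (rule Cons.IH) (use Cons.prems c in \<open>auto simp: u'_def\<close>)
    ultimately show ?case by simp
  qed
  have av: "ins v a us = 0" if us: "set us \<subseteq> span (set (v # bs))" for us
  proof -
    have "ins v a ([] @ us) = 0"
    proof (rule step)
      show "alt_multilinear (ins v a)" by (rule alt_ins[OF Cons.prems(1)])
      show "ins v a us = 0" if "set us \<subseteq> span (set bs)" for us
        by (rule Cons.IH[OF alt_ins[OF Cons.prems(1)] _ that], unfold ins_app, rule Cons.prems(2)) (use sub in blast)
      show "ins v a (ws @ v # us) = 0" for ws us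
        using altD_eq[OF Cons.prems(1), of "[]" v ws us] by (simp add: ins_app)
    qed (use us in auto)
    then show ?thesis by simp
  qed
  have "a ([] @ us) = 0"
  proof (rule step)
    show "a us = 0" if "set us \<subseteq> span (set bs)" for us
      by (rule Cons.IH[OF Cons.prems(1) _ that], rule Cons.prems(2)) (use sub in blast)
    show "a (ws @ v # us) = 0" if "set (ws @ us) \<subseteq> span (set (v # bs))" for ws us
      using av[OF that] by (simp add: alt_move[OF Cons.prems(1)] ins_app)
  qed (use Cons.prems in auto)
  then show ?case by simp
qed

lemma alt_eqI:
  assumes "alt_multilinear a" "alt_multilinear b" "\<And>us. us \<in> set (subseqs bs) \<Longrightarrow> a us = b us"
    "set us \<subseteq> span (set bs)"
  shows "a us = b us"
  using alt_vanish[OF alt_lincomb[OF assms(1,2), of 1 "-1"], of bs us] assms(3,4)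
  by (simp add: lincomb_app)

text \<open>Poincare duality of a flat torus as linear algebra; it is what makes Gysin images
  unique. For the first basis vector \<open>v\<close>, one family of test forms detects the
  contraction of \<open>a\<close> with \<open>v\<close>, another detects the part of
  \<open>a\<close> that does not involve \<open>v\<close>.\<close>

lemma wedge_nondegenerate:
  assumes "distinct bs" "independent (set bs)" "\<And>\<kappa>. alt_multilinear \<kappa> \<Longrightarrow> alt_wedge a \<kappa> bs = 0"
    "us \<in> set (subseqs bs)"
  shows "a us = 0"
  using assms
proof (induction bs arbitrary: a us)
  case Nil
  then show ?case using Nil(3)[OF alt_alt_one] by (simp add: alt_one_def)
next
  case (Cons v bs)
  obtain f :: "vec \<Rightarrow> real" where f: "linear f" "\<And>x. x \<in> set (v # bs) \<Longrightarrow> f x = (if x = v then 1 else 0)"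
    using linear_independent_extend[OF Cons.prems(2), of "\<lambda>x. if x = v then 1 else 0"] by blast
  have fv: "f v = 1" and fb: "x \<in> set bs \<Longrightarrow> f x = 0" for x
    using f(2)[of v] f(2)[of x] Cons.prems(1) by auto
  have ind: "distinct bs" "independent (set bs)"
    using Cons.prems(1) independent_mono[OF Cons.prems(2), of "set bs"] by auto
  \<comment> \<open>The projection along \<open>v\<close> onto the kernel of \<open>f\<close>; it
    fixes the remaining basis vectors.\<close>
  define P where "P u = u - f u *\<^sub>R v" for u
  have linP: "linear P"
    unfolding P_def by (rule linearI) (simp_all add: linear_add[OF f(1)] linear_cmul[OF f(1)] algebra_simps)
  have Pb: "P x = x" if "x \<in> set bs" for x using fb[OF that] by (simp add: P_def)
  have Pv: "P v = 0" by (simp add: P_def fv)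
  have mapP: "map P ws = ws" if "set ws \<subseteq> set bs" for ws
    using that Pb by (induction ws) auto
  have n1: "alt_wedge (ins v a) \<kappa> bs = 0" if \<kappa>: "alt_multilinear \<kappa>" for \<kappa>
  proof -
    \<comment> \<open>Pulled back along \<open>P\<close>, a test form is killed by contraction with
      \<open>v\<close>, so \<open>v\<close> must be fed to \<open>a\<close>.\<close>
    define \<mu> where "\<mu> = (\<lambda>us. \<kappa> (map P us))"
    have "alt_multilinear \<mu>" unfolding \<mu>_def by (rule alt_map[OF \<kappa> linP])
    moreover have "ins v \<mu> = (\<lambda>us. 0)"
      using alt_zero[OF \<kappa>, of "[]"] by (simp add: ins_def \<mu>_def Pv)
    moreover have "alt_wedge (ins v a) \<mu> bs = alt_wedge (ins v a) \<kappa> bs"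
      by (rule alt_wedge_cong) (simp_all add: \<mu>_def mapP)
    ultimately show ?thesis
      using Cons.prems(3)[of \<mu>] by (simp add: alt_wedge_Cons)
  qed
  have n2: "alt_wedge (grade a) \<kappa> bs = 0" if \<kappa>: "alt_multilinear \<kappa>" for \<kappa>
  proof -
    define \<mu> where "\<mu> = (\<lambda>us. \<kappa> (map P us))"
    have \<mu>: "alt_multilinear \<mu>" unfolding \<mu>_def by (rule alt_map[OF \<kappa> linP])
    \<comment> \<open>Here the test form itself absorbs \<open>v\<close> through \<open>f\<close>;
      what remains is the pairing of \<open>a\<close> with \<kappa> on the other basis
      vectors.\<close>
    have "alt_wedge a (alt_wedge (cov f) \<mu>) (v # bs) = 0"
      by (rule Cons.prems(3)[OF alt_wedge_alt[OF alt_cov[OF f(1)] \<mu>]])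
    moreover have "alt_wedge (ins v a) (alt_wedge (cov f) \<mu>) bs = 0"
      by (rule n1[OF alt_wedge_alt[OF alt_cov[OF f(1)] \<mu>]])
    moreover have "alt_wedge (grade a) (ins v (alt_wedge (cov f) \<mu>)) bs = alt_wedge (grade a) \<kappa> bs"
    proof (rule alt_wedge_cong)
      fix us assume us: "set us \<subseteq> set bs"
      have "alt_wedge (cov f) (ins v \<mu>) us = 0"
        by (rule alt_wedge_cov_vanish) (use us fb in auto)
      then show "ins v (alt_wedge (cov f) \<mu>) us = \<kappa> us"
        unfolding ins_app[of v "alt_wedge (cov f) \<mu>"] by (simp add: alt_wedge_cov_Cons fv) (simp add: \<mu>_def mapP[OF us])
    qed simp
    ultimately show ?thesis by (simp only: alt_wedge_Cons)
  qed
  consider ws where "ws \<in> set (subseqs bs)" "us = v # ws" | "us \<in> set (subseqs bs)"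
    using Cons.prems(4) by (auto simp: Let_def)
  then show ?case
  proof cases
    case 1
    then show ?thesis using Cons.IH[OF ind n1, of ws] by (simp add: ins_app)
  next
    case 2
    have "grade a us = 0"
      by (rule Cons.IH[OF ind n2 2])
    then show ?thesis by (simp add: grade_def)
  qed
qed

section \<open>Calculus of forms\<close>

definition csmooth :: "form \<Rightarrow> bool" where
  "csmooth \<alpha> \<longleftrightarrow> (\<forall>us. smooth (\<lambda>z. \<alpha> z us))"

lemma csmoothD: "csmooth \<alpha> \<Longrightarrow> smooth (\<lambda>z. \<alpha> z us)"
  by (simp add: csmooth_def)

lemma is_form_csmooth: "is_form \<alpha> \<Longrightarrow> csmooth \<alpha>"
  by (simp add: is_form_def csmooth_def)

lemma csmooth_ins: "csmooth \<alpha> \<Longrightarrow> csmooth (\<lambda>z. ins v (\<alpha> z))"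
  by (simp add: csmooth_def ins_app)

lemma csmooth_grade: "csmooth \<alpha> \<Longrightarrow> csmooth (\<lambda>z. grade (\<alpha> z))"
  by (simp add: csmooth_def grade_def smooth_cmult)

lemma csmooth_wedge:
  assumes "csmooth \<alpha>" "csmooth \<beta>" shows "csmooth (\<lambda>z. alt_wedge (\<alpha> z) (\<beta> z))"
proof -
  have "smooth (\<lambda>z. alt_wedge (\<alpha> z) (\<beta> z) us)" for us
    using assms
  proof (induction us arbitrary: \<alpha> \<beta>)
    case Nil
    then show ?case by (simp add: smooth_mult csmoothD)
  next
    case (Cons v us)
    then show ?case
      unfolding alt_wedge_Cons
      by (intro smooth_add Cons.IH[of "\<lambda>z. ins v (\<alpha> z)"] Cons.IH[of "\<lambda>z. grade (\<alpha> z)"] csmooth_ins csmooth_grade)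
  qed
  then show ?thesis by (simp add: csmooth_def)
qed

lemma dd_wedge:
  assumes "csmooth \<alpha>" "csmooth \<beta>"
  shows "dd (\<lambda>z. alt_wedge (\<alpha> z) (\<beta> z) us) v z =
    alt_wedge (\<lambda>us. dd (\<lambda>w. \<alpha> w us) v z) (\<beta> z) us + alt_wedge (\<alpha> z) (\<lambda>us. dd (\<lambda>w. \<beta> w us) v z) us"
  using assms
proof (induction us arbitrary: \<alpha> \<beta>)
  case Nil
  then show ?case by (simp add: dd_mult csmoothD)
next
  case (Cons u us)
  have i: "(\<lambda>us. dd (\<lambda>w. ins u (\<alpha> w) us) v z) = ins u (\<lambda>us. dd (\<lambda>w. \<alpha> w us) v z)" for \<alpha>
    by (simp add: ins_def)
  have g: "(\<lambda>us. dd (\<lambda>w. grade (\<alpha> w) us) v z) = grade (\<lambda>us. dd (\<lambda>w. \<alpha> w us) v z)" if "csmooth \<alpha>" for \<alpha>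
    using that by (simp add: grade_def dd_cmult csmoothD)
  have s: "smooth (\<lambda>z. alt_wedge (ins u (\<alpha> z)) (\<beta> z) us)" "smooth (\<lambda>z. alt_wedge (grade (\<alpha> z)) (ins u (\<beta> z)) us)"
    using csmoothD[OF csmooth_wedge[OF csmooth_ins[OF Cons.prems(1), of u] Cons.prems(2)], of us]
      csmoothD[OF csmooth_wedge[OF csmooth_grade[OF Cons.prems(1)] csmooth_ins[OF Cons.prems(2), of u]], of us] by simp_all
  show ?case
    using Cons.IH[OF csmooth_ins[OF Cons.prems(1)] Cons.prems(2), of u]
      Cons.IH[OF csmooth_grade[OF Cons.prems(1)] csmooth_ins[OF Cons.prems(2)], of u]
    by (simp only: alt_wedge_Cons dd_add[OF s] i g[OF Cons.prems(1)])
qed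

lemma ext_d_Nil [simp]: "ext_d \<alpha> z [] = 0"
  by (simp add: ext_d_def)

text \<open>Cartan's formula for the constant field \<open>v\<close>, whose Lie derivative is the
  directional derivative of the coefficients. It turns identities for \<open>ext_d\<close> into
  inductions over the list of vectors.\<close>

lemma ext_d_Cons: "ext_d \<alpha> z (v # us) = dd (\<lambda>w. \<alpha> w us) v z - ext_d (\<lambda>z. ins v (\<alpha> z)) z us"
  by (simp add: ext_d_def sum.lessThan_Suc_shift ins_app sum_negf del: sum.lessThan_Suc)

lemma ext_d_lc:
  assumes "csmooth \<alpha>" "csmooth \<beta>"
  shows "ext_d (\<lambda>z. lincomb c (\<alpha> z) d (\<beta> z)) z = lincomb c (ext_d \<alpha> z) d (ext_d \<beta> z)"
  by (rule ext) (simp add: ext_d_def lincomb_def dd_lincomb csmoothD assms distrib_left sum.distrib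
      sum_distrib_left mult.left_commute)

lemma ext_d_grade:
  assumes "csmooth \<alpha>"
  shows "ext_d (\<lambda>z. grade (\<alpha> z)) z us = - grade (ext_d \<alpha> z) us"
proof (cases us)
  case Nil
  then show ?thesis by (simp add: grade_def)
next
  case (Cons v vs)
  have "length (take i us @ drop (Suc i) us) = length vs" if "i < length us" for i
    using that Cons by auto
  then have "ext_d (\<lambda>z. grade (\<alpha> z)) z us = (\<Sum>i<length us. (-1) ^ i * dd (\<lambda>w. (-1) ^ length vs * \<alpha> w (take i us @ drop (Suc i) us)) (us ! i) z)"
    unfolding ext_d_def grade_def by (intro sum.cong) simp_all
  also have "\<dots> = (-1) ^ length vs * ext_d \<alpha> z us"
    by (simp add: dd_cmult csmoothD assms ext_d_def sum_distrib_left mult.left_commute)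
  finally show ?thesis by (simp add: grade_def Cons)
qed

text \<open>Cartan's formula and the antiderivation rule for \<open>ins\<close> give both sides the
  same recursion in the first vector.\<close>

lemma ext_d_wedge:
  assumes "csmooth \<alpha>" "csmooth \<beta>"
  shows "ext_d (\<lambda>z. alt_wedge (\<alpha> z) (\<beta> z)) z us =
    alt_wedge (ext_d \<alpha> z) (\<beta> z) us + alt_wedge (grade (\<alpha> z)) (ext_d \<beta> z) us"
  using assms
proof (induction us arbitrary: \<alpha> \<beta>)
  case Nil
  then show ?case by simp
next
  case (Cons v us)
  note a = Cons.prems(1) and b = Cons.prems(2)
  have i: "ins v (ext_d \<gamma> z) = lincomb 1 (\<lambda>us. dd (\<lambda>w. \<gamma> w us) v z) (-1) (ext_d (\<lambda>w. ins v (\<gamma> w)) z)" for \<gamma>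
    by (rule ext) (simp add: ins_app ext_d_Cons lincomb_app)
  have g: "ext_d (\<lambda>z. grade (\<gamma> z)) z = lincomb (-1) (grade (ext_d \<gamma> z)) 0 (\<gamma> z)" if "csmooth \<gamma>" for \<gamma>
    using ext_d_grade[OF that] by (simp add: lincomb_def fun_eq_iff)
  have gdd: "grade (\<lambda>us. dd (\<lambda>w. \<alpha> w us) v z) = (\<lambda>us. dd (\<lambda>w. grade (\<alpha> w) us) v z)"
    using a by (simp add: grade_def dd_cmult csmoothD)
  have "ext_d (\<lambda>z. alt_wedge (\<alpha> z) (\<beta> z)) z (v # us) = dd (\<lambda>w. alt_wedge (\<alpha> w) (\<beta> w) us) v z
      - ext_d (\<lambda>z. alt_wedge (ins v (\<alpha> z)) (\<beta> z)) z us
      - ext_d (\<lambda>z. alt_wedge (grade (\<alpha> z)) (ins v (\<beta> z))) z us"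
    unfolding ext_d_Cons ins_wedge
      ext_d_lc[OF csmooth_wedge[OF csmooth_ins[OF a] b] csmooth_wedge[OF csmooth_grade[OF a] csmooth_ins[OF b]]]
    by (simp add: lincomb_app)
  also have "\<dots> = alt_wedge (\<lambda>us. dd (\<lambda>w. \<alpha> w us) v z) (\<beta> z) us + alt_wedge (\<alpha> z) (\<lambda>us. dd (\<lambda>w. \<beta> w us) v z) us
      - (alt_wedge (ext_d (\<lambda>w. ins v (\<alpha> w)) z) (\<beta> z) us + alt_wedge (grade (ins v (\<alpha> z))) (ext_d \<beta> z) us)
      - (alt_wedge (ext_d (\<lambda>w. grade (\<alpha> w)) z) (ins v (\<beta> z)) us + alt_wedge (\<alpha> z) (ext_d (\<lambda>w. ins v (\<beta> w)) z) us)"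
    by (simp only: dd_wedge[OF a b] Cons.IH[OF csmooth_ins[OF a] b] Cons.IH[OF csmooth_grade[OF a] csmooth_ins[OF b]] grade_grade)
  also have "\<dots> = alt_wedge (ext_d \<alpha> z) (\<beta> z) (v # us) + alt_wedge (grade (\<alpha> z)) (ext_d \<beta> z) (v # us)"
    by (simp only: alt_wedge_Cons i g[OF a] ins_grade grade_grade alt_wedge_lincomb_left alt_wedge_lincomb_right)
      (simp add: lincomb_app)
  finally show ?case .
qed

lemma ext_d_pullback:
  assumes "linear g" "csmooth \<alpha>"
  shows "ext_d (pullback g \<alpha>) z us = ext_d \<alpha> (g z) (map g us)"
  by (simp add: ext_d_def pullback_def dd_linear_compose[OF assms(1) csmoothD[OF assms(2)]] take_map drop_map)

lemma is_formI:
  assumes "csmooth \<alpha>" "\<And>z. alt_multilinear (\<alpha> z)" "\<And>z l. l \<in> \<Lambda> \<Longrightarrow> \<alpha> (z + l) = \<alpha> z"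
  shows "is_form \<alpha>"
  using assms by (simp add: is_form_def csmooth_def)

lemma is_formD:
  assumes "is_form \<alpha>"
  shows "csmooth \<alpha>" "alt_multilinear (\<alpha> z)" "l \<in> \<Lambda> \<Longrightarrow> \<alpha> (z + l) = \<alpha> z"
  using assms by (simp_all add: is_form_def csmooth_def)

lemma is_form_wedge: "is_form \<alpha> \<Longrightarrow> is_form \<beta> \<Longrightarrow> is_form (\<alpha> \<wedge> \<beta>)"
  unfolding wedge_def by (intro is_formI csmooth_wedge alt_wedge_alt) (simp_all add: is_formD)

lemma is_form_grade: "is_form \<alpha> \<Longrightarrow> is_form (\<lambda>z. grade (\<alpha> z))"
  by (intro is_formI csmooth_grade alt_grade) (simp_all add: is_formD)

lemma is_form_ins: "is_form \<alpha> \<Longrightarrow> is_form (\<lambda>z. ins v (\<alpha> z))"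
  by (intro is_formI csmooth_ins alt_ins) (simp_all add: is_formD)

lemma is_form_const: "alt_multilinear a \<Longrightarrow> is_form (\<lambda>z. a)"
  by (intro is_formI) (simp_all add: csmooth_def)

lemma ext_d_const [simp]: "ext_d (\<lambda>z. a) z us = 0"
  by (simp add: ext_d_def)

lemma closed_on_const: "alt_multilinear a \<Longrightarrow> closed_on M (\<lambda>z. a)"
  by (simp add: closed_on_def is_form_const eq_on_def zero_form_def)

lemma closed_onD: "closed_on M \<alpha> \<Longrightarrow> is_form \<alpha>"
  "closed_on M \<alpha> \<Longrightarrow> z \<in> \<Union> M \<Longrightarrow> set us \<subseteq> tangent M z \<Longrightarrow> ext_d \<alpha> z us = 0"
  by (simp_all add: closed_on_def) (auto simp: eq_on_def zero_form_def)

lemma closed_onI: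
  assumes "is_form \<alpha>" "\<And>z us. z \<in> \<Union> M \<Longrightarrow> set us \<subseteq> tangent M z \<Longrightarrow> ext_d \<alpha> z us = 0"
  shows "closed_on M \<alpha>"
  using assms by (simp add: closed_on_def eq_on_def zero_form_def del: Union_iff)

lemma closed_on_mono:
  assumes "closed_on Y \<alpha>" "V \<subseteq> Y" shows "closed_on V \<alpha>"
proof (rule closed_onI)
  fix z us assume z: "z \<in> \<Union> V" and us: "set us \<subseteq> tangent V z"
  have "tangent V z \<subseteq> tangent Y z"
    using Union_mono[OF assms(2)] unfolding tangent_def by blast
  then show "ext_d \<alpha> z us = 0"
    using closed_onD(2)[OF assms(1), of z us] z us Union_mono[OF assms(2)] by blast
qed (rule closed_onD(1)[OF assms(1)])

lemma cohomologous_mono: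
  assumes "cohomologous Y \<alpha> \<beta>" "V \<subseteq> Y" shows "cohomologous V \<alpha> \<beta>"
proof -
  obtain \<eta> where \<eta>: "closed_on Y \<alpha>" "closed_on Y \<beta>" "is_form \<eta>"
    "\<And>z vs. z \<in> \<Union> Y \<Longrightarrow> set vs \<subseteq> tangent Y z \<Longrightarrow> \<alpha> z vs = \<beta> z vs + ext_d \<eta> z vs"
    using assms(1) by (rule cohomologousE) blast
  have "tangent V z \<subseteq> tangent Y z" for z
    using Union_mono[OF assms(2)] unfolding tangent_def by blast
  then show ?thesis
    using \<eta> Union_mono[OF assms(2)] by (intro cohomologousI[OF _ _ \<eta>(3)] closed_on_mono[OF _ assms(2)]) blast+
qed

lemma cohomologous_eq_onI:
  assumes "closed_on M \<alpha>" "closed_on M \<beta>"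
    "\<And>z vs. z \<in> \<Union> M \<Longrightarrow> set vs \<subseteq> tangent M z \<Longrightarrow> \<alpha> z vs = \<beta> z vs"
  shows "cohomologous M \<alpha> \<beta>"
proof (rule cohomologousI[OF assms(1,2) is_form_zero])
  fix z vs assume "z \<in> \<Union> M" "set vs \<subseteq> tangent M z"
  then show "\<alpha> z vs = \<beta> z vs + ext_d zero_form z vs"
    by (simp add: assms(3) ext_d_zero zero_form_def del: Union_iff)
qed

lemma cohomologous_closed: "cohomologous M \<alpha> \<beta> \<Longrightarrow> closed_on M \<alpha>" "cohomologous M \<alpha> \<beta> \<Longrightarrow> closed_on M \<beta>"
  by (simp_all add: cohomologous_def)

lemma alt_wedge_eq_zero:
  "(\<And>us. set us \<subseteq> set vs \<Longrightarrow> a us = 0) \<Longrightarrow> alt_wedge a b vs = 0"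
  "(\<And>us. set us \<subseteq> set vs \<Longrightarrow> b us = 0) \<Longrightarrow> alt_wedge a b vs = 0"
  using alt_wedge_cong[of vs a "\<lambda>us. 0" b b] alt_wedge_cong[of vs a a b "\<lambda>us. 0"] by auto

lemma closed_on_wedge:
  assumes "closed_on M \<alpha>" "closed_on M \<beta>" shows "closed_on M (\<alpha> \<wedge> \<beta>)"
proof (rule closed_onI[OF is_form_wedge[OF assms[THEN closed_onD(1)]]])
  fix z us assume z: "z \<in> \<Union> M" and us: "set us \<subseteq> tangent M z"
  have "alt_wedge (ext_d \<alpha> z) (\<beta> z) us = 0"
    by (rule alt_wedge_eq_zero(1), rule closed_onD(2)[OF assms(1) z]) (use us in blast)
  moreover have "alt_wedge (grade (\<alpha> z)) (ext_d \<beta> z) us = 0"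
    by (rule alt_wedge_eq_zero(2), rule closed_onD(2)[OF assms(2) z]) (use us in blast)
  ultimately show "ext_d (\<alpha> \<wedge> \<beta>) z us = 0"
    unfolding wedge_def by (simp add: ext_d_wedge assms[THEN closed_onD(1), THEN is_formD(1)])
qed

lemma cohomologous_wedge_left:
  assumes "cohomologous M \<alpha> \<alpha>'" "closed_on M \<beta>"
  shows "cohomologous M (\<alpha> \<wedge> \<beta>) (\<alpha>' \<wedge> \<beta>)"
proof -
  obtain \<eta> where \<eta>: "closed_on M \<alpha>" "closed_on M \<alpha>'" "is_form \<eta>"
    "\<And>z vs. z \<in> \<Union> M \<Longrightarrow> set vs \<subseteq> tangent M z \<Longrightarrow> \<alpha> z vs = \<alpha>' z vs + ext_d \<eta> z vs"
    using assms(1) by (rule cohomologousE) blast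
  show ?thesis
  proof (rule cohomologousI[OF closed_on_wedge[OF \<eta>(1) assms(2)] closed_on_wedge[OF \<eta>(2) assms(2)] is_form_wedge[OF \<eta>(3) closed_onD(1)[OF assms(2)]]])
    fix z us assume z: "z \<in> \<Union> M" and us: "set us \<subseteq> tangent M z"
    have "alt_wedge (\<alpha> z) (\<beta> z) us = alt_wedge (lincomb 1 (\<alpha>' z) 1 (ext_d \<eta> z)) (\<beta> z) us"
    proof (rule alt_wedge_cong)
      fix ws assume "set ws \<subseteq> set us"
      then show "\<alpha> z ws = lincomb 1 (\<alpha>' z) 1 (ext_d \<eta> z) ws"
        using \<eta>(4)[OF z, of ws] us by (auto simp: lincomb_def)
    qed simp
    moreover have "alt_wedge (grade (\<eta> z)) (ext_d \<beta> z) us = 0"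
      by (rule alt_wedge_eq_zero(2), rule closed_onD(2)[OF assms(2) z]) (use us in blast)
    ultimately show "(\<alpha> \<wedge> \<beta>) z us = (\<alpha>' \<wedge> \<beta>) z us + ext_d (\<eta> \<wedge> \<beta>) z us"
      unfolding wedge_def
      by (simp add: ext_d_wedge closed_onD(1)[OF assms(2)] \<eta>(3) is_formD(1) alt_wedge_lincomb_left lincomb_app)
  qed
qed

text \<open>The sign in the graded Leibniz rule is absorbed by twisting: the primitive is
  \<open>grade\<close> of \<alpha> wedged with \<eta>.\<close>

lemma cohomologous_wedge_right:
  assumes "closed_on M \<alpha>" "cohomologous M \<beta> \<beta>'"
  shows "cohomologous M (\<alpha> \<wedge> \<beta>) (\<alpha> \<wedge> \<beta>')"
proof -
  obtain \<eta> where \<eta>: "closed_on M \<beta>" "closed_on M \<beta>'" "is_form \<eta>"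
    "\<And>z vs. z \<in> \<Union> M \<Longrightarrow> set vs \<subseteq> tangent M z \<Longrightarrow> \<beta> z vs = \<beta>' z vs + ext_d \<eta> z vs"
    using assms(2) by (rule cohomologousE) blast
  note fa = closed_onD(1)[OF assms(1)]
  show ?thesis
  proof (rule cohomologousI[OF closed_on_wedge[OF assms(1) \<eta>(1)] closed_on_wedge[OF assms(1) \<eta>(2)] is_form_wedge[OF is_form_grade[OF fa] \<eta>(3)]])
    fix z us assume z: "z \<in> \<Union> M" and us: "set us \<subseteq> tangent M z"
    have "alt_wedge (\<alpha> z) (\<beta> z) us = alt_wedge (\<alpha> z) (lincomb 1 (\<beta>' z) 1 (ext_d \<eta> z)) us"
    proof (rule alt_wedge_cong)
      fix ws assume "set ws \<subseteq> set us"
      then show "\<beta> z ws = lincomb 1 (\<beta>' z) 1 (ext_d \<eta> z) ws"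
        using \<eta>(4)[OF z, of ws] us by (auto simp: lincomb_def)
    qed simp
    moreover have "alt_wedge (ext_d (\<lambda>z. grade (\<alpha> z)) z) (\<eta> z) us = 0"
    proof (rule alt_wedge_eq_zero(1))
      fix ws assume "set ws \<subseteq> set us"
      then show "ext_d (\<lambda>z. grade (\<alpha> z)) z ws = 0"
        using closed_onD(2)[OF assms(1) z, of ws] us ext_d_grade[OF is_formD(1)[OF fa]] by (auto simp: grade_def)
    qed
    ultimately show "(\<alpha> \<wedge> \<beta>) z us = (\<alpha> \<wedge> \<beta>') z us + ext_d ((\<lambda>z. grade (\<alpha> z)) \<wedge> \<eta>) z us"
      unfolding wedge_def
      by (simp add: ext_d_wedge csmooth_grade fa \<eta>(3) is_formD(1) alt_wedge_lincomb_right lincomb_app)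
  qed
qed

lemma cohomologous_wedge:
  "cohomologous M \<alpha> \<alpha>' \<Longrightarrow> cohomologous M \<beta> \<beta>' \<Longrightarrow> cohomologous M (\<alpha> \<wedge> \<beta>) (\<alpha>' \<wedge> \<beta>')"
  by (meson cohomologous_wedge_left cohomologous_wedge_right cohomologous_trans cohomologous_closed)

section \<open>Averaging and the cohomology of a torus\<close>

definition avf :: "(real \<Rightarrow> real) \<Rightarrow> vec \<Rightarrow> form \<Rightarrow> form" where
  "avf p v \<alpha> = (\<lambda>z us. avint p v (\<lambda>w. \<alpha> w us) z)"

lemma avint_lincomb:
  assumes "continuous_on {0..1} p" "continuous_on UNIV f" "continuous_on UNIV g"
  shows "avint p v (\<lambda>w. c * f w + d * g w) z = c * avint p v f z + d * avint p v g z"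
  using integral_add[OF integrable_on_cmult_left[OF avint_integrable[OF assms(1,2), of z v], of c]
      integrable_on_cmult_left[OF avint_integrable[OF assms(1,3), of z v], of d]]
  by (simp add: avint_def algebra_simps)

lemma avint_sum:
  assumes "continuous_on {0..1} p" "\<And>i. i \<in> I \<Longrightarrow> continuous_on UNIV (f i)" "finite I"
  shows "avint p v (\<lambda>w. \<Sum>i\<in>I. c i * f i w) z = (\<Sum>i\<in>I. c i * avint p v (f i) z)"
  using assms(3,2)
proof (induction I)
  case empty
  then show ?case by (simp add: avint_def)
next
  case (insert i I)
  have "continuous_on UNIV (\<lambda>w. \<Sum>i\<in>I. c i * f i w)"
    by (intro continuous_intros) (use insert.prems in auto)
  from avint_lincomb[OF assms(1) _ this, of "f i" v "c i" 1 z] show ?case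
    using insert by simp
qed

lemma csmooth_avf: "continuous_on {0..1} p \<Longrightarrow> csmooth \<alpha> \<Longrightarrow> csmooth (avf p v \<alpha>)"
  using avint_smooth(1)[of p "\<lambda>z. \<alpha> z us" v for us] by (simp add: csmooth_def avf_def)

lemma ext_d_avf:
  assumes p: "continuous_on {0..1} p" and \<alpha>: "csmooth \<alpha>"
  shows "ext_d (avf p v \<alpha>) z us = avf p v (ext_d \<alpha>) z us"
proof -
  have "dd (\<lambda>w. avint p v (\<lambda>w. \<alpha> w us) w) u z = avint p v (dd (\<lambda>w. \<alpha> w us) u) z" for us u
    using avint_smooth(2)[OF p csmoothD[OF \<alpha>, of us], where v = v and z = z and u = u] by simp
  then show ?thesis
    by (simp add: ext_d_def avf_def avint_sum p smooth_continuous smooth_dd csmoothD \<alpha>)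
qed

lemma is_form_avf:
  assumes p: "continuous_on {0..1} p" and \<alpha>: "is_form \<alpha>"
  shows "is_form (avf p v \<alpha>)"
proof (rule is_formI[OF csmooth_avf[OF p is_formD(1)[OF \<alpha>]]])
  have c: "continuous_on UNIV (\<lambda>w. \<alpha> w us)" for us
    by (rule smooth_continuous[OF csmoothD[OF is_formD(1)[OF \<alpha>]]])
  note alt = is_formD(2)[OF \<alpha>]
  show "alt_multilinear (avf p v \<alpha> z)" for z
  proof (rule alt_multilinearI)
    show "linear (\<lambda>u. avf p v \<alpha> z (us @ u # ws))" for us ws
    proof (rule linearI)
      show "avf p v \<alpha> z (us @ (x + y) # ws) = avf p v \<alpha> z (us @ x # ws) + avf p v \<alpha> z (us @ y # ws)" for x y
        using avint_lincomb[OF p c c, of v 1 _ 1 _ z] by (simp add: avf_def alt_add[OF alt])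
      show "avf p v \<alpha> z (us @ (r *\<^sub>R x) # ws) = r *\<^sub>R avf p v \<alpha> z (us @ x # ws)" for r x
        using avint_lincomb[OF p c c, of v r "us @ x # ws" 0 _ z] by (simp add: avf_def alt_scale[OF alt])
    qed
    show "avf p v \<alpha> z (us @ u # u # ws) = 0" for us u ws
      using altD_eq[OF alt, of _ us u "[]" ws] by (simp add: avf_def avint_def)
  qed
  show "avf p v \<alpha> (z + l) = avf p v \<alpha> z" if "l \<in> \<Lambda>" for z l
  proof -
    have "\<alpha> (z + l + t *\<^sub>R v) = \<alpha> (z + t *\<^sub>R v)" for t
      using is_formD(3)[OF \<alpha> that, of "z + t *\<^sub>R v"] by (simp add: add_ac)
    then show ?thesis by (simp add: avf_def avint_def)
  qed
qed

lemma line_derivative: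
  fixes f :: "vec \<Rightarrow> real"
  assumes "smooth f"
  shows "((\<lambda>t. f (z + t *\<^sub>R v)) has_real_derivative dd f v (z + t *\<^sub>R v)) (at t within S)"
proof -
  have g: "((\<lambda>t. z + t *\<^sub>R v) has_derivative (\<lambda>s. s *\<^sub>R v)) (at t within S)"
    by (auto intro!: derivative_eq_intros)
  have "((\<lambda>t. f (z + t *\<^sub>R v)) has_derivative (\<lambda>s. dd f (s *\<^sub>R v) (z + t *\<^sub>R v))) (at t within S)"
    using has_derivative_compose[OF g has_derivative_dd[OF smooth_differentiable[OF assms]]] .
  then show ?thesis
    using linear_cmul[OF linear_dd[OF assms]]
    by (simp add: has_field_derivative_def mult_commute_abs)
qed

text \<open>Integration by parts: the weight 1 - t kills the boundary term at t = 1 and leaves the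
  value at the starting point.\<close>

lemma avint_dd_linear_weight:
  assumes "smooth f"
  shows "avint (\<lambda>t. 1 - t) v (dd f v) z = avint (\<lambda>t. 1) v f z - f z"
proof -
  define g where "g t = f (z + t *\<^sub>R v)" for t
  have D: "((\<lambda>t. (1 - t) * g t) has_real_derivative (1 - t) * dd f v (z + t *\<^sub>R v) - g t) (at t within {0..1})" for t
    unfolding g_def by (rule DERIV_cong, rule DERIV_mult, rule DERIV_diff[OF DERIV_const DERIV_ident], rule line_derivative[OF assms])
        (simp add: algebra_simps)
  have "((\<lambda>t. (1 - t) * dd f v (z + t *\<^sub>R v) - g t) has_integral ((1 - 1) * g 1 - (1 - 0) * g 0)) {0..1}"
    by (rule fundamental_theorem_of_calculus) (use D in \<open>simp_all add: has_real_derivative_iff_has_vector_derivative\<close>)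
  then have "integral {0..1} (\<lambda>t. (1 - t) * dd f v (z + t *\<^sub>R v) - g t) = - f z"
    by (simp add: integral_unique g_def)
  moreover have "integral {0..1} (\<lambda>t. (1 - t) * dd f v (z + t *\<^sub>R v) - g t) =
      avint (\<lambda>t. 1 - t) v (dd f v) z - integral {0..1} g"
    unfolding avint_def g_def
  proof (rule integral_diff)
    show "(\<lambda>t. (1 - t) * dd f v (z + t *\<^sub>R v)) integrable_on {0..1}"
      by (rule avint_integrable) (auto intro!: continuous_intros smooth_continuous smooth_dd assms)
    show "(\<lambda>t. f (z + t *\<^sub>R v)) integrable_on {0..1}"
      using avint_integrable[OF continuous_on_const[of _ 1] smooth_continuous[OF assms], of z v] by simp
  qed
  ultimately show ?thesis by (simp add: avint_def g_def[abs_def])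
qed

lemma avint_dd_unit_weight:
  assumes "smooth f"
  shows "avint (\<lambda>t. 1) v (dd f v) z = f (z + v) - f z"
proof -
  have "((\<lambda>t. dd f v (z + t *\<^sub>R v)) has_integral (f (z + 1 *\<^sub>R v) - f (z + 0 *\<^sub>R v))) {0..1}"
    by (rule fundamental_theorem_of_calculus)
      (use line_derivative[OF assms] in \<open>simp_all add: has_real_derivative_iff_has_vector_derivative\<close>)
  then show ?thesis by (simp add: avint_def integral_unique)
qed

text \<open>Cartan's formula, integrated along the flow of \<open>v\<close>.\<close>

lemma averaging_homotopy:
  assumes \<alpha>: "csmooth \<alpha>"
  shows "avf (\<lambda>t. 1) v \<alpha> z us - \<alpha> z us =
    ext_d (avf (\<lambda>t. 1 - t) v (\<lambda>z. ins v (\<alpha> z))) z us + avint (\<lambda>t. 1 - t) v (\<lambda>w. ext_d \<alpha> w (v # us)) z"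
proof -
  let ?p = "\<lambda>t::real. 1 - t" and ?e = "\<lambda>w. ext_d (\<lambda>z. ins v (\<alpha> z)) w us"
  have p: "continuous_on {0..1} ?p" by (intro continuous_intros)
  have e: "continuous_on UNIV ?e"
    unfolding ext_d_def by (intro continuous_intros smooth_continuous smooth_dd csmoothD csmooth_ins \<alpha>)
  have "avint ?p v (\<lambda>w. ext_d \<alpha> w (v # us)) z = avint ?p v (\<lambda>w. 1 * dd (\<lambda>w. \<alpha> w us) v w + (-1) * ?e w) z"
    by (simp add: ext_d_Cons)
  also have "\<dots> = 1 * avint ?p v (dd (\<lambda>w. \<alpha> w us) v) z + (-1) * avint ?p v ?e z"
    by (rule avint_lincomb[OF p _ e]) (intro smooth_continuous smooth_dd csmoothD \<alpha>)
  finally show ?thesis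
    using avint_dd_linear_weight[OF csmoothD[OF \<alpha>, of us], where v = v and z = z] ext_d_avf[OF p csmooth_ins[OF \<alpha>, of v], where v = v and z = z and us = us]
    by (simp add: avf_def)
qed

section \<open>The lattice, and iterated integrals over its cells\<close>

lemma Lattice_zero [simp]: "0 \<in> \<Lambda>"
proof -
  have "(0 :: vec) = (of_int 0 + of_int 0 * \<omega>, of_int 0 + of_int 0 * \<omega>)" by (simp add: zero_prod_def)
  then show ?thesis unfolding \<Lambda>_def by blast
qed

lemma Lattice_diff: "l \<in> \<Lambda> \<Longrightarrow> m \<in> \<Lambda> \<Longrightarrow> l - m \<in> \<Lambda>"
proof -
  assume "l \<in> \<Lambda>" "m \<in> \<Lambda>"
  then obtain a b c d a' b' c' d' where
    l: "l = (of_int a + of_int b * \<omega>, of_int c + of_int d * \<omega>)" and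
    m: "m = (of_int a' + of_int b' * \<omega>, of_int c' + of_int d' * \<omega>)"
    unfolding \<Lambda>_def by blast
  have "l - m = (of_int (a - a') + of_int (b - b') * \<omega>, of_int (c - c') + of_int (d - d') * \<omega>)"
    by (simp add: l m algebra_simps)
  then show ?thesis unfolding \<Lambda>_def by blast
qed

lemma Lattice_minus: "l \<in> \<Lambda> \<Longrightarrow> - l \<in> \<Lambda>"
  using Lattice_diff[OF Lattice_zero, of l] by simp

lemma Lattice_add: "l \<in> \<Lambda> \<Longrightarrow> m \<in> \<Lambda> \<Longrightarrow> l + m \<in> \<Lambda>"
  using Lattice_diff[OF _ Lattice_minus, of l m] by simp

lemma cell_integral_avint: "cell_integral f z (v # vs) = avint (\<lambda>t. 1) v (\<lambda>w. cell_integral f w vs) z"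
  by (simp add: avint_def)

declare cell_integral.simps(2) [simp del]

lemma smooth_cell: "smooth f \<Longrightarrow> smooth (\<lambda>z. cell_integral f z bs)"
  by (induction bs) (simp_all add: cell_integral_avint[abs_def] avint_smooth(1))

lemma dd_cell: "smooth f \<Longrightarrow> dd (\<lambda>z. cell_integral f z bs) u z = cell_integral (dd f u) z bs"
proof (induction bs arbitrary: z)
  case Nil
  then show ?case by simp
next
  case (Cons v vs)
  have "dd (\<lambda>z. cell_integral f z vs) u = (\<lambda>z. cell_integral (dd f u) z vs)"
    using Cons by (intro ext) simp
  then show ?case
    using avint_smooth(2)[OF _ smooth_cell[OF Cons.prems, of vs], of "\<lambda>t. 1" v z u]
    by (simp add: cell_integral_avint[abs_def])
qed

lemma cell_periodic: "(\<And>z. f (z + l) = f z) \<Longrightarrow> cell_integral f (z + l) bs = cell_integral f z bs"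
proof (induction bs arbitrary: z)
  case Nil
  then show ?case by simp
next
  case (Cons v vs)
  have "cell_integral f (z + l + t *\<^sub>R v) vs = cell_integral f (z + t *\<^sub>R v) vs" for t
    using Cons.IH[of "z + t *\<^sub>R v"] Cons.prems by (simp add: add_ac)
  then show ?case by (simp add: cell_integral.simps(2))
qed

lemma cell_lincomb:
  "smooth f \<Longrightarrow> smooth g \<Longrightarrow>
    cell_integral (\<lambda>w. c * f w + d * g w) z bs = c * cell_integral f z bs + d * cell_integral g z bs"
proof (induction bs arbitrary: z)
  case Nil
  then show ?case by simp
next
  case (Cons v vs)
  then show ?case
    by (simp add: cell_integral_avint avint_lincomb smooth_continuous smooth_cell)
qed

lemma cell_add:
  "smooth f \<Longrightarrow> smooth g \<Longrightarrow>
    cell_integral (\<lambda>w. f w + g w) z bs = cell_integral f z bs + cell_integral g z bs"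
  using cell_lincomb[of f g 1 1] by simp

lemma cell_const [simp]: "cell_integral (\<lambda>w. c) z bs = c"
  by (induction bs arbitrary: z) (simp_all add: cell_integral.simps(2))

lemma cell_sum:
  "finite I \<Longrightarrow> (\<And>i. i \<in> I \<Longrightarrow> smooth (f i)) \<Longrightarrow>
    cell_integral (\<lambda>w. \<Sum>i\<in>I. c i * f i w) z bs = (\<Sum>i\<in>I. c i * cell_integral (f i) z bs)"
proof (induction I rule: finite_induct)
  case empty
  then show ?case by simp
next
  case (insert i I)
  have "smooth (\<lambda>w. \<Sum>i\<in>I. c i * f i w)"
    using insert(1) insert.prems
    by (induction I rule: finite_induct) (auto intro!: smooth_add smooth_cmult)
  from cell_lincomb[OF _ this, of "f i" "c i" 1] show ?case
    using insert by simp
qed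

text \<open>Along a vector of the frame the derivative integrates to the difference over a full
  period, which is zero; the other integrations commute with the derivative, and linearity extends
  the claim to the span.\<close>

lemma dd_cell_zero:
  assumes "smooth f" "\<And>v z. v \<in> set bs \<Longrightarrow> f (z + v) = f z" "u \<in> span (set bs)"
  shows "dd (\<lambda>z. cell_integral f z bs) u z = 0"
proof -
  have "dd (\<lambda>z. cell_integral f z bs) u z = 0" if "u \<in> set bs" for u z
    using assms(2) that
  proof (induction bs arbitrary: z)
    case Nil
    then show ?case by simp
  next
    case (Cons v vs)
    let ?g = "\<lambda>z. cell_integral f z vs"
    have D: "dd (\<lambda>z. cell_integral f z (v # vs)) u z = avint (\<lambda>t. 1) v (dd ?g u) z"
      using avint_smooth(2)[OF _ smooth_cell[OF assms(1), of vs], of "\<lambda>t. 1" v z u]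
      by (simp add: cell_integral_avint[abs_def])
    show ?case
    proof (cases "u = v")
      case True
      then show ?thesis
        using D avint_dd_unit_weight[OF smooth_cell[OF assms(1), of vs], of v z] cell_periodic[of f v z vs] Cons.prems(1)
        by simp
    next
      case False
      then have "dd ?g u = (\<lambda>z. 0)"
        using Cons by (intro ext) auto
      then show ?thesis using D by (simp add: avint_def)
    qed
  qed
  then show ?thesis
    using linear_eq_0_on_span[OF linear_dd[OF smooth_cell[OF assms(1)]] _ assms(3)] by blast
qed

lemma cell_shift:
  assumes "smooth f" "\<And>v z. v \<in> set bs \<Longrightarrow> f (z + v) = f z" "u \<in> span (set bs)"
  shows "cell_integral f (z + u) bs = cell_integral f z bs"
proof -
  have "((\<lambda>t. cell_integral f (z + t *\<^sub>R u) bs) has_real_derivative 0) (at t)" for t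
    using line_derivative[OF smooth_cell[OF assms(1), of bs], of z u t UNIV] dd_cell_zero[OF assms] by simp
  from DERIV_isconst_all[of "\<lambda>t. cell_integral f (z + t *\<^sub>R u) bs" 1 0, OF allI[OF this]] show ?thesis by simp
qed

text \<open>The cell stays in the affine plane through \<open>z\<close>. Relations that hold only on
  a locus can thus be averaged over it.\<close>

lemma cell_cong:
  assumes "\<And>w. w - z \<in> span (set bs) \<Longrightarrow> f w = g w"
  shows "cell_integral f z bs = cell_integral g z bs"
  using assms
proof (induction bs arbitrary: z)
  case Nil
  then show ?case by (simp add: span_zero)
next
  case (Cons v vs)
  have "cell_integral f (z + t *\<^sub>R v) vs = cell_integral g (z + t *\<^sub>R v) vs" for t
  proof (rule Cons.IH, rule Cons.prems)
    fix w assume w: "w - (z + t *\<^sub>R v) \<in> span (set vs)"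
    have "w - (z + t *\<^sub>R v) \<in> span (set (v # vs))"
      using w span_mono[of "set vs" "set (v # vs)"] by auto
    moreover have "t *\<^sub>R v \<in> span (set (v # vs))" by (simp add: span_base span_mul)
    ultimately have "(w - (z + t *\<^sub>R v)) + t *\<^sub>R v \<in> span (set (v # vs))" by (rule span_add)
    then show "w - z \<in> span (set (v # vs))" by simp
  qed
  then show ?case by (simp add: cell_integral.simps(2))
qed

section \<open>The average of a form over a torus\<close>

definition cavg :: "vec list \<Rightarrow> form \<Rightarrow> form" where
  "cavg bs \<alpha> = (\<lambda>z us. cell_integral (\<lambda>w. \<alpha> w us) z bs)"

text \<open>The value at the origin suffices, because over a subtorus the average is constant
  (\<open>cavg_eq_avg\<close>). The result is an element of the exterior algebra, free of base
  points.\<close>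

definition avg :: "vec list \<Rightarrow> form \<Rightarrow> vec list \<Rightarrow> real" where
  "avg bs \<alpha> = cavg bs \<alpha> 0"

lemma cavg_Nil [simp]: "cavg [] \<alpha> = \<alpha>"
  and cavg_Cons: "cavg (v # bs) \<alpha> = avf (\<lambda>t. 1) v (cavg bs \<alpha>)"
  by (simp_all add: cavg_def avf_def cell_integral_avint)

lemma is_form_cavg: "is_form \<alpha> \<Longrightarrow> is_form (cavg bs \<alpha>)"
  by (induction bs) (simp_all add: cavg_Cons is_form_avf)

lemma ext_d_cavg:
  assumes "csmooth \<alpha>"
  shows "ext_d (cavg bs \<alpha>) z us = cell_integral (\<lambda>w. ext_d \<alpha> w us) z bs"
  by (simp add: ext_d_def cavg_def dd_cell csmoothD assms cell_sum smooth_dd)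

lemma alt_avg: "is_form \<alpha> \<Longrightarrow> alt_multilinear (avg bs \<alpha>)"
  by (simp add: avg_def is_formD(2) is_form_cavg)

lemma avg_lincomb:
  "csmooth \<alpha> \<Longrightarrow> csmooth \<beta> \<Longrightarrow> avg bs (\<lambda>z us. c * \<alpha> z us + d * \<beta> z us) us = c * avg bs \<alpha> us + d * avg bs \<beta> us"
  by (simp add: avg_def cavg_def cell_lincomb csmoothD)

lemma avg_const [simp]: "avg bs (\<lambda>z. a) = a"
  by (simp add: avg_def cavg_def)

lemma avg_pullback:
  assumes "linear g" shows "avg bs (pullback g \<alpha>) us = avg (map g bs) \<alpha> (map g us)"
proof -
  have "cell_integral (\<lambda>w. \<alpha> (g w) (map g us)) z bs = cell_integral (\<lambda>w. \<alpha> w (map g us)) (g z) (map g bs)" for z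
    by (induction bs arbitrary: z)
      (simp_all add: cell_integral.simps(2) linear_add[OF assms] linear_cmul[OF assms])
  then show ?thesis by (simp add: avg_def cavg_def pullback_def linear_0[OF assms])
qed

text \<open>\<open>M\<close> is the connected subtorus through the origin whose tangent space is spanned by the
  lattice vectors \<open>bs\<close>.\<close>

definition subtorus :: "point set \<Rightarrow> vec list \<Rightarrow> bool" where
  "subtorus M bs \<longleftrightarrow> set bs \<subseteq> \<Lambda> \<and> \<Union> M = {l + v |l v. l \<in> \<Lambda> \<and> v \<in> span (set bs)} \<and>
     (\<forall>z\<in>\<Union> M. tangent M z = span (set bs))"

lemma subtorusD:
  assumes "subtorus M bs"
  shows "set bs \<subseteq> \<Lambda>" "\<Union> M = {l + v |l v. l \<in> \<Lambda> \<and> v \<in> span (set bs)}"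
    "z \<in> \<Union> M \<Longrightarrow> tangent M z = span (set bs)"
  using assms unfolding subtorus_def by blast+

lemma subtorus_span:
  assumes "subtorus M bs" "v \<in> span (set bs)" shows "v \<in> \<Union> M"
proof -
  have "v = 0 + v" by simp
  with assms(2) show ?thesis unfolding subtorusD(2)[OF assms(1)] using Lattice_zero by blast
qed

lemma subtorus_add:
  assumes "subtorus M bs" "z \<in> \<Union> M" "v \<in> span (set bs)" shows "z + v \<in> \<Union> M"
proof -
  obtain l w where "z = l + w" "l \<in> \<Lambda>" "w \<in> span (set bs)"
    using assms(2) unfolding subtorusD(2)[OF assms(1)] by blast
  then have "z + v = l + (w + v)" "w + v \<in> span (set bs)" using assms(3) by (auto simp: span_add)
  then show ?thesis unfolding subtorusD(2)[OF assms(1)] using \<open>l \<in> \<Lambda>\<close> by blast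
qed

text \<open>By \<open>averaging_homotopy\<close>: its error term integrates \<open>ext_d\<close> of
  the form along segments that stay in \<open>M\<close>, on tangent vectors, and so vanishes for a
  form closed on \<open>M\<close>.\<close>

lemma cohomologous_avf:
  assumes M: "subtorus M bs" and \<alpha>: "closed_on M \<alpha>" and v: "v \<in> span (set bs)"
  shows "cohomologous M \<alpha> (avf (\<lambda>t. 1) v \<alpha>)"
proof -
  note fa = closed_onD(1)[OF \<alpha>]
  let ?p = "\<lambda>t::real. 1 - t"
  have p: "continuous_on {0..1} ?p" by (intro continuous_intros)
  have z: "ext_d \<alpha> (z + t *\<^sub>R v) us = 0" if "z \<in> \<Union> M" "set us \<subseteq> tangent M z" for z us t
  proof -
    have "z + t *\<^sub>R v \<in> \<Union> M" by (rule subtorus_add[OF M that(1)]) (simp add: span_mul v)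
    then show ?thesis
      using closed_onD(2)[OF \<alpha>] that(2) subtorusD(3)[OF M] that(1) by blast
  qed
  show ?thesis
  proof (rule cohomologous_sym, rule cohomologousI[OF _ \<alpha> is_form_avf[OF p is_form_ins[OF fa, of v], of v]])
    show "closed_on M (avf (\<lambda>t. 1) v \<alpha>)"
    proof (rule closed_onI[OF is_form_avf[OF _ fa]])
      fix x us assume "x \<in> \<Union> M" "set us \<subseteq> tangent M x"
      then have "ext_d \<alpha> (x + t *\<^sub>R v) us = 0" for t by (rule z)
      then show "ext_d (avf (\<lambda>t. 1) v \<alpha>) x us = 0"
        unfolding ext_d_avf[OF continuous_on_const is_formD(1)[OF fa]] by (simp add: avf_def avint_def)
    qed simp
    fix x us assume x: "x \<in> \<Union> M" and us: "set us \<subseteq> tangent M x"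
    have "set (v # us) \<subseteq> tangent M x" using us v subtorusD(3)[OF M x] by simp
    then have "ext_d \<alpha> (x + t *\<^sub>R v) (v # us) = 0" for t by (rule z[OF x])
    then have "avint ?p v (\<lambda>w. ext_d \<alpha> w (v # us)) x = 0" by (simp add: avint_def)
    then show "avf (\<lambda>t. 1) v \<alpha> x us = \<alpha> x us + ext_d (avf ?p v (\<lambda>z. ins v (\<alpha> z))) x us"
      using averaging_homotopy[OF is_formD(1)[OF fa], of v x us] by simp
  qed
qed

lemma cohomologous_cavg:
  assumes M: "subtorus M bs" and \<alpha>: "closed_on M \<alpha>" and vs: "set vs \<subseteq> span (set bs)"
  shows "cohomologous M \<alpha> (cavg vs \<alpha>)"
  using vs
proof (induction vs)
  case Nil
  then show ?case by (simp add: cohomologous_refl \<alpha>)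
next
  case (Cons v vs)
  then have "cohomologous M \<alpha> (cavg vs \<alpha>)" by simp
  then show ?case
    using cohomologous_avf[OF M cohomologous_closed(2), of \<alpha> "cavg vs \<alpha>" v] Cons.prems
    by (auto simp: cavg_Cons intro: cohomologous_trans)
qed

lemma cavg_eq_avg:
  assumes M: "subtorus M bs" and \<alpha>: "is_form \<alpha>" and z: "z \<in> \<Union> M"
  shows "cavg bs \<alpha> z us = avg bs \<alpha> us"
proof -
  obtain l w where zl: "z = l + w" "l \<in> \<Lambda>" "w \<in> span (set bs)"
    using z unfolding subtorusD(2)[OF M] by blast
  have per: "\<alpha> (z + v) us = \<alpha> z us" if "v \<in> \<Lambda>" for v z
    using is_formD(3)[OF \<alpha> that] by simp
  have "cavg bs \<alpha> (l + w) us = cavg bs \<alpha> (0 + l) us"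
    unfolding cavg_def using subtorusD(1)[OF M] per zl(3)
    by (simp add: subset_iff cell_shift csmoothD[OF is_formD(1)[OF \<alpha>]])
  also have "\<dots> = avg bs \<alpha> us"
    unfolding avg_def cavg_def by (rule cell_periodic) (rule per[OF zl(2)])
  finally show ?thesis by (simp add: zl(1))
qed

text \<open>Every class on a subtorus has a constant representative. From here on cohomology is
  computed in the exterior algebra of the tangent space.\<close>

lemma cohomologous_avg:
  assumes M: "subtorus M bs" and \<alpha>: "closed_on M \<alpha>"
  shows "cohomologous M \<alpha> (\<lambda>z. avg bs \<alpha>)"
proof (rule cohomologous_trans)
  show 1: "cohomologous M \<alpha> (cavg bs \<alpha>)"
    by (rule cohomologous_cavg[OF M \<alpha>]) (simp add: span_superset)
  show "cohomologous M (cavg bs \<alpha>) (\<lambda>z. avg bs \<alpha>)"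
    by (rule cohomologous_eq_onI[OF cohomologous_closed(2)[OF 1] closed_on_const[OF alt_avg[OF closed_onD(1)[OF \<alpha>]]]])
      (simp add: cavg_eq_avg[OF M closed_onD(1)[OF \<alpha>]] del: Union_iff)
qed

text \<open>Exact forms average to zero, since averaging commutes with \<open>ext_d\<close> and
  leaves coefficients that are constant in tangent directions.\<close>

lemma avg_cohomologous:
  assumes M: "subtorus M bs" and c: "cohomologous M \<alpha> \<beta>" and us: "set us \<subseteq> span (set bs)"
  shows "avg bs \<alpha> us = avg bs \<beta> us"
proof -
  obtain \<eta> where \<eta>: "closed_on M \<alpha>" "closed_on M \<beta>" "is_form \<eta>"
    "\<And>z vs. z \<in> \<Union> M \<Longrightarrow> set vs \<subseteq> tangent M z \<Longrightarrow> \<alpha> z vs = \<beta> z vs + ext_d \<eta> z vs"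
    using c by (rule cohomologousE) blast
  have sd: "smooth (\<lambda>w. ext_d \<eta> w us)"
  proof -
    have "smooth (\<lambda>w. \<Sum>i\<in>I. (-1) ^ i * dd (\<lambda>w. \<eta> w (take i us @ drop (Suc i) us)) (us ! i) w)" if "finite I" for I
      using that csmoothD[OF is_formD(1)[OF \<eta>(3)]] by (induction I rule: finite_induct)
        (simp_all add: smooth_add smooth_cmult smooth_dd)
    then show ?thesis by (simp add: ext_d_def)
  qed
  have "avg bs \<alpha> us = cell_integral (\<lambda>w. \<beta> w us + ext_d \<eta> w us) 0 bs"
    unfolding avg_def cavg_def
  proof (rule cell_cong)
    fix w assume "w - 0 \<in> span (set bs)"
    then have w: "w \<in> \<Union> M" using subtorus_span[OF M] by simp
    show "\<alpha> w us = \<beta> w us + ext_d \<eta> w us" by (rule \<eta>(4)[OF w]) (simp add: subtorusD(3)[OF M w] us)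
  qed
  also have "\<dots> = avg bs \<beta> us + ext_d (cavg bs \<eta>) 0 us"
    by (simp add: cell_add sd csmoothD[OF is_formD(1)[OF closed_onD(1)[OF \<eta>(2)]]] avg_def ext_d_cavg[OF is_formD(1)[OF \<eta>(3)]]) (simp add: cavg_def)
  also have "ext_d (cavg bs \<eta>) 0 us = 0"
  proof -
    have "dd (\<lambda>w. cavg bs \<eta> w ws) (us ! i) 0 = 0" if "i < length us" for i ws
      unfolding cavg_def
    proof (rule dd_cell_zero)
      show "smooth (\<lambda>w. \<eta> w ws)" by (rule csmoothD[OF is_formD(1)[OF \<eta>(3)]])
      show "\<eta> (z + v) ws = \<eta> z ws" if "v \<in> set bs" for v z
        using is_formD(3)[OF \<eta>(3), of v z] subtorusD(1)[OF M] that by (simp add: subset_iff)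
      show "us ! i \<in> span (set bs)" using us that by auto
    qed
    then show ?thesis by (simp add: ext_d_def)
  qed
  finally show ?thesis by simp
qed

text \<open>By multilinearity an alternating form on the tangent space is known from its values on
  the sublists of \<open>bs\<close>, so these averages are complete invariants of a class.\<close>

lemma cohomologous_iff_avg:
  assumes M: "subtorus M bs" and \<alpha>: "closed_on M \<alpha>" and \<beta>: "closed_on M \<beta>"
  shows "cohomologous M \<alpha> \<beta> \<longleftrightarrow> (\<forall>us\<in>set (subseqs bs). avg bs \<alpha> us = avg bs \<beta> us)"
proof
  assume "cohomologous M \<alpha> \<beta>"
  moreover have "set us \<subseteq> span (set bs)" if "us \<in> set (subseqs bs)" for us
    using that span_superset[of "set bs"] subseqs_powset[of bs] by blast
  ultimately show "\<forall>us\<in>set (subseqs bs). avg bs \<alpha> us = avg bs \<beta> us"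
    using avg_cohomologous[OF M] by blast
next
  assume "\<forall>us\<in>set (subseqs bs). avg bs \<alpha> us = avg bs \<beta> us"
  then have e: "avg bs \<alpha> us = avg bs \<beta> us" if "set us \<subseteq> span (set bs)" for us
    by (intro alt_eqI[OF alt_avg alt_avg _ that] closed_onD(1)[OF \<alpha>] closed_onD(1)[OF \<beta>]) blast
  have "cohomologous M (\<lambda>z. avg bs \<alpha>) (\<lambda>z. avg bs \<beta>)"
  proof (rule cohomologous_eq_onI)
    fix z us assume "z \<in> \<Union> M" "set us \<subseteq> tangent M z"
    then show "avg bs \<alpha> us = avg bs \<beta> us" using e subtorusD(3)[OF M] by blast
  qed (rule closed_on_const alt_avg closed_onD(1)[OF \<alpha>] closed_onD(1)[OF \<beta>])+
  then show "cohomologous M \<alpha> \<beta>"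
    by (rule cohomologous_trans[OF cohomologous_trans[OF cohomologous_avg[OF M \<alpha>]]
          cohomologous_sym[OF cohomologous_avg[OF M \<beta>]]])
qed

text \<open>Frames are chosen arbitrarily in \<open>integral_over\<close> and moved about by the
  group, so averages over different frames have to be comparable. A constant representative has the
  same average over each of them.\<close>

lemma avg_frame_independent:
  assumes "subtorus M bs" "subtorus M cs" "closed_on M \<alpha>" "set us \<subseteq> span (set bs)"
  shows "avg cs \<alpha> us = avg bs \<alpha> us"
proof -
  have "span (set cs) = span (set bs)"
    using subtorusD(3)[OF assms(1) subtorus_span[OF assms(1) span_zero]]
      subtorusD(3)[OF assms(2) subtorus_span[OF assms(1) span_zero]] by simp
  then show ?thesis
    using avg_cohomologous[OF assms(2) cohomologous_avg[OF assms(1,3)]] assms(4) by simp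
qed

text \<open>Averaging is not multiplicative on functions, but it is on closed forms: replacing each
  factor by its constant representative does not change the class of the product.\<close>

lemma avg_wedge:
  assumes M: "subtorus M bs" and "closed_on M \<alpha>" "closed_on M \<beta>" "set us \<subseteq> span (set bs)"
  shows "avg bs (\<alpha> \<wedge> \<beta>) us = alt_wedge (avg bs \<alpha>) (avg bs \<beta>) us"
  using avg_cohomologous[OF M cohomologous_wedge[OF cohomologous_avg[OF M] cohomologous_avg[OF M]], of \<alpha> \<beta> us] assms
  by (simp add: wedge_def)

section \<open>Lattice coordinates and the group\<close>

definition X1 :: "vec \<Rightarrow> real" where "X1 v = xcoord (fst v)"
definition Y1 :: "vec \<Rightarrow> real" where "Y1 v = ycoord (fst v)"
definition X2 :: "vec \<Rightarrow> real" where "X2 v = xcoord (snd v)"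
definition Y2 :: "vec \<Rightarrow> real" where "Y2 v = ycoord (snd v)"

text \<open>Lattice coordinates: in them the group acts by integer matrices and each fixed locus is
  given by integrality conditions.\<close>

definition mk :: "real \<Rightarrow> real \<Rightarrow> real \<Rightarrow> real \<Rightarrow> vec" where
  "mk a b c d = (of_real a + of_real b * \<omega>, of_real c + of_real d * \<omega>)"

lemma omega_Re [simp]: "Re \<omega> = - 1 / 2" and omega_Im [simp]: "Im \<omega> = sqrt 3 / 2"
  unfolding \<omega>_def cis.sel by (rule cos_120 sin_120)+

lemma omega_cnj: "cnj \<omega> = - 1 - \<omega>"
  by (simp add: complex_eq_iff)

lemma omega_sq: "\<omega> * \<omega> = - 1 - \<omega>"
  by (simp add: complex_eq_iff)

lemma omega_inverse: "inverse \<omega> = - 1 - \<omega>"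
  by (rule inverse_unique) (simp add: algebra_simps omega_sq)

lemma coords_mk [simp]: "X1 (mk a b c d) = a" "Y1 (mk a b c d) = b" "X2 (mk a b c d) = c" "Y2 (mk a b c d) = d"
  by (simp_all add: X1_def Y1_def X2_def Y2_def mk_def xcoord_def ycoord_def)

lemma mk_coords [simp]: "mk (X1 v) (Y1 v) (X2 v) (Y2 v) = v"
  by (simp add: X1_def Y1_def X2_def Y2_def mk_def xcoord_def ycoord_def prod_eq_iff complex_eq_iff)

lemma vec_eq_iff4: "v = w \<longleftrightarrow> X1 v = X1 w \<and> Y1 v = Y1 w \<and> X2 v = X2 w \<and> Y2 v = Y2 w"
proof
  assume "X1 v = X1 w \<and> Y1 v = Y1 w \<and> X2 v = X2 w \<and> Y2 v = Y2 w"
  then have "mk (X1 v) (Y1 v) (X2 v) (Y2 v) = mk (X1 w) (Y1 w) (X2 w) (Y2 w)" by simp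
  then show "v = w" unfolding mk_coords .
qed simp

lemma linear_coords: "linear X1" "linear Y1" "linear X2" "linear Y2"
  by (intro linearI; simp add: X1_def Y1_def X2_def Y2_def xcoord_def ycoord_def field_simps)+

lemma coords_add [simp]: "X1 (v + w) = X1 v + X1 w" "Y1 (v + w) = Y1 v + Y1 w" "X2 (v + w) = X2 v + X2 w" "Y2 (v + w) = Y2 v + Y2 w"
  and coords_scale [simp]: "X1 (r *\<^sub>R v) = r * X1 v" "Y1 (r *\<^sub>R v) = r * Y1 v" "X2 (r *\<^sub>R v) = r * X2 v" "Y2 (r *\<^sub>R v) = r * Y2 v"
  and coords_diff [simp]: "X1 (v - w) = X1 v - X1 w" "Y1 (v - w) = Y1 v - Y1 w" "X2 (v - w) = X2 v - X2 w" "Y2 (v - w) = Y2 v - Y2 w"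
  and coords_zero [simp]: "X1 0 = 0" "Y1 0 = 0" "X2 0 = 0" "Y2 0 = 0"
  using linear_coords by (simp_all add: linear_add linear_cmul linear_diff linear_0)

lemma coords_sum [simp]: "X1 (\<Sum>i\<in>I. f i) = (\<Sum>i\<in>I. X1 (f i))" "Y1 (\<Sum>i\<in>I. f i) = (\<Sum>i\<in>I. Y1 (f i))"
    "X2 (\<Sum>i\<in>I. f i) = (\<Sum>i\<in>I. X2 (f i))" "Y2 (\<Sum>i\<in>I. f i) = (\<Sum>i\<in>I. Y2 (f i))"
  using linear_coords by (simp_all add: linear_sum)

lemma mk_eq_iff: "mk a b c d = mk a' b' c' d' \<longleftrightarrow> a = a' \<and> b = b' \<and> c = c' \<and> d = d'"
  by (simp add: vec_eq_iff4)

lemma mk_arith: "mk a b c d + mk a' b' c' d' = mk (a + a') (b + b') (c + c') (d + d')"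
  "mk a b c d - mk a' b' c' d' = mk (a - a') (b - b') (c - c') (d - d')"
  "r *\<^sub>R mk a b c d = mk (r * a) (r * b) (r * c) (r * d)"
  by (simp_all add: vec_eq_iff4)

lemma mk_ext: "(\<And>a b c d. f (mk a b c d) = g (mk a b c d)) \<Longrightarrow> f = g"
proof (rule ext)
  fix v assume *: "\<And>a b c d. f (mk a b c d) = g (mk a b c d)"
  show "f v = g v" using *[of "X1 v" "Y1 v" "X2 v" "Y2 v"] by simp
qed

lemma Lattice_iff: "v \<in> \<Lambda> \<longleftrightarrow> X1 v \<in> \<int> \<and> Y1 v \<in> \<int> \<and> X2 v \<in> \<int> \<and> Y2 v \<in> \<int>"
proof
  assume "v \<in> \<Lambda>"
  then obtain a b c d where "v = (of_int a + of_int b * \<omega>, of_int c + of_int d * \<omega>)"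
    unfolding \<Lambda>_def by blast
  then have "v = mk (of_int a) (of_int b) (of_int c) (of_int d)" by (simp add: mk_def)
  then show "X1 v \<in> \<int> \<and> Y1 v \<in> \<int> \<and> X2 v \<in> \<int> \<and> Y2 v \<in> \<int>" by simp
next
  assume "X1 v \<in> \<int> \<and> Y1 v \<in> \<int> \<and> X2 v \<in> \<int> \<and> Y2 v \<in> \<int>"
  then obtain a b c d where "X1 v = of_int a" "Y1 v = of_int b" "X2 v = of_int c" "Y2 v = of_int d"
    by (auto elim!: Ints_cases)
  then have "v = mk (of_int a) (of_int b) (of_int c) (of_int d)" by (simp add: vec_eq_iff4)
  then have "v = (of_int a + of_int b * \<omega>, of_int c + of_int d * \<omega>)" by (simp add: mk_def)
  then show "v \<in> \<Lambda>" unfolding \<Lambda>_def by blast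
qed

lemma omega_mult: "\<omega> * (of_real a + of_real b * \<omega>) = of_real (- b) + of_real (a - b) * \<omega>"
  "(- 1 - \<omega>) * (of_real a + of_real b * \<omega>) = of_real (b - a) + of_real (- a) * \<omega>"
proof -
  have "\<omega> * (of_real a + of_real b * \<omega>) = of_real a * \<omega> + of_real b * (\<omega> * \<omega>)"
    by (simp add: algebra_simps)
  then show 1: "\<omega> * (of_real a + of_real b * \<omega>) = of_real (- b) + of_real (a - b) * \<omega>"
    by (simp add: omega_sq) (simp add: algebra_simps)
  have "(- 1 - \<omega>) * w = - w - \<omega> * w" for w by (simp add: algebra_simps)
  then show "(- 1 - \<omega>) * (of_real a + of_real b * \<omega>) = of_real (b - a) + of_real (- a) * \<omega>"
    by (simp only: 1) (simp add: algebra_simps)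
qed

lemma rot_mk: "rot (mk a b c d) = mk (- b) (a - b) (d - c) (- c)"
  by (simp only: rot_def mk_def omega_inverse omega_mult fst_conv snd_conv)

lemma refl_mk: "refl (mk a b c d) = mk (b - a) b (d - c) d"
  by (simp add: refl_def mk_def omega_cnj algebra_simps)

lemma rot2_mk: "(rot ^^ 2) (mk a b c d) = mk (b - a) (- a) (- d) (c - d)"
  by (simp add: numeral_2_eq_2 rot_mk)

lemma s_mk: "s 0 (mk a b c d) = mk (b - a) b (d - c) d" "s (Suc 0) (mk a b c d) = mk (- b) (- a) c (c - d)"
  "s 2 (mk a b c d) = mk a (a - b) (- d) (- c)"
  by (simp_all add: s_def refl_mk rot_mk numeral_2_eq_2)

section \<open>The group of order six\<close>

lemmas act_mk = rot_mk refl_mk rot2_mk s_mk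

abbreviation elts :: "(vec \<Rightarrow> vec) set" where
  "elts \<equiv> {id, rot, rot ^^ 2, s 0, s (Suc 0), s 2}"

text \<open>The test vector is generic: its six images under the group are pairwise different, so
  this one vector tells all elements apart.\<close>

lemma mk_fun_neq: "f (mk 1 3 1 5) \<noteq> g (mk 1 3 1 5) \<Longrightarrow> f \<noteq> g"
  by auto

lemma elts_distinct [simp]:
  "id \<noteq> rot" "id \<noteq> rot ^^ 2" "id \<noteq> s 0" "id \<noteq> s (Suc 0)" "id \<noteq> s 2" "rot \<noteq> rot ^^ 2" "rot \<noteq> s 0" "rot \<noteq> s (Suc 0)"
  "rot \<noteq> s 2" "rot ^^ 2 \<noteq> s 0" "rot ^^ 2 \<noteq> s (Suc 0)" "rot ^^ 2 \<noteq> s 2" "s 0 \<noteq> s (Suc 0)" "s 0 \<noteq> s 2" "s (Suc 0) \<noteq> s 2"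
  by (rule mk_fun_neq; simp add: act_mk mk_eq_iff)+

lemmas elts_distinct' [simp] = elts_distinct[symmetric]

lemma comp_table:
  "rot \<circ> rot = rot ^^ 2" "rot \<circ> rot ^^ 2 = id" "rot ^^ 2 \<circ> rot = id" "rot ^^ 2 \<circ> rot ^^ 2 = rot"
  "rot \<circ> s 0 = s (Suc 0)" "rot \<circ> s (Suc 0) = s 2" "rot \<circ> s 2 = s 0"
  "rot ^^ 2 \<circ> s 0 = s 2" "rot ^^ 2 \<circ> s (Suc 0) = s 0" "rot ^^ 2 \<circ> s 2 = s (Suc 0)"
  "s 0 \<circ> rot = s 2" "s (Suc 0) \<circ> rot = s 0" "s 2 \<circ> rot = s (Suc 0)"
  "s 0 \<circ> rot ^^ 2 = s (Suc 0)" "s (Suc 0) \<circ> rot ^^ 2 = s 2" "s 2 \<circ> rot ^^ 2 = s 0"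
  "s 0 \<circ> s 0 = id" "s (Suc 0) \<circ> s (Suc 0) = id" "s 2 \<circ> s 2 = id"
  "s (Suc 0) \<circ> s 0 = rot" "s 2 \<circ> s (Suc 0) = rot" "s 0 \<circ> s 2 = rot"
  "s 2 \<circ> s 0 = rot ^^ 2" "s 0 \<circ> s (Suc 0) = rot ^^ 2" "s (Suc 0) \<circ> s 2 = rot ^^ 2"
  by (rule mk_ext; simp add: act_mk mk_eq_iff)+

lemma refl_eq_s: "refl = s 0"
  by (simp add: s_def)

lemma Ghat_eq: "Ghat = elts"
proof
  show "Ghat \<subseteq> elts"
  proof
    fix g assume "g \<in> Ghat"
    then show "g \<in> elts"
      by induction (auto simp: refl_eq_s comp_table simp del: comp_apply id_apply)
  qed
  have "rot \<in> Ghat" "refl \<in> Ghat" using Ghat.rot[OF Ghat.one] Ghat.refl[OF Ghat.one] by simp_all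
  then have *: "rot \<in> Ghat" "s 0 \<in> Ghat" "rot ^^ 2 \<in> Ghat" using Ghat.rot[of rot] by (simp_all add: refl_eq_s comp_table del: comp_apply id_apply)
  then have "s (Suc 0) \<in> Ghat" "s 2 \<in> Ghat"
    using Ghat.rot[of "s 0"] Ghat.rot[of "s (Suc 0)"] by (simp_all add: comp_table del: comp_apply id_apply)
  with * show "elts \<subseteq> Ghat" using Ghat.one by simp
qed

lemma card_Ghat: "card Ghat = 6"
  by (simp add: Ghat_eq)

lemma inv_elts [simp]: "inv id = id" "inv rot = rot ^^ 2" "inv (rot ^^ 2) = rot"
   "inv (s 0) = s 0" "inv (s (Suc 0)) = s (Suc 0)" "inv (s 2) = s 2"
  by (rule inv_unique_comp; simp add: comp_table del: comp_apply id_apply)+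

lemma linear_rot: "linear rot" and linear_refl: "linear refl"
  by (rule linearI; simp add: rot_def refl_def algebra_simps prod_eq_iff scaleR_conv_of_real)+

lemma linear_Ghat: "g \<in> Ghat \<Longrightarrow> linear g"
proof (induction rule: Ghat.induct)
  case one
  then show ?case by (rule linear_id)
next
  case (rot g)
  then show ?case by (intro linear_compose[OF _ linear_rot])
next
  case (refl g)
  then show ?case by (intro linear_compose[OF _ linear_refl])
qed

lemma Lattice_rot: "l \<in> \<Lambda> \<Longrightarrow> rot l \<in> \<Lambda>" and Lattice_refl: "l \<in> \<Lambda> \<Longrightarrow> refl l \<in> \<Lambda>"
  using rot_mk[of "X1 l" "Y1 l" "X2 l" "Y2 l"] refl_mk[of "X1 l" "Y1 l" "X2 l" "Y2 l"]
  unfolding mk_coords by (simp_all add: Lattice_iff)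

lemma Lattice_Ghat: "g \<in> Ghat \<Longrightarrow> l \<in> \<Lambda> \<Longrightarrow> g l \<in> \<Lambda>"
  by (induction rule: Ghat.induct) (simp_all add: Lattice_rot Lattice_refl)

lemma Ghat_elts: "id \<in> Ghat" "rot \<in> Ghat" "rot ^^ 2 \<in> Ghat" "s 0 \<in> Ghat" "s (Suc 0) \<in> Ghat" "s 2 \<in> Ghat"
  by (simp_all add: Ghat_eq)

lemma Ghat_cases:
  assumes "g \<in> Ghat"
  obtains "g = id" | "g = rot" | "g = rot ^^ 2" | "g = s 0" | "g = s (Suc 0)" | "g = s 2"
  using assms unfolding Ghat_eq by auto

lemma inv_Ghat:
  assumes "g \<in> Ghat" shows "inv g \<in> Ghat" "inv g \<circ> g = id" "g \<circ> inv g = id"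
  using assms by (cases rule: Ghat_cases; simp add: Ghat_elts comp_table del: comp_apply id_apply)+

lemma comp_Ghat: "g \<in> Ghat \<Longrightarrow> h \<in> Ghat \<Longrightarrow> g \<circ> h \<in> Ghat"
proof (induction rule: Ghat.induct)
  case one
  then show ?case by (simp only: id_comp)
qed (simp_all only: comp_assoc Ghat.intros)

section \<open>Fixed loci\<close>

lemma lattice_rel_class: "lattice_rel `` {z} = {w. w - z \<in> \<Lambda>}"
  by (auto simp: lattice_rel_def)

lemma X_class: "P \<in> X \<Longrightarrow> z \<in> P \<Longrightarrow> P = {w. w - z \<in> \<Lambda>}"
proof -
  assume P: "P \<in> X" and z: "z \<in> P"
  from P obtain x where x: "P = lattice_rel `` {x}" by (auto simp: X_def quotient_def)
  then have zx: "z - x \<in> \<Lambda>" using z by (simp add: lattice_rel_class)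
  show "P = {w. w - z \<in> \<Lambda>}"
    unfolding x lattice_rel_class
  proof (intro Collect_cong iffI)
    fix w show "w - x \<in> \<Lambda> \<Longrightarrow> w - z \<in> \<Lambda>" using Lattice_diff[OF _ zx, of "w - x"] by simp
    show "w - z \<in> \<Lambda> \<Longrightarrow> w - x \<in> \<Lambda>" using Lattice_add[OF _ zx, of "w - z"] by simp
  qed
qed

lemma class_in_X [simp]: "{w. w - z \<in> \<Lambda>} \<in> X"
  using quotientI[of z UNIV lattice_rel] by (simp add: X_def lattice_rel_class)

lemma Union_X [simp]: "\<Union> X = UNIV"
proof -
  have "z \<in> \<Union> X" for z :: vec
    using class_in_X[of z] by (rule UnionI) simp
  then show ?thesis by blast
qed

lemma X_nonempty: "P \<in> X \<Longrightarrow> \<exists>z. z \<in> P"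
proof -
  assume "P \<in> X"
  then obtain x where "P = {w. w - x \<in> \<Lambda>}" by (auto simp: X_def quotient_def lattice_rel_class)
  then have "x \<in> P" by simp
  then show ?thesis by blast
qed

lemma mem_Union_class: "M \<subseteq> X \<Longrightarrow> P \<in> X \<Longrightarrow> z \<in> P \<Longrightarrow> z \<in> \<Union> M \<longleftrightarrow> P \<in> M"
proof
  assume "M \<subseteq> X" "P \<in> X" "z \<in> P" "z \<in> \<Union> M"
  then obtain Q where "Q \<in> M" "z \<in> Q" by blast
  then show "P \<in> M" using X_class[of P z] X_class[of Q z] \<open>M \<subseteq> X\<close> \<open>P \<in> X\<close> \<open>z \<in> P\<close> by auto
qed blast

text \<open>Cosets are disjoint, so a set of points of the torus is faithfully recorded by its
  preimage in the cover. Loci can then be compared through congruences.\<close>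

lemma point_set_eqI:
  assumes "M \<subseteq> X" "N \<subseteq> X" "\<Union> M = \<Union> N" shows "M = N"
proof -
  have "P \<in> N" if "M \<subseteq> X" "N \<subseteq> X" "\<Union> M = \<Union> N" "P \<in> M" for P M N
  proof -
    have P: "P \<in> X" using that by blast
    then obtain z where "z \<in> P" using X_nonempty by blast
    then show ?thesis using mem_Union_class[OF that(1) P, of z] mem_Union_class[OF that(2) P, of z] that by simp
  qed
  from this[OF assms] this[OF assms(2,1) assms(3)[symmetric]] show ?thesis by (intro equalityI subsetI)
qed

lemma Union_Int_points: "M \<subseteq> X \<Longrightarrow> N \<subseteq> X \<Longrightarrow> \<Union> (M \<inter> N) = \<Union> M \<inter> \<Union> N"
proof (rule set_eqI)
  fix z assume M: "M \<subseteq> X" and N: "N \<subseteq> X"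
  have P: "{w. w - z \<in> \<Lambda>} \<in> X" "z \<in> {w. w - z \<in> \<Lambda>}" by simp_all
  show "z \<in> \<Union> (M \<inter> N) \<longleftrightarrow> z \<in> \<Union> M \<inter> \<Union> N"
    by (simp only: mem_Union_class[OF M P] mem_Union_class[OF N P] mem_Union_class[OF le_infI1[OF M] P] Int_iff)
qed

lemma Fix_subset: "Fix g \<subseteq> X"
  by (auto simp: Fix_def)

text \<open>A linear map preserving the lattice carries a coset into itself as soon as one
  representative moves by a lattice vector; that it maps onto the coset follows because its inverse
  preserves the lattice too.\<close>

lemma Union_Fix:
  assumes "g \<in> Ghat" shows "\<Union> (Fix g) = {z. g z - z \<in> \<Lambda>}"
proof (rule set_eqI)
  fix z
  let ?P = "{w. w - z \<in> \<Lambda>}"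
  note lin = linear_Ghat[OF assms]
  have P: "?P \<in> X" "z \<in> ?P" by simp_all
  have "g ` ?P = ?P \<longleftrightarrow> g z - z \<in> \<Lambda>"
  proof
    assume "g ` ?P = ?P"
    moreover have "g z \<in> g ` ?P" by (rule imageI[OF P(2)])
    ultimately have "g z \<in> ?P" by (simp only:)
    then show "g z - z \<in> \<Lambda>" by simp
  next
    assume gz: "g z - z \<in> \<Lambda>"
    show "g ` ?P = ?P"
    proof (intro equalityI subsetI)
      fix w assume "w \<in> g ` ?P"
      then obtain x where x: "w = g x" "x - z \<in> \<Lambda>" by blast
      have "g (x - z) + (g z - z) \<in> \<Lambda>" by (rule Lattice_add[OF Lattice_Ghat[OF assms x(2)] gz])
      then show "w \<in> ?P" by (simp add: x linear_diff[OF lin])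
    next
      fix w assume w: "w \<in> ?P"
      have i: "inv g \<in> Ghat" "inv g (g x) = x" "g (inv g x) = x" for x
        using inv_Ghat[OF assms] by (simp_all add: fun_eq_iff)
      have "inv g (w - z) - inv g (g z - z) \<in> \<Lambda>"
        using w by (intro Lattice_diff[OF Lattice_Ghat[OF i(1)] Lattice_Ghat[OF i(1) gz]]) simp
      then have "inv g w - z \<in> \<Lambda>"
        by (simp add: linear_diff[OF linear_Ghat[OF i(1)]] i)
      then have "g (inv g w) \<in> g ` ?P" by (intro imageI) simp
      then show "w \<in> g ` ?P" by (simp only: i)
    qed
  qed
  then show "z \<in> \<Union> (Fix g) \<longleftrightarrow> z \<in> {z. g z - z \<in> \<Lambda>}"
    using mem_Union_class[OF Fix_subset P, of g] P(1) by (simp add: Fix_def del: Union_iff)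
qed

text \<open>Discreteness of the lattice, one coordinate at a time.\<close>

lemma Ints_small_multiples:
  assumes "e > 0" "\<And>t. \<bar>t\<bar> < e \<Longrightarrow> t * x \<in> \<int>" shows "x = (0 :: real)"
proof (rule ccontr)
  assume x: "x \<noteq> 0"
  \<comment> \<open>Positive, below \<open>e\<close>, and so small that \<open>t * x\<close> has
    absolute value at most 1/2; an integer of that size is 0.\<close>
  define t where "t = min (e / 2) (1 / (2 * \<bar>x\<bar>))"
  have t: "t > 0" "\<bar>t\<bar> < e" using x assms(1) by (auto simp: t_def)
  have "t * \<bar>x\<bar> \<le> 1 / (2 * \<bar>x\<bar>) * \<bar>x\<bar>" by (intro mult_right_mono) (simp_all add: t_def)
  then have "\<bar>t * x\<bar> < 1" using x t by (simp add: abs_mult)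
  moreover obtain k where "t * x = of_int k" using assms(2)[OF t(2)] by (elim Ints_cases)
  ultimately have "t * x = 0" by (simp del: mult_eq_0_iff)
  then show False using x t by simp
qed

text \<open>Along a segment in the locus the vector \<open>g z - z\<close> stays in a discrete set
  and is therefore constant. Being fixed modulo \<Lambda> thus becomes being fixed exactly for
  tangent vectors.\<close>

lemma tangent_Fix:
  assumes g: "g \<in> Ghat" and z: "z \<in> \<Union> (Fix g)"
  shows "tangent (Fix g) z = {v. g v = v}"
proof -
  note lin = linear_Ghat[OF g]
  have gz: "g z - z \<in> \<Lambda>" using z unfolding Union_Fix[OF g] by simp
  have *: "z + t *\<^sub>R v \<in> \<Union> (Fix g) \<longleftrightarrow> t *\<^sub>R (g v - v) \<in> \<Lambda>" for t v
  proof -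
    have "g (z + t *\<^sub>R v) - (z + t *\<^sub>R v) = (g z - z) + t *\<^sub>R (g v - v)"
      by (simp add: linear_add[OF lin] linear_cmul[OF lin] algebra_simps)
    moreover have "(g z - z) + w \<in> \<Lambda> \<longleftrightarrow> w \<in> \<Lambda>" for w
      using Lattice_add[OF gz, of w] Lattice_diff[OF _ gz, of "(g z - z) + w"] by auto
    ultimately show ?thesis unfolding Union_Fix[OF g] mem_Collect_eq by (simp only:)
  qed
  show ?thesis
  proof (intro equalityI subsetI)
    fix v assume "v \<in> tangent (Fix g) z"
    then obtain e where e: "e > 0" "\<And>t::real. \<bar>t\<bar> < e \<Longrightarrow> t *\<^sub>R (g v - v) \<in> \<Lambda>"
      unfolding tangent_def * by blast
    then have "X1 (g v - v) = 0 \<and> Y1 (g v - v) = 0 \<and> X2 (g v - v) = 0 \<and> Y2 (g v - v) = 0"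
      unfolding Lattice_iff coords_scale
      by (intro conjI Ints_small_multiples[OF e(1)]) (simp_all del: coords_diff)
    then show "v \<in> {v. g v = v}" by (simp add: vec_eq_iff4)
  next
    fix v assume "v \<in> {v. g v = v}"
    then have "t *\<^sub>R (g v - v) \<in> \<Lambda>" for t :: real by simp
    then show "v \<in> tangent (Fix g) z" unfolding tangent_def * using zero_less_one by blast
  qed
qed

lemma Fix_id: "Fix id = X"
  by (auto simp: Fix_def)

lemma mem_Union_Fix_mk:
  "mk a b c d \<in> \<Union> (Fix rot) \<longleftrightarrow> b + a \<in> \<int> \<and> a - 2 * b \<in> \<int> \<and> d - 2 * c \<in> \<int> \<and> c + d \<in> \<int>"
  "mk a b c d \<in> \<Union> (Fix (rot ^^ 2)) \<longleftrightarrow> b - 2 * a \<in> \<int> \<and> a + b \<in> \<int> \<and> c + d \<in> \<int> \<and> c - 2 * d \<in> \<int>"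
  "mk a b c d \<in> \<Union> (Fix (s 0)) \<longleftrightarrow> b - 2 * a \<in> \<int> \<and> d - 2 * c \<in> \<int>"
  "mk a b c d \<in> \<Union> (Fix (s (Suc 0))) \<longleftrightarrow> a + b \<in> \<int> \<and> c - 2 * d \<in> \<int>"
  "mk a b c d \<in> \<Union> (Fix (s 2)) \<longleftrightarrow> a - 2 * b \<in> \<int> \<and> c + d \<in> \<int>"
proof -
  have neg: "- x - y \<in> \<int> \<longleftrightarrow> x + y \<in> \<int>" for x y :: real
  proof -
    have "- x - y = - (x + y)" "x + y = - (- x - y)" by simp_all
    then show ?thesis by (metis Ints_minus)
  qed
  have n: "x - y - y = x - 2 * y" for x y :: real by simp
  show "mk a b c d \<in> \<Union> (Fix rot) \<longleftrightarrow> b + a \<in> \<int> \<and> a - 2 * b \<in> \<int> \<and> d - 2 * c \<in> \<int> \<and> c + d \<in> \<int>"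
    "mk a b c d \<in> \<Union> (Fix (rot ^^ 2)) \<longleftrightarrow> b - 2 * a \<in> \<int> \<and> a + b \<in> \<int> \<and> c + d \<in> \<int> \<and> c - 2 * d \<in> \<int>"
    "mk a b c d \<in> \<Union> (Fix (s 0)) \<longleftrightarrow> b - 2 * a \<in> \<int> \<and> d - 2 * c \<in> \<int>"
    "mk a b c d \<in> \<Union> (Fix (s (Suc 0))) \<longleftrightarrow> a + b \<in> \<int> \<and> c - 2 * d \<in> \<int>"
    "mk a b c d \<in> \<Union> (Fix (s 2)) \<longleftrightarrow> a - 2 * b \<in> \<int> \<and> c + d \<in> \<int>"
    by (simp_all only: Union_Fix Ghat_elts mem_Collect_eq act_mk mk_arith Lattice_iff coords_mk n neg diff_self Ints_0 simp_thms)
      (simp_all only: add.commute[of b a] add.commute[of d c] conj_ac simp_thms)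
qed

text \<open>The two quantities add up to -(a + b). This is what identifies the fixed points of the
  two rotations.\<close>

lemma Ints_lin3:
  assumes "a + b \<in> \<int>" shows "a - 2 * b \<in> \<int> \<longleftrightarrow> b - 2 * a \<in> (\<int> :: real set)"
proof -
  have "b - 2 * a = - (a - 2 * b) - (a + b)" "a - 2 * b = - (b - 2 * a) - (a + b)" by simp_all
  then show ?thesis
    using Ints_diff[OF Ints_minus assms, of "a - 2 * b"] Ints_diff[OF Ints_minus assms, of "b - 2 * a"]
    by (simp only:) blast
qed

lemma Fix_eqI:
  assumes "M \<subseteq> X" "N \<subseteq> X" "\<And>a b c d. mk a b c d \<in> \<Union> M \<longleftrightarrow> mk a b c d \<in> \<Union> N"
  shows "M = N"
proof (rule point_set_eqI[OF assms(1,2)])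
  show "\<Union> M = \<Union> N"
  proof (rule set_eqI)
    fix z show "z \<in> \<Union> M \<longleftrightarrow> z \<in> \<Union> N"
      using assms(3)[of "X1 z" "Y1 z" "X2 z" "Y2 z"] unfolding mk_coords .
  qed
qed

section \<open>Lattice frames\<close>

text \<open>When \<open>f\<close> is dual to \<open>bs\<close>, this is the dual top form: its value
  on another basis of the same span is the determinant of the change of basis.\<close>

definition dual_form :: "(vec \<Rightarrow> vec \<Rightarrow> real) \<Rightarrow> vec list \<Rightarrow> vec list \<Rightarrow> real" where
  "dual_form f bs = foldr (\<lambda>b w. alt_wedge (cov (f b)) w) bs alt_one"

lemma dual_form_simps [simp]: "dual_form f [] = alt_one"
  "dual_form f (b # bs) = alt_wedge (cov (f b)) (dual_form f bs)"
  by (simp_all add: dual_form_def)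

lemma alt_dual_form: "(\<And>b. b \<in> set bs \<Longrightarrow> linear (f b)) \<Longrightarrow> alt_multilinear (dual_form f bs)"
  by (induction bs) (simp_all add: alt_wedge_alt alt_cov)

lemma dual_form_self:
  assumes "distinct bs" "\<And>b c. b \<in> set bs \<Longrightarrow> c \<in> set bs \<Longrightarrow> f b c = (if b = c then 1 else 0)"
  shows "dual_form f bs bs = 1"
  using assms
proof (induction bs)
  case Nil
  then show ?case by (simp add: alt_one_def)
next
  case (Cons b bs)
  have "alt_wedge (cov (f b)) (ins b (dual_form f bs)) bs = 0"
    by (rule alt_wedge_cov_vanish) (use Cons.prems in auto)
  then show ?case using Cons by (simp add: alt_wedge_cov_Cons)
qed

lemma alt_wedge_cov_degree:
  assumes "\<And>ws. length ws \<noteq> k \<Longrightarrow> w ws = 0" "length us \<noteq> Suc k"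
  shows "alt_wedge (cov c) w us = 0"
  using assms
proof (induction us arbitrary: w k)
  case Nil
  then show ?case by (simp add: cov_def)
next
  case (Cons v us)
  have "alt_wedge (cov c) (ins v w) us = 0"
  proof (cases k)
    case 0
    then have "ins v w = (\<lambda>us. 0)" using Cons.prems(1) by (simp add: ins_def)
    then show ?thesis by simp
  next
    case (Suc k')
    show ?thesis
      by (rule Cons.IH[of k']) (use Cons.prems Suc in \<open>simp_all add: ins_app\<close>)
  qed
  then show ?case using Cons.prems by (simp add: alt_wedge_cov_Cons)
qed

lemma dual_form_degree: "length us \<noteq> length bs \<Longrightarrow> dual_form f bs us = 0"
proof (induction bs arbitrary: us)
  case Nil
  then show ?case by (simp add: alt_one_def)
next
  case (Cons b bs)
  then show ?case by (simp add: alt_wedge_cov_degree[of "length bs"])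
qed

lemma dual_form_Ints:
  assumes "\<And>b u. b \<in> set bs \<Longrightarrow> u \<in> S \<Longrightarrow> f b u \<in> \<int>" "set us \<subseteq> S"
  shows "dual_form f bs us \<in> \<int>"
  using assms
proof (induction bs arbitrary: us)
  case Nil
  then show ?case by (simp add: alt_one_def)
next
  case (Cons b bs)
  have "cov (f b) ws \<in> \<int>" if "set ws \<subseteq> S" for ws
    using that Cons.prems(1)[of b] by (auto simp: cov_def split: list.split)
  then show ?case
    using alt_wedge_in_Ints[of S "cov (f b)" "dual_form f bs" us] Cons by simp
qed

lemma subseqs_full: "us \<in> set (subseqs bs) \<Longrightarrow> length us \<le> length bs \<and> (length us = length bs \<longrightarrow> us = bs)"
proof (induction bs arbitrary: us)
  case Nil
  then show ?case by simp
next
  case (Cons b bs)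
  then show ?case by (fastforce simp: Let_def)
qed

lemma alt_restrict: "alt_multilinear a \<Longrightarrow> alt_multilinear (\<lambda>us. if length us = n then a us else 0)"
proof (rule alt_multilinearI)
  fix us ws assume a: "alt_multilinear a"
  show "linear (\<lambda>v. if length (us @ v # ws) = n then a (us @ v # ws) else 0)"
    using altD_linear[OF a, of us ws] by (cases "length (us @ undefined # ws) = n") (simp_all add: linear_zero)
qed (use altD_eq[of a _ _ "[]"] in simp)

text \<open>The top exterior power of the span is a line. Cutting \<open>a\<close> down to its top
  degree first leaves \<open>bs\<close> as the only sublist on which the comparison is not
  trivial.\<close>

lemma top_form:
  assumes a: "alt_multilinear a" and bs: "distinct bs" and f: "\<And>b. b \<in> set bs \<Longrightarrow> linear (f b)"
    "\<And>b c. b \<in> set bs \<Longrightarrow> c \<in> set bs \<Longrightarrow> f b c = (if b = c then 1 else 0)"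
    and us: "set us \<subseteq> span (set bs)" "length us = length bs"
  shows "a us = a bs * dual_form f bs us"
proof -
  have "(if length us = length bs then a us else 0) = a bs * dual_form f bs us"
  proof (rule alt_eqI[OF alt_restrict[OF a] alt_scaled[OF alt_dual_form[OF f(1)]] _ us(1)])
    fix ws assume "ws \<in> set (subseqs bs)"
    then show "(if length ws = length bs then a ws else 0) = a bs * dual_form f bs ws"
      using subseqs_full[of ws bs] dual_form_self[OF bs f(2)] by (auto simp: dual_form_degree)
  qed
  then show ?thesis by (simp add: us)
qed

lemma dual_family:
  assumes "independent S"
  shows "\<exists>f :: vec \<Rightarrow> vec \<Rightarrow> real. \<forall>b. linear (f b) \<and> (\<forall>c\<in>S. f b c = (if b = c then 1 else 0))"
proof (rule choice, rule allI)
  show "\<exists>g. linear g \<and> (\<forall>c\<in>S. g c = (if b = c then 1 else (0 :: real)))" for b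
    using linear_independent_extend[OF assms, of "\<lambda>c. if b = c then 1 else 0"] by blast
qed

lemma oriented_frameD:
  assumes "oriented_frame M z bs"
  shows "distinct bs" "independent (set bs)" "span (set bs) = tangent M z"
    "{\<Sum>i<length bs. of_int (n i) *\<^sub>R bs ! i | n :: nat \<Rightarrow> int. True} = \<Lambda> \<inter> tangent M z" "pos_oriented bs"
  using assms by (simp_all add: oriented_frame_def)

lemma oriented_frame_subset: "oriented_frame M z bs \<Longrightarrow> set bs \<subseteq> \<Lambda>"
proof
  fix b assume fr: "oriented_frame M z bs" and "b \<in> set bs"
  then obtain i where i: "i < length bs" "b = bs ! i" by (auto simp: in_set_conv_nth)
  let ?n = "\<lambda>j. if j = i then 1 else (0 :: int)"
  have "(\<Sum>j<length bs. of_int (?n j) *\<^sub>R bs ! j) = (\<Sum>j<length bs. if j = i then bs ! i else 0)"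
    by (rule sum.cong) auto
  also have "\<dots> = b" using i by simp
  finally have "b = (\<Sum>j<length bs. of_int (?n j) *\<^sub>R bs ! j)" ..
  then have "b \<in> {\<Sum>i<length bs. of_int (n i) *\<^sub>R bs ! i | n :: nat \<Rightarrow> int. True}"
    by (intro CollectI exI[of _ ?n] conjI TrueI)
  then show "b \<in> \<Lambda>" unfolding oriented_frameD(4)[OF fr] by simp
qed

text \<open>Orientation as the sign of an alternating form, so that it scales by the determinant
  under a change of basis. For n = 2 this is the real part of dz1 \<and> dz2.\<close>

definition orient_form :: "nat \<Rightarrow> vec list \<Rightarrow> real" where
  "orient_form n = (if n = 2 then lincomb 1 (alt_wedge (cov (\<lambda>v. Re (fst v))) (cov (\<lambda>v. Re (snd v))))
      (-1) (alt_wedge (cov (\<lambda>v. Im (fst v))) (cov (\<lambda>v. Im (snd v))))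
     else alt_wedge (alt_wedge (alt_wedge (cov (\<lambda>v. Re (fst v))) (cov (\<lambda>v. Im (fst v)))) (cov (\<lambda>v. Re (snd v)))) (cov (\<lambda>v. Im (snd v))))"

lemma linear_Re_Im: "linear (\<lambda>v :: vec. Re (fst v))" "linear (\<lambda>v :: vec. Im (fst v))"
  "linear (\<lambda>v :: vec. Re (snd v))" "linear (\<lambda>v :: vec. Im (snd v))"
  by (rule linearI; simp)+

lemma alt_orient_form: "alt_multilinear (orient_form n)"
  by (simp add: orient_form_def alt_lincomb alt_wedge_alt alt_cov linear_Re_Im)

lemma covec_eq_cov: "covec f = (\<lambda>z. cov f)"
  by (simp add: covec_def cov_def)

lemma pos_oriented_iff:
  assumes "length bs = 2 \<or> length bs = 4"
  shows "pos_oriented bs \<longleftrightarrow> orient_form (length bs) bs > 0"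
  using assms
proof
  assume l: "length bs = 2"
  then obtain v w where "bs = [v, w]" by (auto simp: numeral_2_eq_2 length_Suc_conv)
  then show ?thesis
    by (simp add: pos_oriented_def orient_form_def lincomb_app alt_wedge_cov_Cons Re_Omega_def ins_app)
      (simp add: cov_def algebra_simps)
next
  assume l: "length bs = 4"
  then show ?thesis by (simp add: pos_oriented_def orient_form_def covec_eq_cov wedge_def)
qed

text \<open>The two dual top forms take integer values on each other's frames, and these values are
  inverse to each other.\<close>

lemma oriented_frames_eval:
  assumes bs: "oriented_frame M z bs" and vs: "oriented_frame M z' vs" and t: "tangent M z' = tangent M z"
    and l: "length bs = 2 \<or> length bs = 4" and a: "alt_multilinear a"
  shows "a vs = a bs"
proof -
  note b = oriented_frameD[OF bs] and v = oriented_frameD[OF vs, unfolded t]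
  have len: "length vs = length bs"
    using independent_span_bound[of "set bs" "set vs"] independent_span_bound[of "set vs" "set bs"]
      span_superset[of "set vs"] span_superset[of "set bs"]
      distinct_card[OF b(1)] distinct_card[OF v(1)] b(2,3) v(2,3) by simp
  have sb: "set bs \<subseteq> span (set vs)" and sv: "set vs \<subseteq> span (set bs)"
    using b(3) v(3) span_superset by auto
  obtain f :: "vec \<Rightarrow> vec \<Rightarrow> real"
    where "\<forall>b. linear (f b) \<and> (\<forall>c\<in>set bs. f b c = (if b = c then 1 else 0))"
    using dual_family[OF b(2)] ..
  then have f: "\<And>b. linear (f b)" "\<And>b c. c \<in> set bs \<Longrightarrow> f b c = (if b = c then 1 else 0)"
    by simp_all
  obtain g :: "vec \<Rightarrow> vec \<Rightarrow> real"
    where "\<forall>b. linear (g b) \<and> (\<forall>c\<in>set vs. g b c = (if b = c then 1 else 0))"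
    using dual_family[OF v(2)] ..
  then have g: "\<And>b. linear (g b)" "\<And>b c. c \<in> set vs \<Longrightarrow> g b c = (if b = c then 1 else 0)"
    by simp_all
  have int: "h b u \<in> \<int>" if h: "\<And>b. linear (h b)" "\<And>b c. c \<in> set cs \<Longrightarrow> h b c = (if b = c then 1 else 0)"
    "u \<in> \<Lambda> \<inter> tangent M z"
    "{\<Sum>i<length cs. of_int (n i) *\<^sub>R cs ! i | n :: nat \<Rightarrow> int. True} = \<Lambda> \<inter> tangent M z"
    for h :: "vec \<Rightarrow> vec \<Rightarrow> real" and cs b u
  proof -
    obtain n :: "nat \<Rightarrow> int" where "u = (\<Sum>i<length cs. of_int (n i) *\<^sub>R cs ! i)"
      using h(3) unfolding h(4)[symmetric] by blast
    then have "h b u = (\<Sum>i<length cs. of_int (n i) * h b (cs ! i))"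
      by (simp add: linear_sum[OF h(1)] linear_cmul[OF h(1)])
    also have "\<dots> \<in> \<int>" by (rule Ints_sum) (simp add: h(2))
    finally show ?thesis .
  qed
  have lat: "set bs \<subseteq> \<Lambda> \<inter> tangent M z" "set vs \<subseteq> \<Lambda> \<inter> tangent M z"
    using oriented_frame_subset[OF bs] oriented_frame_subset[OF vs] sb sv b(3) v(3) by auto
  have i: "dual_form f bs vs \<in> \<int>" "dual_form g vs bs \<in> \<int>"
    subgoal by (rule dual_form_Ints[OF int[OF f _ b(4)] lat(2)])
    subgoal by (rule dual_form_Ints[OF int[OF g _ v(4)] lat(1)])
    done
  have "dual_form g vs bs * dual_form f bs vs = dual_form g vs vs"
    by (rule top_form[symmetric]) (use f g b v sv len in \<open>auto intro: alt_dual_form\<close>)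
  also have "\<dots> = 1" by (rule dual_form_self) (use v g in auto)
  finally have "\<bar>dual_form f bs vs\<bar> = 1"
  proof -
    obtain m n where mn: "dual_form f bs vs = of_int m" "dual_form g vs bs = of_int n"
      using i by (auto elim!: Ints_cases)
    assume "dual_form g vs bs * dual_form f bs vs = 1"
    then have "of_int (n * m) = (of_int 1 :: real)" by (simp add: mn)
    then have "n * m = 1" by (simp only: of_int_eq_iff)
    then have "\<bar>m\<bar> = 1" by (auto simp: zmult_eq_1_iff)
    then show ?thesis by (simp add: mn)
  qed
  moreover have "dual_form f bs vs > 0"
  proof -
    have "orient_form (length bs) vs = orient_form (length bs) bs * dual_form f bs vs"
      by (rule top_form) (use f b sv len in \<open>auto intro: alt_orient_form\<close>)
    then show ?thesis
      using b(5) v(5) l len by (simp add: pos_oriented_iff zero_less_mult_iff)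
  qed
  moreover have "a vs = a bs * dual_form f bs vs"
    by (rule top_form[OF a]) (use f b sv len in auto)
  ultimately show ?thesis by simp
qed

section \<open>Tori of dimension two and four, and integration over them\<close>

definition torus :: "point set \<Rightarrow> vec list \<Rightarrow> bool" where
  "torus M bs \<longleftrightarrow> M \<subseteq> X \<and> subtorus M bs \<and> oriented_frame M 0 bs \<and> (length bs = 2 \<or> length bs = 4)"

lemma torusD:
  assumes "torus M bs"
  shows "M \<subseteq> X" "subtorus M bs" "oriented_frame M 0 bs" "length bs = 2 \<or> length bs = 4"
    "distinct bs" "independent (set bs)" "0 \<in> \<Union> M" "z \<in> \<Union> M \<Longrightarrow> tangent M z = span (set bs)"
    "set bs \<subseteq> span (set bs)"
  using assms subtorus_span[OF _ span_zero, of M bs] subtorusD(3)[of M bs z] span_superset[of "set bs"]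
  unfolding torus_def oriented_frame_def by auto

text \<open>Any two points of \<open>M\<close> have lifts that differ by a tangent vector, so the
  sum over components in \<open>integral_over\<close> has a single term.\<close>

lemma component_torus:
  assumes M: "torus M bs" and P: "P \<in> M" shows "component M P = M"
proof (intro equalityI subsetI)
  note sub = torusD(2)[OF M]
  fix Q assume "Q \<in> component M P"
  then obtain z v where Q: "Q = lattice_rel `` {z + v}" "z \<in> P" "v \<in> tangent M z"
    unfolding component_def by blast
  have z: "z \<in> \<Union> M" using P Q by blast
  have "z + v \<in> \<Union> M" using subtorus_add[OF sub z] Q(3) torusD(8)[OF M z] by simp
  then show "Q \<in> M"
    using mem_Union_class[OF torusD(1)[OF M], of Q "z + v"] by (simp add: Q lattice_rel_class)
next
  note sub = torusD(2)[OF M]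
  fix Q assume Q: "Q \<in> M"
  have QX: "Q \<in> X" and PX: "P \<in> X" using P Q torusD(1)[OF M] by auto
  obtain w z where w: "w \<in> Q" and z: "z \<in> P" using X_nonempty QX PX by blast
  have wM: "w \<in> \<Union> M" and zM: "z \<in> \<Union> M" using P Q w z by auto
  obtain l u where wl: "w = l + u" "l \<in> \<Lambda>" "u \<in> span (set bs)"
    using wM unfolding subtorusD(2)[OF sub] by blast
  obtain l' u' where zl: "z = l' + u'" "l' \<in> \<Lambda>" "u' \<in> span (set bs)"
    using zM unfolding subtorusD(2)[OF sub] by blast
  have "u - u' \<in> tangent M z" using torusD(8)[OF M zM] wl zl span_diff by blast
  moreover have "Q = lattice_rel `` {z + (u - u')}"
  proof -
    have "w - (z + (u - u')) = l - l'" by (simp add: wl zl)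
    then have "w - (z + (u - u')) \<in> \<Lambda>" using Lattice_diff wl zl by simp
    then have "w \<in> {x. x - (z + (u - u')) \<in> \<Lambda>}" by simp
    then show ?thesis
      using X_class[OF QX w] X_class[OF class_in_X, of w "z + (u - u')"] by (simp only: lattice_rel_class)
  qed
  ultimately show "Q \<in> component M P" unfolding component_def using z by blast
qed

text \<open>The definition picks a base point and a frame arbitrarily. The base point drops out
  because the average is constant on \<open>M\<close>; the frame drops out twice, as domain of the
  average and as argument of the form, the latter because oriented lattice frames have determinant
  1.\<close>

lemma integral_over_torus:
  assumes M: "torus M bs" and \<alpha>: "closed_on M \<alpha>"
  shows "integral_over M \<alpha> = avg bs \<alpha> bs"
proof -
  define z where "z = (SOME z. z \<in> \<Union> M)"
  define vs where "vs = (SOME vs. oriented_frame M z vs)"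
  have z: "z \<in> \<Union> M" unfolding z_def by (rule someI[of _ 0]) (rule torusD(7)[OF M])
  have tz: "tangent M z = tangent M 0" using torusD(8)[OF M] z torusD(7)[OF M] by simp
  have "oriented_frame M z bs" using torusD(3)[OF M] by (simp add: oriented_frame_def tz)
  then have vs: "oriented_frame M z vs" unfolding vs_def by (rule someI)
  have span: "span (set vs) = span (set bs)"
    using oriented_frameD(3)[OF vs] torusD(8)[OF M z] by simp
  have sub: "subtorus M vs"
    using torusD(2)[OF M] oriented_frame_subset[OF vs] 
    unfolding subtorus_def span by blast
  obtain P where "P \<in> M" using torusD(7)[OF M] by blast
  then have "component M ` M = {M}" using component_torus[OF M] by force
  then have "integral_over M \<alpha> = cell_integral (\<lambda>w. \<alpha> w vs) z vs"
    unfolding integral_over_def by (simp add: z_def[symmetric] vs_def[symmetric] Let_def del: Union_iff)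
  also have "\<dots> = cavg vs \<alpha> z vs" by (simp add: cavg_def)
  also have "\<dots> = avg vs \<alpha> vs" by (rule cavg_eq_avg[OF sub closed_onD(1)[OF \<alpha>] z])
  also have "\<dots> = avg bs \<alpha> vs"
    by (rule avg_frame_independent[OF torusD(2)[OF M] sub \<alpha>]) (use span span_superset in blast)
  also have "\<dots> = avg bs \<alpha> bs"
    by (rule oriented_frames_eval[OF torusD(3)[OF M] vs tz torusD(4)[OF M] alt_avg[OF closed_onD(1)[OF \<alpha>]]])
  finally show ?thesis .
qed

lemma span_pair: "v \<in> span {p, q} \<longleftrightarrow> (\<exists>a b. v = a *\<^sub>R p + b *\<^sub>R q)" for v :: vec
  unfolding span_insert span_singleton
  by (auto simp: algebra_simps)

lemma independent_dual:
  fixes f :: "vec \<Rightarrow> vec \<Rightarrow> real"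
  assumes "\<And>b. b \<in> S \<Longrightarrow> linear (f b)" "\<And>b. b \<in> S \<Longrightarrow> f b b \<noteq> 0"
    "\<And>b c. b \<in> S \<Longrightarrow> c \<in> S \<Longrightarrow> b \<noteq> c \<Longrightarrow> f b c = 0"
  shows "independent S"
proof
  assume "dependent S"
  then obtain b where b: "b \<in> S" "b \<in> span (S - {b})" unfolding dependent_def by blast
  have "f b b = 0"
    by (rule linear_eq_0_on_span[OF assms(1)[OF b(1)] _ b(2)]) (use assms(3)[OF b(1)] in blast)
  then show False using assms(2) b(1) by blast
qed

text \<open>Criterion for the reflection loci. Integrality of \<open>f1\<close> and
  \<open>f2\<close> on \<Lambda> makes \<open>p\<close>, \<open>q\<close> generate all fixed lattice
  vectors rather than a sublattice; the condition on points fixed modulo \<Lambda> makes the locus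
  connected.\<close>

lemma pair_torus:
  assumes g: "g \<in> Ghat" and f: "linear f1" "linear f2"
    and dual: "f1 p = 1" "f1 q = 0" "f2 p = 0" "f2 q = 1"
    and pq: "p \<in> \<Lambda>" "q \<in> \<Lambda>" "g p = p" "g q = q"
    and fixed: "\<And>v. g v = v \<Longrightarrow> v = f1 v *\<^sub>R p + f2 v *\<^sub>R q"
    and int: "\<And>v. v \<in> \<Lambda> \<Longrightarrow> f1 v \<in> \<int> \<and> f2 v \<in> \<int>"
    and red: "\<And>z. g z - z \<in> \<Lambda> \<Longrightarrow> z - (f1 z *\<^sub>R p + f2 z *\<^sub>R q) \<in> \<Lambda>"
    and pos: "Re_Omega p q > 0"
  shows "torus (Fix g) [p, q]"
proof -
  note lin = linear_Ghat[OF g]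
  have fx: "g (a *\<^sub>R p + b *\<^sub>R q) = a *\<^sub>R p + b *\<^sub>R q" for a b
    by (simp add: linear_add[OF lin] linear_cmul[OF lin] pq)
  have T: "{v. g v = v} = span {p, q}"
  proof (intro equalityI subsetI)
    fix v assume "v \<in> {v. g v = v}"
    then show "v \<in> span {p, q}" using fixed[of v] unfolding span_pair by blast
  next
    fix v assume "v \<in> span {p, q}"
    then show "v \<in> {v. g v = v}" unfolding span_pair using fx by auto
  qed
  have U: "\<Union> (Fix g) = {l + v |l v. l \<in> \<Lambda> \<and> v \<in> span {p, q}}"
  proof (intro equalityI subsetI)
    fix z assume "z \<in> \<Union> (Fix g)"
    then have "z - (f1 z *\<^sub>R p + f2 z *\<^sub>R q) \<in> \<Lambda>" unfolding Union_Fix[OF g] by (simp add: red)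
    moreover have "f1 z *\<^sub>R p + f2 z *\<^sub>R q \<in> span {p, q}" unfolding span_pair by blast
    moreover have "z = (z - (f1 z *\<^sub>R p + f2 z *\<^sub>R q)) + (f1 z *\<^sub>R p + f2 z *\<^sub>R q)" by simp
    ultimately show "z \<in> {l + v |l v. l \<in> \<Lambda> \<and> v \<in> span {p, q}}" by blast
  next
    fix z assume "z \<in> {l + v |l v. l \<in> \<Lambda> \<and> v \<in> span {p, q}}"
    then obtain l v where z: "z = l + v" "l \<in> \<Lambda>" "g v = v" unfolding T[symmetric] by blast
    then have "g z - z = g l - l" by (simp add: linear_add[OF lin])
    then show "z \<in> \<Union> (Fix g)" unfolding Union_Fix[OF g] using Lattice_diff[OF Lattice_Ghat[OF g z(2)] z(2)] by simp
  qed
  have z0: "0 \<in> \<Union> (Fix g)" unfolding Union_Fix[OF g] by (simp add: linear_0[OF lin])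
  have ne: "p \<noteq> q" using dual by auto
  have ind: "independent {p, q}"
    by (rule independent_dual[of _ "\<lambda>b. if b = p then f1 else f2"]) (use f dual ne in auto)
  have L: "{\<Sum>i<length [p, q]. of_int (n i) *\<^sub>R [p, q] ! i | n :: nat \<Rightarrow> int. True} = \<Lambda> \<inter> {v. g v = v}"
  proof (intro equalityI subsetI)
    fix v assume "v \<in> {\<Sum>i<length [p, q]. of_int (n i) *\<^sub>R [p, q] ! i | n :: nat \<Rightarrow> int. True}"
    then obtain n :: "nat \<Rightarrow> int" where v: "v = of_int (n 0) *\<^sub>R p + of_int (n 1) *\<^sub>R q" by auto
    then show "v \<in> \<Lambda> \<inter> {v. g v = v}" using pq(1,2) by (simp add: fx Lattice_iff)
  next
    fix v assume v: "v \<in> \<Lambda> \<inter> {v. g v = v}"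
    then obtain m k where mk: "f1 v = of_int m" "f2 v = of_int k" using int[of v] by (auto elim!: Ints_cases)
    let ?n = "\<lambda>i. if i = 0 then m else (k :: int)"
    have "v = (\<Sum>i<length [p, q]. of_int (?n i) *\<^sub>R [p, q] ! i)"
      using fixed[of v] v by (simp add: mk)
    then show "v \<in> {\<Sum>i<length [p, q]. of_int (n i) *\<^sub>R [p, q] ! i | n :: nat \<Rightarrow> int. True}"
      by (intro CollectI exI[of _ ?n] conjI TrueI)
  qed
  show ?thesis
    unfolding torus_def subtorus_def oriented_frame_def tangent_Fix[OF g z0]
  proof (intro conjI)
    show "\<forall>z\<in>\<Union> (Fix g). tangent (Fix g) z = span (set [p, q])"
      by (intro ballI) (simp add: tangent_Fix[OF g] T)
    show "pos_oriented [p, q]" using pos by (simp add: pos_oriented_def)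
  qed (use Fix_subset ne ind pq U T L in simp_all)
qed

definition std :: "vec list" where
  "std = [mk 1 0 0 0, mk 0 1 0 0, mk 0 0 1 0, mk 0 0 0 1]"

text \<open>The frame of \<open>L 0\<close>, carried to \<open>L i\<close> by the rotation that also
  transports classes, so that an invariant class has the same values on all three frames. The vector
  (1, 2) generates the lattice points of the line y = 2x, and the signs in the second vector make
  the frame positive for Re \<Omega>.\<close>

definition bs :: "nat \<Rightarrow> vec list" where
  "bs i = map (rot ^^ (2 * i)) [mk 1 2 0 0, mk 0 0 (-1) (-2)]"

lemma bs_explicit: "bs 0 = [mk 1 2 0 0, mk 0 0 (-1) (-2)]" "bs (Suc 0) = [mk 1 (-1) 0 0, mk 0 0 2 1]"
  "bs 2 = [mk (-2) (-1) 0 0, mk 0 0 (-1) 1]"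
  by (simp_all add: bs_def numeral_eq_Suc rot_mk)

lemma Re_Omega_mk: "Re_Omega (mk a b 0 0) (mk 0 0 c d) = a * c - (a * d + b * c) / 2 - b * d / 2"
  by (simp add: Re_Omega_def mk_def algebra_simps power2_eq_square)

lemma s_fixed_iff: "s 0 v = v \<longleftrightarrow> Y1 v = 2 * X1 v \<and> Y2 v = 2 * X2 v"
  "s (Suc 0) v = v \<longleftrightarrow> Y1 v = - X1 v \<and> X2 v = 2 * Y2 v"
  "s 2 v = v \<longleftrightarrow> X1 v = 2 * Y1 v \<and> X2 v = - Y2 v"
  using s_mk[of "X1 v" "Y1 v" "X2 v" "Y2 v"] by (auto simp: vec_eq_iff4)

lemma mem_Union_Fix_s:
  "s 0 z - z \<in> \<Lambda> \<Longrightarrow> Y1 z - 2 * X1 z \<in> \<int> \<and> Y2 z - 2 * X2 z \<in> \<int>"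
  "s (Suc 0) z - z \<in> \<Lambda> \<Longrightarrow> X1 z + Y1 z \<in> \<int> \<and> X2 z - 2 * Y2 z \<in> \<int>"
  "s 2 z - z \<in> \<Lambda> \<Longrightarrow> X1 z - 2 * Y1 z \<in> \<int> \<and> X2 z + Y2 z \<in> \<int>"
  using mem_Union_Fix_mk[of "X1 z" "Y1 z" "X2 z" "Y2 z"] by (simp_all add: Union_Fix Ghat_elts del: Union_iff)

lemma torus_s: "torus (Fix (s 0)) (bs 0)" "torus (Fix (s (Suc 0))) (bs (Suc 0))" "torus (Fix (s 2)) (bs 2)"
proof -
  have neg: "linear (\<lambda>v. - f v)" if "linear f" for f :: "vec \<Rightarrow> real" using linear_compose_neg[OF that] .
  show "torus (Fix (s 0)) (bs 0)"
    unfolding bs_explicit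
  proof (rule pair_torus[where ?f1.0 = X1 and ?f2.0 = "\<lambda>v. - X2 v"])
    show "z - (X1 z *\<^sub>R mk 1 2 0 0 + (- X2 z) *\<^sub>R mk 0 0 (- 1) (- 2)) \<in> \<Lambda>" if "s 0 z - z \<in> \<Lambda>" for z
      using mem_Union_Fix_s(1)[OF that] by (simp add: Lattice_iff mult.commute)
    show "v = X1 v *\<^sub>R mk 1 2 0 0 + (- X2 v) *\<^sub>R mk 0 0 (- 1) (- 2)" if "s 0 v = v" for v
      using that unfolding s_fixed_iff by (simp add: vec_eq_iff4)
  qed (use linear_coords neg in \<open>simp_all add: Ghat_elts Lattice_iff s_mk Re_Omega_mk\<close>)
  show "torus (Fix (s (Suc 0))) (bs (Suc 0))"
    unfolding bs_explicit
  proof (rule pair_torus[where ?f1.0 = X1 and ?f2.0 = Y2])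
    show "z - (X1 z *\<^sub>R mk 1 (- 1) 0 0 + Y2 z *\<^sub>R mk 0 0 2 1) \<in> \<Lambda>" if "s (Suc 0) z - z \<in> \<Lambda>" for z
      using mem_Union_Fix_s(2)[OF that] by (simp add: Lattice_iff mult.commute add.commute)
    show "v = X1 v *\<^sub>R mk 1 (- 1) 0 0 + Y2 v *\<^sub>R mk 0 0 2 1" if "s (Suc 0) v = v" for v
      using that unfolding s_fixed_iff by (simp add: vec_eq_iff4)
  qed (use linear_coords neg in \<open>simp_all add: Ghat_elts Lattice_iff s_mk Re_Omega_mk\<close>)
  show "torus (Fix (s 2)) (bs 2)"
    unfolding bs_explicit
  proof (rule pair_torus[where ?f1.0 = "\<lambda>v. - Y1 v" and ?f2.0 = Y2])
    show "z - ((- Y1 z) *\<^sub>R mk (- 2) (- 1) 0 0 + Y2 z *\<^sub>R mk 0 0 (- 1) 1) \<in> \<Lambda>" if "s 2 z - z \<in> \<Lambda>" for z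
      using mem_Union_Fix_s(3)[OF that] by (simp add: Lattice_iff mult.commute)
    show "v = (- Y1 v) *\<^sub>R mk (- 2) (- 1) 0 0 + Y2 v *\<^sub>R mk 0 0 (- 1) 1" if "s 2 v = v" for v
      using that unfolding s_fixed_iff by (simp add: vec_eq_iff4)
  qed (use linear_coords neg in \<open>simp_all add: Ghat_elts Lattice_iff s_mk Re_Omega_mk\<close>)
qed

lemma std_expand: "v = X1 v *\<^sub>R mk 1 0 0 0 + Y1 v *\<^sub>R mk 0 1 0 0 + X2 v *\<^sub>R mk 0 0 1 0 + Y2 v *\<^sub>R mk 0 0 0 1"
  by (simp add: vec_eq_iff4)

lemma span_std: "span (set std) = UNIV"
proof -
  have "v \<in> span (set std)" for v
    by (subst std_expand[of v]) (intro span_add span_mul span_base; simp add: std_def)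
  then show ?thesis by blast
qed

lemma tangent_X: "tangent X z = UNIV"
  using tangent_Fix[OF Ghat_elts(1), of z] by (simp add: Fix_id)

lemma torus_X: "torus X std"
proof -
  have sub: "set std \<subseteq> \<Lambda>" by (simp add: std_def Lattice_iff)
  have ind: "independent (set std)"
    by (rule independent_dual[of _ "\<lambda>b. if X1 b = 1 then X1 else if Y1 b = 1 then Y1 else if X2 b = 1 then X2 else Y2"])
      (unfold std_def list.set, elim insertE emptyE; simp add: linear_coords mk_eq_iff)+
  have L: "{\<Sum>i<length std. of_int (n i) *\<^sub>R std ! i | n :: nat \<Rightarrow> int. True} = \<Lambda>"
  proof (intro equalityI subsetI)
    fix v assume "v \<in> {\<Sum>i<length std. of_int (n i) *\<^sub>R std ! i | n :: nat \<Rightarrow> int. True}"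
    then show "v \<in> \<Lambda>" by (auto simp: std_def numeral_eq_Suc Lattice_iff)
  next
    fix v assume "v \<in> \<Lambda>"
    then obtain a b c d where v: "X1 v = of_int a" "Y1 v = of_int b" "X2 v = of_int c" "Y2 v = of_int d"
      unfolding Lattice_iff by (auto elim!: Ints_cases)
    let ?n = "\<lambda>i::nat. if i = 0 then a else if i = 1 then b else if i = 2 then c else d"
    have "v = (\<Sum>i<length std. of_int (?n i) *\<^sub>R std ! i)"
      by (subst std_expand) (simp add: std_def numeral_eq_Suc v)
    then show "v \<in> {\<Sum>i<length std. of_int (n i) *\<^sub>R std ! i | n :: nat \<Rightarrow> int. True}"
      by (intro CollectI exI[of _ ?n] conjI TrueI)
  qed
  have pos: "pos_oriented std"
    by (simp add: pos_oriented_def std_def covec_eq_cov wedge_def alt_wedge_assoc alt_wedge_cov_Cons ins_app)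
      (simp add: cov_def mk_def)
  show ?thesis
    unfolding torus_def subtorus_def oriented_frame_def tangent_X Union_X span_std
  proof (intro conjI)
    have "w \<in> {l + v |l v. l \<in> \<Lambda> \<and> v \<in> UNIV}" for w
      by (intro CollectI exI[of _ 0] exI[of _ w]) simp
    then show "UNIV = {l + v |l v. l \<in> \<Lambda> \<and> v \<in> UNIV}" by blast
    show "distinct std" by (simp add: std_def mk_eq_iff)
  qed (use sub ind L pos in \<open>simp_all add: std_def\<close>)
qed

section \<open>Intersections of the fixed loci\<close>

lemma Fix_rot2: "Fix (rot ^^ 2) = F"
  unfolding F_def
proof (rule Fix_eqI[OF Fix_subset Fix_subset], unfold mem_Union_Fix_mk)
  fix a b c d :: real
  show "(b - 2 * a \<in> \<int> \<and> a + b \<in> \<int> \<and> c + d \<in> \<int> \<and> c - 2 * d \<in> \<int>) =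
       (b + a \<in> \<int> \<and> a - 2 * b \<in> \<int> \<and> d - 2 * c \<in> \<int> \<and> c + d \<in> (\<int> :: real set))"
    using Ints_lin3[of a b] Ints_lin3[of c d] by (auto simp: add.commute)
qed

lemma F_subset_X: "F \<subseteq> X" by (simp add: F_def Fix_subset)

lemma Fix_Int_eqI:
  assumes "\<And>a b c d. mk a b c d \<in> \<Union> (Fix g) \<and> mk a b c d \<in> \<Union> (Fix h) \<longleftrightarrow> mk a b c d \<in> \<Union> (Fix rot)"
  shows "Fix g \<inter> Fix h = F"
  unfolding F_def
  by (rule Fix_eqI) (use Fix_subset assms in \<open>auto simp: Union_Int_points simp del: Union_iff\<close>)

text \<open>Two reflections generate the group, so points on both loci are fixed by all of it. That
  conversely every point fixed by \<open>rot\<close> lies on the reflection loci is arithmetic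
  modulo \<Lambda>.\<close>

lemma Fix_Int_table:
  "Fix (s 0) \<inter> Fix (s (Suc 0)) = F" "Fix (s (Suc 0)) \<inter> Fix (s 2) = F" "Fix (s 2) \<inter> Fix (s 0) = F"
proof -
  have l: "a + b \<in> \<int>" if "a - 2 * b \<in> \<int>" "b - 2 * a \<in> \<int>" for a b :: real
    using Ints_minus[OF Ints_add[OF that]] by simp
  show "Fix (s 0) \<inter> Fix (s (Suc 0)) = F" "Fix (s (Suc 0)) \<inter> Fix (s 2) = F" "Fix (s 2) \<inter> Fix (s 0) = F"
    by (rule Fix_Int_eqI; unfold mem_Union_Fix_mk;
        use Ints_lin3 l in \<open>metis add.commute\<close>)+
qed

text \<open>The whole group fixes the nine points one by one; invariance therefore never permutes
  them.\<close>

lemma F_subset_Fix: "g \<in> Ghat \<Longrightarrow> F \<subseteq> Fix g"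
  using Fix_Int_table Fix_rot2 F_subset_X by (elim Ghat_cases) (auto simp: F_def Fix_id)

section \<open>The nine fixed points of the rotation\<close>

text \<open>In each factor a multiple of (1 + 2 \<omega>) / 3, which generates the kernel of
  multiplication by 1 - \<omega> on the elliptic curve, a group of order three.\<close>

definition fpt :: "nat \<Rightarrow> nat \<Rightarrow> vec" where
  "fpt m n = mk (m / 3) (2 * m / 3) (n / 3) (2 * n / 3)"

definition pt :: "nat \<times> nat \<Rightarrow> point" where
  "pt mn = {w. w - fpt (fst mn) (snd mn) \<in> \<Lambda>}"

lemma mem_F_iff: "mk a b c d \<in> \<Union> F \<longleftrightarrow> a + b \<in> \<int> \<and> b - 2 * a \<in> \<int> \<and> c + d \<in> \<int> \<and> d - 2 * c \<in> \<int>"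
  unfolding F_def mem_Union_Fix_mk using Ints_lin3[of a b] Ints_lin3[of c d] by (auto simp: add.commute)

lemma third_residue:
  assumes "a + b \<in> \<int>" "b - 2 * a \<in> (\<int> :: real set)"
  obtains m :: nat where "m < 3" "a - m / 3 \<in> \<int>" "b - 2 * m / 3 \<in> \<int>"
proof -
  obtain k l where k: "a + b = of_int k" and l: "b - 2 * a = of_int l" using assms by (auto elim!: Ints_cases)
  \<comment> \<open>Subtracting the two congruences gives 3 a = k - l, so the residue of k - l
    modulo 3 decides which third \<open>a\<close> is.\<close>
  define m where "m = nat ((k - l) mod 3)"
  define j where "j = (k - l) div 3"
  have m: "real m = of_int ((k - l) mod 3)" by (simp add: m_def)
  have "k - l = 3 * j + (k - l) mod 3" by (simp add: j_def)
  then have "of_int (k - l) = (of_int (3 * j + (k - l) mod 3) :: real)" by simp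
  then have e: "of_int k - of_int l = 3 * of_int j + real m" by (simp add: m)
  have a: "a - m / 3 = of_int j" using k l e by simp
  have b: "b - 2 * m / 3 = of_int (k - j) - m" using k a by simp
  show ?thesis
    by (rule that[of m]) (unfold a b, simp_all add: m_def)
qed

lemma fpt_mem_F: "fpt m n \<in> \<Union> F"
  unfolding fpt_def mem_F_iff by (simp add: field_simps)

lemma pt_mem: "fpt (fst mn) (snd mn) \<in> pt mn"
  by (simp add: pt_def)

lemma pt_in_F: "pt mn \<in> F"
  using mem_Union_class[OF F_subset_X, of "pt mn" "fpt (fst mn) (snd mn)"] fpt_mem_F pt_mem
  by (simp add: pt_def del: Union_iff)

lemma F_eq: "F = pt ` ({..<3} \<times> {..<3})"
proof (intro equalityI subsetI)
  fix P assume P: "P \<in> F"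
  then have PX: "P \<in> X" using F_subset_X by blast
  then obtain z where z: "z \<in> P" using X_nonempty by blast
  then have zF: "mk (X1 z) (Y1 z) (X2 z) (Y2 z) \<in> \<Union> F" unfolding mk_coords using P by (rule UnionI[rotated])
  obtain m :: nat where m: "m < 3" "X1 z - m / 3 \<in> \<int>" "Y1 z - 2 * m / 3 \<in> \<int>"
    using zF unfolding mem_F_iff using third_residue[of "X1 z" "Y1 z"] by blast
  obtain n :: nat where n: "n < 3" "X2 z - n / 3 \<in> \<int>" "Y2 z - 2 * n / 3 \<in> \<int>"
    using zF unfolding mem_F_iff using third_residue[of "X2 z" "Y2 z"] by blast
  have "z \<in> pt (m, n)" using m n by (simp add: pt_def fpt_def Lattice_iff)
  then have "P = pt (m, n)"
    using X_class[OF PX z] X_class[of "pt (m, n)" z] pt_in_F[of "(m, n)"] F_subset_X by blast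
  then show "P \<in> pt ` ({..<3} \<times> {..<3})" using m n by simp
next
  fix P assume "P \<in> pt ` ({..<3} \<times> {..<3})"
  then show "P \<in> F" using pt_in_F by blast
qed

lemma third_Ints: "m < 3 \<Longrightarrow> n < 3 \<Longrightarrow> real m / 3 - real n / 3 \<in> \<int> \<Longrightarrow> m = n"
proof -
  assume mn: "m < 3" "n < 3" "real m / 3 - real n / 3 \<in> \<int>"
  then obtain k where "real m / 3 - real n / 3 = of_int k" by (auto elim!: Ints_cases)
  then have "real m - real n = 3 * of_int k" by simp
  then have "of_int (int m - int n) = (of_int (3 * k) :: real)" by simp
  then have "int m - int n = 3 * k" by (simp only: of_int_eq_iff)
  then show ?thesis using mn(1,2) by presburger
qed

lemma inj_pt: "inj_on pt ({..<3} \<times> {..<3})"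
proof (rule inj_onI)
  fix x y :: "nat \<times> nat" assume x: "x \<in> {..<3} \<times> {..<3}" and y: "y \<in> {..<3} \<times> {..<3}" and e: "pt x = pt y"
  have "fpt (fst x) (snd x) \<in> pt y" using pt_mem[of x] by (simp add: e)
  then have "fst x = fst y" "snd x = snd y"
    using third_Ints[of "fst x" "fst y"] third_Ints[of "snd x" "snd y"] x y
    by (auto simp: pt_def fpt_def mk_arith Lattice_iff)
  then show "x = y" by (simp add: prod_eq_iff)
qed

lemma card_F: "card F = 9" and finite_F [simp]: "finite F"
  unfolding F_eq by (simp_all add: card_image[OF inj_pt])

text \<open>By periodicity any representative of the coset gives the same number
  (\<open>val_eq\<close>).\<close>

definition val :: "form \<Rightarrow> point \<Rightarrow> real" where
  "val \<alpha> p = \<alpha> (SOME z. z \<in> p) []"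

lemma val_eq:
  assumes "is_form \<alpha>" "p \<in> F" "z \<in> p" shows "\<alpha> z [] = val \<alpha> p"
proof -
  define w where "w = (SOME z. z \<in> p)"
  have w: "w \<in> p" unfolding w_def by (rule someI[of _ z]) (rule assms)
  have "p = {x. x - w \<in> \<Lambda>}" using X_class[OF _ w] assms(2) F_subset_X by blast
  then have "z - w \<in> \<Lambda>" using assms(3) by simp
  then have "\<alpha> (w + (z - w)) = \<alpha> w" by (rule is_formD(3)[OF assms(1)])
  then show ?thesis by (simp add: val_def w_def)
qed

lemma point_in_UnionF: "p \<in> F \<Longrightarrow> z \<in> p \<Longrightarrow> z \<in> \<Union> F" by blast

lemma F_point: "p \<in> F \<Longrightarrow> \<exists>z. z \<in> p"
  using X_nonempty F_subset_X by blast

lemma tangent_F: "z \<in> \<Union> F \<Longrightarrow> tangent F z = {0}"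
proof -
  assume "z \<in> \<Union> F"
  then have "tangent F z = {v. rot v = v}" unfolding F_def by (rule tangent_Fix[OF Ghat_elts(2)])
  moreover have "v = 0" if "rot v = v" for v
    using that rot_mk[of "X1 v" "Y1 v" "X2 v" "Y2 v"] by (simp add: vec_eq_iff4)
  moreover have "rot 0 = 0" by (rule linear_0[OF linear_rot])
  ultimately show ?thesis by auto
qed

lemma form_zero_tangent:
  assumes "alt_multilinear a" "set us \<subseteq> {0}" "us \<noteq> []" shows "a us = 0"
proof -
  obtain ws where "us = 0 # ws" using assms(2,3) by (cases us) auto
  then show ?thesis using alt_zero[OF assms(1), of "[]" ws] by simp
qed

lemma closed_on_F: "is_form \<alpha> \<Longrightarrow> closed_on F \<alpha>"
proof (rule closed_onI)
  fix z us assume a: "is_form \<alpha>" and z: "z \<in> \<Union> F" and us: "set us \<subseteq> tangent F z"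
  show "ext_d \<alpha> z us = 0"
  proof (cases us)
    case (Cons u ws)
    have "dd (\<lambda>w. \<alpha> w (take i us @ drop (Suc i) us)) (us ! i) z = 0" if "i < length us" for i
    proof -
      have "us ! i = 0" using us nth_mem[OF that] unfolding tangent_F[OF z] by blast
      then show ?thesis using linear_0[OF linear_dd[OF csmoothD[OF is_formD(1)[OF a]]]] by simp
    qed
    then show ?thesis by (simp add: ext_d_def)
  qed simp
qed

text \<open>The locus is discrete: positive degree is invisible on the zero tangent space, and in
  degree zero no form is exact except 0.\<close>

lemma cohomologous_F_iff:
  assumes "is_form \<alpha>" "is_form \<beta>"
  shows "cohomologous F \<alpha> \<beta> \<longleftrightarrow> (\<forall>p\<in>F. val \<alpha> p = val \<beta> p)"
proof
  assume "cohomologous F \<alpha> \<beta>"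
  then obtain \<eta> where \<eta>: "is_form \<eta>"
    "\<And>z vs. z \<in> \<Union> F \<Longrightarrow> set vs \<subseteq> tangent F z \<Longrightarrow> \<alpha> z vs = \<beta> z vs + ext_d \<eta> z vs"
    by (rule cohomologousE) blast
  show "\<forall>p\<in>F. val \<alpha> p = val \<beta> p"
  proof
    fix p assume p: "p \<in> F"
    obtain z where z: "z \<in> p" using F_point[OF p] by blast
    have "\<alpha> z [] = \<beta> z []" using \<eta>(2)[OF point_in_UnionF[OF p z], of "[]"] by simp
    then show "val \<alpha> p = val \<beta> p" using val_eq[OF assms(1) p z] val_eq[OF assms(2) p z] by simp
  qed
next
  assume v: "\<forall>p\<in>F. val \<alpha> p = val \<beta> p"
  show "cohomologous F \<alpha> \<beta>"
  proof (rule cohomologous_eq_onI[OF closed_on_F[OF assms(1)] closed_on_F[OF assms(2)]])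
    fix z us assume z: "z \<in> \<Union> F" and us: "set us \<subseteq> tangent F z"
    obtain p where p: "p \<in> F" "z \<in> p" using z by blast
    show "\<alpha> z us = \<beta> z us"
    proof (cases "us = []")
      case True
      then show ?thesis using val_eq[OF assms(1) p] val_eq[OF assms(2) p] v p by simp
    next
      case False
      then show ?thesis
        using form_zero_tangent[OF is_formD(2)[OF assms(1)], of us z] form_zero_tangent[OF is_formD(2)[OF assms(2)], of us z]
          us tangent_F[OF z] by simp
    qed
  qed
qed

lemma component_F: "p \<in> F \<Longrightarrow> component F p = {p}"
proof -
  assume p: "p \<in> F"
  have pX: "p \<in> X" using p F_subset_X by blast
  obtain z where z: "z \<in> p" using F_point[OF p] by blast
  have "lattice_rel `` {w + v} = p" if "w \<in> p" "v \<in> tangent F w" for w v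
    using that tangent_F[OF point_in_UnionF[OF p that(1)]] X_class[OF pX that(1)] by (simp add: lattice_rel_class)
  moreover have "0 \<in> tangent F z" using tangent_F[OF point_in_UnionF[OF p z]] by simp
  ultimately show ?thesis unfolding component_def using z by blast
qed

text \<open>The empty list satisfies \<open>pos_oriented\<close> vacuously, so each point counts
  with sign +1, which is the complex orientation.\<close>

lemma oriented_frame_F: "z \<in> \<Union> F \<Longrightarrow> oriented_frame F z vs \<longleftrightarrow> vs = []"
proof
  assume z: "z \<in> \<Union> F" and "oriented_frame F z vs"
  then have "independent (set vs)" "span (set vs) = {0}" by (simp_all add: oriented_frameD tangent_F)
  then have "set vs \<subseteq> {0}" "0 \<notin> set vs" using span_superset[of "set vs"] dependent_zero by blast+
  then have "set vs = {}" using subset_singletonD[of "set vs" 0] by auto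
  then show "vs = []" by simp
next
  assume z: "z \<in> \<Union> F" and "vs = []"
  then show "oriented_frame F z vs"
    by (simp add: oriented_frame_def tangent_F pos_oriented_def independent_empty)
qed

lemma integral_over_F:
  assumes "is_form \<alpha>" shows "integral_over F \<alpha> = (\<Sum>p\<in>F. val \<alpha> p)"
proof -
  have im: "component F ` F = (\<lambda>p. {p}) ` F" by (rule image_cong) (simp_all add: component_F)
  have "(let z = SOME z. z \<in> \<Union> {p}; vs = SOME vs. oriented_frame F z vs in cell_integral (\<lambda>w. \<alpha> w vs) z vs) = val \<alpha> p"
    if p: "p \<in> F" for p
  proof -
    define z where "z = (SOME z. z \<in> \<Union> {p})"
    have "\<exists>z. z \<in> \<Union> {p}" using F_point[OF p] by simp
    then have z: "z \<in> p" unfolding z_def using someI_ex[of "\<lambda>z. z \<in> \<Union> {p}"] by simp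
    have "(SOME vs. oriented_frame F z vs) = []"
      using oriented_frame_F[OF point_in_UnionF[OF p z]] by simp
    then show ?thesis unfolding z_def[symmetric] Let_def by (simp add: val_eq[OF assms p z])
  qed
  then show ?thesis
    unfolding integral_over_def im
    by (subst sum.reindex, simp, unfold o_def, intro sum.cong HOL.refl)
qed

section \<open>Point functions\<close>

text \<open>One third of the Dirichlet kernel of order one: a smooth function of period 1 whose
  values at the thirds are 1, 0, 0.\<close>

definition bump :: "real \<Rightarrow> real" where
  "bump t = (1 + 2 * cos (2 * pi * t)) / 3"

lemma cos_2pi_Ints: "k \<in> \<int> \<Longrightarrow> cos (2 * pi * (t + k)) = cos (2 * pi * t)"
proof -
  assume "k \<in> \<int>"
  then obtain n where "k = of_int n" by (elim Ints_cases)
  moreover have "cos (2 * pi * t + 2 * pi * of_int n) = cos (2 * pi * t)"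
    using cos_int_2pin[of n] sin_int_2pin[of n] by (simp add: cos_add mult.assoc)
  ultimately show ?thesis by (simp add: algebra_simps)
qed

lemma bump_Ints: "k \<in> \<int> \<Longrightarrow> bump (t + k) = bump t"
  by (simp add: bump_def cos_2pi_Ints)

lemma bump_thirds:
  assumes "m < 3" "n < 3" shows "bump (real m / 3 - real n / 3) = (if m = n then 1 else 0)"
proof -
  have c: "cos (2 * pi / 3) = - 1 / 2" "cos (4 * pi / 3) = - 1 / 2"
    using cos_120 cos_2pi_Ints[of "-1" "2/3"] by (simp_all add: field_simps)
  have b: "bump 0 = 1" "bump (1 / 3) = 0" "bump (2 / 3) = 0" "bump (- 1 / 3) = 0" "bump (- 2 / 3) = 0"
    using c by (simp_all add: bump_def field_simps)
  have "m = 0 \<or> m = 1 \<or> m = 2" "n = 0 \<or> n = 1 \<or> n = 2" using assms by auto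
  then show ?thesis using b by (elim disjE) simp_all
qed

lemma smooth_bump:
  assumes "linear l" shows "smooth (\<lambda>z. bump (l z - c))"
proof -
  have "linear (\<lambda>z. 2 * pi * l z)" using linear_compose_scale_right[OF assms, of "2 * pi"] by simp
  from smooth_lincomb[OF smooth_const smooth_cos_affine[OF this], of "1 / 3" 1 "2 / 3" "- 2 * pi * c"]
  show ?thesis by (simp add: bump_def algebra_simps add_divide_distrib)
qed

lemma point_fun_exists:
  assumes "p \<in> F"
  shows "\<exists>\<alpha>. is_form \<alpha> \<and> homogeneous 0 \<alpha> \<and> (\<forall>p'\<in>F. \<forall>z\<in>p'. \<alpha> z [] = (if p' = p then 1 else 0))"
proof -
  obtain mn where mn: "mn \<in> {..<3} \<times> {..<3}" "p = pt mn" using assms unfolding F_eq by blast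
  \<comment> \<open>The coordinates X1 and X2 modulo 1 already tell the nine points apart, since y =
    2x modulo 1 on \<open>F\<close> in both factors.\<close>
  define f where "f z = bump (X1 z - fst mn / 3) * bump (X2 z - snd mn / 3)" for z
  define \<alpha> :: form where "\<alpha> = (\<lambda>z us. f z * alt_one us)"
  have "is_form \<alpha>"
  proof (rule is_formI)
    have "smooth f" unfolding f_def by (intro smooth_mult smooth_bump linear_coords)
    then have "smooth (\<lambda>z. alt_one us * f z)" for us by (rule smooth_cmult)
    then show "csmooth \<alpha>" by (simp add: csmooth_def \<alpha>_def mult.commute)
    show "alt_multilinear (\<alpha> z)" for z unfolding \<alpha>_def by (rule alt_scaled) simp
    fix z l assume "l \<in> \<Lambda>"
    then have l: "X1 l \<in> \<int>" "X2 l \<in> \<int>" by (simp_all add: Lattice_iff)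
    have "f (z + l) = f z"
      using bump_Ints[OF l(1), of "X1 z - fst mn / 3"] bump_Ints[OF l(2), of "X2 z - snd mn / 3"]
      by (simp add: f_def algebra_simps)
    then show "\<alpha> (z + l) = \<alpha> z" by (simp add: \<alpha>_def)
  qed
  moreover have "homogeneous 0 \<alpha>" by (simp add: homogeneous_def \<alpha>_def alt_one_def)
  moreover have "\<alpha> z [] = (if p' = p then 1 else 0)" if p': "p' \<in> F" "z \<in> p'" for p' z
  proof -
    obtain kl where kl: "kl \<in> {..<3} \<times> {..<3}" "p' = pt kl" using p'(1) unfolding F_eq by blast
    have "X1 z - fst kl / 3 \<in> \<int>" "X2 z - snd kl / 3 \<in> \<int>"
      using p'(2) by (simp_all add: kl(2) pt_def fpt_def Lattice_iff)
    from bump_Ints[OF this(1), of "fst kl / 3 - fst mn / 3"] bump_Ints[OF this(2), of "snd kl / 3 - snd mn / 3"]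
    have "f z = bump (fst kl / 3 - fst mn / 3) * bump (snd kl / 3 - snd mn / 3)" by (simp add: f_def)
    also have "\<dots> = (if kl = mn then 1 else 0)"
      using kl mn bump_thirds[of "fst kl" "fst mn"] bump_thirds[of "snd kl" "snd mn"] by (auto simp: prod_eq_iff)
    also have "kl = mn \<longleftrightarrow> p' = p" using inj_on_eq_iff[OF inj_pt kl(1) mn(1)] by (simp add: kl(2) mn(2))
    finally show ?thesis by (simp add: \<alpha>_def alt_one_def)
  qed
  ultimately show ?thesis by blast
qed

lemma point_fun:
  assumes "p \<in> F"
  shows "is_form (point_fun p)" "homogeneous 0 (point_fun p)"
    "p' \<in> F \<Longrightarrow> val (point_fun p) p' = (if p' = p then 1 else 0)"
proof -
  note P = someI_ex[OF point_fun_exists[OF assms], folded point_fun_def]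
  show f: "is_form (point_fun p)" "homogeneous 0 (point_fun p)" using P by simp_all
  assume p': "p' \<in> F"
  then obtain z where "z \<in> p'" using F_point by blast
  then show "val (point_fun p) p' = (if p' = p then 1 else 0)"
    using P p' val_eq[OF f(1) p'] by metis
qed

section \<open>Gysin maps\<close>

lemma val_wedge:
  assumes "is_form \<alpha>" "is_form \<beta>" shows "val (\<alpha> \<wedge> \<beta>) p = val \<alpha> p * val \<beta> p"
  by (simp add: val_def wedge_def)

lemma integral_wedge_torus:
  assumes M: "torus M cs" and "closed_on M \<alpha>" "closed_on M \<beta>"
  shows "integral_over M (\<alpha> \<wedge> \<beta>) = alt_wedge (avg cs \<alpha>) (avg cs \<beta>) cs"
  using integral_over_torus[OF M closed_on_wedge[OF assms(2,3)]] avg_wedge[OF torusD(2)[OF M] assms(2,3) torusD(9)[OF M]]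
  by simp

text \<open>One form with the right integrals pins down the Hilbert choice up to cohomology: the
  difference pairs to zero with every constant form, and the wedge pairing is nondegenerate.\<close>

lemma gysin_torus:
  assumes Y: "torus Y cs" and \<beta>: "closed_on Y \<beta>"
    and e: "\<And>\<kappa>. closed_on Y \<kappa> \<Longrightarrow> integral_over Y (\<beta> \<wedge> \<kappa>) = integral_over V (\<alpha> \<wedge> \<kappa>)"
  shows "cohomologous Y (gysin V Y \<alpha>) \<beta>"
proof -
  let ?P = "\<lambda>\<beta>. closed_on Y \<beta> \<and> (\<forall>\<kappa>. closed_on Y \<kappa> \<longrightarrow> integral_over Y (\<beta> \<wedge> \<kappa>) = integral_over V (\<alpha> \<wedge> \<kappa>))"
  have "?P \<beta>" using \<beta> e by blast
  then have g: "?P (gysin V Y \<alpha>)" unfolding gysin_def by (rule someI[of ?P])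
  let ?a = "avg cs (gysin V Y \<alpha>)" and ?b = "avg cs \<beta>"
  have "lincomb 1 ?a (-1) ?b us = 0" if us: "us \<in> set (subseqs cs)" for us
  proof (rule wedge_nondegenerate[OF torusD(5,6)[OF Y] _ us])
    fix \<kappa> assume k: "alt_multilinear \<kappa>"
    note kc = closed_on_const[OF k, of Y]
    have "integral_over Y (gysin V Y \<alpha> \<wedge> (\<lambda>z. \<kappa>)) = integral_over Y (\<beta> \<wedge> (\<lambda>z. \<kappa>))"
      using g kc e[OF kc] by simp
    then have "alt_wedge ?a \<kappa> cs = alt_wedge ?b \<kappa> cs"
      using g integral_wedge_torus[OF Y _ kc] \<beta> by simp
    then show "alt_wedge (lincomb 1 ?a (-1) ?b) \<kappa> cs = 0" by (simp add: alt_wedge_lincomb_left lincomb_app)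
  qed
  then show ?thesis
    using g \<beta> by (simp add: cohomologous_iff_avg[OF torusD(2)[OF Y]] lincomb_app)
qed

lemma gysin_self: "torus Y cs \<Longrightarrow> closed_on Y \<alpha> \<Longrightarrow> cohomologous Y (gysin Y Y \<alpha>) \<alpha>"
  by (rule gysin_torus) simp_all

text \<open>Here the test classes are the point functions, which isolate one value at a
  time.\<close>

lemma gysin_F:
  assumes "is_form \<alpha>"
  shows "cohomologous F (gysin F F \<alpha>) \<alpha>"
proof -
  let ?P = "\<lambda>\<beta>. closed_on F \<beta> \<and> (\<forall>\<kappa>. closed_on F \<kappa> \<longrightarrow> integral_over F (\<beta> \<wedge> \<kappa>) = integral_over F (\<alpha> \<wedge> \<kappa>))"
  have "?P \<alpha>" using closed_on_F[OF assms] by simp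
  then have g: "?P (gysin F F \<alpha>)" unfolding gysin_def by (rule someI[of ?P])
  then have fg: "is_form (gysin F F \<alpha>)" using closed_onD(1) by blast
  have "val (gysin F F \<alpha>) p = val \<alpha> p" if p: "p \<in> F" for p
  proof -
    have i: "integral_over F (\<beta> \<wedge> point_fun p) = val \<beta> p" if "is_form \<beta>" for \<beta>
      using p that point_fun(1)[OF p]
      by (simp add: integral_over_F is_form_wedge val_wedge point_fun(3) if_distrib cong: if_cong)
    have "closed_on F (point_fun p)" by (rule closed_on_F[OF point_fun(1)[OF p]])
    then show ?thesis using g i[OF fg] i[OF assms] by simp
  qed
  then show ?thesis by (simp add: cohomologous_F_iff fg assms)
qed

text \<open>Restricted to a point only degree zero is left, and a closed function on a connected
  torus equals its average.\<close>

lemma val_avg: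
  assumes Y: "torus Y cs" and "F \<subseteq> Y" "closed_on Y \<kappa>" "p \<in> F"
  shows "val \<kappa> p = avg cs \<kappa> []"
proof -
  have "cohomologous F \<kappa> (\<lambda>z. avg cs \<kappa>)"
    by (rule cohomologous_mono[OF cohomologous_avg[OF torusD(2)[OF Y] assms(3)] assms(2)])
  then show ?thesis
    using assms(4) cohomologous_F_iff[OF closed_onD(1)[OF assms(3)] is_form_const[OF alt_avg[OF closed_onD(1)[OF assms(3)]]]]
    by (simp add: val_def)
qed

text \<open>Integrals over points see only the degree-zero average of a test form, so the Gysin
  image is the total mass times any form of volume 1 without lower-degree part.\<close>

lemma gysin_F_torus:
  assumes Y: "torus Y cs" and FY: "F \<subseteq> Y" and \<alpha>: "is_form \<alpha>"
    and w: "alt_multilinear w" "w cs = 1" "\<And>us. length us < length cs \<Longrightarrow> w us = 0"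
  shows "cohomologous Y (gysin F Y \<alpha>) (\<lambda>z us. (\<Sum>p\<in>F. val \<alpha> p) * w us)"
proof (rule gysin_torus[OF Y])
  let ?S = "\<Sum>p\<in>F. val \<alpha> p"
  have aw: "alt_multilinear (\<lambda>us. ?S * w us)" by (rule alt_scaled[OF w(1)])
  show c: "closed_on Y (\<lambda>z us. ?S * w us)" by (rule closed_on_const[OF aw])
  fix \<kappa> assume \<kappa>: "closed_on Y \<kappa>"
  have "integral_over Y ((\<lambda>z us. ?S * w us) \<wedge> \<kappa>) = ?S * avg cs \<kappa> []"
    using integral_wedge_torus[OF Y c \<kappa>] alt_wedge_top[of cs w "avg cs \<kappa>"] w
    by (simp add: alt_wedge_scale_left)
  moreover have "integral_over F (\<alpha> \<wedge> \<kappa>) = ?S * avg cs \<kappa> []"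
    using val_avg[OF Y FY \<kappa>] closed_onD(1)[OF \<kappa>] \<alpha>
    by (simp add: integral_over_F is_form_wedge val_wedge sum_distrib_right)
  ultimately show "integral_over Y ((\<lambda>z us. ?S * w us) \<wedge> \<kappa>) = integral_over F (\<alpha> \<wedge> \<kappa>)" by simp
qed

lemma L_simps: "L 0 = Fix (s 0)" "L (Suc 0) = Fix (s (Suc 0))" "L 2 = Fix (s 2)"
  by (simp_all add: L_def)

lemma less3_cases: "i < 3 \<Longrightarrow> i = 0 \<or> i = Suc 0 \<or> i = (2 :: nat)"
  by auto

lemma torus_L: "i < 3 \<Longrightarrow> torus (Fix (s i)) (bs i)"
  using less3_cases[of i] torus_s by auto

lemma s_Ghat: "i < 3 \<Longrightarrow> s i \<in> Ghat"
  using less3_cases[of i] Ghat_elts by auto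

lemma torus_volume:
  assumes "torus Y cs"
  obtains w where "alt_multilinear w" "w cs = 1" "\<And>us. length us \<noteq> length cs \<Longrightarrow> w us = 0"
proof -
  obtain f :: "vec \<Rightarrow> vec \<Rightarrow> real"
    where f: "\<forall>b. linear (f b) \<and> (\<forall>c\<in>set cs. f b c = (if b = c then 1 else 0))"
    using dual_family[OF torusD(6)[OF assms]] ..
  show ?thesis
    by (rule that[of "dual_form f cs"])
      (use f torusD(5)[OF assms] in \<open>simp_all add: alt_dual_form dual_form_self dual_form_degree\<close>)
qed

text \<open>Wedging with the two conormal covectors of \<open>L i\<close> represents its Gysin map.\<close>

definition nrm1 :: "nat \<Rightarrow> vec \<Rightarrow> real" where "nrm1 i v = 2 * X1 ((rot ^^ i) v) - Y1 ((rot ^^ i) v)"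
definition nrm2 :: "nat \<Rightarrow> vec \<Rightarrow> real" where "nrm2 i v = 2 * X2 ((rot ^^ i) v) - Y2 ((rot ^^ i) v)"

text \<open>\<open>rot ^^ i\<close> carries \<open>L i\<close> back to \<open>L 0\<close>, on which
  2 x - y vanishes in both factors; the conormal covectors are the pullbacks of these two
  equations.\<close>

definition push :: "nat \<Rightarrow> (vec list \<Rightarrow> real) \<Rightarrow> vec list \<Rightarrow> real" where
  "push i a = alt_wedge (cov (nrm1 i)) (alt_wedge (cov (nrm2 i)) a)"

lemma linear_rot_pow: "linear (rot ^^ n)"
  by (induction n) (simp_all add: linear_compose linear_rot linear_id del: comp_apply id_apply)

lemma linear_nrm: "linear (nrm1 i)" "linear (nrm2 i)"
  by (rule linearI; simp add: nrm1_def nrm2_def linear_add[OF linear_rot_pow] linear_cmul[OF linear_rot_pow] algebra_simps)+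

lemma alt_push: "alt_multilinear a \<Longrightarrow> alt_multilinear (push i a)"
  by (simp add: push_def alt_wedge_alt alt_cov linear_nrm)

lemma nrm_mk: "nrm1 0 (mk a b c d) = 2 * a - b" "nrm2 0 (mk a b c d) = 2 * c - d"
  "nrm1 (Suc 0) (mk a b c d) = - a - b" "nrm2 (Suc 0) (mk a b c d) = 2 * d - c"
  "nrm1 2 (mk a b c d) = 2 * b - a" "nrm2 2 (mk a b c d) = - c - d"
  by (simp_all add: nrm1_def nrm2_def rot_mk rot2_mk)

lemma alt_pair_mk:
  assumes "alt_multilinear a"
  shows "a [mk p q 0 0, mk 0 0 r t] = p * r * a [mk 1 0 0 0, mk 0 0 1 0] + p * t * a [mk 1 0 0 0, mk 0 0 0 1]
    + q * r * a [mk 0 1 0 0, mk 0 0 1 0] + q * t * a [mk 0 1 0 0, mk 0 0 0 1]"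
proof -
  have v: "mk p q 0 0 = p *\<^sub>R mk 1 0 0 0 + q *\<^sub>R mk 0 1 0 0" "mk 0 0 r t = r *\<^sub>R mk 0 0 1 0 + t *\<^sub>R mk 0 0 0 1"
    by (simp_all add: vec_eq_iff4)
  note l = alt_add[OF assms, of "[]"] alt_add[OF assms, of "[_]" _ _ "[]"] alt_scale[OF assms, of "[]"] alt_scale[OF assms, of "[_]" _ _ "[]"]
  show ?thesis unfolding v using l by (simp add: algebra_simps)
qed

lemma cov_Nil: "cov c [] = 0" and cov_single: "cov c [v] = c v"
  by (simp_all add: cov_def)

text \<open>This equation fixes the order and the scale of the two covectors: integrating over
  \<open>X\<close> after \<open>push\<close> is integrating over \<open>L i\<close>, orientations
  included.\<close>

lemma push_std:
  assumes a: "alt_multilinear a" and i: "i < 3" shows "push i a std = a (bs i)"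
proof -
  have e: "push i a std = nrm1 i (mk 1 0 0 0) * nrm2 i (mk 0 0 0 1) * a [mk 0 1 0 0, mk 0 0 1 0]
    - nrm1 i (mk 1 0 0 0) * nrm2 i (mk 0 0 1 0) * a [mk 0 1 0 0, mk 0 0 0 1]
    - nrm1 i (mk 0 1 0 0) * nrm2 i (mk 0 0 0 1) * a [mk 1 0 0 0, mk 0 0 1 0]
    + nrm1 i (mk 0 1 0 0) * nrm2 i (mk 0 0 1 0) * a [mk 1 0 0 0, mk 0 0 0 1]"
  proof -
    have z: "nrm1 i (mk 0 0 1 0) = 0" "nrm1 i (mk 0 0 0 1) = 0" "nrm2 i (mk 1 0 0 0) = 0" "nrm2 i (mk 0 1 0 0) = 0"
      using less3_cases[OF i] by (auto simp: nrm_mk)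
    show ?thesis
      by (simp add: push_def std_def alt_wedge_cov_Cons ins_app z cov_Nil algebra_simps)
  qed
  consider "i = 0" | "i = Suc 0" | "i = 2" using less3_cases[OF i] by blast
  then show ?thesis
  proof cases
    case 1
    then show ?thesis unfolding e using alt_pair_mk[OF a, of 1 2 "-1" "-2"] by (simp add: bs_explicit nrm_mk)
  next
    case 2
    then show ?thesis unfolding e using alt_pair_mk[OF a, of 1 "-1" 2 1] by (simp add: bs_explicit nrm_mk)
  next
    case 3
    then show ?thesis unfolding e using alt_pair_mk[OF a, of "-2" "-1" "-1" 1] by (simp add: bs_explicit nrm_mk)
  qed
qed

text \<open>The average of a test form over \<open>L i\<close> is the restriction of its average
  over \<open>X\<close>; associativity moves the test form inside \<open>push\<close>, where
  \<open>push_std\<close> applies.\<close>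

lemma gysin_L:
  assumes i: "i < 3" and \<alpha>: "closed_on (Fix (s i)) \<alpha>" and a: "alt_multilinear a"
    and e: "\<And>us. set us \<subseteq> span (set (bs i)) \<Longrightarrow> avg (bs i) \<alpha> us = a us"
  shows "cohomologous X (gysin (Fix (s i)) X \<alpha>) (\<lambda>z. push i a)"
proof (rule gysin_torus[OF torus_X])
  note T = torus_L[OF i]
  show c: "closed_on X (\<lambda>z. push i a)" by (rule closed_on_const[OF alt_push[OF a]])
  fix \<kappa> assume \<kappa>: "closed_on X \<kappa>"
  have kL: "closed_on (Fix (s i)) \<kappa>" by (rule closed_on_mono[OF \<kappa> Fix_subset])
  have k: "avg (bs i) \<kappa> us = avg std \<kappa> us" if "set us \<subseteq> span (set (bs i))" for us
    using avg_cohomologous[OF torusD(2)[OF T] cohomologous_mono[OF cohomologous_avg[OF torusD(2)[OF torus_X] \<kappa>] Fix_subset] that]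
    by simp
  have "integral_over X ((\<lambda>z. push i a) \<wedge> \<kappa>) = push i (alt_wedge a (avg std \<kappa>)) std"
    using integral_wedge_torus[OF torus_X c \<kappa>] by (simp only: avg_const) (simp only: push_def alt_wedge_assoc)
  also have "\<dots> = alt_wedge a (avg std \<kappa>) (bs i)"
    by (rule push_std[OF alt_wedge_alt[OF a alt_avg[OF closed_onD(1)[OF \<kappa>]]] i])
  also have "\<dots> = alt_wedge (avg (bs i) \<alpha>) (avg (bs i) \<kappa>) (bs i)"
    by (rule alt_wedge_cong) (use k e torusD(9)[OF T] in \<open>simp_all add: subset_trans\<close>)
  also have "\<dots> = integral_over (Fix (s i)) (\<alpha> \<wedge> \<kappa>)"
    by (rule integral_wedge_torus[OF T \<alpha> kL, symmetric])
  finally show "integral_over X ((\<lambda>z. push i a) \<wedge> \<kappa>) = integral_over (Fix (s i)) (\<alpha> \<wedge> \<kappa>)" .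
qed

section \<open>Coordinates on the group-labelled space\<close>

lemma sector_equiv_self: "sector_equiv \<phi> \<phi> \<longleftrightarrow> (\<forall>g\<in>Ghat. closed_on (Fix g) (\<phi> g))"
  unfolding sector_equiv_def using cohomologous_refl cohomologous_closed by blast

lemma rep_labelled_closed: "g \<in> Ghat \<Longrightarrow> closed_on (Fix g) (rep_labelled \<xi> g)"
  using Quotient3_rep_reflp[OF Quotient3_labelled, of \<xi>] by (simp add: sector_equiv_self)

lemma abs_rep_labelled: "abs_labelled (rep_labelled \<xi>) = \<xi>"
  by (rule Quotient3_abs_rep[OF Quotient3_labelled])

lemma rep_abs_labelled:
  assumes "\<And>g. g \<in> Ghat \<Longrightarrow> closed_on (Fix g) (\<phi> g)" "g \<in> Ghat"
  shows "cohomologous (Fix g) (rep_labelled (abs_labelled \<phi>) g) (\<phi> g)"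
  using rep_abs_rsp_left[OF Quotient3_labelled, of \<phi> \<phi>] assms by (auto simp: sector_equiv_self) (simp add: sector_equiv_def)

lemma abs_labelled_eqI:
  assumes "sector_equiv \<phi> \<psi>" shows "abs_labelled \<phi> = abs_labelled \<psi>"
  by (rule Quotient3_rel_abs[OF Quotient3_labelled]) (rule assms)

text \<open>The coordinates \<open>cid\<close>, \<open>cpt\<close> and \<open>cL\<close> are read
  off the chosen representative, but on points of \<open>F\<close> and tangent vectors of the sector
  they depend only on the class, as \<open>coords_abs\<close> shows.\<close>

definition cid :: "labelled \<Rightarrow> vec list \<Rightarrow> real" where
  "cid \<xi> = avg std (rep_labelled \<xi> id)"

definition cpt :: "(vec \<Rightarrow> vec) \<Rightarrow> labelled \<Rightarrow> point \<Rightarrow> real" where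
  "cpt g \<xi> = val (rep_labelled \<xi> g)"

definition cL :: "nat \<Rightarrow> labelled \<Rightarrow> vec list \<Rightarrow> real" where
  "cL i \<xi> = avg (bs i) (rep_labelled \<xi> (s i))"

lemma alt_cid: "alt_multilinear (cid \<xi>)"
  unfolding cid_def by (rule alt_avg[OF closed_onD(1)[OF rep_labelled_closed[OF Ghat_elts(1)]]])

lemma alt_cL: "i < 3 \<Longrightarrow> alt_multilinear (cL i \<xi>)"
  unfolding cL_def by (rule alt_avg[OF closed_onD(1)[OF rep_labelled_closed[OF s_Ghat]]])

lemma subseqs_subset_span: "us \<in> set (subseqs cs) \<Longrightarrow> set us \<subseteq> span (set cs)"
  using span_superset[of "set cs"] subseqs_powset[of cs] by blast

lemma labelled_eqI:
  assumes "\<And>us. us \<in> set (subseqs std) \<Longrightarrow> cid \<xi> us = cid \<eta> us"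
    "\<And>p. p \<in> F \<Longrightarrow> cpt rot \<xi> p = cpt rot \<eta> p" "\<And>p. p \<in> F \<Longrightarrow> cpt (rot ^^ 2) \<xi> p = cpt (rot ^^ 2) \<eta> p"
    "\<And>i us. i < 3 \<Longrightarrow> us \<in> set (subseqs (bs i)) \<Longrightarrow> cL i \<xi> us = cL i \<eta> us"
  shows "\<xi> = \<eta>"
proof -
  note c = rep_labelled_closed
  have T: "cohomologous (Fix g) (rep_labelled \<xi> g) (rep_labelled \<eta> g)"
    if "torus (Fix g) cs" "g \<in> Ghat" "\<And>us. us \<in> set (subseqs cs) \<Longrightarrow> avg cs (rep_labelled \<xi> g) us = avg cs (rep_labelled \<eta> g) us"
    for g cs
    using cohomologous_iff_avg[OF torusD(2)[OF that(1)] c[OF that(2)] c[OF that(2)]] that(3) by blast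
  have P: "cohomologous F (rep_labelled \<xi> g) (rep_labelled \<eta> g)"
    if "g \<in> Ghat" "\<And>p. p \<in> F \<Longrightarrow> cpt g \<xi> p = cpt g \<eta> p" for g
    using cohomologous_F_iff[OF closed_onD(1)[OF c[OF that(1)]] closed_onD(1)[OF c[OF that(1)]]] that(2)
    unfolding cpt_def by blast
  have "cohomologous (Fix g) (rep_labelled \<xi> g) (rep_labelled \<eta> g)" if "g \<in> Ghat" for g
  proof (cases rule: Ghat_cases[OF that])
    case 1
    show ?thesis unfolding 1
      by (rule T[of id std]) (use assms(1) torus_X in \<open>simp_all only: Fix_id Ghat_elts cid_def\<close>)
  next
    case 2
    show ?thesis unfolding 2 using P[OF Ghat_elts(2) assms(2)] by (simp add: F_def)
  next
    case 3
    show ?thesis unfolding 3 Fix_rot2 using P[OF Ghat_elts(3) assms(3)] by simp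
  next
    case 4
    show ?thesis unfolding 4 by (rule T[OF torus_s(1) Ghat_elts(4)]) (use assms(4)[of 0] in \<open>simp add: cL_def\<close>)
  next
    case 5
    show ?thesis unfolding 5 by (rule T[OF torus_s(2) Ghat_elts(5)]) (use assms(4)[of "Suc 0"] in \<open>simp add: cL_def\<close>)
  next
    case 6
    show ?thesis unfolding 6 by (rule T[OF torus_s(3) Ghat_elts(6)]) (use assms(4)[of 2] in \<open>simp add: cL_def\<close>)
  qed
  then have "sector_equiv (rep_labelled \<xi>) (rep_labelled \<eta>)" by (simp add: sector_equiv_def)
  then show ?thesis using abs_labelled_eqI abs_rep_labelled by metis
qed

lemma coords_abs:
  assumes c: "\<And>g. g \<in> Ghat \<Longrightarrow> closed_on (Fix g) (\<phi> g)"
  shows "cid (abs_labelled \<phi>) us = avg std (\<phi> id) us"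
    "p \<in> F \<Longrightarrow> cpt rot (abs_labelled \<phi>) p = val (\<phi> rot) p"
    "p \<in> F \<Longrightarrow> cpt (rot ^^ 2) (abs_labelled \<phi>) p = val (\<phi> (rot ^^ 2)) p"
    "i < 3 \<Longrightarrow> set us \<subseteq> span (set (bs i)) \<Longrightarrow> cL i (abs_labelled \<phi>) us = avg (bs i) (\<phi> (s i)) us"
proof -
  have e: "cohomologous (Fix g) (rep_labelled (abs_labelled \<phi>) g) (\<phi> g)" if "g \<in> Ghat" for g
    using c that by (rule rep_abs_labelled)
  show "cid (abs_labelled \<phi>) us = avg std (\<phi> id) us"
    unfolding cid_def
    by (rule avg_cohomologous[OF torusD(2)[OF torus_X] e[OF Ghat_elts(1), unfolded Fix_id]]) (simp add: span_std)
  have v: "val (rep_labelled (abs_labelled \<phi>) g) p = val (\<phi> g) p" if "g \<in> Ghat" "Fix g = F" "p \<in> F" for g p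
    using e[OF that(1)] that cohomologous_F_iff[of "rep_labelled (abs_labelled \<phi>) g" "\<phi> g"]
      closed_onD(1)[OF rep_labelled_closed[OF that(1)]] closed_onD(1)[OF c[OF that(1)]] by simp
  show "p \<in> F \<Longrightarrow> cpt rot (abs_labelled \<phi>) p = val (\<phi> rot) p"
    unfolding cpt_def by (rule v[OF Ghat_elts(2)]) (simp_all add: F_def)
  show "p \<in> F \<Longrightarrow> cpt (rot ^^ 2) (abs_labelled \<phi>) p = val (\<phi> (rot ^^ 2)) p"
    unfolding cpt_def by (rule v[OF Ghat_elts(3) Fix_rot2])
  show "cL i (abs_labelled \<phi>) us = avg (bs i) (\<phi> (s i)) us" if "i < 3" "set us \<subseteq> span (set (bs i))"
    unfolding cL_def by (rule avg_cohomologous[OF torusD(2)[OF torus_L[OF that(1)]] e[OF s_Ghat[OF that(1)]] that(2)])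
qed

lemma lincomb_abs:
  "a *\<^sub>R \<xi> + b *\<^sub>R \<eta> = abs_labelled (\<lambda>g z us. a * rep_labelled \<xi> g z us + b * rep_labelled \<eta> g z us)"
proof -
  have r: "sector_equiv (rep_labelled \<xi>) (rep_labelled \<xi>)" for \<xi> by (simp add: sector_equiv_self rep_labelled_closed)
  have sc: "a *\<^sub>R \<xi> = abs_labelled (\<lambda>g z us. a * rep_labelled \<xi> g z us)" for a \<xi>
    using scaleR_labelled.abs_eq[OF r[of \<xi>]] by (simp add: abs_rep_labelled)
  have rs: "sector_equiv (\<lambda>g z us. a * rep_labelled \<xi> g z us) (\<lambda>g z us. a * rep_labelled \<xi> g z us)" for a \<xi>
    using closed_on_lincomb[OF rep_labelled_closed rep_labelled_closed, where a = a and b = 0] by (simp add: sector_equiv_self)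
  show ?thesis unfolding sc by (rule plus_labelled.abs_eq[OF rs rs])
qed

lemma coords_lincomb:
  "cid (a *\<^sub>R \<xi> + b *\<^sub>R \<eta>) us = a * cid \<xi> us + b * cid \<eta> us"
  "p \<in> F \<Longrightarrow> cpt rot (a *\<^sub>R \<xi> + b *\<^sub>R \<eta>) p = a * cpt rot \<xi> p + b * cpt rot \<eta> p"
  "p \<in> F \<Longrightarrow> cpt (rot ^^ 2) (a *\<^sub>R \<xi> + b *\<^sub>R \<eta>) p = a * cpt (rot ^^ 2) \<xi> p + b * cpt (rot ^^ 2) \<eta> p"
  "i < 3 \<Longrightarrow> set us \<subseteq> span (set (bs i)) \<Longrightarrow> cL i (a *\<^sub>R \<xi> + b *\<^sub>R \<eta>) us = a * cL i \<xi> us + b * cL i \<eta> us"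
proof -
  have c: "closed_on (Fix g) (\<lambda>z us. a * rep_labelled \<xi> g z us + b * rep_labelled \<eta> g z us)" if "g \<in> Ghat" for g
    using that by (intro closed_on_lincomb rep_labelled_closed)
  note s = is_form_csmooth[OF closed_onD(1)[OF rep_labelled_closed]]
  show "cid (a *\<^sub>R \<xi> + b *\<^sub>R \<eta>) us = a * cid \<xi> us + b * cid \<eta> us"
    unfolding lincomb_abs by (subst coords_abs(1), erule c, unfold cid_def, rule avg_lincomb[OF s[OF Ghat_elts(1)] s[OF Ghat_elts(1)]])
  show "cpt rot (a *\<^sub>R \<xi> + b *\<^sub>R \<eta>) p = a * cpt rot \<xi> p + b * cpt rot \<eta> p" if "p \<in> F"
    unfolding lincomb_abs by (subst coords_abs(2), erule c, rule that, simp add: cpt_def val_def)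
  show "cpt (rot ^^ 2) (a *\<^sub>R \<xi> + b *\<^sub>R \<eta>) p = a * cpt (rot ^^ 2) \<xi> p + b * cpt (rot ^^ 2) \<eta> p" if "p \<in> F"
    unfolding lincomb_abs by (subst coords_abs(3), erule c, rule that, simp add: cpt_def val_def)
  show "cL i (a *\<^sub>R \<xi> + b *\<^sub>R \<eta>) us = a * cL i \<xi> us + b * cL i \<eta> us" if "i < 3" "set us \<subseteq> span (set (bs i))"
    unfolding lincomb_abs
    by (subst coords_abs(4), erule c, rule that, rule that, unfold cL_def, rule avg_lincomb[OF s[OF s_Ghat[OF that(1)]] s[OF s_Ghat[OF that(1)]]])
qed

lemma coords_in_sector:
  assumes g: "g \<in> Ghat" and c: "closed_on (Fix g) \<alpha>"
  shows "cid (in_sector g \<alpha>) us = (if g = id then avg std \<alpha> us else 0)"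
    "p \<in> F \<Longrightarrow> cpt rot (in_sector g \<alpha>) p = (if g = rot then val \<alpha> p else 0)"
    "p \<in> F \<Longrightarrow> cpt (rot ^^ 2) (in_sector g \<alpha>) p = (if g = rot ^^ 2 then val \<alpha> p else 0)"
    "i < 3 \<Longrightarrow> set us \<subseteq> span (set (bs i)) \<Longrightarrow> cL i (in_sector g \<alpha>) us = (if g = s i then avg (bs i) \<alpha> us else 0)"
proof -
  have z: "avg cs zero_form us = 0" "val zero_form p = 0" for cs us p
    using avg_const[of cs "\<lambda>us. 0"] by (simp_all add: zero_form_def val_def)
  have cl: "closed_on (Fix h) (if h = g then \<alpha> else zero_form)" for h
    using c closed_on_zero by simp
  show "cid (in_sector g \<alpha>) us = (if g = id then avg std \<alpha> us else 0)"
    unfolding in_sector_def by (subst coords_abs(1), rule cl, simp add: z eq_commute[of id g] del: id_apply)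
  show "cpt rot (in_sector g \<alpha>) p = (if g = rot then val \<alpha> p else 0)" if "p \<in> F"
    unfolding in_sector_def by (subst coords_abs(2), rule cl, rule that, simp add: z eq_commute[of rot g])
  show "cpt (rot ^^ 2) (in_sector g \<alpha>) p = (if g = rot ^^ 2 then val \<alpha> p else 0)" if "p \<in> F"
    unfolding in_sector_def by (subst coords_abs(3), rule cl, rule that, simp add: z eq_commute[of "rot ^^ 2" g])
  show "cL i (in_sector g \<alpha>) us = (if g = s i then avg (bs i) \<alpha> us else 0)" if "i < 3" "set us \<subseteq> span (set (bs i))"
    unfolding in_sector_def by (subst coords_abs(4), rule cl, rule that, rule that, simp add: z eq_commute[of "s i" g])
qed

section \<open>The group action\<close>

lemma Fix_conj:
  assumes k: "k \<in> Ghat" and g: "g \<in> Ghat" and z: "z \<in> \<Union> (Fix g)"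
  shows "inv k z \<in> \<Union> (Fix (inv k \<circ> g \<circ> k))"
    "v \<in> tangent (Fix g) z \<Longrightarrow> inv k v \<in> tangent (Fix (inv k \<circ> g \<circ> k)) (inv k z)"
proof -
  have ki: "inv k \<in> Ghat" "\<And>x. k (inv k x) = x" using inv_Ghat[OF k] by (simp_all add: fun_eq_iff)
  have g': "inv k \<circ> g \<circ> k \<in> Ghat" by (intro comp_Ghat ki g k)
  have gz: "g z - z \<in> \<Lambda>" using z unfolding Union_Fix[OF g] by simp
  have "(inv k \<circ> g \<circ> k) (inv k z) - inv k z = inv k (g z - z)"
    by (simp add: ki linear_diff[OF linear_Ghat[OF ki(1)]])
  then show u: "inv k z \<in> \<Union> (Fix (inv k \<circ> g \<circ> k))"
    unfolding Union_Fix[OF g'] mem_Collect_eq using Lattice_Ghat[OF ki(1) gz] by (simp only:)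
  show "inv k v \<in> tangent (Fix (inv k \<circ> g \<circ> k)) (inv k z)" if "v \<in> tangent (Fix g) z"
    using that unfolding tangent_Fix[OF g z] tangent_Fix[OF g' u] by (simp add: ki)
qed

lemma is_form_pullback:
  assumes k: "k \<in> Ghat" and \<alpha>: "is_form \<alpha>" shows "is_form (pullback k \<alpha>)"
proof (rule is_formI)
  note lin = linear_Ghat[OF k]
  show "csmooth (pullback k \<alpha>)"
    using smooth_linear_compose[OF lin csmoothD[OF is_formD(1)[OF \<alpha>]]] by (simp add: csmooth_def pullback_def)
  show "alt_multilinear (pullback k \<alpha> z)" for z
    unfolding pullback_def by (rule alt_map[OF is_formD(2)[OF \<alpha>] lin])
  show "pullback k \<alpha> (z + l) = pullback k \<alpha> z" if "l \<in> \<Lambda>" for z l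
    using is_formD(3)[OF \<alpha> Lattice_Ghat[OF k that]] by (simp add: pullback_def linear_add[OF lin])
qed

lemma pullback_closed:
  assumes k: "k \<in> Ghat" and g: "g \<in> Ghat" and \<alpha>: "closed_on (Fix (inv k \<circ> g \<circ> k)) \<alpha>"
  shows "closed_on (Fix g) (pullback (inv k) \<alpha>)"
proof (rule closed_onI[OF is_form_pullback[OF inv_Ghat(1)[OF k] closed_onD(1)[OF \<alpha>]]])
  fix z us assume z: "z \<in> \<Union> (Fix g)" and us: "set us \<subseteq> tangent (Fix g) z"
  have "ext_d \<alpha> (inv k z) (map (inv k) us) = 0"
    by (rule closed_onD(2)[OF \<alpha> Fix_conj(1)[OF k g z]]) (use Fix_conj(2)[OF k g z] us in auto)
  then show "ext_d (pullback (inv k) \<alpha>) z us = 0"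
    by (simp add: ext_d_pullback[OF linear_Ghat[OF inv_Ghat(1)[OF k]] is_formD(1)[OF closed_onD(1)[OF \<alpha>]]])
qed

lemma pullback_cohomologous:
  assumes k: "k \<in> Ghat" and g: "g \<in> Ghat" and c: "cohomologous (Fix (inv k \<circ> g \<circ> k)) \<alpha> \<beta>"
  shows "cohomologous (Fix g) (pullback (inv k) \<alpha>) (pullback (inv k) \<beta>)"
proof -
  obtain \<eta> where \<eta>: "is_form \<eta>"
    "\<And>z vs. z \<in> \<Union> (Fix (inv k \<circ> g \<circ> k)) \<Longrightarrow> set vs \<subseteq> tangent (Fix (inv k \<circ> g \<circ> k)) z \<Longrightarrow> \<alpha> z vs = \<beta> z vs + ext_d \<eta> z vs"
    using c by (rule cohomologousE) blast
  show ?thesis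
  proof (rule cohomologousI[OF pullback_closed[OF k g cohomologous_closed(1)[OF c]]
        pullback_closed[OF k g cohomologous_closed(2)[OF c]] is_form_pullback[OF inv_Ghat(1)[OF k] \<eta>(1)]])
    fix z us assume z: "z \<in> \<Union> (Fix g)" and us: "set us \<subseteq> tangent (Fix g) z"
    have "\<alpha> (inv k z) (map (inv k) us) = \<beta> (inv k z) (map (inv k) us) + ext_d \<eta> (inv k z) (map (inv k) us)"
      by (rule \<eta>(2)[OF Fix_conj(1)[OF k g z]]) (use Fix_conj(2)[OF k g z] us in auto)
    then show "pullback (inv k) \<alpha> z us = pullback (inv k) \<beta> z us + ext_d (pullback (inv k) \<eta>) z us"
      unfolding ext_d_pullback[OF linear_Ghat[OF inv_Ghat(1)[OF k]] is_formD(1)[OF \<eta>(1)]]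
      by (simp add: pullback_def)
  qed
qed

lemma act_closed:
  assumes "k \<in> Ghat" "\<And>g. g \<in> Ghat \<Longrightarrow> closed_on (Fix g) (\<phi> g)" "g \<in> Ghat"
  shows "closed_on (Fix g) (pullback (inv k) (\<phi> (inv k \<circ> g \<circ> k)))"
  by (rule pullback_closed[OF assms(1,3) assms(2)]) (intro comp_Ghat inv_Ghat(1) assms)

lemma act_abs:
  assumes k: "k \<in> Ghat" and c: "\<And>g. g \<in> Ghat \<Longrightarrow> closed_on (Fix g) (\<phi> g)"
  shows "act k (abs_labelled \<phi>) = abs_labelled (\<lambda>g. pullback (inv k) (\<phi> (inv k \<circ> g \<circ> k)))"
  unfolding act_def transport_def
proof (rule abs_labelled_eqI, unfold sector_equiv_def, rule ballI)
  fix g assume g: "g \<in> Ghat"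
  have "inv k \<circ> g \<circ> k \<in> Ghat" by (intro comp_Ghat inv_Ghat(1) g k)
  then show "cohomologous (Fix g) (pullback (inv k) (rep_labelled (abs_labelled \<phi>) (inv k \<circ> g \<circ> k)))
      (pullback (inv k) (\<phi> (inv k \<circ> g \<circ> k)))"
    using c by (intro pullback_cohomologous[OF k g] rep_abs_labelled)
qed

lemma inv_comp_Ghat: "k \<in> Ghat \<Longrightarrow> h \<in> Ghat \<Longrightarrow> inv (k \<circ> h) = inv h \<circ> inv k"
  by (rule inv_unique_comp) (simp_all add: inv_Ghat comp_assoc rewriteL_comp_comp[OF inv_Ghat(2)] rewriteL_comp_comp[OF inv_Ghat(3)] del: comp_apply id_apply)

lemma act_comp:
  assumes k: "k \<in> Ghat" and h: "h \<in> Ghat"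
  shows "act (k \<circ> h) \<xi> = act k (act h \<xi>)"
proof -
  have "act k (act h \<xi>) = act k (abs_labelled (\<lambda>g. pullback (inv h) (rep_labelled \<xi> (inv h \<circ> g \<circ> h))))"
    by (simp add: act_def transport_def del: comp_apply)
  also have "\<dots> = abs_labelled (\<lambda>g. pullback (inv k) (pullback (inv h) (rep_labelled \<xi> (inv h \<circ> (inv k \<circ> g \<circ> k) \<circ> h))))"
    by (rule act_abs[OF k]) (rule act_closed[OF h rep_labelled_closed])
  also have "\<dots> = act (k \<circ> h) \<xi>"
    unfolding act_def transport_def inv_comp_Ghat[OF k h] by (simp add: pullback_def comp_def)
  finally show ?thesis ..
qed

lemma H_Ori_iff: "\<xi> \<in> H_Ori \<longleftrightarrow> act rot \<xi> = \<xi> \<and> act (s 0) \<xi> = \<xi>"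
proof
  assume "\<xi> \<in> H_Ori"
  then show "act rot \<xi> = \<xi> \<and> act (s 0) \<xi> = \<xi>" using Ghat_elts by (simp add: H_Ori_def)
next
  assume *: "act rot \<xi> = \<xi> \<and> act (s 0) \<xi> = \<xi>"
  have "act k \<xi> = \<xi>" if "k \<in> Ghat" for k
    using that
  proof (induction rule: Ghat.induct)
    case one
    have "pullback id \<alpha> = \<alpha>" for \<alpha> by (simp add: pullback_def)
    then show ?case unfolding act_def transport_def inv_elts id_comp comp_id by (simp only: abs_rep_labelled)
  next
    case (rot g)
    then show ?case using * act_comp[OF Ghat_elts(2) rot(1), of \<xi>] by (simp del: comp_apply)
  next
    case (refl g)
    then show ?case using * act_comp[OF Ghat_elts(4) refl(1), of \<xi>] by (simp add: refl_eq_s del: comp_apply)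
  qed
  then show "\<xi> \<in> H_Ori" by (simp add: H_Ori_def)
qed

lemma zero_in_Union_Fix: "g \<in> Ghat \<Longrightarrow> 0 \<in> \<Union> (Fix g)"
proof -
  assume g: "g \<in> Ghat"
  show ?thesis unfolding Union_Fix[OF g] mem_Collect_eq linear_0[OF linear_Ghat[OF g]] by simp
qed

lemma subtorus_span_Fix: "g \<in> Ghat \<Longrightarrow> subtorus (Fix g) cs \<Longrightarrow> span (set cs) = {v. g v = v}"
  using subtorusD(3)[of "Fix g" cs 0] tangent_Fix[of g 0] zero_in_Union_Fix[of g] by simp

lemma subtorus_image:
  assumes k: "k \<in> Ghat" and g: "g \<in> Ghat" and T: "subtorus (Fix g) cs"
  shows "subtorus (Fix (inv k \<circ> g \<circ> k)) (map (inv k) cs)"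
proof -
  let ?g = "inv k \<circ> g \<circ> k"
  have ki: "inv k \<in> Ghat" "\<And>x. k (inv k x) = x" "\<And>x. inv k (k x) = x" using inv_Ghat[OF k] by (simp_all add: fun_eq_iff)
  have g': "?g \<in> Ghat" by (intro comp_Ghat ki g k)
  have "span (set (map (inv k) cs)) = inv k ` {v. g v = v}"
    by (simp add: linear_span_image[OF linear_Ghat[OF ki(1)]] subtorus_span_Fix[OF g T])
  also have "\<dots> = {v. ?g v = v}"
  proof (intro equalityI subsetI)
    fix v assume "v \<in> {v. ?g v = v}"
    then have "inv k (g (k v)) = v" by simp
    then have "g (k v) = k v" using ki(2)[of "g (k v)"] by simp
    then have "inv k (k v) \<in> inv k ` {v. g v = v}" by (intro imageI) simp
    then show "v \<in> inv k ` {v. g v = v}" by (simp only: ki)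
  qed (auto simp: ki)
  finally have sp: "span (set (map (inv k) cs)) = {v. ?g v = v}" .
  have U: "\<Union> (Fix ?g) = {l + v |l v. l \<in> \<Lambda> \<and> v \<in> {v. ?g v = v}}"
  proof (intro equalityI subsetI)
    fix z assume "z \<in> \<Union> (Fix ?g)"
    then have "?g z - z \<in> \<Lambda>" unfolding Union_Fix[OF g'] by simp
    from Lattice_Ghat[OF k this] have "g (k z) - k z \<in> \<Lambda>"
      by (simp add: linear_diff[OF linear_Ghat[OF k]] ki)
    then have "k z \<in> \<Union> (Fix g)" unfolding Union_Fix[OF g] by simp
    then obtain l v where lv: "k z = l + v" "l \<in> \<Lambda>" "v \<in> span (set cs)" unfolding subtorusD(2)[OF T] by blast
    have "z = inv k l + inv k v" using ki(3)[of z] lv(1) linear_add[OF linear_Ghat[OF ki(1)]] by simp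
    moreover have "inv k v \<in> {v. ?g v = v}" using lv(3) unfolding subtorus_span_Fix[OF g T] by (simp add: ki)
    ultimately show "z \<in> {l + v |l v. l \<in> \<Lambda> \<and> v \<in> {v. ?g v = v}}" using Lattice_Ghat[OF ki(1) lv(2)] by blast
  next
    fix z assume "z \<in> {l + v |l v. l \<in> \<Lambda> \<and> v \<in> {v. ?g v = v}}"
    then obtain l v where z: "z = l + v" "l \<in> \<Lambda>" "?g v = v" by blast
    then have "?g z - z = ?g l - l" using linear_add[OF linear_Ghat[OF g'], of l v] by simp
    then show "z \<in> \<Union> (Fix ?g)"
      unfolding Union_Fix[OF g'] mem_Collect_eq using Lattice_diff[OF Lattice_Ghat[OF g' z(2)] z(2)] by (simp only:)
  qed
  show ?thesis
    unfolding subtorus_def sp U[symmetric]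
  proof (intro conjI ballI)
    show "set (map (inv k) cs) \<subseteq> \<Lambda>" using subtorusD(1)[OF T] Lattice_Ghat[OF ki(1)] by auto
    fix z assume "z \<in> \<Union> (Fix ?g)"
    then show "tangent (Fix ?g) z = {v. ?g v = v}" by (rule tangent_Fix[OF g'])
  qed simp
qed

text \<open>Pulling back moves the frame \<open>cs\<close> to its image under \<open>inv k\<close>,
  which need not be the frame \<open>ds\<close> in use; frame independence bridges the gap.\<close>

lemma avg_transport:
  assumes k: "k \<in> Ghat" and g: "g \<in> Ghat" and T: "subtorus (Fix g) cs" and T': "subtorus (Fix (inv k \<circ> g \<circ> k)) ds"
    and \<alpha>: "closed_on (Fix (inv k \<circ> g \<circ> k)) \<alpha>" and us: "set us \<subseteq> span (set cs)"
  shows "avg cs (pullback (inv k) \<alpha>) us = avg ds \<alpha> (map (inv k) us)"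
proof -
  have lin: "linear (inv k)" by (rule linear_Ghat[OF inv_Ghat(1)[OF k]])
  have "avg cs (pullback (inv k) \<alpha>) us = avg (map (inv k) cs) \<alpha> (map (inv k) us)" by (rule avg_pullback[OF lin])
  also have "\<dots> = avg ds \<alpha> (map (inv k) us)"
  proof (rule avg_frame_independent[OF T' subtorus_image[OF k g T] \<alpha>])
    have "inv k ` span (set cs) = span (set ds)"
      using subtorus_span_Fix[OF _ subtorus_image[OF k g T]] subtorus_span_Fix[OF _ T']
        comp_Ghat[OF comp_Ghat[OF inv_Ghat(1)[OF k] g] k] linear_span_image[OF lin, of "set cs"] by simp
    then show "set (map (inv k) us) \<subseteq> span (set ds)" using us by auto
  qed
  finally show ?thesis .
qed

lemma F_point_fixed: "k \<in> Ghat \<Longrightarrow> p \<in> F \<Longrightarrow> z \<in> p \<Longrightarrow> k z \<in> p"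
proof -
  assume k: "k \<in> Ghat" and p: "p \<in> F" "z \<in> p"
  have "p = {w. w - z \<in> \<Lambda>}" using X_class p F_subset_X by blast
  moreover have "z \<in> \<Union> (Fix k)" using F_subset_Fix[OF k] p by blast
  then have "k z - z \<in> \<Lambda>" unfolding Union_Fix[OF k] by simp
  ultimately show "k z \<in> p" by blast
qed

lemma val_pullback:
  assumes "k \<in> Ghat" "is_form \<alpha>" "p \<in> F" shows "val (pullback k \<alpha>) p = val \<alpha> p"
proof -
  obtain z where z: "z \<in> p" using F_point[OF assms(3)] by blast
  have "pullback k \<alpha> z [] = \<alpha> (k z) []" by (simp add: pullback_def)
  then show ?thesis
    using val_eq[OF is_form_pullback[OF assms(1,2)] assms(3) z] val_eq[OF assms(2,3) F_point_fixed[OF assms(1,3) z]] by simp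
qed

lemma coords_act:
  assumes k: "k \<in> Ghat"
  shows "cid (act k \<xi>) us = cid \<xi> (map (inv k) us)"
    "p \<in> F \<Longrightarrow> inv k \<circ> rot \<circ> k \<in> {rot, rot ^^ 2} \<Longrightarrow> cpt rot (act k \<xi>) p = cpt (inv k \<circ> rot \<circ> k) \<xi> p"
    "p \<in> F \<Longrightarrow> inv k \<circ> rot ^^ 2 \<circ> k \<in> {rot, rot ^^ 2} \<Longrightarrow> cpt (rot ^^ 2) (act k \<xi>) p = cpt (inv k \<circ> rot ^^ 2 \<circ> k) \<xi> p"
    "i < 3 \<Longrightarrow> j < 3 \<Longrightarrow> inv k \<circ> s i \<circ> k = s j \<Longrightarrow> set us \<subseteq> span (set (bs i)) \<Longrightarrow>
      cL i (act k \<xi>) us = cL j \<xi> (map (inv k) us)"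
proof -
  note ki = inv_Ghat(1)[OF k]
  have c: "closed_on (Fix g) (pullback (inv k) (rep_labelled \<xi> (inv k \<circ> g \<circ> k)))" if "g \<in> Ghat" for g
    by (rule act_closed[OF k rep_labelled_closed that])
  have ii: "inv k \<circ> id \<circ> k = id" using inv_Ghat(2)[OF k] by (simp add: comp_def id_def)
  have e: "avg std (pullback (inv k) (rep_labelled \<xi> id)) us = avg std (rep_labelled \<xi> id) (map (inv k) us)"
    by (rule avg_transport[OF k Ghat_elts(1), unfolded ii Fix_id, OF torusD(2)[OF torus_X] torusD(2)[OF torus_X]
          rep_labelled_closed[OF Ghat_elts(1), unfolded Fix_id]]) (simp add: span_std)
  show "cid (act k \<xi>) us = cid \<xi> (map (inv k) us)"
    unfolding act_def transport_def by (subst coords_abs(1), erule c) (simp only: ii cid_def e)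
  show "cpt rot (act k \<xi>) p = cpt (inv k \<circ> rot \<circ> k) \<xi> p" if "p \<in> F" "inv k \<circ> rot \<circ> k \<in> {rot, rot ^^ 2}"
    unfolding act_def transport_def
    by (subst coords_abs(2), erule c, rule that(1), unfold cpt_def, rule val_pullback[OF ki _ that(1)],
        rule closed_onD(1), rule rep_labelled_closed) (intro comp_Ghat ki k Ghat_elts)
  show "cpt (rot ^^ 2) (act k \<xi>) p = cpt (inv k \<circ> rot ^^ 2 \<circ> k) \<xi> p" if "p \<in> F" "inv k \<circ> rot ^^ 2 \<circ> k \<in> {rot, rot ^^ 2}"
    unfolding act_def transport_def
    by (subst coords_abs(3), erule c, rule that(1), unfold cpt_def, rule val_pullback[OF ki _ that(1)],
        rule closed_onD(1), rule rep_labelled_closed) (intro comp_Ghat ki k Ghat_elts)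
  show "cL i (act k \<xi>) us = cL j \<xi> (map (inv k) us)"
    if ij: "i < 3" "j < 3" "inv k \<circ> s i \<circ> k = s j" "set us \<subseteq> span (set (bs i))"
  proof -
    have e: "avg (bs i) (pullback (inv k) (rep_labelled \<xi> (s j))) us = avg (bs j) (rep_labelled \<xi> (s j)) (map (inv k) us)"
      by (rule avg_transport[OF k s_Ghat[OF ij(1)], unfolded ij(3), OF torusD(2)[OF torus_L[OF ij(1)]]
            torusD(2)[OF torus_L[OF ij(2)]] rep_labelled_closed[OF s_Ghat[OF ij(2)]] ij(4)])
    show ?thesis
      unfolding act_def transport_def by (subst coords_abs(4), erule c, rule ij(1), rule ij(4)) (simp only: ij(3) cL_def e)
  qed
qed

section \<open>Obstruction bundles\<close>

lemma cis_2pi_inj: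
  assumes "cis (2 * pi * a) = cis (2 * pi * b)" "a \<in> {0..<1}" "b \<in> {0..<1}"
  shows "a = b"
proof -
  have "sin (2 * pi * a) = sin (2 * pi * b) \<and> cos (2 * pi * a) = cos (2 * pi * b)"
    using assms(1) by (simp add: complex_eq_iff)
  then obtain n :: int where "2 * pi * a = 2 * pi * b + 2 * pi * n"
    unfolding sin_cos_eq_iff by blast
  then have "2 * pi * a = 2 * pi * (b + n)" by (simp add: algebra_simps)
  then have "a = b + n" by simp
  then have "\<bar>real_of_int n\<bar> < 1" using assms(2,3) by auto
  then show ?thesis using \<open>a = b + n\<close> by simp
qed

lemma omega_cis: "\<omega> = cis (2 * pi * (1 / 3))" "inverse \<omega> = cis (2 * pi * (2 / 3))" "\<omega> * \<omega> = cis (2 * pi * (2 / 3))"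
proof -
  show 1: "\<omega> = cis (2 * pi * (1 / 3))" by (simp add: \<omega>_def)
  show 3: "\<omega> * \<omega> = cis (2 * pi * (2 / 3))" unfolding 1 cis_mult by (simp add: algebra_simps)
  show "inverse \<omega> = cis (2 * pi * (2 / 3))" unfolding omega_inverse 3[symmetric] omega_sq ..
qed

lemma rot2_pair: "(rot ^^ 2) v = (\<omega> * \<omega> * fst v, \<omega> * snd v)"
proof -
  have "inverse \<omega> * inverse \<omega> = \<omega>"
    by (simp add: omega_inverse algebra_simps omega_sq)
  then show ?thesis by (simp add: numeral_2_eq_2 rot_def mult.assoc[symmetric])
qed

lemma obstruction_zero:
  assumes "\<And>v a b. a \<in> {0..<1} \<Longrightarrow> b \<in> {0..<1} \<Longrightarrow> a + b > 1 \<Longrightarrow>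
    g v = (cis (2 * pi * a) * fst v, cis (2 * pi * a) * snd v) \<Longrightarrow>
    h v = (cis (2 * pi * b) * fst v, cis (2 * pi * b) * snd v) \<Longrightarrow> v = 0"
  shows "obstruction_fibre g h = {0}"
proof -
  have "obstruction_fibre g h \<subseteq> span {0}"
    unfolding obstruction_fibre_def by (rule span_mono) (use assms in blast)
  then have "obstruction_fibre g h \<subseteq> {0}" by simp
  moreover have "0 \<in> obstruction_fibre g h" unfolding obstruction_fibre_def by (rule span_zero)
  ultimately show ?thesis by blast
qed

lemma obstruction_nonzero:
  assumes "w \<noteq> 0" "\<And>u. g u = u \<Longrightarrow> u = 0" "a \<in> {0..<1}" "a + a > 1"
    "g w = (cis (2 * pi * a) * fst w, cis (2 * pi * a) * snd w)"
  shows "obstruction_fibre g g \<noteq> {0}"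
proof -
  have "w \<in> obstruction_fibre g g"
    unfolding obstruction_fibre_def
  proof (rule span_base, intro CollectI conjI allI impI)
    show "orthogonal w u" if "g u = u \<and> g u = u" for u
      using assms(2)[of u] that by (simp add: orthogonal_def)
    show "\<exists>a\<in>{0..<1}. \<exists>b\<in>{0..<1}. a + b > 1 \<and> g w = (cis (2 * pi * a) * fst w, cis (2 * pi * a) * snd w) \<and>
        g w = (cis (2 * pi * b) * fst w, cis (2 * pi * b) * snd w)"
      using assms(3-5) by (intro bexI[of _ a] conjI)
  qed
  then show ?thesis using assms(1) by blast
qed

lemma pair_zeroI: "fst v = 0 \<Longrightarrow> snd v = 0 \<Longrightarrow> v = (0 :: vec)"
  by (simp add: prod_eq_iff)

lemma weight_eq:
  assumes "cis (2 * pi * b) * x = cis (2 * pi * a) * (x :: complex)" "a \<in> {0..<1}" "b \<in> {0..<1}" "x \<noteq> 0"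
  shows "a = b"
  using assms cis_2pi_inj[of b a] by simp

text \<open>The identity has weight 0 and the other weight lies below 1, so the sum never exceeds
  1.\<close>

lemma obstruction_id: "obstruction_fibre id h = {0}" "obstruction_fibre h id = {0}"
proof -
  have z: "v = 0" if v: "id v = (cis (2 * pi * a) * fst v, cis (2 * pi * a) * snd v)" and a: "a \<in> {0..<1}" "b < 1" "a + b > 1"
    for v a b
  proof -
    have e: "cis (2 * pi * 0) * fst v = cis (2 * pi * a) * fst v" "cis (2 * pi * 0) * snd v = cis (2 * pi * a) * snd v"
      using v by (simp_all add: prod_eq_iff)
    have "a \<noteq> 0" using a by auto
    then have "fst v = 0" "snd v = 0"
      using weight_eq[OF e(1) a(1)] weight_eq[OF e(2) a(1)] by auto
    then show ?thesis by (rule pair_zeroI)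
  qed
  show "obstruction_fibre id h = {0}"
    by (rule obstruction_zero, rule z) auto
  show "obstruction_fibre h id = {0}"
    by (rule obstruction_zero, rule z) (assumption, auto simp: add.commute)
qed

lemma rot_weights:
  assumes "a \<in> {0..<1}" "rot v = (cis (2 * pi * a) * fst v, cis (2 * pi * a) * snd v)"
  shows "fst v \<noteq> 0 \<Longrightarrow> a = 1 / 3" "snd v \<noteq> 0 \<Longrightarrow> a = 2 / 3"
proof -
  have e: "\<omega> * fst v = cis (2 * pi * a) * fst v" "inverse \<omega> * snd v = cis (2 * pi * a) * snd v"
    using assms(2) by (simp_all add: rot_def)
  show "fst v \<noteq> 0 \<Longrightarrow> a = 1 / 3" "snd v \<noteq> 0 \<Longrightarrow> a = 2 / 3"
    using weight_eq[OF e(1)[unfolded omega_cis(1)] assms(1)] weight_eq[OF e(2)[unfolded omega_cis(2)] assms(1)] by simp_all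
qed

lemma rot2_weights:
  assumes "a \<in> {0..<1}" "(rot ^^ 2) v = (cis (2 * pi * a) * fst v, cis (2 * pi * a) * snd v)"
  shows "fst v \<noteq> 0 \<Longrightarrow> a = 2 / 3" "snd v \<noteq> 0 \<Longrightarrow> a = 1 / 3"
proof -
  have e: "\<omega> * \<omega> * fst v = cis (2 * pi * a) * fst v" "\<omega> * snd v = cis (2 * pi * a) * snd v"
    using assms(2) by (simp_all add: rot2_pair)
  show "fst v \<noteq> 0 \<Longrightarrow> a = 2 / 3" "snd v \<noteq> 0 \<Longrightarrow> a = 1 / 3"
    using weight_eq[OF e(1)[unfolded omega_cis(3)] assms(1)] weight_eq[OF e(2)[unfolded omega_cis(1)] assms(1)] by simp_all
qed

text \<open>For inverse rotations the weights on each axis are 1/3 and 2/3. They add up to exactly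
  1, and the inequality in the definition is strict.\<close>

lemma obstruction_rot: "obstruction_fibre rot (rot ^^ 2) = {0}" "obstruction_fibre (rot ^^ 2) rot = {0}"
proof -
  have z: "v = 0" if "a \<in> {0..<1}" "b \<in> {0..<1}" "a + b > 1"
    "rot v = (cis (2 * pi * a) * fst v, cis (2 * pi * a) * snd v)"
    "(rot ^^ 2) v = (cis (2 * pi * b) * fst v, cis (2 * pi * b) * snd v)" for v a b
  proof (rule pair_zeroI)
    show "fst v = 0"
      using rot_weights(1)[OF that(1,4)] rot2_weights(1)[OF that(2,5)] that(3) by (cases "fst v = 0") auto
    show "snd v = 0"
      using rot_weights(2)[OF that(1,4)] rot2_weights(2)[OF that(2,5)] that(3) by (cases "snd v = 0") auto
  qed
  show "obstruction_fibre rot (rot ^^ 2) = {0}"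
    by (rule obstruction_zero) (rule z)
  show "obstruction_fibre (rot ^^ 2) rot = {0}"
    by (rule obstruction_zero, rule z, assumption, assumption) (simp_all add: add.commute)
qed

lemma rot_fixed: "rot u = u \<Longrightarrow> u = 0" "(rot ^^ 2) u = u \<Longrightarrow> u = 0"
  using act_mk(1,3)[of "X1 u" "Y1 u" "X2 u" "Y2 u"] by (auto simp: vec_eq_iff4)

text \<open>The second axis has weight 2/3 for \<open>rot\<close>, the first has weight 2/3 for
  \<open>rot ^^ 2\<close>. Doubled this exceeds 1, so the bundle has positive rank and its Euler
  form kills the product.\<close>

lemma obstruction_rot_rot: "obstruction_fibre rot rot \<noteq> {0}" "obstruction_fibre (rot ^^ 2) (rot ^^ 2) \<noteq> {0}"
proof -
  show "obstruction_fibre rot rot \<noteq> {0}"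
    by (rule obstruction_nonzero[of "(0, 1)" _ "2 / 3"])
      (simp_all add: rot_def omega_cis(2)[symmetric] zero_prod_def rot_fixed(1)[unfolded zero_prod_def] flip: times_divide_eq_right)
  show "obstruction_fibre (rot ^^ 2) (rot ^^ 2) \<noteq> {0}"
    by (rule obstruction_nonzero[of "(1, 0)" _ "2 / 3"])
      (simp_all add: rot2_pair omega_cis(3)[symmetric] zero_prod_def rot_fixed(2)[unfolded zero_prod_def] flip: times_divide_eq_right)
qed

lemma Geven_eq: "Geven = {id, rot, rot ^^ 2}"
proof
  have "rot ^^ n \<in> {id, rot, rot ^^ 2}" for n
    by (induction n) (auto simp: comp_table simp del: comp_apply id_apply)
  then show "Geven \<subseteq> {id, rot, rot ^^ 2}" unfolding Geven_def by blast
  have "rot ^^ 0 \<in> Geven" "rot ^^ 1 \<in> Geven" "rot ^^ 2 \<in> Geven" unfolding Geven_def by blast+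
  then show "{id, rot, rot ^^ 2} \<subseteq> Geven" by (simp only: funpow_0 funpow.simps id_comp One_nat_def comp_id insert_subset empty_subsetI simp_thms)
qed

lemma one_form_eq: "one_form = (\<lambda>z. alt_one)"
  by (simp add: one_form_def alt_one_def)

lemma s_not_Geven: "i < 3 \<Longrightarrow> s i \<notin> Geven"
  using less3_cases[of i] by (auto simp: Geven_eq)

lemma excess_even: "excess id h = one_form" "excess g id = one_form"
  "excess rot (rot ^^ 2) = one_form" "excess (rot ^^ 2) rot = one_form"
  "excess rot rot = zero_form" "excess (rot ^^ 2) (rot ^^ 2) = zero_form"
  by (simp_all add: excess_def euler_product_bundle_def obstruction_id obstruction_rot obstruction_rot_rot Geven_eq
      del: id_apply)

lemma excess_odd: "i < 3 \<Longrightarrow> excess (s i) h = one_form" "i < 3 \<Longrightarrow> excess g (s i) = one_form"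
  by (simp_all add: excess_def s_not_Geven)

lemmas excess_values = excess_even excess_odd

lemma wedge_one_form [simp]: "\<alpha> \<wedge> one_form = \<alpha>"
  by (simp add: wedge_def one_form_eq)

lemma wedge_zero_form [simp]: "\<alpha> \<wedge> zero_form = zero_form"
  by (simp add: wedge_def zero_form_def fun_eq_iff)

section \<open>The product in coordinates\<close>

definition qf :: "vec list \<Rightarrow> real" where
  "qf = alt_wedge (alt_wedge (alt_wedge (cov X1) (cov Y1)) (cov X2)) (cov Y2)"

lemma qf_right: "qf = alt_wedge (cov X1) (alt_wedge (cov Y1) (alt_wedge (cov X2) (cov Y2)))"
  by (simp add: qf_def alt_wedge_assoc)

lemma alt_qf: "alt_multilinear qf"
  by (simp add: qf_def alt_wedge_alt alt_cov linear_coords)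

lemma qf_std: "qf std = 1"
  by (simp add: qf_right std_def alt_wedge_cov_Cons ins_app cov_Nil cov_single)

lemma qf_degree: "length us \<noteq> 4 \<Longrightarrow> qf us = 0"
proof -
  have c: "length ws \<noteq> 1 \<Longrightarrow> cov f ws = 0" for f ws
    by (cases ws; cases "tl ws") (auto simp: cov_def split: list.split)
  have 1: "alt_wedge (cov X2) (cov Y2) ws = 0" if "length ws \<noteq> 2" for ws
    by (rule alt_wedge_cov_degree[of 1]) (use c that in \<open>simp_all add: numeral_eq_Suc\<close>)
  have 2: "alt_wedge (cov Y1) (alt_wedge (cov X2) (cov Y2)) ws = 0" if "length ws \<noteq> 3" for ws
    by (rule alt_wedge_cov_degree[of 2]) (use 1 that in \<open>simp_all add: numeral_eq_Suc\<close>)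
  show "length us \<noteq> 4 \<Longrightarrow> qf us = 0"
    unfolding qf_right by (rule alt_wedge_cov_degree[of 3]) (use 2 in \<open>simp_all add: numeral_eq_Suc\<close>)
qed

section \<open>The six factorizations of each group element\<close>

lemma pairs_sum:
  assumes "k \<in> Ghat"
  shows "(\<Sum>(g, h)\<in>{(g, h). g \<in> Ghat \<and> h \<in> Ghat \<and> g \<circ> h = k}. f g h) = (\<Sum>g\<in>Ghat. f g (inv g \<circ> k))"
proof -
  have "{(g, h). g \<in> Ghat \<and> h \<in> Ghat \<and> g \<circ> h = k} = (\<lambda>g. (g, inv g \<circ> k)) ` Ghat"
  proof (intro equalityI subsetI)
    fix x assume "x \<in> {(g, h). g \<in> Ghat \<and> h \<in> Ghat \<and> g \<circ> h = k}"
    then obtain g h where x: "x = (g, h)" "g \<in> Ghat" "h \<in> Ghat" "g \<circ> h = k" by blast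
    have "inv g \<circ> k = (inv g \<circ> g) \<circ> h" using x(4) by (simp add: comp_assoc del: comp_apply)
    also have "\<dots> = h" using inv_Ghat(2)[OF x(2)] by (simp only: id_comp)
    finally show "x \<in> (\<lambda>g. (g, inv g \<circ> k)) ` Ghat" using x by (intro image_eqI[of _ _ g]) simp_all
  next
    fix x assume "x \<in> (\<lambda>g. (g, inv g \<circ> k)) ` Ghat"
    then obtain g where x: "x = (g, inv g \<circ> k)" "g \<in> Ghat" by blast
    have "g \<circ> (inv g \<circ> k) = (g \<circ> inv g) \<circ> k" by (simp only: comp_assoc)
    also have "\<dots> = k" using inv_Ghat(3)[OF x(2)] by (simp only: id_comp)
    finally show "x \<in> {(g, h). g \<in> Ghat \<and> h \<in> Ghat \<and> g \<circ> h = k}"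
      using x comp_Ghat[OF inv_Ghat(1)[OF x(2)] assms] by (simp del: comp_apply)
  qed
  moreover have "inj_on (\<lambda>g. (g, inv g \<circ> k)) Ghat" by (rule inj_onI) simp
  ultimately show ?thesis by (simp add: sum.reindex)
qed

lemma sum_Ghat: "(\<Sum>g\<in>Ghat. f g) = f id + f rot + f (rot ^^ 2) + f (s 0) + f (s (Suc 0)) + (f (s 2) :: real)"
  by (simp add: Ghat_eq add.assoc del: id_apply)

definition gterm :: "labelled \<Rightarrow> labelled \<Rightarrow> (vec \<Rightarrow> vec) \<Rightarrow> (vec \<Rightarrow> vec) \<Rightarrow> (vec \<Rightarrow> vec) \<Rightarrow> form" where
  "gterm \<xi> \<eta> k g h = gysin (Fix g \<inter> Fix h) (Fix k) (rep_labelled \<xi> g \<wedge> rep_labelled \<eta> h \<wedge> excess g h)"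

definition star_form :: "labelled \<Rightarrow> labelled \<Rightarrow> (vec \<Rightarrow> vec) \<Rightarrow> form" where
  "star_form \<xi> \<eta> k = (\<lambda>z vs. \<Sum>(g, h) \<in> {(g, h). g \<in> Ghat \<and> h \<in> Ghat \<and> g \<circ> h = k}. gterm \<xi> \<eta> k g h z vs)"

lemma star_abs: "\<xi> \<star> \<eta> = abs_labelled (star_form \<xi> \<eta>)"
  unfolding star_def star_form_def[abs_def] gterm_def ..

lemma star_form_eqs:
  "star_form \<xi> \<eta> id = (\<lambda>z vs. gterm \<xi> \<eta> id id id z vs + gterm \<xi> \<eta> id rot (rot ^^ 2) z vs + gterm \<xi> \<eta> id (rot ^^ 2) rot z vs
     + gterm \<xi> \<eta> id (s 0) (s 0) z vs + gterm \<xi> \<eta> id (s (Suc 0)) (s (Suc 0)) z vs + gterm \<xi> \<eta> id (s 2) (s 2) z vs)"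
  "star_form \<xi> \<eta> rot = (\<lambda>z vs. gterm \<xi> \<eta> rot id rot z vs + gterm \<xi> \<eta> rot rot id z vs + gterm \<xi> \<eta> rot (rot ^^ 2) (rot ^^ 2) z vs
     + gterm \<xi> \<eta> rot (s 0) (s 2) z vs + gterm \<xi> \<eta> rot (s (Suc 0)) (s 0) z vs + gterm \<xi> \<eta> rot (s 2) (s (Suc 0)) z vs)"
  "star_form \<xi> \<eta> (rot ^^ 2) = (\<lambda>z vs. gterm \<xi> \<eta> (rot ^^ 2) id (rot ^^ 2) z vs + gterm \<xi> \<eta> (rot ^^ 2) rot rot z vs + gterm \<xi> \<eta> (rot ^^ 2) (rot ^^ 2) id z vs
     + gterm \<xi> \<eta> (rot ^^ 2) (s 0) (s (Suc 0)) z vs + gterm \<xi> \<eta> (rot ^^ 2) (s (Suc 0)) (s 2) z vs + gterm \<xi> \<eta> (rot ^^ 2) (s 2) (s 0) z vs)"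
  "star_form \<xi> \<eta> (s 0) = (\<lambda>z vs. gterm \<xi> \<eta> (s 0) id (s 0) z vs + gterm \<xi> \<eta> (s 0) rot (s 2) z vs + gterm \<xi> \<eta> (s 0) (rot ^^ 2) (s (Suc 0)) z vs
     + gterm \<xi> \<eta> (s 0) (s 0) id z vs + gterm \<xi> \<eta> (s 0) (s (Suc 0)) rot z vs + gterm \<xi> \<eta> (s 0) (s 2) (rot ^^ 2) z vs)"
  "star_form \<xi> \<eta> (s (Suc 0)) = (\<lambda>z vs. gterm \<xi> \<eta> (s (Suc 0)) id (s (Suc 0)) z vs + gterm \<xi> \<eta> (s (Suc 0)) rot (s 0) z vs + gterm \<xi> \<eta> (s (Suc 0)) (rot ^^ 2) (s 2) z vs
     + gterm \<xi> \<eta> (s (Suc 0)) (s 0) (rot ^^ 2) z vs + gterm \<xi> \<eta> (s (Suc 0)) (s (Suc 0)) id z vs + gterm \<xi> \<eta> (s (Suc 0)) (s 2) rot z vs)"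
  "star_form \<xi> \<eta> (s 2) = (\<lambda>z vs. gterm \<xi> \<eta> (s 2) id (s 2) z vs + gterm \<xi> \<eta> (s 2) rot (s (Suc 0)) z vs + gterm \<xi> \<eta> (s 2) (rot ^^ 2) (s 0) z vs
     + gterm \<xi> \<eta> (s 2) (s 0) rot z vs + gterm \<xi> \<eta> (s 2) (s (Suc 0)) (rot ^^ 2) z vs + gterm \<xi> \<eta> (s 2) (s 2) id z vs)"
  unfolding star_form_def
  by (subst pairs_sum, rule Ghat_elts, unfold sum_Ghat inv_elts id_comp comp_id comp_table, rule HOL.refl)+

lemma rep_form: "g \<in> Ghat \<Longrightarrow> is_form (rep_labelled \<xi> g)"
  by (rule closed_onD(1)[OF rep_labelled_closed])

lemma rep_id_cohomologous: "g \<in> Ghat \<Longrightarrow> cohomologous (Fix g) (rep_labelled \<xi> id) (\<lambda>z. cid \<xi>)"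
  unfolding cid_def
  by (rule cohomologous_mono[OF cohomologous_avg[OF torusD(2)[OF torus_X] rep_labelled_closed[OF Ghat_elts(1), unfolded Fix_id]] Fix_subset])

lemma gterm_id:
  assumes h: "h \<in> Ghat" and T: "torus (Fix h) cs"
  shows "cohomologous (Fix h) (gterm \<xi> \<eta> h id h) (\<lambda>z. alt_wedge (cid \<xi>) (avg cs (rep_labelled \<eta> h)))"
    "cohomologous (Fix h) (gterm \<xi> \<eta> h h id) (\<lambda>z. alt_wedge (avg cs (rep_labelled \<xi> h)) (cid \<eta>))"
proof -
  have i: "Fix id \<inter> Fix h = Fix h" "Fix h \<inter> Fix id = Fix h" using Fix_subset[of h] by (auto simp: Fix_id)
  have c: "cohomologous (Fix h) (rep_labelled \<zeta> h) (\<lambda>z. avg cs (rep_labelled \<zeta> h))" for \<zeta>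
    by (rule cohomologous_avg[OF torusD(2)[OF T] rep_labelled_closed[OF h]])
  have 1: "cohomologous (Fix h) (rep_labelled \<xi> id \<wedge> rep_labelled \<eta> h) ((\<lambda>z. cid \<xi>) \<wedge> (\<lambda>z. avg cs (rep_labelled \<eta> h)))"
    by (rule cohomologous_wedge[OF rep_id_cohomologous[OF h] c])
  have 2: "cohomologous (Fix h) (rep_labelled \<xi> h \<wedge> rep_labelled \<eta> id) ((\<lambda>z. avg cs (rep_labelled \<xi> h)) \<wedge> (\<lambda>z. cid \<eta>))"
    by (rule cohomologous_wedge[OF c rep_id_cohomologous[OF h]])
  show "cohomologous (Fix h) (gterm \<xi> \<eta> h id h) (\<lambda>z. alt_wedge (cid \<xi>) (avg cs (rep_labelled \<eta> h)))"
    unfolding gterm_def i excess_values wedge_one_form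
    using cohomologous_trans[OF gysin_self[OF T cohomologous_closed(1)[OF 1]] 1] unfolding wedge_def .
  show "cohomologous (Fix h) (gterm \<xi> \<eta> h h id) (\<lambda>z. alt_wedge (avg cs (rep_labelled \<xi> h)) (cid \<eta>))"
    unfolding gterm_def i excess_values wedge_one_form
    using cohomologous_trans[OF gysin_self[OF T cohomologous_closed(1)[OF 2]] 2] unfolding wedge_def .
qed

lemma gterm_F:
  assumes "g \<in> Ghat" "h \<in> Ghat" "Fix g \<inter> Fix h = F"
  shows "cohomologous F (gysin (Fix g \<inter> Fix h) F (rep_labelled \<xi> g \<wedge> rep_labelled \<eta> h \<wedge> excess g h))
    (rep_labelled \<xi> g \<wedge> rep_labelled \<eta> h \<wedge> excess g h)"
proof -
  have "is_form (excess g h)"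
    using is_form_zero is_form_const[OF alt_alt_one] by (auto simp: excess_def euler_product_bundle_def one_form_eq)
  then show ?thesis
    unfolding assms(3) by (intro gysin_F is_form_wedge rep_form assms)
qed

lemma gterm_F_torus:
  assumes "g \<in> Ghat" "h \<in> Ghat" "Fix g \<inter> Fix h = F" "excess g h = one_form" "k \<in> Ghat" "torus (Fix k) cs"
    "alt_multilinear w" "w cs = 1" "\<And>us. length us < length cs \<Longrightarrow> w us = 0"
  shows "cohomologous (Fix k) (gterm \<xi> \<eta> k g h) (\<lambda>z us. (\<Sum>p\<in>F. val (rep_labelled \<xi> g) p * val (rep_labelled \<eta> h) p) * w us)"
proof -
  have "is_form (rep_labelled \<xi> g \<wedge> rep_labelled \<eta> h)" by (intro is_form_wedge rep_form assms)
  from gysin_F_torus[OF assms(6) F_subset_Fix[OF assms(5)] this assms(7,8,9)] show ?thesis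
    unfolding gterm_def assms(3,4) wedge_one_form by (simp add: val_def wedge_def)
qed

lemma gterm_L:
  assumes i: "i < 3"
  shows "cohomologous X (gterm \<xi> \<eta> id (s i) (s i)) (\<lambda>z. push i (alt_wedge (cL i \<xi>) (cL i \<eta>)))"
proof -
  note c = rep_labelled_closed[OF s_Ghat[OF i]]
  have "cohomologous X (gysin (Fix (s i)) X (rep_labelled \<xi> (s i) \<wedge> rep_labelled \<eta> (s i))) (\<lambda>z. push i (alt_wedge (cL i \<xi>) (cL i \<eta>)))"
    by (rule gysin_L[OF i closed_on_wedge[OF c c] alt_wedge_alt[OF alt_cL[OF i] alt_cL[OF i]]])
      (simp add: cL_def avg_wedge[OF torusD(2)[OF torus_L[OF i]] c c])
  then show ?thesis by (simp add: gterm_def Fix_id excess_values i)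
qed

lemma cohomologous_add:
  "cohomologous M \<alpha> \<alpha>' \<Longrightarrow> cohomologous M \<beta> \<beta>' \<Longrightarrow>
    cohomologous M (\<lambda>z vs. \<alpha> z vs + \<beta> z vs) (\<lambda>z vs. \<alpha>' z vs + \<beta>' z vs)"
  using cohomologous_lincomb[of M \<alpha> \<alpha>' \<beta> \<beta>' 1 1] by simp

lemma Fix_Int_F:
  assumes "g \<in> Ghat" "h \<in> Ghat" "g \<in> {rot, rot ^^ 2} \<or> h \<in> {rot, rot ^^ 2}"
  shows "Fix g \<inter> Fix h = F"
  using assms(3) F_subset_Fix[OF assms(1)] F_subset_Fix[OF assms(2)] Fix_rot2 by (auto simp: F_def)

lemma Fix_Int_s: "Fix (s 0) \<inter> Fix (s (Suc 0)) = F" "Fix (s (Suc 0)) \<inter> Fix (s 2) = F" "Fix (s 2) \<inter> Fix (s 0) = F"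
  "Fix (s (Suc 0)) \<inter> Fix (s 0) = F" "Fix (s 2) \<inter> Fix (s (Suc 0)) = F" "Fix (s 0) \<inter> Fix (s 2) = F"
  using Fix_Int_table by (simp_all add: Int_commute)

lemma val_rep_id: "p \<in> F \<Longrightarrow> val (rep_labelled \<xi> id) p = cid \<xi> []"
  unfolding cid_def by (rule val_avg[OF torus_X F_subset_X rep_labelled_closed[OF Ghat_elts(1), unfolded Fix_id]])

lemma val_rep_s: "i < 3 \<Longrightarrow> p \<in> F \<Longrightarrow> val (rep_labelled \<xi> (s i)) p = cL i \<xi> []"
  unfolding cL_def by (rule val_avg[OF torus_L F_subset_Fix[OF s_Ghat] rep_labelled_closed[OF s_Ghat]])

lemma val_rep_rot: "val (rep_labelled \<xi> rot) = cpt rot \<xi>" "val (rep_labelled \<xi> (rot ^^ 2)) = cpt (rot ^^ 2) \<xi>"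
  by (simp_all add: cpt_def)

lemma gterm_point:
  assumes k: "Fix k = F" and gh: "g \<in> Ghat" "h \<in> Ghat" "Fix g \<inter> Fix h = F"
  shows "closed_on F (gterm \<xi> \<eta> k g h)"
    "p \<in> F \<Longrightarrow> val (gterm \<xi> \<eta> k g h) p = val (rep_labelled \<xi> g) p * val (rep_labelled \<eta> h) p * val (excess g h) p"
proof -
  note c = gterm_F[OF gh, of \<xi> \<eta>, folded gterm_def[of \<xi> \<eta> k g h, unfolded k]]
  show "closed_on F (gterm \<xi> \<eta> k g h)" by (rule cohomologous_closed(1)[OF c])
  show "val (gterm \<xi> \<eta> k g h) p = val (rep_labelled \<xi> g) p * val (rep_labelled \<eta> h) p * val (excess g h) p" if "p \<in> F"
    using c that cohomologous_F_iff[OF cohomologous_closed(1)[OF c, THEN closed_onD(1)] cohomologous_closed(2)[OF c, THEN closed_onD(1)]]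
    by (simp add: val_def wedge_def)
qed

lemma val_one_zero: "val one_form p = 1" "val zero_form p = 0"
  by (simp_all add: val_def one_form_def zero_form_def)

lemma closed_on_add: "closed_on M \<alpha> \<Longrightarrow> closed_on M \<beta> \<Longrightarrow> closed_on M (\<lambda>z vs. \<alpha> z vs + \<beta> z vs)"
  using closed_on_lincomb[of M \<alpha> \<beta> 1 1] by simp

text \<open>The factorizations of the identity behave in three ways: the trivial one gives the wedge
  product, the two with inverse rotations give multiples of the volume form, and the squares of
  reflections give conormal pushforwards.\<close>

lemma star_form_id:
  "cohomologous X (star_form \<xi> \<eta> id) (\<lambda>z us. alt_wedge (cid \<xi>) (cid \<eta>) us
      + (\<Sum>p\<in>F. cpt rot \<xi> p * cpt (rot ^^ 2) \<eta> p) * qf us + (\<Sum>p\<in>F. cpt (rot ^^ 2) \<xi> p * cpt rot \<eta> p) * qf us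
      + push 0 (alt_wedge (cL 0 \<xi>) (cL 0 \<eta>)) us + push (Suc 0) (alt_wedge (cL (Suc 0) \<xi>) (cL (Suc 0) \<eta>)) us
      + push 2 (alt_wedge (cL 2 \<xi>) (cL 2 \<eta>)) us)"
proof -
  have T: "torus (Fix id) std" by (simp only: Fix_id torus_X)
  have q: "alt_multilinear qf" "qf std = 1" "\<And>us. length us < length std \<Longrightarrow> qf us = 0"
    by (rule alt_qf, rule qf_std, rule qf_degree) (simp add: std_def)
  have 1: "cohomologous X (gterm \<xi> \<eta> id id id) (\<lambda>z. alt_wedge (cid \<xi>) (cid \<eta>))"
    using gterm_id(1)[OF Ghat_elts(1) T, of \<xi> \<eta>] unfolding Fix_id cid_def .
  have 2: "cohomologous X (gterm \<xi> \<eta> id rot (rot ^^ 2)) (\<lambda>z us. (\<Sum>p\<in>F. cpt rot \<xi> p * cpt (rot ^^ 2) \<eta> p) * qf us)"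
    using gterm_F_torus[OF Ghat_elts(2,3) Fix_Int_F[OF Ghat_elts(2,3)] excess_values(3) Ghat_elts(1) T q, of \<xi> \<eta>]
    unfolding Fix_id val_rep_rot by simp
  have 3: "cohomologous X (gterm \<xi> \<eta> id (rot ^^ 2) rot) (\<lambda>z us. (\<Sum>p\<in>F. cpt (rot ^^ 2) \<xi> p * cpt rot \<eta> p) * qf us)"
    using gterm_F_torus[OF Ghat_elts(3,2) Fix_Int_F[OF Ghat_elts(3,2)] excess_values(4) Ghat_elts(1) T q, of \<xi> \<eta>]
    unfolding Fix_id val_rep_rot by simp
  show ?thesis
    unfolding star_form_eqs(1)
    by (intro cohomologous_add 1 2 3 gterm_L) simp_all
qed

text \<open>The factorization of a rotation as the square of the other one drops out, since its
  excess form is zero. Each of the three factorizations into reflections contributes its degree-zero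
  parts at every point of \<open>F\<close>.\<close>

lemma star_form_rot:
  "closed_on F (star_form \<xi> \<eta> rot)" "closed_on F (star_form \<xi> \<eta> (rot ^^ 2))"
  "p \<in> F \<Longrightarrow> val (star_form \<xi> \<eta> rot) p = cid \<xi> [] * cpt rot \<eta> p + cpt rot \<xi> p * cid \<eta> []
      + cL 0 \<xi> [] * cL 2 \<eta> [] + cL (Suc 0) \<xi> [] * cL 0 \<eta> [] + cL 2 \<xi> [] * cL (Suc 0) \<eta> []"
  "p \<in> F \<Longrightarrow> val (star_form \<xi> \<eta> (rot ^^ 2)) p = cid \<xi> [] * cpt (rot ^^ 2) \<eta> p + cpt (rot ^^ 2) \<xi> p * cid \<eta> []
      + cL 0 \<xi> [] * cL (Suc 0) \<eta> [] + cL (Suc 0) \<xi> [] * cL 2 \<eta> [] + cL 2 \<xi> [] * cL 0 \<eta> []"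
proof -
  have F1: "Fix rot = F" by (simp add: F_def)
  note I = Fix_Int_F Fix_Int_s Ghat_elts
  have c: "closed_on F (gterm \<xi> \<eta> k g h)" if "Fix k = F" "g \<in> Ghat" "h \<in> Ghat" "Fix g \<inter> Fix h = F" for k g h
    using gterm_point(1)[OF that] .
  show "closed_on F (star_form \<xi> \<eta> rot)"
    unfolding star_form_eqs(2) by (intro closed_on_add c F1 Fix_Int_s Ghat_elts Fix_Int_F) simp_all
  show "closed_on F (star_form \<xi> \<eta> (rot ^^ 2))"
    unfolding star_form_eqs(3) by (intro closed_on_add c Fix_rot2 Fix_Int_s Ghat_elts Fix_Int_F) simp_all
  have v: "val (\<lambda>z vs. \<alpha> z vs + \<beta> z vs) p = val \<alpha> p + val \<beta> p" for \<alpha> \<beta> p by (simp add: val_def)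
  show "val (star_form \<xi> \<eta> rot) p = cid \<xi> [] * cpt rot \<eta> p + cpt rot \<xi> p * cid \<eta> []
      + cL 0 \<xi> [] * cL 2 \<eta> [] + cL (Suc 0) \<xi> [] * cL 0 \<eta> [] + cL 2 \<xi> [] * cL (Suc 0) \<eta> []" if p: "p \<in> F"
    unfolding star_form_eqs(2) v
    by (simp add: Fix_rot2 gterm_point(2)[OF F1] I p excess_values val_one_zero val_rep_id val_rep_s val_rep_rot del: id_apply)
  show "val (star_form \<xi> \<eta> (rot ^^ 2)) p = cid \<xi> [] * cpt (rot ^^ 2) \<eta> p + cpt (rot ^^ 2) \<xi> p * cid \<eta> []
      + cL 0 \<xi> [] * cL (Suc 0) \<eta> [] + cL (Suc 0) \<xi> [] * cL 2 \<eta> [] + cL 2 \<xi> [] * cL 0 \<eta> []" if p: "p \<in> F"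
    unfolding star_form_eqs(3) v
    by (simp add: F1 gterm_point(2)[OF Fix_rot2] I p excess_values val_one_zero val_rep_id val_rep_s val_rep_rot del: id_apply)
qed

text \<open>Coefficient of the volume class in a reflection sector. The labels \<open>a\<close>,
  \<open>b\<close> are the reflections that \<open>rot\<close>, \<open>rot ^^ 2\<close> carry to the
  target by multiplication from the left; \<open>c\<close>, \<open>d\<close> are those for
  multiplication from the right.\<close>

definition twist :: "labelled \<Rightarrow> labelled \<Rightarrow> nat \<Rightarrow> nat \<Rightarrow> nat \<Rightarrow> nat \<Rightarrow> real" where
  "twist \<xi> \<eta> a b c d = (\<Sum>p\<in>F. cpt rot \<xi> p * cL a \<eta> []) + (\<Sum>p\<in>F. cpt (rot ^^ 2) \<xi> p * cL b \<eta> [])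
     + (\<Sum>p\<in>F. cL c \<xi> [] * cpt rot \<eta> p) + (\<Sum>p\<in>F. cL d \<xi> [] * cpt (rot ^^ 2) \<eta> p)"

lemma star_form_s:
  assumes m: "m < 3" and w: "alt_multilinear w" "w (bs m) = 1" "\<And>us. length us < length (bs m) \<Longrightarrow> w us = 0"
    and abcd: "(m, a, b, c, d) \<in> {(0, 2, 1, 1, 2), (1, 0, 2, 2, 0), (2, 1, 0, 0, 1)}"
  shows "cohomologous (Fix (s m)) (star_form \<xi> \<eta> (s m)) (\<lambda>z us. alt_wedge (cid \<xi>) (cL m \<eta>) us + alt_wedge (cL m \<xi>) (cid \<eta>) us
    + twist \<xi> \<eta> a b c d * w us)"
proof -
  note T = torus_L[OF m] and G = s_Ghat[OF m]
  have 1: "cohomologous (Fix (s m)) (gterm \<xi> \<eta> (s m) id (s m)) (\<lambda>z. alt_wedge (cid \<xi>) (cL m \<eta>))"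
    "cohomologous (Fix (s m)) (gterm \<xi> \<eta> (s m) (s m) id) (\<lambda>z. alt_wedge (cL m \<xi>) (cid \<eta>))"
    using gterm_id[OF G T] unfolding cL_def by blast+
  have 2: "cohomologous (Fix (s m)) (gterm \<xi> \<eta> (s m) rot (s i)) (\<lambda>z us. (\<Sum>p\<in>F. cpt rot \<xi> p * cL i \<eta> []) * w us)"
      "cohomologous (Fix (s m)) (gterm \<xi> \<eta> (s m) (rot ^^ 2) (s i)) (\<lambda>z us. (\<Sum>p\<in>F. cpt (rot ^^ 2) \<xi> p * cL i \<eta> []) * w us)"
      "cohomologous (Fix (s m)) (gterm \<xi> \<eta> (s m) (s i) rot) (\<lambda>z us. (\<Sum>p\<in>F. cL i \<xi> [] * cpt rot \<eta> p) * w us)"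
      "cohomologous (Fix (s m)) (gterm \<xi> \<eta> (s m) (s i) (rot ^^ 2)) (\<lambda>z us. (\<Sum>p\<in>F. cL i \<xi> [] * cpt (rot ^^ 2) \<eta> p) * w us)"
    if i: "i < 3" for i
    using gterm_F_torus[OF Ghat_elts(2) s_Ghat[OF i] Fix_Int_F[OF Ghat_elts(2) s_Ghat[OF i]] excess_values(8)[OF i] G T w, of \<xi> \<eta>]
      gterm_F_torus[OF Ghat_elts(3) s_Ghat[OF i] Fix_Int_F[OF Ghat_elts(3) s_Ghat[OF i]] excess_values(8)[OF i] G T w, of \<xi> \<eta>]
      gterm_F_torus[OF s_Ghat[OF i] Ghat_elts(2) Fix_Int_F[OF s_Ghat[OF i] Ghat_elts(2)] excess_values(7)[OF i] G T w, of \<xi> \<eta>]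
      gterm_F_torus[OF s_Ghat[OF i] Ghat_elts(3) Fix_Int_F[OF s_Ghat[OF i] Ghat_elts(3)] excess_values(7)[OF i] G T w, of \<xi> \<eta>]
    by (simp_all add: val_rep_rot val_rep_s i cong: sum.cong)
  have e: "(\<lambda>z us. A us + B us + twist \<xi> \<eta> a b c d * w us) = (\<lambda>z us. A us + B us + ((\<Sum>p\<in>F. cpt rot \<xi> p * cL a \<eta> []) * w us
     + (\<Sum>p\<in>F. cpt (rot ^^ 2) \<xi> p * cL b \<eta> []) * w us
     + (\<Sum>p\<in>F. cL c \<xi> [] * cpt rot \<eta> p) * w us + (\<Sum>p\<in>F. cL d \<xi> [] * cpt (rot ^^ 2) \<eta> p) * w us))" for A B :: "vec list \<Rightarrow> real"
    by (simp add: twist_def distrib_right)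
  have lt: "a < 3" "b < 3" "c < 3" "d < 3" using abcd by auto
  have "star_form \<xi> \<eta> (s m) = (\<lambda>z us. gterm \<xi> \<eta> (s m) id (s m) z us + gterm \<xi> \<eta> (s m) (s m) id z us +
      (gterm \<xi> \<eta> (s m) rot (s a) z us + gterm \<xi> \<eta> (s m) (rot ^^ 2) (s b) z us + gterm \<xi> \<eta> (s m) (s c) rot z us
        + gterm \<xi> \<eta> (s m) (s d) (rot ^^ 2) z us))"
    using abcd star_form_eqs(4-6)[of \<xi> \<eta>] by (elim insertE emptyE) (simp_all add: fun_eq_iff del: id_apply)
  then show ?thesis
    unfolding e by (simp only:) (intro cohomologous_add 1 2 lt)
qed

lemma bs_length: "length (bs i) = 2"
  by (simp add: bs_def)

lemma star_form_closed: "k \<in> Ghat \<Longrightarrow> closed_on (Fix k) (star_form \<xi> \<eta> k)"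
proof (erule Ghat_cases)
  have sm: "closed_on (Fix (s m)) (star_form \<xi> \<eta> (s m))"
    if m: "m < 3" and "(m, a, b, c, d) \<in> {(0, 2, 1, 1, 2), (1, 0, 2, 2, 0), (2, 1, 0, 0, 1)}" for m a b c d :: nat
  proof -
    obtain w where "alt_multilinear w" "w (bs m) = 1" "\<And>us. length us \<noteq> length (bs m) \<Longrightarrow> w us = 0"
      using torus_volume[OF torus_L[OF m]] by blast
    then show ?thesis using cohomologous_closed(1)[OF star_form_s[OF m _ _ _ that(2)]] by simp
  qed
  show "closed_on (Fix k) (star_form \<xi> \<eta> k)" if "k = id"
    unfolding that Fix_id by (rule cohomologous_closed(1)[OF star_form_id])
  show "closed_on (Fix k) (star_form \<xi> \<eta> k)" if "k = rot"
    unfolding that using star_form_rot(1) by (simp add: F_def)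
  show "closed_on (Fix k) (star_form \<xi> \<eta> k)" if "k = rot ^^ 2"
    unfolding that Fix_rot2 by (rule star_form_rot(2))
  show "closed_on (Fix k) (star_form \<xi> \<eta> k)" if "k = s 0"
    unfolding that by (rule sm[of 0 2 1 1 2]) simp_all
  show "closed_on (Fix k) (star_form \<xi> \<eta> k)" if "k = s (Suc 0)"
    unfolding that by (rule sm[of "Suc 0" 0 2 2 0]) simp_all
  show "closed_on (Fix k) (star_form \<xi> \<eta> k)" if "k = s 2"
    unfolding that by (rule sm[of 2 1 0 0 1]) simp_all
qed

lemma star_coords:
  "cid (\<xi> \<star> \<eta>) us = alt_wedge (cid \<xi>) (cid \<eta>) us
      + (\<Sum>p\<in>F. cpt rot \<xi> p * cpt (rot ^^ 2) \<eta> p) * qf us + (\<Sum>p\<in>F. cpt (rot ^^ 2) \<xi> p * cpt rot \<eta> p) * qf us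
      + push 0 (alt_wedge (cL 0 \<xi>) (cL 0 \<eta>)) us + push (Suc 0) (alt_wedge (cL (Suc 0) \<xi>) (cL (Suc 0) \<eta>)) us
      + push 2 (alt_wedge (cL 2 \<xi>) (cL 2 \<eta>)) us"
  "p \<in> F \<Longrightarrow> cpt rot (\<xi> \<star> \<eta>) p = cid \<xi> [] * cpt rot \<eta> p + cpt rot \<xi> p * cid \<eta> []
      + cL 0 \<xi> [] * cL 2 \<eta> [] + cL (Suc 0) \<xi> [] * cL 0 \<eta> [] + cL 2 \<xi> [] * cL (Suc 0) \<eta> []"
  "p \<in> F \<Longrightarrow> cpt (rot ^^ 2) (\<xi> \<star> \<eta>) p = cid \<xi> [] * cpt (rot ^^ 2) \<eta> p + cpt (rot ^^ 2) \<xi> p * cid \<eta> []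
      + cL 0 \<xi> [] * cL (Suc 0) \<eta> [] + cL (Suc 0) \<xi> [] * cL 2 \<eta> [] + cL 2 \<xi> [] * cL 0 \<eta> []"
  "m < 3 \<Longrightarrow> (m, a, b, c, d) \<in> {(0, 2, 1, 1, 2), (1, 0, 2, 2, 0), (2, 1, 0, 0, 1)} \<Longrightarrow> us \<in> set (subseqs (bs m)) \<Longrightarrow>
    cL m (\<xi> \<star> \<eta>) us = alt_wedge (cid \<xi>) (cL m \<eta>) us + alt_wedge (cL m \<xi>) (cid \<eta>) us
      + (if length us = 2 then twist \<xi> \<eta> a b c d else 0)"
proof -
  show "cid (\<xi> \<star> \<eta>) us = alt_wedge (cid \<xi>) (cid \<eta>) us
      + (\<Sum>p\<in>F. cpt rot \<xi> p * cpt (rot ^^ 2) \<eta> p) * qf us + (\<Sum>p\<in>F. cpt (rot ^^ 2) \<xi> p * cpt rot \<eta> p) * qf us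
      + push 0 (alt_wedge (cL 0 \<xi>) (cL 0 \<eta>)) us + push (Suc 0) (alt_wedge (cL (Suc 0) \<xi>) (cL (Suc 0) \<eta>)) us
      + push 2 (alt_wedge (cL 2 \<xi>) (cL 2 \<eta>)) us"
    unfolding star_abs
    by (subst coords_abs(1), erule star_form_closed,
        subst avg_cohomologous[OF torusD(2)[OF torus_X] star_form_id], simp add: span_std, simp only: avg_const)
  show "cpt rot (\<xi> \<star> \<eta>) p = cid \<xi> [] * cpt rot \<eta> p + cpt rot \<xi> p * cid \<eta> []
      + cL 0 \<xi> [] * cL 2 \<eta> [] + cL (Suc 0) \<xi> [] * cL 0 \<eta> [] + cL 2 \<xi> [] * cL (Suc 0) \<eta> []" if p: "p \<in> F"
    unfolding star_abs by (subst coords_abs(2), erule star_form_closed, rule p, rule star_form_rot(3)[OF p])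
  show "cpt (rot ^^ 2) (\<xi> \<star> \<eta>) p = cid \<xi> [] * cpt (rot ^^ 2) \<eta> p + cpt (rot ^^ 2) \<xi> p * cid \<eta> []
      + cL 0 \<xi> [] * cL (Suc 0) \<eta> [] + cL (Suc 0) \<xi> [] * cL 2 \<eta> [] + cL 2 \<xi> [] * cL 0 \<eta> []" if p: "p \<in> F"
    unfolding star_abs by (subst coords_abs(3), erule star_form_closed, rule p, rule star_form_rot(4)[OF p])
  show "cL m (\<xi> \<star> \<eta>) us = alt_wedge (cid \<xi>) (cL m \<eta>) us + alt_wedge (cL m \<xi>) (cid \<eta>) us
      + (if length us = 2 then twist \<xi> \<eta> a b c d else 0)"
    if m: "m < 3" and abcd: "(m, a, b, c, d) \<in> {(0, 2, 1, 1, 2), (1, 0, 2, 2, 0), (2, 1, 0, 0, 1)}"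
      and us: "us \<in> set (subseqs (bs m))"
  proof -
    obtain w where w: "alt_multilinear w" "w (bs m) = 1" "\<And>us. length us \<noteq> length (bs m) \<Longrightarrow> w us = 0"
      using torus_volume[OF torus_L[OF m]] by blast
    \<comment> \<open>Among the sublists of a frame with two vectors only the whole frame has length
      two, so the choice of the volume form leaves no trace.\<close>
    have wu: "w us = (if length us = 2 then 1 else 0)"
      using subseqs_full[OF us] w(2,3) by (auto simp: bs_length)
    have sf: "cohomologous (Fix (s m)) (star_form \<xi> \<eta> (s m)) (\<lambda>z us. alt_wedge (cid \<xi>) (cL m \<eta>) us + alt_wedge (cL m \<xi>) (cid \<eta>) us
      + twist \<xi> \<eta> a b c d * w us)"
      by (rule star_form_s[OF m w(1,2) _ abcd]) (simp add: w(3))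
    have "cL m (\<xi> \<star> \<eta>) us = avg (bs m) (star_form \<xi> \<eta> (s m)) us"
      unfolding star_abs by (rule coords_abs(4)[OF star_form_closed m subseqs_subset_span[OF us]])
    also have "\<dots> = alt_wedge (cid \<xi>) (cL m \<eta>) us + alt_wedge (cL m \<xi>) (cid \<eta>) us + twist \<xi> \<eta> a b c d * w us"
      using avg_cohomologous[OF torusD(2)[OF torus_L[OF m]] sf subseqs_subset_span[OF us]] by (simp only: avg_const)
    finally show ?thesis by (simp add: wu)
  qed
qed

section \<open>Invariant classes\<close>

lemma rot_rot2: "rot ((rot ^^ 2) v) = v" "(rot ^^ 2) (rot v) = v" "rot (rot v) = (rot ^^ 2) v" "(rot ^^ 2) ((rot ^^ 2) v) = rot v"
  and s0_rot: "s 0 (rot v) = (rot ^^ 2) (s 0 v)" "s 0 ((rot ^^ 2) v) = rot (s 0 v)"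
  by (subst (1 2) mk_coords[symmetric, of v], simp only: act_mk, simp add: mk_eq_iff del: mk_coords)+

lemma s0_fixed: "v \<in> span (set (bs 0)) \<Longrightarrow> s 0 v = v"
  using subtorus_span_Fix[OF Ghat_elts(4) torusD(2)[OF torus_s(1)]] by simp

lemma bs_rot: "bs (Suc 0) = map (rot ^^ 2) (bs 0)" "bs 2 = map rot (bs 0)"
  by (simp_all add: bs_explicit rot_mk rot2_mk)

lemma span_bs_rot: "span (set (bs (Suc 0))) = (rot ^^ 2) ` span (set (bs 0))" "span (set (bs 2)) = rot ` span (set (bs 0))"
  by (simp_all add: bs_rot linear_span_image[OF linear_rot] linear_span_image[OF linear_rot_pow])

lemma H_Ori_conj: "(rot ^^ 2) \<circ> s 0 \<circ> rot = s (Suc 0)" "(rot ^^ 2) \<circ> s (Suc 0) \<circ> rot = s 2" "(rot ^^ 2) \<circ> s 2 \<circ> rot = s 0"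
  "s 0 \<circ> s 0 \<circ> s 0 = s 0" "s 0 \<circ> s (Suc 0) \<circ> s 0 = s 2" "s 0 \<circ> s 2 \<circ> s 0 = s (Suc 0)"
  "(rot ^^ 2) \<circ> rot \<circ> rot = rot" "(rot ^^ 2) \<circ> (rot ^^ 2) \<circ> rot = rot ^^ 2"
  "s 0 \<circ> rot \<circ> s 0 = rot ^^ 2" "s 0 \<circ> (rot ^^ 2) \<circ> s 0 = rot"
  by (simp_all only: comp_table id_comp)

text \<open>Conjugation by a rotation permutes the three reflection sectors cyclically, and a
  reflection swaps the two rotation sectors, so an invariant class is known from one sector of each
  kind and the untwisted one.\<close>

lemma H_OriD:
  assumes "\<xi> \<in> H_Ori"
  shows "cid \<xi> (map rot us) = cid \<xi> us" "cid \<xi> (map (s 0) us) = cid \<xi> us"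
    "p \<in> F \<Longrightarrow> cpt (rot ^^ 2) \<xi> p = cpt rot \<xi> p"
    "set us \<subseteq> span (set (bs 0)) \<Longrightarrow> cL (Suc 0) \<xi> (map (rot ^^ 2) us) = cL 0 \<xi> us"
    "set us \<subseteq> span (set (bs 0)) \<Longrightarrow> cL 2 \<xi> (map rot us) = cL 0 \<xi> us"
proof -
  have r: "act rot \<xi> = \<xi>" and t: "act (s 0) \<xi> = \<xi>" using assms unfolding H_Ori_iff by auto
  show "cid \<xi> (map rot us) = cid \<xi> us"
    using coords_act(1)[OF Ghat_elts(2), of \<xi> "map rot us"] by (simp add: r rot_rot2 o_def)
  show "cid \<xi> (map (s 0) us) = cid \<xi> us"
    using coords_act(1)[OF Ghat_elts(4), of \<xi> us] by (simp add: t)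
  show "cpt (rot ^^ 2) \<xi> p = cpt rot \<xi> p" if "p \<in> F"
    using coords_act(2)[OF Ghat_elts(4) that, of \<xi>] unfolding inv_elts H_Ori_conj t by simp
  show 1: "cL (Suc 0) \<xi> (map (rot ^^ 2) us) = cL 0 \<xi> us" if "set us \<subseteq> span (set (bs 0))" for us
    using coords_act(4)[OF Ghat_elts(2), of 0 "Suc 0" us \<xi>, unfolded inv_elts H_Ori_conj r, OF _ _ _ that] by simp
  show "cL 2 \<xi> (map rot us) = cL 0 \<xi> us" if "set us \<subseteq> span (set (bs 0))"
  proof -
    have "set (map (rot ^^ 2) us) \<subseteq> span (set (bs (Suc 0)))" using that unfolding span_bs_rot by auto
    from coords_act(4)[OF Ghat_elts(2), of "Suc 0" 2 "map (rot ^^ 2) us" \<xi>, unfolded inv_elts H_Ori_conj r, OF _ _ _ this]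
    show ?thesis using 1[OF that] by (simp add: o_def rot_rot2)
  qed
qed

lemma subseqs_map: "subseqs (map f xs) = map (map f) (subseqs xs)"
  by (induction xs) (simp_all add: Let_def)

text \<open>Invariance is checked on the generators. Since \<open>s 0\<close> fixes the tangent
  plane of \<open>L 0\<close> pointwise, it imposes nothing on that sector, and its effect on the
  other two follows from their comparison with \<open>L 0\<close> by rotations.\<close>

lemma H_OriI:
  assumes 1: "\<And>us. cid \<xi> (map rot us) = cid \<xi> us" and 2: "\<And>us. cid \<xi> (map (s 0) us) = cid \<xi> us"
    and 3: "\<And>p. p \<in> F \<Longrightarrow> cpt (rot ^^ 2) \<xi> p = cpt rot \<xi> p"
    and 4: "\<And>us. us \<in> set (subseqs (bs 0)) \<Longrightarrow> cL (Suc 0) \<xi> (map (rot ^^ 2) us) = cL 0 \<xi> us"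
    and 5: "\<And>us. us \<in> set (subseqs (bs 0)) \<Longrightarrow> cL 2 \<xi> (map rot us) = cL 0 \<xi> us"
  shows "\<xi> \<in> H_Ori"
proof -
  note alts = alt_cL[of 0 \<xi>] alt_map[OF alt_cL[of "Suc 0" \<xi>] linear_rot_pow] alt_map[OF alt_cL[of 2 \<xi>] linear_rot]
  have 4: "cL (Suc 0) \<xi> (map (rot ^^ 2) us) = cL 0 \<xi> us" if "set us \<subseteq> span (set (bs 0))" for us
    by (rule alt_eqI[OF _ _ 4 that]) (simp_all add: alts)
  have 5: "cL 2 \<xi> (map rot us) = cL 0 \<xi> us" if "set us \<subseteq> span (set (bs 0))" for us
    by (rule alt_eqI[OF _ _ 5 that]) (simp_all add: alts)
  have sub: "set us \<subseteq> span (set (bs i))" if "us \<in> set (subseqs (bs i))" for us i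
    by (rule subseqs_subset_span[OF that])
  have m0: "us \<in> set (subseqs (bs 0)) \<Longrightarrow> set us \<subseteq> span (set (bs 0))" for us by (rule sub)
  have m1: "\<exists>ws. us = map (rot ^^ 2) ws \<and> set ws \<subseteq> span (set (bs 0))" if "us \<in> set (subseqs (bs (Suc 0)))" for us
    using that m0 by (auto simp: bs_rot subseqs_map)
  have m2: "\<exists>ws. us = map rot ws \<and> set ws \<subseteq> span (set (bs 0))" if "us \<in> set (subseqs (bs 2))" for us
    using that m0 by (auto simp: bs_rot subseqs_map)
  have lt: "0 < (3 :: nat)" "Suc 0 < 3" "2 < (3 :: nat)" by simp_all
  have "act rot \<xi> = \<xi>"
  proof (rule labelled_eqI)
    show "cid (act rot \<xi>) us = cid \<xi> us" for us
      using 1[of "map (rot ^^ 2) us"] by (simp add: coords_act(1) Ghat_elts o_def rot_rot2)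
    show "cpt rot (act rot \<xi>) p = cpt rot \<xi> p" if "p \<in> F" for p
      using coords_act(2)[OF Ghat_elts(2) that, of \<xi>] unfolding inv_elts H_Ori_conj by simp
    show "cpt (rot ^^ 2) (act rot \<xi>) p = cpt (rot ^^ 2) \<xi> p" if "p \<in> F" for p
      using coords_act(3)[OF Ghat_elts(2) that, of \<xi>] unfolding inv_elts H_Ori_conj by simp
    show "cL i (act rot \<xi>) us = cL i \<xi> us" if "i < 3" and us: "us \<in> set (subseqs (bs i))" for i us
      using less3_cases[OF \<open>i < 3\<close>]
    proof (elim disjE)
      assume i: "i = 0"
      show ?thesis
        using coords_act(4)[OF Ghat_elts(2) lt(1,2), unfolded inv_elts H_Ori_conj, OF HOL.refl sub[OF us[unfolded i]], of \<xi>]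
          4[OF m0[OF us[unfolded i]]] by (simp add: i)
    next
      assume i: "i = Suc 0"
      obtain ws where ws: "us = map (rot ^^ 2) ws" "set ws \<subseteq> span (set (bs 0))" using m1 us i by blast
      show ?thesis
        using coords_act(4)[OF Ghat_elts(2) lt(2,3), unfolded inv_elts H_Ori_conj, OF HOL.refl sub[OF us[unfolded i]], of \<xi>]
          4[OF ws(2)] 5[OF ws(2)] by (simp add: i ws(1) o_def rot_rot2)
    next
      assume i: "i = 2"
      obtain ws where ws: "us = map rot ws" "set ws \<subseteq> span (set (bs 0))" using m2 us i by blast
      show ?thesis
        using coords_act(4)[OF Ghat_elts(2) lt(3,1), unfolded inv_elts H_Ori_conj, OF HOL.refl sub[OF us[unfolded i]], of \<xi>]
          5[OF ws(2)] by (simp add: i ws(1) o_def rot_rot2)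
    qed
  qed
  moreover have "act (s 0) \<xi> = \<xi>"
  proof (rule labelled_eqI)
    have s0: "map (s 0) ws = ws" if "set ws \<subseteq> span (set (bs 0))" for ws
      using that s0_fixed by (induction ws) auto
    have s0': "s 0 v = v" if "set ws \<subseteq> span (set (bs 0))" "v \<in> set ws" for ws v
      using that by (intro s0_fixed) blast
    show "cid (act (s 0) \<xi>) us = cid \<xi> us" for us
      using 2[of us] by (simp add: coords_act(1) Ghat_elts)
    show "cpt rot (act (s 0) \<xi>) p = cpt rot \<xi> p" if "p \<in> F" for p
      using coords_act(2)[OF Ghat_elts(4) that, of \<xi>] 3[OF that] unfolding inv_elts H_Ori_conj by simp
    show "cpt (rot ^^ 2) (act (s 0) \<xi>) p = cpt (rot ^^ 2) \<xi> p" if "p \<in> F" for p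
      using coords_act(3)[OF Ghat_elts(4) that, of \<xi>] 3[OF that] unfolding inv_elts H_Ori_conj by simp
    show "cL i (act (s 0) \<xi>) us = cL i \<xi> us" if "i < 3" and us: "us \<in> set (subseqs (bs i))" for i us
      using less3_cases[OF \<open>i < 3\<close>]
    proof (elim disjE)
      assume i: "i = 0"
      show ?thesis
        using coords_act(4)[OF Ghat_elts(4) lt(1,1), unfolded inv_elts H_Ori_conj, OF HOL.refl sub[OF us[unfolded i]], of \<xi>]
          s0[OF m0[OF us[unfolded i]]] by (simp add: i)
    next
      assume i: "i = Suc 0"
      obtain ws where ws: "us = map (rot ^^ 2) ws" "set ws \<subseteq> span (set (bs 0))" using m1 us i by blast
      have m: "map (s 0) us = map rot ws" using s0'[OF ws(2)] by (simp add: ws(1) s0_rot)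
      have "cL (Suc 0) (act (s 0) \<xi>) us = cL 2 \<xi> (map rot ws)"
        using coords_act(4)[OF Ghat_elts(4) lt(2,3), unfolded inv_elts H_Ori_conj, OF HOL.refl sub[OF us[unfolded i]], of \<xi>]
        unfolding m .
      then show ?thesis using 4[OF ws(2)] 5[OF ws(2)] by (simp add: i ws(1))
    next
      assume i: "i = 2"
      obtain ws where ws: "us = map rot ws" "set ws \<subseteq> span (set (bs 0))" using m2 us i by blast
      have m: "map (s 0) us = map (rot ^^ 2) ws" using s0'[OF ws(2)] by (simp add: ws(1) s0_rot)
      have "cL 2 (act (s 0) \<xi>) us = cL (Suc 0) \<xi> (map (rot ^^ 2) ws)"
        using coords_act(4)[OF Ghat_elts(4) lt(3,2), unfolded inv_elts H_Ori_conj, OF HOL.refl sub[OF us[unfolded i]], of \<xi>]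
        unfolding m .
      then show ?thesis using 4[OF ws(2)] 5[OF ws(2)] by (simp add: i ws(1))
    qed
  qed
  ultimately show ?thesis by (simp add: H_Ori_iff)
qed

section \<open>Invariant alternating forms and their wedge products\<close>

definition thf :: "vec list \<Rightarrow> real" where
  "thf = (\<lambda>us. (-2) * alt_wedge (cov X1) (cov X2) us + alt_wedge (cov X1) (cov Y2) us
    + alt_wedge (cov Y1) (cov X2) us + alt_wedge (cov Y1) (cov Y2) us)"

abbreviation "e1 \<equiv> mk 1 0 0 0"
abbreviation "e2 \<equiv> mk 0 1 0 0"
abbreviation "e3 \<equiv> mk 0 0 1 0"
abbreviation "e4 \<equiv> mk 0 0 0 1"

lemma alt_add_fun: "alt_multilinear a \<Longrightarrow> alt_multilinear b \<Longrightarrow> alt_multilinear (\<lambda>us. a us + b us)"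
  using alt_lincomb[of a b 1 1] by (simp add: lincomb_def)

lemma alt_thf: "alt_multilinear thf"
  unfolding thf_def by (intro alt_add_fun alt_scaled alt_wedge_alt alt_cov linear_coords)

lemmas eval_forms = alt_wedge_cov_Cons ins_app cov_Nil cov_single alt_wedge_cov_Nil

lemma cov_long: "cov c (v # w # us) = 0"
  by (simp add: cov_def)

lemma thf_values: "thf [] = 0" "thf [v] = 0" "thf (u # v # w # us) = 0"
  "thf [v, w] = (-2) * (X1 v * X2 w - X1 w * X2 v) + (X1 v * Y2 w - X1 w * Y2 v) + (Y1 v * X2 w - Y1 w * X2 v)
     + (Y1 v * Y2 w - Y1 w * Y2 v)"
proof -
  have d: "alt_wedge (cov f) (cov g) us = 0" if "length us \<noteq> 2" for f g us
    by (rule alt_wedge_cov_degree[of 1]) (use that in \<open>auto simp: cov_def numeral_2_eq_2 split: list.split\<close>)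
  show "thf [] = 0" "thf [v] = 0" "thf (u # v # w # us) = 0" by (simp_all add: thf_def d cov_Nil)
  show "thf [v, w] = (-2) * (X1 v * X2 w - X1 w * X2 v) + (X1 v * Y2 w - X1 w * Y2 v) + (Y1 v * X2 w - Y1 w * X2 v)
     + (Y1 v * Y2 w - Y1 w * Y2 v)"
    by (simp add: thf_def eval_forms algebra_simps)
qed

lemma subseqs_std: "set (subseqs std) = {[], [e1], [e2], [e3], [e4], [e1, e2], [e1, e3], [e1, e4], [e2, e3], [e2, e4], [e3, e4],
   [e1, e2, e3], [e1, e2, e4], [e1, e3, e4], [e2, e3, e4], [e1, e2, e3, e4]}"
  by (auto simp: std_def Let_def)

lemma std_alt_eqI:
  assumes "alt_multilinear a" "alt_multilinear b" "\<And>us. us \<in> set (subseqs std) \<Longrightarrow> a us = b us"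
  shows "a us = b us"
  by (rule alt_eqI[OF assms]) (auto simp: span_std)

lemma linear_s0: "linear (s 0)"
  by (rule linear_Ghat[OF Ghat_elts(4)])

lemma thf_invariant: "thf (map rot us) = thf us" "thf (map (s 0) us) = thf us"
proof -
  show "thf (map rot us) = thf us"
    by (rule std_alt_eqI[OF alt_map[OF alt_thf linear_rot] alt_thf])
      (unfold subseqs_std, elim insertE emptyE; simp add: thf_values rot_mk)
  show "thf (map (s 0) us) = thf us"
    by (rule std_alt_eqI[OF alt_map[OF alt_thf linear_s0] alt_thf])
      (unfold subseqs_std, elim insertE emptyE; simp add: thf_values s_mk)
qed

lemma qf_eval: "qf [u, v, w, x] = alt_wedge (cov X1) (alt_wedge (cov Y1) (alt_wedge (cov X2) (cov Y2))) [u, v, w, x]"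
  by (simp add: qf_right)

lemma qf_invariant: "qf (map rot us) = qf us" "qf (map (s 0) us) = qf us"
proof -
  show "qf (map rot us) = qf us"
    by (rule std_alt_eqI[OF alt_map[OF alt_qf linear_rot] alt_qf])
      (unfold subseqs_std, elim insertE emptyE; simp add: qf_degree rot_mk; simp add: qf_eval eval_forms cov_long)
  show "qf (map (s 0) us) = qf us"
    by (rule std_alt_eqI[OF alt_map[OF alt_qf linear_s0] alt_qf])
      (unfold subseqs_std, elim insertE emptyE; simp add: qf_degree s_mk; simp add: qf_eval eval_forms cov_long)
qed

lemma alt_single_mk: "alt_multilinear a \<Longrightarrow> a (us @ mk p q r t # ws) = p * a (us @ e1 # ws) + q * a (us @ e2 # ws) + r * a (us @ e3 # ws) + t * a (us @ e4 # ws)"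
proof -
  assume a: "alt_multilinear a"
  have "mk p q r t = p *\<^sub>R e1 + q *\<^sub>R e2 + r *\<^sub>R e3 + t *\<^sub>R e4" by (simp add: vec_eq_iff4)
  then show ?thesis by (simp only: alt_add[OF a] alt_scale[OF a])
qed

text \<open>Solving the linear equations that express invariance under \<open>rot\<close> and \<open>s 0\<close> on basis vectors.\<close>

lemma invariant_form:
  assumes a: "alt_multilinear a" and r: "\<And>us. a (map rot us) = a us" and t: "\<And>us. a (map (s 0) us) = a us"
  shows "a us = a [] * alt_one us + a [e1, e4] * thf us + a std * qf us"
proof (rule std_alt_eqI[OF a])
  show "alt_multilinear (\<lambda>us. a [] * alt_one us + a [e1, e4] * thf us + a std * qf us)"
    by (intro alt_add_fun alt_scaled alt_alt_one alt_thf alt_qf)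
  note L0 = alt_single_mk[OF a, of "[]", unfolded append_Nil]
  note L1 = alt_single_mk[OF a, of "[v]" for v, unfolded append_Cons append_Nil]
  note L2 = alt_single_mk[OF a, of "[v, w]" for v w, unfolded append_Cons append_Nil]
  have sw0: "a (v # w # us) = - a (w # v # us)" for v w us using alt_swap[OF a, of "[]" v w us] by simp
  have sw1: "a (u # v # w # us) = - a (u # w # v # us)" for u v w us using alt_swap[OF a, of "[u]" v w us] by simp
  have z: "a (v # v # us) = 0" "a (u # v # v # us) = 0" "a (v # w # v # us) = 0" for u v w us
    using altD_eq[OF a, of "[]" v "[]" us] altD_eq[OF a, of "[u]" v "[]" us] altD_eq[OF a, of "[]" v "[w]" us] by simp_all
  have s1: "a [e1] = 0 \<and> a [e2] = 0" "a [e3] = 0 \<and> a [e4] = 0"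
    using r[of "[e1]"] r[of "[e2]"] L0[of 0 1 0 0 "[]"] L0[of "-1" "-1" 0 0 "[]"] r[of "[e3]"] r[of "[e4]"] L0[of 0 0 "-1" "-1" "[]"]
    by (simp_all add: rot_mk)
  have s2: "a [e1, e2] = 0" "a [e3, e4] = 0"
    using t[of "[e1, e2]"] L0[of "-1" 0 0 0 "[mk 1 1 0 0]"] L1[of e1 1 1 0 0 "[]"]
      t[of "[e3, e4]"] L0[of 0 0 "-1" 0 "[mk 0 0 1 1]"] L1[of e3 0 0 1 1 "[]"] z
    by (simp_all add: s_mk)
  \<comment> \<open>In degree two one parameter survives; it is normalized by the value on
    \<open>e1\<close>, \<open>e4\<close>, where \<Theta> takes the value 1.\<close>
  have b: "a [e1, e3] = - 2 * a [e1, e4]" "a [e2, e3] = a [e1, e4]" "a [e2, e4] = a [e1, e4]"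
    using t[of "[e1, e4]"] L0[of "-1" 0 0 0 "[mk 0 0 1 1]"] L1[of e1 0 0 1 1 "[]"]
      r[of "[e1, e4]"] r[of "[e2, e4]"] L0[of "-1" "-1" 0 0 "[e3]"]
    by (simp_all add: s_mk rot_mk)
  have c1: "a [e1, e2, e3] = 0 \<and> a [e1, e2, e4] = 0"
  proof -
    have "a [e1, e2, e4] = a [e1, e2, e3]"
      using r[of "[e1, e2, e4]"] L1[of e2 "-1" "-1" 0 0 "[e3]"] z(1)[of e2] sw0[of e2 e1] by (simp add: rot_mk)
    moreover have "a [e1, e2, e3] = - a [e1, e2, e3] - a [e1, e2, e4]"
      using r[of "[e1, e2, e3]"] L1[of e2 "-1" "-1" 0 0 "[mk 0 0 (-1) (-1)]"] z(1)[of e2] sw0[of e2 e1 "[mk 0 0 (-1) (-1)]"]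
        L2[of e1 e2 0 0 "-1" "-1" "[]"] by (simp add: rot_mk)
    ultimately show ?thesis by simp
  qed
  have c2: "a [e1, e3, e4] = 0 \<and> a [e2, e3, e4] = 0"
  proof -
    have "a [e1, e3, e4] = a [e2, e3, e4]"
      using r[of "[e1, e3, e4]"] L1[of e2 0 0 "-1" "-1" "[e3]"] z(2)[of e2 e3] sw1[of e2 e4 e3] by (simp add: rot_mk)
    moreover have "a [e2, e3, e4] = - a [e1, e3, e4] - a [e2, e3, e4]"
      using r[of "[e2, e3, e4]"] L0[of "-1" "-1" 0 0 "[mk 0 0 (-1) (-1), e3]"] L1[of e1 0 0 "-1" "-1" "[e3]"] L1[of e2 0 0 "-1" "-1" "[e3]"]
        z(2)[of e2 e3] z(2)[of e1 e3] sw1[of e2 e4 e3] sw1[of e1 e4 e3] by (simp add: rot_mk)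
    ultimately show ?thesis by simp
  qed
  fix us assume "us \<in> set (subseqs std)"
  then show "a us = a [] * alt_one us + a [e1, e4] * thf us + a std * qf us"
    unfolding subseqs_std
    by (elim insertE emptyE; simp add: alt_one_def thf_values qf_degree s1 s2 b c1 c2)
      (simp add: qf_std[unfolded std_def] std_def)
qed

lemma alt_wedge_single: "alt_wedge a b [v] = a [v] * b [] + a [] * b [v]"
  and alt_wedge_pair: "alt_wedge a b [v, w] = a [v, w] * b [] + a [v] * b [w] - a [w] * b [v] + a [] * b [v, w]"
  by (simp_all add: alt_wedge.simps(2))

lemma bs0: "bs 0 = [mk 1 2 0 0, mk 0 0 (-1) (-2)]"
  by (rule bs_explicit)

text \<open>The Gysin images of the unit, of the two degree-one classes and of the volume classes add up
  to \<open>-3 \<Theta>\<close>, \<open>0\<close> and \<open>3 q\<close>.\<close>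

lemma push_sum:
  assumes a: "\<And>i. i < 3 \<Longrightarrow> alt_multilinear (a i)"
    and v0: "\<And>i. i < 3 \<Longrightarrow> a i [] = l0"
    and v1: "\<And>i. i < 3 \<Longrightarrow> a i [bs i ! 0] = l1" and v2: "\<And>i. i < 3 \<Longrightarrow> a i [bs i ! 1] = l2"
    and v12: "\<And>i. i < 3 \<Longrightarrow> a i (bs i) = l12"
    and us: "us \<in> set (subseqs std)"
  shows "push 0 (a 0) us + push (Suc 0) (a (Suc 0)) us + push 2 (a 2) us = - 3 * l0 * thf us + 3 * l12 * qf us"
proof -
  have lt: "0 < (3 :: nat)" "Suc 0 < 3" "2 < (3 :: nat)" by simp_all
  note S = alt_single_mk[of _ "[]" _ _ _ _ "[]", unfolded append_Nil]
  \<comment> \<open>The degree-one values on the three frames, rewritten in the standard basis. With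
    these relations the degree-three parts of the three pushforwards cancel.\<close>
  have e: "a 0 [e1] + 2 * a 0 [e2] = l1" "- a 0 [e3] - 2 * a 0 [e4] = l2"
    "a (Suc 0) [e1] - a (Suc 0) [e2] = l1" "2 * a (Suc 0) [e3] + a (Suc 0) [e4] = l2"
    "- 2 * a 2 [e1] - a 2 [e2] = l1" "- a 2 [e3] + a 2 [e4] = l2"
    using v1[OF lt(1)] v2[OF lt(1)] v1[OF lt(2)] v2[OF lt(2)] v1[OF lt(3)] v2[OF lt(3)]
      S[OF a[OF lt(1)], of 1 2 0 0] S[OF a[OF lt(1)], of 0 0 "-1" "-2"] S[OF a[OF lt(2)], of 1 "-1" 0 0]
      S[OF a[OF lt(2)], of 0 0 2 1] S[OF a[OF lt(3)], of "-2" "-1" 0 0] S[OF a[OF lt(3)], of 0 0 "-1" 1]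
    by (simp_all add: bs_explicit)
  have full: "push 0 (a 0) std + push (Suc 0) (a (Suc 0)) std + push 2 (a 2) std = 3 * l12"
    using push_std[OF a[OF lt(1)] lt(1)] push_std[OF a[OF lt(2)] lt(2)] push_std[OF a[OF lt(3)] lt(3)]
      v12[OF lt(1)] v12[OF lt(2)] v12[OF lt(3)] by simp
  have P: "push i b [] = 0" "push i b [u] = 0" "push i b [u, v] = (nrm1 i u * nrm2 i v - nrm1 i v * nrm2 i u) * b []"
    "push i b [u, v, w] = nrm1 i u * (nrm2 i v * b [w] - nrm2 i w * b [v]) - nrm1 i v * (nrm2 i u * b [w] - nrm2 i w * b [u])
      + nrm1 i w * (nrm2 i u * b [v] - nrm2 i v * b [u])" for i b u v w
    by (simp_all add: push_def eval_forms algebra_simps)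
  show ?thesis
    using us unfolding subseqs_std
    apply (elim insertE emptyE)
    apply (simp_all add: P nrm_mk thf_values qf_degree v0 algebra_simps)
    using e full apply (simp_all add: qf_std[unfolded std_def] std_def thf_values algebra_simps)
    done
qed

abbreviation "b1 \<equiv> mk 1 2 0 0"
abbreviation "b2 \<equiv> mk 0 0 (-1) (-2)"

lemma H_Ori_cid: "\<xi> \<in> H_Ori \<Longrightarrow> cid \<xi> us = cid \<xi> [] * alt_one us + cid \<xi> [e1, e4] * thf us + cid \<xi> std * qf us"
  by (rule invariant_form[OF alt_cid H_OriD(1,2)])

text \<open>Frames and classes are transported by the same rotations, so an invariant class has the
  same four frame values in every reflection sector.\<close>

lemma H_Ori_cL:
  assumes "\<xi> \<in> H_Ori" "i < 3"
  shows "cL i \<xi> [] = cL 0 \<xi> []" "cL i \<xi> [bs i ! 0] = cL 0 \<xi> [b1]" "cL i \<xi> [bs i ! Suc 0] = cL 0 \<xi> [b2]" "cL i \<xi> (bs i) = cL 0 \<xi> (bs 0)"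
    "cL i \<xi> [bs i ! 0, bs i ! Suc 0] = cL 0 \<xi> [b1, b2]"
proof -
  note D = H_OriD(4,5)[OF assms(1)]
  have S: "set [] \<subseteq> span (set (bs 0))" "set [b1] \<subseteq> span (set (bs 0))" "set [b2] \<subseteq> span (set (bs 0))" "set (bs 0) \<subseteq> span (set (bs 0))"
    by (simp_all add: bs0 span_base)
  show "cL i \<xi> [] = cL 0 \<xi> []"
    using less3_cases[OF assms(2)] D[OF S(1)] by auto
  show "cL i \<xi> [bs i ! 0] = cL 0 \<xi> [b1]"
    using less3_cases[OF assms(2)] D[OF S(2)] by (elim disjE) (simp_all add: bs_rot bs0)
  show "cL i \<xi> [bs i ! Suc 0] = cL 0 \<xi> [b2]"
    using less3_cases[OF assms(2)] D[OF S(3)] by (elim disjE) (simp_all add: bs_rot bs0)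
  show bs: "cL i \<xi> (bs i) = cL 0 \<xi> (bs 0)"
    using less3_cases[OF assms(2)] D[OF S(4)] by (elim disjE) (simp_all add: bs_rot)
  have "bs i = [bs i ! 0, bs i ! Suc 0]" by (simp add: bs_def)
  then show "cL i \<xi> [bs i ! 0, bs i ! Suc 0] = cL 0 \<xi> [b1, b2]" using bs by (simp add: bs0)
qed

lemma alt_wedge_top_right:
  assumes "\<And>ws. length ws < length us \<Longrightarrow> b ws = 0"
  shows "alt_wedge a b us = a [] * b us"
  using assms
proof (induction us arbitrary: a b)
  case Nil
  then show ?case by simp
next
  case (Cons v vs)
  have "alt_wedge (ins v a) b vs = 0"
    by (rule trans[OF alt_wedge_cong[of vs "ins v a" "ins v a" b "\<lambda>us. 0"]]) (use Cons.prems in auto)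
  moreover have "alt_wedge (grade a) (ins v b) vs = grade a [] * ins v b vs"
    by (rule Cons.IH) (use Cons.prems in \<open>auto simp: ins_app\<close>)
  ultimately show ?case by (simp add: alt_wedge_Cons) (simp add: grade_def ins_app)
qed

text \<open>The 6 consists of two cross terms, each occurring in both orders: -2 x1 x2 with y1 y2
  contributes 4 q, and x1 y2 with y1 x2 contributes 2 q.\<close>

lemma wedge_table:
  assumes "us \<in> set (subseqs std)"
  shows "alt_wedge thf thf us = 6 * qf us" "alt_wedge thf qf us = 0" "alt_wedge qf b us = qf us * b []"
proof -
  have l: "length us \<le> 4" using subseqs_full[OF assms] by (simp add: std_def)
  show "alt_wedge qf b us = qf us * b []"
    by (rule alt_wedge_top) (use l in \<open>simp add: qf_degree\<close>)
  show "alt_wedge thf qf us = 0"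
    using alt_wedge_top_right[of us qf thf] l by (simp add: qf_degree thf_values)
  have q: "qf [e1, e2, e3, e4] = 1" using qf_std by (simp add: std_def)
  show "alt_wedge thf thf us = 6 * qf us"
    using assms unfolding subseqs_std
    by (elim insertE emptyE) (simp_all add: alt_wedge.simps(2) thf_values q qf_degree)
qed

lemma wedge_invariant_forms:
  assumes "us \<in> set (subseqs std)"
  shows "alt_wedge (\<lambda>us. a * alt_one us + b * thf us + c * qf us) (\<lambda>us. a' * alt_one us + b' * thf us + c' * qf us) us =
    a * a' * alt_one us + (a * b' + b * a') * thf us + (a * c' + c * a' + 6 * b * b') * qf us"
proof -
  have e: "(\<lambda>us. a * alt_one us + b * thf us + c * qf us) = lincomb 1 (lincomb a alt_one b thf) c qf" for a b c
    by (simp add: lincomb_def)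
  have z: "thf [] = 0" "qf [] = 0" "alt_one [] = 1" by (simp_all add: thf_values qf_degree alt_one_def)
  show ?thesis
    unfolding e alt_wedge_lincomb_left alt_wedge_lincomb_right
    by (simp add: lincomb_app wedge_table[OF assms] z algebra_simps)
qed

section \<open>The product of invariant classes as a polynomial in coordinates\<close>

abbreviation usum :: "labelled \<Rightarrow> labelled \<Rightarrow> real" where
  "usum \<xi> \<eta> \<equiv> \<Sum>p\<in>F. cpt rot \<xi> p * cpt rot \<eta> p"

lemma alt_invariant_form: "alt_multilinear (\<lambda>us. a * alt_one us + b * thf us + c * qf us)"
  by (intro alt_add_fun alt_scaled alt_alt_one alt_thf alt_qf)

text \<open>The factor 2 counts the two orders of a pair of inverse rotations; the coefficients -3
  and 3 are those of \<open>push_sum\<close>, applied to the products in the three reflection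
  sectors.\<close>

lemma star_H_cid:
  assumes x: "\<xi> \<in> H_Ori" and y: "\<eta> \<in> H_Ori"
  shows "cid (\<xi> \<star> \<eta>) us = cid \<xi> [] * cid \<eta> [] * alt_one us
    + (cid \<xi> [] * cid \<eta> [e1, e4] + cid \<xi> [e1, e4] * cid \<eta> [] - 3 * cL 0 \<xi> [] * cL 0 \<eta> []) * thf us
    + (cid \<xi> [] * cid \<eta> std + cid \<xi> std * cid \<eta> [] + 6 * cid \<xi> [e1, e4] * cid \<eta> [e1, e4] + 2 * usum \<xi> \<eta>
      + 3 * (cL 0 \<xi> [] * cL 0 \<eta> (bs 0) + cL 0 \<xi> (bs 0) * cL 0 \<eta> [] + cL 0 \<xi> [b1] * cL 0 \<eta> [b2] - cL 0 \<xi> [b2] * cL 0 \<eta> [b1])) * qf us"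
proof -
  define R where "R = (\<lambda>us. cid \<xi> [] * cid \<eta> [] * alt_one us
    + (cid \<xi> [] * cid \<eta> [e1, e4] + cid \<xi> [e1, e4] * cid \<eta> [] - 3 * cL 0 \<xi> [] * cL 0 \<eta> []) * thf us
    + (cid \<xi> [] * cid \<eta> std + cid \<xi> std * cid \<eta> [] + 6 * cid \<xi> [e1, e4] * cid \<eta> [e1, e4] + 2 * usum \<xi> \<eta>
      + 3 * (cL 0 \<xi> [] * cL 0 \<eta> (bs 0) + cL 0 \<xi> (bs 0) * cL 0 \<eta> [] + cL 0 \<xi> [b1] * cL 0 \<eta> [b2] - cL 0 \<xi> [b2] * cL 0 \<eta> [b1])) * qf us)"
  have aR: "alt_multilinear R"
    unfolding R_def by (rule alt_invariant_form)
  have "cid (\<xi> \<star> \<eta>) us = R us" if us: "us \<in> set (subseqs std)" for us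
  proof -
  have c: "(\<lambda>us. cid \<zeta> [] * alt_one us + cid \<zeta> [e1, e4] * thf us + cid \<zeta> std * qf us) = cid \<zeta>" if "\<zeta> \<in> H_Ori" for \<zeta>
    by (rule ext) (rule H_Ori_cid[OF that, symmetric])
  have W: "alt_wedge (cid \<xi>) (cid \<eta>) us = cid \<xi> [] * cid \<eta> [] * alt_one us
    + (cid \<xi> [] * cid \<eta> [e1, e4] + cid \<xi> [e1, e4] * cid \<eta> []) * thf us
    + (cid \<xi> [] * cid \<eta> std + cid \<xi> std * cid \<eta> [] + 6 * cid \<xi> [e1, e4] * cid \<eta> [e1, e4]) * qf us"
    using wedge_invariant_forms[OF us, of "cid \<xi> []" "cid \<xi> [e1, e4]" "cid \<xi> std" "cid \<eta> []" "cid \<eta> [e1, e4]" "cid \<eta> std"]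
    unfolding c[OF x] c[OF y] .
  have l: "bs i = [bs i ! 0, bs i ! Suc 0]" for i by (simp add: bs_def)
  have P: "push 0 (alt_wedge (cL 0 \<xi>) (cL 0 \<eta>)) us + push (Suc 0) (alt_wedge (cL (Suc 0) \<xi>) (cL (Suc 0) \<eta>)) us
      + push 2 (alt_wedge (cL 2 \<xi>) (cL 2 \<eta>)) us = - 3 * (cL 0 \<xi> [] * cL 0 \<eta> []) * thf us
      + 3 * (cL 0 \<xi> (bs 0) * cL 0 \<eta> [] + cL 0 \<xi> [b1] * cL 0 \<eta> [b2] - cL 0 \<xi> [b2] * cL 0 \<eta> [b1] + cL 0 \<xi> [] * cL 0 \<eta> (bs 0)) * qf us"
  proof (rule push_sum[where a = "\<lambda>i. alt_wedge (cL i \<xi>) (cL i \<eta>)" and ?l1.0 = "cL 0 \<xi> [b1] * cL 0 \<eta> [] + cL 0 \<xi> [] * cL 0 \<eta> [b1]"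
        and ?l2.0 = "cL 0 \<xi> [b2] * cL 0 \<eta> [] + cL 0 \<xi> [] * cL 0 \<eta> [b2]", OF _ _ _ _ _ us])
    fix i :: nat assume i: "i < 3"
    note V = H_Ori_cL[OF x i] H_Ori_cL[OF y i]
    show "alt_multilinear (alt_wedge (cL i \<xi>) (cL i \<eta>))" by (rule alt_wedge_alt[OF alt_cL[OF i] alt_cL[OF i]])
    show "alt_wedge (cL i \<xi>) (cL i \<eta>) [] = cL 0 \<xi> [] * cL 0 \<eta> []" by (simp add: V)
    show "alt_wedge (cL i \<xi>) (cL i \<eta>) [bs i ! 0] = cL 0 \<xi> [b1] * cL 0 \<eta> [] + cL 0 \<xi> [] * cL 0 \<eta> [b1]"
      by (simp add: alt_wedge_single V)
    show "alt_wedge (cL i \<xi>) (cL i \<eta>) [bs i ! 1] = cL 0 \<xi> [b2] * cL 0 \<eta> [] + cL 0 \<xi> [] * cL 0 \<eta> [b2]"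
      by (simp add: alt_wedge_single V)
    show "alt_wedge (cL i \<xi>) (cL i \<eta>) (bs i) = cL 0 \<xi> (bs 0) * cL 0 \<eta> [] + cL 0 \<xi> [b1] * cL 0 \<eta> [b2] - cL 0 \<xi> [b2] * cL 0 \<eta> [b1] + cL 0 \<xi> [] * cL 0 \<eta> (bs 0)"
      by (subst l) (simp add: alt_wedge_pair V bs0)
  qed
  have u: "(\<Sum>p\<in>F. cpt rot \<xi> p * cpt (rot ^^ 2) \<eta> p) = usum \<xi> \<eta>" "(\<Sum>p\<in>F. cpt (rot ^^ 2) \<xi> p * cpt rot \<eta> p) = usum \<xi> \<eta>"
    using H_OriD(3)[OF x] H_OriD(3)[OF y] by (simp_all cong: sum.cong)
  \<comment> \<open>Only a regrouping of terms, isolated so that all values of forms appear as plain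
    real variables.\<close>
  have arith: "A * o1 + B * t + C * q + S * q + S * q + (- 3 * (l * l') * t + 3 * (m1 + m2 - m3 + m4) * q) =
      A * o1 + (B - 3 * l * l') * t + (C + 2 * S + 3 * (m4 + m1 + m2 - m3)) * q" for A B C S l l' m1 m2 m3 m4 o1 t q :: real
    by algebra
  show ?thesis
    using arith unfolding star_coords(1) u W R_def add.assoc[symmetric] unfolding P add.assoc
    by (simp only: add.assoc[symmetric] P)
  qed
  from std_alt_eqI[OF alt_cid aR this] show ?thesis unfolding R_def .
qed

lemma star_H_cpt:
  assumes x: "\<xi> \<in> H_Ori" and y: "\<eta> \<in> H_Ori" and p: "p \<in> F"
  shows "cpt rot (\<xi> \<star> \<eta>) p = cid \<xi> [] * cpt rot \<eta> p + cpt rot \<xi> p * cid \<eta> [] + 3 * cL 0 \<xi> [] * cL 0 \<eta> []"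
    "cpt (rot ^^ 2) (\<xi> \<star> \<eta>) p = cpt rot (\<xi> \<star> \<eta>) p"
  using H_Ori_cL(1)[OF x, of "Suc 0"] H_Ori_cL(1)[OF x, of 2] H_Ori_cL(1)[OF y, of "Suc 0"] H_Ori_cL(1)[OF y, of 2]
  by (simp_all add: star_coords(2,3)[OF p] H_OriD(3)[OF x p] H_OriD(3)[OF y p])

text \<open>The common value of all \<open>twist\<close> coefficients on invariant classes; the
  factors 2 arise because the two rotation sectors contribute equally.\<close>

definition utwist :: "labelled \<Rightarrow> labelled \<Rightarrow> real" where
  "utwist \<xi> \<eta> = 2 * (\<Sum>p\<in>F. cpt rot \<xi> p) * cL 0 \<eta> [] + 2 * cL 0 \<xi> [] * (\<Sum>p\<in>F. cpt rot \<eta> p)"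

lemma twist_H:
  assumes x: "\<xi> \<in> H_Ori" and y: "\<eta> \<in> H_Ori" and "a < 3" "b < 3" "c < 3" "d < 3"
  shows "twist \<xi> \<eta> a b c d = utwist \<xi> \<eta>"
proof -
  have "(\<Sum>p\<in>F. cpt (rot ^^ 2) \<xi> p) = (\<Sum>p\<in>F. cpt rot \<xi> p)" "(\<Sum>p\<in>F. cpt (rot ^^ 2) \<eta> p) = (\<Sum>p\<in>F. cpt rot \<eta> p)"
    by (rule sum.cong; simp add: H_OriD(3)[OF x] H_OriD(3)[OF y])+
  then show ?thesis
    unfolding twist_def utwist_def sum_distrib_right[symmetric] sum_distrib_left[symmetric]
      H_Ori_cL(1)[OF x assms(5)] H_Ori_cL(1)[OF x assms(6)] H_Ori_cL(1)[OF y assms(3)] H_Ori_cL(1)[OF y assms(4)]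
    by simp
qed

lemma star_H_cL:
  assumes x: "\<xi> \<in> H_Ori" and y: "\<eta> \<in> H_Ori" and us: "us \<in> set (subseqs (bs 0))"
  shows "cL 0 (\<xi> \<star> \<eta>) us = alt_wedge (cid \<xi>) (cL 0 \<eta>) us + alt_wedge (cL 0 \<xi>) (cid \<eta>) us
      + (if length us = 2 then utwist \<xi> \<eta> else 0)"
    "cL (Suc 0) (\<xi> \<star> \<eta>) (map (rot ^^ 2) us) = cL 0 (\<xi> \<star> \<eta>) us"
    "cL 2 (\<xi> \<star> \<eta>) (map rot us) = cL 0 (\<xi> \<star> \<eta>) us"
proof -
  show 0: "cL 0 (\<xi> \<star> \<eta>) us = alt_wedge (cid \<xi>) (cL 0 \<eta>) us + alt_wedge (cL 0 \<xi>) (cid \<eta>) us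
      + (if length us = 2 then utwist \<xi> \<eta> else 0)"
    using star_coords(4)[of 0 2 1 1 2 us \<xi> \<eta>] us twist_H[OF x y, of 2 1 1 2] by simp
  have sp: "set ws \<subseteq> span (set (bs 0))" if "set ws \<subseteq> set us" for ws
    using subseqs_subset_span[OF us] that by blast
  have c2: "cid \<xi> (map (rot ^^ 2) ws) = cid \<xi> ws" if "\<xi> \<in> H_Ori" for \<xi> ws
    using H_OriD(1)[OF that, of "map rot ws"] H_OriD(1)[OF that, of ws] by (simp add: o_def rot_rot2)
  have m1: "map (rot ^^ 2) us \<in> set (subseqs (bs (Suc 0)))" and m2: "map rot us \<in> set (subseqs (bs 2))"
    using us by (simp_all add: bs_rot subseqs_map)
  have "alt_wedge (cid \<xi>) (cL (Suc 0) \<eta>) (map (rot ^^ 2) us) = alt_wedge (cid \<xi>) (cL 0 \<eta>) us"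
    "alt_wedge (cL (Suc 0) \<xi>) (cid \<eta>) (map (rot ^^ 2) us) = alt_wedge (cL 0 \<xi>) (cid \<eta>) us"
    unfolding alt_wedge_map[symmetric]
    by (rule alt_wedge_cong; simp add: c2[OF x] c2[OF y] H_OriD(4)[OF x sp] H_OriD(4)[OF y sp])+
  then show "cL (Suc 0) (\<xi> \<star> \<eta>) (map (rot ^^ 2) us) = cL 0 (\<xi> \<star> \<eta>) us"
    using star_coords(4)[of "Suc 0" 0 2 2 0 "map (rot ^^ 2) us" \<xi> \<eta>] m1 twist_H[OF x y, of 0 2 2 0] 0 by simp
  have "alt_wedge (cid \<xi>) (cL 2 \<eta>) (map rot us) = alt_wedge (cid \<xi>) (cL 0 \<eta>) us"
    "alt_wedge (cL 2 \<xi>) (cid \<eta>) (map rot us) = alt_wedge (cL 0 \<xi>) (cid \<eta>) us"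
    unfolding alt_wedge_map[symmetric]
    by (rule alt_wedge_cong; simp add: H_OriD(1)[OF x] H_OriD(1)[OF y] H_OriD(5)[OF x sp] H_OriD(5)[OF y sp])+
  then show "cL 2 (\<xi> \<star> \<eta>) (map rot us) = cL 0 (\<xi> \<star> \<eta>) us"
    using star_coords(4)[of 2 1 0 0 1 "map rot us" \<xi> \<eta>] m2 twist_H[OF x y, of 1 0 0 1] 0 by simp
qed

lemma star_in_H:
  assumes x: "\<xi> \<in> H_Ori" and y: "\<eta> \<in> H_Ori" shows "\<xi> \<star> \<eta> \<in> H_Ori"
proof (rule H_OriI)
  have one: "alt_one (map g us) = alt_one us" for g us by (simp add: alt_one_def)
  show "cid (\<xi> \<star> \<eta>) (map rot us) = cid (\<xi> \<star> \<eta>) us" "cid (\<xi> \<star> \<eta>) (map (s 0) us) = cid (\<xi> \<star> \<eta>) us" for us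
    unfolding star_H_cid[OF x y] thf_invariant qf_invariant one by (rule HOL.refl)+
qed (rule star_H_cpt(2)[OF x y] star_H_cL(2,3)[OF x y], assumption)+

lemma subseqs_bs0: "set (subseqs (bs 0)) = {[], [b1], [b2], [b1, b2]}"
  by (auto simp: bs0 Let_def)

lemma H_Ori_eqI:
  assumes x: "\<xi> \<in> H_Ori" and y: "\<eta> \<in> H_Ori"
    and "cid \<xi> [] = cid \<eta> []" "cid \<xi> [e1, e4] = cid \<eta> [e1, e4]" "cid \<xi> std = cid \<eta> std"
    and u: "\<And>p. p \<in> F \<Longrightarrow> cpt rot \<xi> p = cpt rot \<eta> p"
    and l: "cL 0 \<xi> [] = cL 0 \<eta> []" "cL 0 \<xi> [b1] = cL 0 \<eta> [b1]" "cL 0 \<xi> [b2] = cL 0 \<eta> [b2]" "cL 0 \<xi> (bs 0) = cL 0 \<eta> (bs 0)"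
  shows "\<xi> = \<eta>"
proof (rule labelled_eqI)
  show "cid \<xi> us = cid \<eta> us" for us by (subst H_Ori_cid[OF x], subst H_Ori_cid[OF y]) (simp add: assms)
  show "cpt rot \<xi> p = cpt rot \<eta> p" "cpt (rot ^^ 2) \<xi> p = cpt (rot ^^ 2) \<eta> p" if "p \<in> F" for p
    using that by (simp_all add: u H_OriD(3)[OF x] H_OriD(3)[OF y])
  have c0: "cL 0 \<xi> us = cL 0 \<eta> us" if "us \<in> set (subseqs (bs 0))" for us
    using that l unfolding subseqs_bs0 by (auto simp: bs0)
  show "cL i \<xi> us = cL i \<eta> us" if i: "i < 3" and us: "us \<in> set (subseqs (bs i))" for i us
    using less3_cases[OF i]
  proof (elim disjE)
    assume "i = 0"
    then show ?thesis using c0 us by simp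
  next
    assume "i = Suc 0"
    then obtain ws where ws: "us = map (rot ^^ 2) ws" "ws \<in> set (subseqs (bs 0))" using us by (auto simp: bs_rot subseqs_map)
    note sp = subseqs_subset_span[OF ws(2)]
    show ?thesis using H_OriD(4)[OF x sp] H_OriD(4)[OF y sp] c0[OF ws(2)] by (simp add: \<open>i = Suc 0\<close> ws(1))
  next
    assume "i = 2"
    then obtain ws where ws: "us = map rot ws" "ws \<in> set (subseqs (bs 0))" using us by (auto simp: bs_rot subseqs_map)
    note sp = subseqs_subset_span[OF ws(2)]
    show ?thesis using H_OriD(5)[OF x sp] H_OriD(5)[OF y sp] c0[OF ws(2)] by (simp add: \<open>i = 2\<close> ws(1))
  qed
qed

lemma star_H_values:
  assumes x: "\<xi> \<in> H_Ori" and y: "\<eta> \<in> H_Ori"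
  shows "cid (\<xi> \<star> \<eta>) [] = cid \<xi> [] * cid \<eta> []"
    "cid (\<xi> \<star> \<eta>) [e1, e4] = cid \<xi> [] * cid \<eta> [e1, e4] + cid \<xi> [e1, e4] * cid \<eta> [] - 3 * cL 0 \<xi> [] * cL 0 \<eta> []"
    "cid (\<xi> \<star> \<eta>) std = cid \<xi> [] * cid \<eta> std + cid \<xi> std * cid \<eta> [] + 6 * cid \<xi> [e1, e4] * cid \<eta> [e1, e4] + 2 * usum \<xi> \<eta>
      + 3 * (cL 0 \<xi> [] * cL 0 \<eta> (bs 0) + cL 0 \<xi> (bs 0) * cL 0 \<eta> [] + cL 0 \<xi> [b1] * cL 0 \<eta> [b2] - cL 0 \<xi> [b2] * cL 0 \<eta> [b1])"
    "cL 0 (\<xi> \<star> \<eta>) [] = cid \<xi> [] * cL 0 \<eta> [] + cL 0 \<xi> [] * cid \<eta> []"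
    "cL 0 (\<xi> \<star> \<eta>) [b1] = cid \<xi> [] * cL 0 \<eta> [b1] + cL 0 \<xi> [b1] * cid \<eta> []"
    "cL 0 (\<xi> \<star> \<eta>) [b2] = cid \<xi> [] * cL 0 \<eta> [b2] + cL 0 \<xi> [b2] * cid \<eta> []"
    "cL 0 (\<xi> \<star> \<eta>) (bs 0) = cid \<xi> [] * cL 0 \<eta> (bs 0) + cL 0 \<xi> (bs 0) * cid \<eta> []
       - 6 * (cid \<xi> [e1, e4] * cL 0 \<eta> [] + cL 0 \<xi> [] * cid \<eta> [e1, e4]) + utwist \<xi> \<eta>"
proof -
  have v: "alt_one [] = 1" "alt_one [e1, e4] = 0" "alt_one std = 0" "thf [e1, e4] = 1" "thf std = 0" "qf [e1, e4] = 0"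
    "thf [] = 0" "qf [] = 0" "qf std = 1"
    using qf_std by (simp_all add: alt_one_def thf_values std_def qf_degree)
  show "cid (\<xi> \<star> \<eta>) [] = cid \<xi> [] * cid \<eta> []"
    "cid (\<xi> \<star> \<eta>) [e1, e4] = cid \<xi> [] * cid \<eta> [e1, e4] + cid \<xi> [e1, e4] * cid \<eta> [] - 3 * cL 0 \<xi> [] * cL 0 \<eta> []"
    "cid (\<xi> \<star> \<eta>) std = cid \<xi> [] * cid \<eta> std + cid \<xi> std * cid \<eta> [] + 6 * cid \<xi> [e1, e4] * cid \<eta> [e1, e4] + 2 * usum \<xi> \<eta>
      + 3 * (cL 0 \<xi> [] * cL 0 \<eta> (bs 0) + cL 0 \<xi> (bs 0) * cL 0 \<eta> [] + cL 0 \<xi> [b1] * cL 0 \<eta> [b2] - cL 0 \<xi> [b2] * cL 0 \<eta> [b1])"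
    by (simp_all only: star_H_cid[OF x y] v) simp_all
  \<comment> \<open>The invariant two-form \<Theta> evaluates to -6 on the frame of
    \<open>L 0\<close>; this is the constant in the product of \<Theta> and
    \<open>E\<close>.\<close>
  have w: "cid \<zeta> [v] = 0" "cid \<zeta> [b1, b2] = - 6 * cid \<zeta> [e1, e4]" if "\<zeta> \<in> H_Ori" for \<zeta> v
    by (subst H_Ori_cid[OF that], simp add: alt_one_def thf_values qf_degree)+
  show "cL 0 (\<xi> \<star> \<eta>) [] = cid \<xi> [] * cL 0 \<eta> [] + cL 0 \<xi> [] * cid \<eta> []"
    "cL 0 (\<xi> \<star> \<eta>) [b1] = cid \<xi> [] * cL 0 \<eta> [b1] + cL 0 \<xi> [b1] * cid \<eta> []"
    "cL 0 (\<xi> \<star> \<eta>) [b2] = cid \<xi> [] * cL 0 \<eta> [b2] + cL 0 \<xi> [b2] * cid \<eta> []"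
    "cL 0 (\<xi> \<star> \<eta>) (bs 0) = cid \<xi> [] * cL 0 \<eta> (bs 0) + cL 0 \<xi> (bs 0) * cid \<eta> []
       - 6 * (cid \<xi> [e1, e4] * cL 0 \<eta> [] + cL 0 \<xi> [] * cid \<eta> [e1, e4]) + utwist \<xi> \<eta>"
    using star_H_cL(1)[OF x y, of "[]"] star_H_cL(1)[OF x y, of "[b1]"] star_H_cL(1)[OF x y, of "[b2]"] star_H_cL(1)[OF x y, of "[b1, b2]"]
    by (simp_all add: subseqs_bs0 bs0 alt_wedge_single alt_wedge_pair w[OF x] w[OF y])
qed

subsection \<open>Linearity of the coordinates\<close>

text \<open>On vectors outside the tangent plane \<open>cL\<close> may depend on the representative.
  This predicate marks the lists on which it is a linear functional of the class.\<close>

definition inner_list :: "nat \<Rightarrow> vec list \<Rightarrow> bool" where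
  "inner_list i us \<longleftrightarrow> i < 3 \<and> set us \<subseteq> span (set (bs i))"

lemma linear_coordinates:
  "linear (\<lambda>\<xi>. cid \<xi> us)" "p \<in> F \<Longrightarrow> linear (\<lambda>\<xi>. cpt rot \<xi> p)" "p \<in> F \<Longrightarrow> linear (\<lambda>\<xi>. cpt (rot ^^ 2) \<xi> p)"
  "inner_list i us \<Longrightarrow> linear (\<lambda>\<xi>. cL i \<xi> us)"
proof -
  have L: "linear f" if "\<And>a b \<xi> \<eta>. f (a *\<^sub>R \<xi> + b *\<^sub>R \<eta>) = a * f \<xi> + b * f \<eta>" for f :: "labelled \<Rightarrow> real"
  proof (rule linearI)
    show "f (x + y) = f x + f y" for x y using that[of 1 x 1 y] by simp
    show "f (r *\<^sub>R x) = r *\<^sub>R f x" for r x using that[of r x 0 0] by simp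
  qed
  show "linear (\<lambda>\<xi>. cid \<xi> us)" by (rule L) (rule coords_lincomb)
  show "linear (\<lambda>\<xi>. cpt rot \<xi> p)" if "p \<in> F" by (rule L) (rule coords_lincomb(2)[OF that])
  show "linear (\<lambda>\<xi>. cpt (rot ^^ 2) \<xi> p)" if "p \<in> F" by (rule L) (rule coords_lincomb(3)[OF that])
  show "linear (\<lambda>\<xi>. cL i \<xi> us)" if "inner_list i us"
    using that unfolding inner_list_def by (intro L coords_lincomb(4)) auto
qed

lemma inner_list_subseqs: "us \<in> set (subseqs (bs i)) \<Longrightarrow> i < 3 \<Longrightarrow> inner_list i us"
  by (simp add: inner_list_def subseqs_subset_span)

lemma inner_list_cases:
  "us \<in> set (subseqs (bs 0)) \<Longrightarrow> inner_list 0 us"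
  "us \<in> set (subseqs (bs 0)) \<Longrightarrow> inner_list (Suc 0) (map (rot ^^ 2) us)"
  "us \<in> set (subseqs (bs 0)) \<Longrightarrow> inner_list 2 (map rot us)"
  by (rule inner_list_subseqs; simp add: bs_rot subseqs_map)+

lemma inner_list_0: "inner_list 0 []" "inner_list 0 [b1]" "inner_list 0 [b2]" "inner_list 0 (bs 0)" "inner_list 0 [b1, b2]"
  by (rule inner_list_cases; simp add: subseqs_bs0 bs0)+

lemma H_Ori_subspace: "subspace H_Ori"
proof -
  have z: "f 0 = 0" if "linear f" for f :: "labelled \<Rightarrow> real" by (rule linear_0[OF that])
  note L = linear_coordinates(1) linear_coordinates(2) linear_coordinates(3) linear_coordinates(4)
  show ?thesis
  proof (rule subspaceI)
    show "0 \<in> H_Ori"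
      by (rule H_OriI) (simp_all add: z[OF L(1)] z[OF L(2)] z[OF L(3)] z[OF L(4)] inner_list_cases)
    show "x + y \<in> H_Ori" if x: "x \<in> H_Ori" and y: "y \<in> H_Ori" for x y
      by (rule H_OriI) (simp_all add: linear_add[OF L(1)] linear_add[OF L(2)] linear_add[OF L(3)] linear_add[OF L(4)] inner_list_cases
          H_OriD[OF x] H_OriD[OF y] subseqs_subset_span)
    show "c *\<^sub>R x \<in> H_Ori" if x: "x \<in> H_Ori" for c x
      by (rule H_OriI) (simp_all add: linear_cmul[OF L(1)] linear_cmul[OF L(2)] linear_cmul[OF L(3)] linear_cmul[OF L(4)] inner_list_cases
          H_OriD[OF x] subseqs_subset_span)
  qed
qed

section \<open>The named classes in coordinates\<close>

lemma cid_linear [simp]: "cid (\<xi> + \<eta>) us = cid \<xi> us + cid \<eta> us" "cid (\<xi> - \<eta>) us = cid \<xi> us - cid \<eta> us"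
  "cid (c *\<^sub>R \<xi>) us = c * cid \<xi> us" "cid 0 us = 0" "cid (\<Sum>i\<in>I. f i) us = (\<Sum>i\<in>I. cid (f i) us)"
  using linear_add[OF linear_coordinates(1)] linear_diff[OF linear_coordinates(1)] linear_cmul[OF linear_coordinates(1)]
    linear_0[OF linear_coordinates(1)] linear_sum[OF linear_coordinates(1)] by simp_all

lemma cpt_linear [simp]:
  assumes "p \<in> F"
  shows "cpt rot (\<xi> + \<eta>) p = cpt rot \<xi> p + cpt rot \<eta> p" "cpt rot (\<xi> - \<eta>) p = cpt rot \<xi> p - cpt rot \<eta> p"
  "cpt rot (c *\<^sub>R \<xi>) p = c * cpt rot \<xi> p" "cpt rot 0 p = 0" "cpt rot (\<Sum>i\<in>I. f i) p = (\<Sum>i\<in>I. cpt rot (f i) p)"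
  using linear_add[OF linear_coordinates(2)[OF assms]] linear_diff[OF linear_coordinates(2)[OF assms]] linear_cmul[OF linear_coordinates(2)[OF assms]]
    linear_0[OF linear_coordinates(2)[OF assms]] linear_sum[OF linear_coordinates(2)[OF assms]] by simp_all

lemma cpt2_linear [simp]:
  assumes "p \<in> F"
  shows "cpt (rot ^^ 2) (\<xi> + \<eta>) p = cpt (rot ^^ 2) \<xi> p + cpt (rot ^^ 2) \<eta> p"
    "cpt (rot ^^ 2) (\<xi> - \<eta>) p = cpt (rot ^^ 2) \<xi> p - cpt (rot ^^ 2) \<eta> p"
    "cpt (rot ^^ 2) (c *\<^sub>R \<xi>) p = c * cpt (rot ^^ 2) \<xi> p"
  using linear_diff[OF linear_coordinates(3)[OF assms]] linear_add[OF linear_coordinates(3)[OF assms]] linear_cmul[OF linear_coordinates(3)[OF assms]] by simp_all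

lemma cL_linear [simp]:
  assumes "inner_list i us"
  shows "cL i (\<xi> + \<eta>) us = cL i \<xi> us + cL i \<eta> us" "cL i (\<xi> - \<eta>) us = cL i \<xi> us - cL i \<eta> us"
  "cL i (c *\<^sub>R \<xi>) us = c * cL i \<xi> us" "cL i 0 us = 0" "cL i (\<Sum>j\<in>I. f j) us = (\<Sum>j\<in>I. cL i (f j) us)"
  using linear_add[OF linear_coordinates(4)[OF assms]] linear_diff[OF linear_coordinates(4)[OF assms]] linear_cmul[OF linear_coordinates(4)[OF assms]]
    linear_0[OF linear_coordinates(4)[OF assms]] linear_sum[OF linear_coordinates(4)[OF assms]] by simp_all

lemmas [simp] = inner_list_0

lemma inner_listD: "inner_list i us \<Longrightarrow> i < 3" "inner_list i us \<Longrightarrow> set us \<subseteq> span (set (bs i))"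
  by (simp_all add: inner_list_def)

lemma s_neq: "i < 3 \<Longrightarrow> id \<noteq> s i" "i < 3 \<Longrightarrow> rot \<noteq> s i" "i < 3 \<Longrightarrow> rot ^^ 2 \<noteq> s i"
  using less3_cases[of i] by (auto simp del: id_apply)

lemma id_sector_coords:
  assumes "alt_multilinear a"
  shows "cid (in_sector id (\<lambda>z. a)) us = a us" "p \<in> F \<Longrightarrow> cpt rot (in_sector id (\<lambda>z. a)) p = 0"
    "p \<in> F \<Longrightarrow> cpt (rot ^^ 2) (in_sector id (\<lambda>z. a)) p = 0" "inner_list i us \<Longrightarrow> cL i (in_sector id (\<lambda>z. a)) us = 0"
proof -
  note C = coords_in_sector[OF Ghat_elts(1) closed_on_const[OF assms]]
  show "cid (in_sector id (\<lambda>z. a)) us = a us" by (simp add: C(1) del: id_apply)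
  show "cpt rot (in_sector id (\<lambda>z. a)) p = 0" "cpt (rot ^^ 2) (in_sector id (\<lambda>z. a)) p = 0" if "p \<in> F"
    by (simp_all add: C(2,3)[OF that] del: id_apply)
  show "cL i (in_sector id (\<lambda>z. a)) us = 0" if "inner_list i us"
    using s_neq(1)[OF inner_listD(1)[OF that]] by (simp add: C(4)[OF inner_listD[OF that]] del: id_apply)
qed

lemma id_sector_in_H:
  assumes "\<And>us. cid \<xi> (map rot us) = cid \<xi> us" "\<And>us. cid \<xi> (map (s 0) us) = cid \<xi> us"
    "\<And>p. p \<in> F \<Longrightarrow> cpt rot \<xi> p = 0" "\<And>p. p \<in> F \<Longrightarrow> cpt (rot ^^ 2) \<xi> p = 0"
    "\<And>i us. inner_list i us \<Longrightarrow> cL i \<xi> us = 0"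
  shows "\<xi> \<in> H_Ori"
  by (rule H_OriI) (simp_all add: assms inner_list_cases)

lemma unit_eq: "unit_cls = in_sector id (\<lambda>z. alt_one)"
  by (simp only: unit_cls_def one_form_eq)

lemma dx_eq: "dx1 = (\<lambda>z. cov X1)" "dy1 = (\<lambda>z. cov Y1)" "dx2 = (\<lambda>z. cov X2)" "dy2 = (\<lambda>z. cov Y2)"
  by (simp_all add: dx1_def dy1_def dx2_def dy2_def covec_eq_cov X1_def[abs_def] Y1_def[abs_def] X2_def[abs_def] Y2_def[abs_def])

lemma q_eq: "q_cls = in_sector id (\<lambda>z. qf)"
  by (simp only: q_cls_def dx_eq wedge_def qf_def)

lemma Theta_eq: "Theta_cls = (-2) *\<^sub>R in_sector id (\<lambda>z. alt_wedge (cov X1) (cov X2)) + in_sector id (\<lambda>z. alt_wedge (cov X1) (cov Y2))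
     + in_sector id (\<lambda>z. alt_wedge (cov Y1) (cov X2)) + in_sector id (\<lambda>z. alt_wedge (cov Y1) (cov Y2))"
  by (simp only: Theta_cls_def dx_eq wedge_def)

lemma alt_cov_pair: "alt_multilinear (alt_wedge (cov X1) (cov X2))" "alt_multilinear (alt_wedge (cov X1) (cov Y2))"
  "alt_multilinear (alt_wedge (cov Y1) (cov X2))" "alt_multilinear (alt_wedge (cov Y1) (cov Y2))"
  by (simp_all add: alt_wedge_alt alt_cov linear_coords)

lemma unit_coords: "cid unit_cls us = alt_one us" "p \<in> F \<Longrightarrow> cpt rot unit_cls p = 0" "p \<in> F \<Longrightarrow> cpt (rot ^^ 2) unit_cls p = 0"
    "inner_list i us \<Longrightarrow> cL i unit_cls us = 0"
  unfolding unit_eq by (simp_all add: id_sector_coords)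

lemma q_coords: "cid q_cls us = qf us" "p \<in> F \<Longrightarrow> cpt rot q_cls p = 0" "p \<in> F \<Longrightarrow> cpt (rot ^^ 2) q_cls p = 0"
    "inner_list i us \<Longrightarrow> cL i q_cls us = 0"
  unfolding q_eq by (simp_all add: id_sector_coords alt_qf)

lemma Theta_coords: "cid Theta_cls us = thf us" "p \<in> F \<Longrightarrow> cpt rot Theta_cls p = 0" "p \<in> F \<Longrightarrow> cpt (rot ^^ 2) Theta_cls p = 0"
    "inner_list i us \<Longrightarrow> cL i Theta_cls us = 0"
  unfolding Theta_eq by (simp_all add: id_sector_coords alt_cov_pair thf_def)

lemma unit_in_H: "unit_cls \<in> H_Ori"
  by (rule id_sector_in_H) (simp_all add: unit_coords alt_one_def)

lemma q_in_H: "q_cls \<in> H_Ori"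
  by (rule id_sector_in_H) (simp_all add: q_coords qf_invariant)

lemma Theta_in_H: "Theta_cls \<in> H_Ori"
  by (rule id_sector_in_H) (simp_all add: Theta_coords thf_invariant)

lemma U_coords:
  assumes p: "p \<in> F"
  shows "cid (U_cls p) us = 0" "p' \<in> F \<Longrightarrow> cpt rot (U_cls p) p' = (if p' = p then 1 else 0)"
    "p' \<in> F \<Longrightarrow> cpt (rot ^^ 2) (U_cls p) p' = (if p' = p then 1 else 0)" "inner_list i us \<Longrightarrow> cL i (U_cls p) us = 0"
proof -
  have c1: "closed_on (Fix rot) (point_fun p)" using closed_on_F[OF point_fun(1)[OF p]] by (simp add: F_def)
  have c2: "closed_on (Fix (rot ^^ 2)) (point_fun p)" using closed_on_F[OF point_fun(1)[OF p]] by (simp add: Fix_rot2)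
  have e: "U_cls p = in_sector rot (point_fun p) + in_sector (rot ^^ 2) (point_fun p)"
    by (simp add: U_cls_def u_cls_def)
  note C = coords_in_sector[OF Ghat_elts(2) c1] coords_in_sector[OF Ghat_elts(3) c2]
  show "cid (U_cls p) us = 0" by (simp add: e C del: id_apply)
  show "cpt rot (U_cls p) p' = (if p' = p then 1 else 0)" "cpt (rot ^^ 2) (U_cls p) p' = (if p' = p then 1 else 0)" if "p' \<in> F"
    using that by (simp_all add: e C point_fun(3)[OF p])
  show "cL i (U_cls p) us = 0" if "inner_list i us"
    using that C(4,8)[OF inner_listD[OF that]] s_neq[OF inner_listD(1)[OF that]] by (simp add: e)
qed

lemma U_in_H: "p \<in> F \<Longrightarrow> U_cls p \<in> H_Ori"
  by (rule H_OriI) (simp_all add: U_coords inner_list_cases)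

lemma rot_pow4: "rot ^^ (2 * 2) = rot"
  by (rule mk_ext) (simp add: numeral_eq_Suc rot_mk)

lemma to_L_eqs: "to_L 0 c = c" "to_L (Suc 0) c = pullback rot c" "to_L 2 c = pullback (rot ^^ 2) c"
proof -
  have "rot ^^ (2 * 0) = id" "rot ^^ (2 * Suc 0) = rot ^^ 2" by (simp_all add: id_def)
  then show "to_L (Suc 0) c = pullback rot c" "to_L 0 c = c" unfolding to_L_def transport_def
    by (simp_all only: inv_elts) (simp add: pullback_def)
  show "to_L 2 c = pullback (rot ^^ 2) c" unfolding to_L_def transport_def rot_pow4 inv_elts ..
qed

lemma sum3: "(\<Sum>i<3. f i) = f 0 + f (Suc 0) + f (2 :: nat)" for f :: "nat \<Rightarrow> labelled"
  by (simp add: numeral_3_eq_3 numeral_2_eq_2)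

lemma orbit_eq: "orbit_cls c = in_sector (s 0) c + in_sector (s (Suc 0)) (pullback rot c) + in_sector (s 2) (pullback (rot ^^ 2) c)"
  unfolding orbit_cls_def sum3 to_L_eqs ..

lemma orbit_closed:
  assumes "closed_on (L 0) c"
  shows "closed_on (Fix (s 0)) c" "closed_on (Fix (s (Suc 0))) (pullback rot c)" "closed_on (Fix (s 2)) (pullback (rot ^^ 2) c)"
proof -
  show c: "closed_on (Fix (s 0)) c" using assms by (simp add: L_simps)
  have e: "rot \<circ> s (Suc 0) \<circ> rot ^^ 2 = s 0" by (simp only: comp_table)
  show "closed_on (Fix (s (Suc 0))) (pullback rot c)"
    using pullback_closed[OF Ghat_elts(3,5), unfolded inv_elts e, OF c] .
  show "closed_on (Fix (s 2)) (pullback (rot ^^ 2) c)"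
    using pullback_closed[OF Ghat_elts(2,6), unfolded inv_elts H_Ori_conj, OF c] .
qed

text \<open>The rotation along which \<open>c\<close> is pulled back to \<open>L i\<close> also
  carries the frame of \<open>L i\<close> to that of \<open>L 0\<close>, so the average is the same
  in all three sectors.\<close>

lemma orbit_coords:
  assumes c: "closed_on (L 0) c"
  shows "cid (orbit_cls c) us = 0" "p \<in> F \<Longrightarrow> cpt rot (orbit_cls c) p = 0" "p \<in> F \<Longrightarrow> cpt (rot ^^ 2) (orbit_cls c) p = 0"
    "inner_list 0 us \<Longrightarrow> cL 0 (orbit_cls c) us = avg (bs 0) c us"
    "us \<in> set (subseqs (bs 0)) \<Longrightarrow> cL (Suc 0) (orbit_cls c) (map (rot ^^ 2) us) = avg (bs 0) c us"
    "us \<in> set (subseqs (bs 0)) \<Longrightarrow> cL 2 (orbit_cls c) (map rot us) = avg (bs 0) c us"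
proof -
  note oc = orbit_closed[OF c]
  note C = coords_in_sector[OF Ghat_elts(4) oc(1)] coords_in_sector[OF Ghat_elts(5) oc(2)] coords_in_sector[OF Ghat_elts(6) oc(3)]
  show "cid (orbit_cls c) us = 0" by (simp add: orbit_eq C del: id_apply)
  show "cpt rot (orbit_cls c) p = 0" "cpt (rot ^^ 2) (orbit_cls c) p = 0" if "p \<in> F"
    using that by (simp_all add: orbit_eq C)
  show "cL 0 (orbit_cls c) us = avg (bs 0) c us" if "inner_list 0 us"
    using that C(4,8,12)[OF inner_listD[OF that]] by (simp add: orbit_eq)
  have r: "map rot (map rot (bs 2)) = bs 0" "map rot (bs (Suc 0)) = bs 0" "map (rot ^^ 2) (bs 2) = bs 0"
    by (simp_all add: bs_explicit rot_mk rot2_mk)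
  show "cL (Suc 0) (orbit_cls c) (map (rot ^^ 2) us) = avg (bs 0) c us" if us: "us \<in> set (subseqs (bs 0))"
  proof -
    note i = inner_list_cases(2)[OF us]
    have "cL (Suc 0) (orbit_cls c) (map (rot ^^ 2) us) = avg (bs (Suc 0)) (pullback rot c) (map (rot ^^ 2) us)"
      using i C(4,8,12)[OF inner_listD[OF i]] by (simp add: orbit_eq)
    also have "\<dots> = avg (bs 0) c us"
      unfolding avg_pullback[OF linear_rot] r by (simp add: o_def rot_rot2)
    finally show ?thesis .
  qed
  show "cL 2 (orbit_cls c) (map rot us) = avg (bs 0) c us" if us: "us \<in> set (subseqs (bs 0))"
  proof -
    note i = inner_list_cases(3)[OF us]
    have "cL 2 (orbit_cls c) (map rot us) = avg (bs 2) (pullback (rot ^^ 2) c) (map rot us)"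
      using i C(4,8,12)[OF inner_listD[OF i]] by (simp add: orbit_eq)
    also have "\<dots> = avg (bs 0) c us"
      unfolding avg_pullback[OF linear_rot_pow] r by (simp add: o_def rot_rot2)
    finally show ?thesis .
  qed
qed

lemma orbit_in_H: "closed_on (L 0) c \<Longrightarrow> orbit_cls c \<in> H_Ori"
  by (rule H_OriI) (simp_all add: orbit_coords inner_list_cases)

lemma to_L_one: "i < 3 \<Longrightarrow> to_L i one_form = one_form"
  by (simp add: to_L_def transport_def pullback_def one_form_def)

lemma to_L_wedge: "to_L i (a \<wedge> b) = to_L i a \<wedge> to_L i b"
  unfolding to_L_def transport_def pullback_def wedge_def by (intro ext) (rule alt_wedge_map[symmetric])

lemma E_eq: "E_cls = orbit_cls one_form"
  by (simp add: E_cls_def e_cls_def orbit_cls_def to_L_one)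

lemma T_eq: "T_cls a b = orbit_cls (a \<wedge> b)"
  by (simp add: T_cls_def orbit_cls_def to_L_wedge)

lemma closed_one: "closed_on M one_form"
  unfolding one_form_eq by (rule closed_on_const[OF alt_alt_one])

lemmas E_in_H = orbit_in_H[OF closed_one, folded E_eq]
lemmas E_coords' = orbit_coords[OF closed_one, folded E_eq]

lemma E_coords: "cid E_cls us = 0" "p \<in> F \<Longrightarrow> cpt rot E_cls p = 0" "inner_list 0 us \<Longrightarrow> cL 0 E_cls us = alt_one us"
  using E_coords' by (simp_all add: one_form_eq)

section \<open>Degrees\<close>

lemma shift_values: "shift id = 0" "shift rot = 2" "shift (rot ^^ 2) = 2" "i < 3 \<Longrightarrow> shift (s i) = 1"
  using s_not_Geven[of i] s_neq(1)[of i] by (auto simp: shift_def Geven_eq simp del: id_apply)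

lemma homogeneous_zero: "homogeneous k zero_form"
  by (simp add: homogeneous_def zero_form_def)

lemma in_sector_Hdeg:
  assumes g: "g \<in> Ghat" and c: "closed_on (Fix g) \<alpha>" and h: "shift g \<le> k" "homogeneous (k - shift g) \<alpha>"
  shows "in_sector g \<alpha> \<in> Hdeg k"
  unfolding in_sector_def Hdeg_def
proof (intro CollectI exI conjI ballI)
  show "sector_equiv (\<lambda>h. if h = g then \<alpha> else zero_form) (\<lambda>h. if h = g then \<alpha> else zero_form)"
    using c closed_on_zero by (simp add: sector_equiv_self)
qed (use h homogeneous_zero in \<open>auto simp del: id_apply\<close>)

lemma Hdeg_lincomb:
  assumes "\<xi> \<in> Hdeg k" "\<eta> \<in> Hdeg k" shows "a *\<^sub>R \<xi> + b *\<^sub>R \<eta> \<in> Hdeg k"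
proof -
  obtain \<phi> where \<phi>: "\<xi> = abs_labelled \<phi>" "sector_equiv \<phi> \<phi>"
    "\<And>g. g \<in> Ghat \<Longrightarrow> if shift g \<le> k then homogeneous (k - shift g) (\<phi> g) else \<phi> g = zero_form"
    using assms(1) unfolding Hdeg_def by blast
  obtain \<psi> where \<psi>: "\<eta> = abs_labelled \<psi>" "sector_equiv \<psi> \<psi>"
    "\<And>g. g \<in> Ghat \<Longrightarrow> if shift g \<le> k then homogeneous (k - shift g) (\<psi> g) else \<psi> g = zero_form"
    using assms(2) unfolding Hdeg_def by blast
  have s1: "sector_equiv (\<lambda>g z us. c * \<phi> g z us) (\<lambda>g z us. c * \<phi> g z us)" if "sector_equiv \<phi> \<phi>" for c \<phi>
    using that closed_on_lincomb[of _ "\<phi> g" "\<phi> g" c 0 for g] by (simp add: sector_equiv_self)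
  have e: "a *\<^sub>R \<xi> + b *\<^sub>R \<eta> = abs_labelled (\<lambda>g z us. a * \<phi> g z us + b * \<psi> g z us)"
    unfolding \<phi>(1) \<psi>(1) scaleR_labelled.abs_eq[OF \<phi>(2)] scaleR_labelled.abs_eq[OF \<psi>(2)]
    by (rule plus_labelled.abs_eq[OF s1[OF \<phi>(2)] s1[OF \<psi>(2)]])
  show ?thesis
    unfolding e Hdeg_def
  proof (intro CollectI exI conjI ballI)
    show "sector_equiv (\<lambda>g z us. a * \<phi> g z us + b * \<psi> g z us) (\<lambda>g z us. a * \<phi> g z us + b * \<psi> g z us)"
      using \<phi>(2) \<psi>(2) by (simp add: sector_equiv_self closed_on_lincomb)
    fix g assume "g \<in> Ghat"
    then show "if shift g \<le> k then homogeneous (k - shift g) (\<lambda>z us. a * \<phi> g z us + b * \<psi> g z us)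
      else (\<lambda>z us. a * \<phi> g z us + b * \<psi> g z us) = zero_form"
      using \<phi>(3)[of g] \<psi>(3)[of g] by (auto simp: homogeneous_def zero_form_def split: if_splits)
  qed simp
qed

lemma Hdeg_add: "\<xi> \<in> Hdeg k \<Longrightarrow> \<eta> \<in> Hdeg k \<Longrightarrow> \<xi> + \<eta> \<in> Hdeg k"
  and Hdeg_scale: "\<xi> \<in> Hdeg k \<Longrightarrow> a *\<^sub>R \<xi> \<in> Hdeg k"
  using Hdeg_lincomb[of \<xi> k \<eta> 1 1] Hdeg_lincomb[of \<xi> k \<xi> a 0] by simp_all

lemma avg_homogeneous: "homogeneous k \<alpha> \<Longrightarrow> length us \<noteq> k \<Longrightarrow> avg cs \<alpha> us = 0"
  by (simp add: homogeneous_def avg_def cavg_def)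

lemma avg_zero_form: "avg cs zero_form us = 0"
  by (simp add: zero_form_def avg_def cavg_def)

text \<open>Degree enters the computations only in this form, as a pattern of vanishing
  coordinates.\<close>

lemma Hdeg_coords:
  assumes "\<xi> \<in> Hdeg k"
  shows "length us \<noteq> k \<Longrightarrow> cid \<xi> us = 0" "p \<in> F \<Longrightarrow> k \<noteq> 2 \<Longrightarrow> cpt rot \<xi> p = 0"
    "inner_list 0 us \<Longrightarrow> Suc (length us) \<noteq> k \<Longrightarrow> cL 0 \<xi> us = 0"
proof -
  obtain \<phi> where \<phi>: "\<xi> = abs_labelled \<phi>" "sector_equiv \<phi> \<phi>"
    "\<And>g. g \<in> Ghat \<Longrightarrow> if shift g \<le> k then homogeneous (k - shift g) (\<phi> g) else \<phi> g = zero_form"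
    using assms(1) unfolding Hdeg_def by blast
  have c: "closed_on (Fix g) (\<phi> g)" if "g \<in> Ghat" for g using \<phi>(2) that by (simp add: sector_equiv_self)
  note C = coords_abs[of \<phi>, folded \<phi>(1)]
  have h: "homogeneous k (\<phi> id)" using \<phi>(3)[OF Ghat_elts(1)] by (simp add: shift_values del: id_apply)
  show "cid \<xi> us = 0" if "length us \<noteq> k"
    using C(1)[OF c] avg_homogeneous[OF h that] by simp
  show "cpt rot \<xi> p = 0" if "p \<in> F" "k \<noteq> 2"
    using C(2)[OF c that(1)] \<phi>(3)[OF Ghat_elts(2)] that(2)
    by (auto simp: shift_values val_def zero_form_def homogeneous_def split: if_splits)
  show "cL 0 \<xi> us = 0" if "inner_list 0 us" "Suc (length us) \<noteq> k"
    using C(4)[OF c inner_listD[OF that(1)]] \<phi>(3)[OF Ghat_elts(4)] that(2) avg_homogeneous[of "k - 1" "\<phi> (s 0)" us "bs 0"]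
    by (auto simp: shift_values avg_zero_form split: if_splits)
qed

lemma homogeneous_pullback: "homogeneous k \<alpha> \<Longrightarrow> homogeneous k (pullback g \<alpha>)"
  by (simp add: homogeneous_def pullback_def)

lemma orbit_Hdeg: "closed_on (L 0) c \<Longrightarrow> homogeneous k c \<Longrightarrow> orbit_cls c \<in> Hdeg (Suc k)"
  unfolding orbit_eq
  by (intro Hdeg_add in_sector_Hdeg orbit_closed Ghat_elts) (simp_all add: shift_values homogeneous_pullback)

lemma alt_wedge_degree:
  assumes "\<And>us. length us \<noteq> i \<Longrightarrow> a us = 0" "\<And>us. length us \<noteq> j \<Longrightarrow> b us = 0" "length us \<noteq> i + j"
  shows "alt_wedge a b us = 0"
  using assms
proof (induction us arbitrary: a b i j)
  case Nil
  then show ?case by (cases "i = 0") auto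
next
  case (Cons v us)
  have "alt_wedge (ins v a) b us = 0"
  proof (cases i)
    case 0
    then have "ins v a = (\<lambda>us. 0)" using Cons.prems(1) by (simp add: ins_def)
    then show ?thesis by simp
  next
    case (Suc i')
    show ?thesis by (rule Cons.IH[of i' _ j]) (use Cons.prems Suc in \<open>simp_all add: ins_app\<close>)
  qed
  moreover have "alt_wedge (grade a) (ins v b) us = 0"
  proof (cases j)
    case 0
    then have "ins v b = (\<lambda>us. 0)" using Cons.prems(2) by (simp add: ins_def)
    then show ?thesis by simp
  next
    case (Suc j')
    show ?thesis by (rule Cons.IH[of i _ j']) (use Cons.prems Suc in \<open>simp_all add: ins_app grade_def\<close>)
  qed
  ultimately show ?case by (simp add: alt_wedge_Cons)
qed

lemma homogeneous_wedge: "homogeneous i \<alpha> \<Longrightarrow> homogeneous j \<beta> \<Longrightarrow> homogeneous (i + j) (\<alpha> \<wedge> \<beta>)"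
  unfolding homogeneous_def wedge_def by (intro allI impI alt_wedge_degree[of i _ j]) auto

lemma closed_const_X: "alt_multilinear a \<Longrightarrow> closed_on (Fix id) (\<lambda>z. a)"
  by (rule closed_on_const)

lemma class_degrees: "unit_cls \<in> Hdeg 0" "Theta_cls \<in> Hdeg 2" "q_cls \<in> Hdeg 4" "p \<in> F \<Longrightarrow> U_cls p \<in> Hdeg 2" "E_cls \<in> Hdeg 1"
proof -
  have h: "homogeneous k (\<lambda>z. a)" if "\<And>us. length us \<noteq> k \<Longrightarrow> a us = 0" for k a using that by (simp add: homogeneous_def)
  have I: "in_sector id (\<lambda>z. a) \<in> Hdeg k" if "alt_multilinear a" "\<And>us. length us \<noteq> k \<Longrightarrow> a us = 0" for k a
    by (rule in_sector_Hdeg[OF Ghat_elts(1) closed_const_X[OF that(1)]]) (use h that(2) in \<open>simp_all add: shift_values del: id_apply\<close>)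
  show "unit_cls \<in> Hdeg 0" unfolding unit_eq by (rule I[OF alt_alt_one]) (simp add: alt_one_def)
  show "q_cls \<in> Hdeg 4" unfolding q_eq by (rule I[OF alt_qf qf_degree])
  have d: "alt_wedge (cov f) (cov g) us = 0" if "length us \<noteq> 2" for f g us
    by (rule alt_wedge_cov_degree[of 1]) (use that in \<open>auto simp: cov_def numeral_2_eq_2 split: list.split\<close>)
  show "Theta_cls \<in> Hdeg 2" unfolding Theta_eq by (intro Hdeg_add Hdeg_scale I alt_cov_pair d)
  have one: "homogeneous 0 one_form" by (simp add: homogeneous_def one_form_def)
  show "E_cls \<in> Hdeg 1" using orbit_Hdeg[OF closed_one one] by (simp add: E_eq)
  show "U_cls p \<in> Hdeg 2" if p: "p \<in> F"
  proof -
    have c1: "closed_on (Fix rot) (point_fun p)" using closed_on_F[OF point_fun(1)[OF p]] by (simp add: F_def)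
    have c2: "closed_on (Fix (rot ^^ 2)) (point_fun p)" using closed_on_F[OF point_fun(1)[OF p]] by (simp add: Fix_rot2)
    have e: "U_cls p = in_sector rot (point_fun p) + in_sector (rot ^^ 2) (point_fun p)"
      by (simp add: U_cls_def u_cls_def)
    show ?thesis
      unfolding e by (intro Hdeg_add in_sector_Hdeg Ghat_elts c1 c2) (simp_all add: shift_values point_fun(2)[OF p])
  qed
qed

section \<open>Multiplication in coordinates\<close>

text \<open>The rules below evaluate whole sums over \<open>F\<close>; this congruence rule would rewrite inside them first.\<close>

declare sum.cong_simp [cong del]

lemma coords_neg [simp]: "cid (- \<xi>) us = - cid \<xi> us" "p \<in> F \<Longrightarrow> cpt rot (- \<xi>) p = - cpt rot \<xi> p"
  "inner_list 0 us \<Longrightarrow> cL 0 (- \<xi>) us = - cL 0 \<xi> us"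
  using cid_linear(3)[of "-1"] cpt_linear(3)[of p "-1"] cL_linear(3)[of 0 us "-1"] by simp_all

definition Usum :: "(point \<Rightarrow> real) \<Rightarrow> labelled" where
  "Usum c = (\<Sum>p\<in>F. c p *\<^sub>R U_cls p)"

lemma W_eq: "W_cls = Usum (\<lambda>p. 1)"
  by (simp add: W_cls_def Usum_def)

lemma H_Ori_closure [simp]:
  "\<xi> \<in> H_Ori \<Longrightarrow> \<eta> \<in> H_Ori \<Longrightarrow> \<xi> + \<eta> \<in> H_Ori" "\<xi> \<in> H_Ori \<Longrightarrow> \<eta> \<in> H_Ori \<Longrightarrow> \<xi> - \<eta> \<in> H_Ori"
  "\<xi> \<in> H_Ori \<Longrightarrow> c *\<^sub>R \<xi> \<in> H_Ori" "0 \<in> H_Ori" "\<xi> \<in> H_Ori \<Longrightarrow> \<eta> \<in> H_Ori \<Longrightarrow> \<xi> \<star> \<eta> \<in> H_Ori"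
  "\<xi> \<in> H_Ori \<Longrightarrow> - \<xi> \<in> H_Ori"
  using H_Ori_subspace by (simp_all add: subspace_neg subspace_add subspace_diff subspace_scale subspace_0 star_in_H)

lemmas [simp] = unit_in_H q_in_H Theta_in_H U_in_H E_in_H

lemma Usum_in_H [simp]: "Usum c \<in> H_Ori"
  unfolding Usum_def by (rule subspace_sum[OF H_Ori_subspace]) simp

lemma std_values: "alt_one [] = 1" "alt_one [e1, e4] = 0" "alt_one std = 0" "thf [] = 0" "thf [e1, e4] = 1" "thf std = 0"
  "qf [] = 0" "qf [e1, e4] = 0" "qf std = 1"
  using qf_std by (simp_all add: alt_one_def thf_values std_def qf_degree)

lemma unit_table [simp]: "cid unit_cls [] = 1" "cid unit_cls [e1, e4] = 0" "cid unit_cls std = 0" "p \<in> F \<Longrightarrow> cpt rot unit_cls p = 0"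
  "cL 0 unit_cls [] = 0" "cL 0 unit_cls [b1] = 0" "cL 0 unit_cls [b2] = 0" "cL 0 unit_cls (bs 0) = 0"
  by (simp_all add: unit_coords std_values)

lemma Theta_table [simp]: "cid Theta_cls [] = 0" "cid Theta_cls [e1, e4] = 1" "cid Theta_cls std = 0" "p \<in> F \<Longrightarrow> cpt rot Theta_cls p = 0"
  "cL 0 Theta_cls [] = 0" "cL 0 Theta_cls [b1] = 0" "cL 0 Theta_cls [b2] = 0" "cL 0 Theta_cls (bs 0) = 0"
  by (simp_all add: Theta_coords std_values)

lemma q_table [simp]: "cid q_cls [] = 0" "cid q_cls [e1, e4] = 0" "cid q_cls std = 1" "p \<in> F \<Longrightarrow> cpt rot q_cls p = 0"
  "cL 0 q_cls [] = 0" "cL 0 q_cls [b1] = 0" "cL 0 q_cls [b2] = 0" "cL 0 q_cls (bs 0) = 0"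
  by (simp_all add: q_coords std_values)

lemma U_table [simp]:
  assumes "p \<in> F"
  shows "cid (U_cls p) us = 0" "p' \<in> F \<Longrightarrow> cpt rot (U_cls p) p' = (if p' = p then 1 else 0)"
    "cL 0 (U_cls p) [] = 0" "cL 0 (U_cls p) [b1] = 0" "cL 0 (U_cls p) [b2] = 0" "cL 0 (U_cls p) (bs 0) = 0"
  using assms by (simp_all add: U_coords)

lemma E_table [simp]: "cid E_cls us = 0" "p \<in> F \<Longrightarrow> cpt rot E_cls p = 0"
  "cL 0 E_cls [] = 1" "cL 0 E_cls [b1] = 0" "cL 0 E_cls [b2] = 0" "cL 0 E_cls (bs 0) = 0"
  by (simp_all add: E_coords alt_one_def) (simp add: bs0)

lemma Usum_table [simp]: "cid (Usum c) us = 0" "p \<in> F \<Longrightarrow> cpt rot (Usum c) p = c p"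
  "inner_list 0 us \<Longrightarrow> cL 0 (Usum c) us = 0"
proof -
  show "cid (Usum c) us = 0" unfolding Usum_def cid_linear by (rule sum.neutral) simp
  show "cpt rot (Usum c) p = c p" if p: "p \<in> F"
  proof -
    have "cpt rot (Usum c) p = (\<Sum>p'\<in>F. if p' = p then c p' else 0)"
      unfolding Usum_def cpt_linear[OF p] by (rule sum.cong) (simp_all add: p)
    then show ?thesis using p by simp
  qed
  show "cL 0 (Usum c) us = 0" if "inner_list 0 us"
    unfolding Usum_def cL_linear[OF that] by (rule sum.neutral) (simp add: U_coords that)
qed

lemma sum_cpt_zero [simp]:
  "(\<Sum>p\<in>F. cpt rot unit_cls p) = 0" "(\<Sum>p\<in>F. cpt rot Theta_cls p) = 0" "(\<Sum>p\<in>F. cpt rot q_cls p) = 0" "(\<Sum>p\<in>F. cpt rot E_cls p) = 0"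
  "(\<Sum>p\<in>F. cpt rot unit_cls p * f p) = 0" "(\<Sum>p\<in>F. cpt rot Theta_cls p * f p) = 0" "(\<Sum>p\<in>F. cpt rot q_cls p * f p) = 0"
  "(\<Sum>p\<in>F. cpt rot E_cls p * f p) = 0" "(\<Sum>p\<in>F. f p * cpt rot unit_cls p) = 0" "(\<Sum>p\<in>F. f p * cpt rot Theta_cls p) = 0"
  "(\<Sum>p\<in>F. f p * cpt rot q_cls p) = 0" "(\<Sum>p\<in>F. f p * cpt rot E_cls p) = 0"
  by (rule sum.neutral; simp)+

lemma sum_cpt_U [simp]:
  assumes "p \<in> F"
  shows "(\<Sum>p'\<in>F. cpt rot (U_cls p) p') = 1" "(\<Sum>p'\<in>F. cpt rot (U_cls p) p' * f p') = f p" "(\<Sum>p'\<in>F. f p' * cpt rot (U_cls p) p') = f p"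
proof -
  have "(\<Sum>p'\<in>F. cpt rot (U_cls p) p') = (\<Sum>p'\<in>F. if p' = p then 1 else 0)"
    "(\<Sum>p'\<in>F. cpt rot (U_cls p) p' * f p') = (\<Sum>p'\<in>F. if p' = p then f p' else 0)"
    "(\<Sum>p'\<in>F. f p' * cpt rot (U_cls p) p') = (\<Sum>p'\<in>F. if p' = p then f p' else 0)"
    by (rule sum.cong; simp add: assms)+
  then show "(\<Sum>p'\<in>F. cpt rot (U_cls p) p') = 1" "(\<Sum>p'\<in>F. cpt rot (U_cls p) p' * f p') = f p" "(\<Sum>p'\<in>F. f p' * cpt rot (U_cls p) p') = f p"
    using assms by simp_all
qed

lemmas star_table = star_H_values star_H_cpt utwist_def

subsection \<open>Associativity\<close>

text \<open>The sums over \<open>F\<close> that occur inside triple products. The constant 27 is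
  three pairs of reflections at each of nine points.\<close>

lemma sum_cpt_star:
  assumes x: "\<xi> \<in> H_Ori" and y: "\<eta> \<in> H_Ori"
  shows "(\<Sum>p\<in>F. cpt rot (\<xi> \<star> \<eta>) p) = cid \<xi> [] * (\<Sum>p\<in>F. cpt rot \<eta> p) + (\<Sum>p\<in>F. cpt rot \<xi> p) * cid \<eta> [] + 27 * (cL 0 \<xi> [] * cL 0 \<eta> [])"
    "usum (\<xi> \<star> \<eta>) \<zeta> = cid \<xi> [] * usum \<eta> \<zeta> + cid \<eta> [] * usum \<xi> \<zeta> + 3 * cL 0 \<xi> [] * cL 0 \<eta> [] * (\<Sum>p\<in>F. cpt rot \<zeta> p)"
    "usum \<zeta> (\<xi> \<star> \<eta>) = cid \<xi> [] * usum \<zeta> \<eta> + cid \<eta> [] * usum \<zeta> \<xi> + 3 * cL 0 \<xi> [] * cL 0 \<eta> [] * (\<Sum>p\<in>F. cpt rot \<zeta> p)"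
proof -
  show "(\<Sum>p\<in>F. cpt rot (\<xi> \<star> \<eta>) p) = cid \<xi> [] * (\<Sum>p\<in>F. cpt rot \<eta> p) + (\<Sum>p\<in>F. cpt rot \<xi> p) * cid \<eta> [] + 27 * (cL 0 \<xi> [] * cL 0 \<eta> [])"
    by (simp add: star_H_cpt(1)[OF x y] sum.distrib sum_distrib_left sum_distrib_right card_F cong: sum.cong)
  show "usum (\<xi> \<star> \<eta>) \<zeta> = cid \<xi> [] * usum \<eta> \<zeta> + cid \<eta> [] * usum \<xi> \<zeta> + 3 * cL 0 \<xi> [] * cL 0 \<eta> [] * (\<Sum>p\<in>F. cpt rot \<zeta> p)"
    "usum \<zeta> (\<xi> \<star> \<eta>) = cid \<xi> [] * usum \<zeta> \<eta> + cid \<eta> [] * usum \<zeta> \<xi> + 3 * cL 0 \<xi> [] * cL 0 \<eta> [] * (\<Sum>p\<in>F. cpt rot \<zeta> p)"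
    unfolding sum_distrib_left sum.distrib[symmetric]
    by (rule sum.cong; simp add: star_H_cpt(1)[OF x y] algebra_simps)+
qed

text \<open>In coordinates this is a polynomial identity. Beyond the terms with a unit component it
  rests on matching constants: 6 * (-3) = 3 * (-6) for \<open>E\<close>, \<open>E\<close> and
  \<Theta>, and 2 * 3 = 3 * 2 for \<open>E\<close>, \<open>E\<close> and a point class.\<close>

lemma star_assoc:
  assumes "\<xi> \<in> H_Ori" "\<eta> \<in> H_Ori" "\<zeta> \<in> H_Ori"
  shows "\<xi> \<star> \<eta> \<star> \<zeta> = \<xi> \<star> (\<eta> \<star> \<zeta>)"
  by (rule H_Ori_eqI) (simp_all add: assms star_table sum_cpt_star algebra_simps)

lemma star_bilinear:
  assumes [simp]: "\<xi> \<in> H_Ori" "\<eta> \<in> H_Ori" "\<zeta> \<in> H_Ori"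
  shows "(\<xi> + \<eta>) \<star> \<zeta> = \<xi> \<star> \<zeta> + \<eta> \<star> \<zeta>" "\<zeta> \<star> (\<xi> + \<eta>) = \<zeta> \<star> \<xi> + \<zeta> \<star> \<eta>"
    "(c *\<^sub>R \<xi>) \<star> \<eta> = c *\<^sub>R (\<xi> \<star> \<eta>)" "\<xi> \<star> (c *\<^sub>R \<eta>) = c *\<^sub>R (\<xi> \<star> \<eta>)"
proof -
  have s: "(\<Sum>p\<in>F. cpt rot (\<xi> + \<eta>) p) = (\<Sum>p\<in>F. cpt rot \<xi> p) + (\<Sum>p\<in>F. cpt rot \<eta> p)"
    "usum (\<xi> + \<eta>) \<zeta> = usum \<xi> \<zeta> + usum \<eta> \<zeta>" "usum \<zeta> (\<xi> + \<eta>) = usum \<zeta> \<xi> + usum \<zeta> \<eta>"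
    "(\<Sum>p\<in>F. cpt rot (c *\<^sub>R \<xi>) p) = c * (\<Sum>p\<in>F. cpt rot \<xi> p)" "(\<Sum>p\<in>F. cpt rot (c *\<^sub>R \<eta>) p) = c * (\<Sum>p\<in>F. cpt rot \<eta> p)"
    "usum (c *\<^sub>R \<xi>) \<eta> = c * usum \<xi> \<eta>" "usum \<xi> (c *\<^sub>R \<eta>) = c * usum \<xi> \<eta>"
    unfolding sum_distrib_left sum.distrib[symmetric] by (rule sum.cong; simp add: algebra_simps)+
  show "(\<xi> + \<eta>) \<star> \<zeta> = \<xi> \<star> \<zeta> + \<eta> \<star> \<zeta>" "\<zeta> \<star> (\<xi> + \<eta>) = \<zeta> \<star> \<xi> + \<zeta> \<star> \<eta>"
    by (rule H_Ori_eqI; simp add: star_table s; (simp add: algebra_simps)?)+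
  show "(c *\<^sub>R \<xi>) \<star> \<eta> = c *\<^sub>R (\<xi> \<star> \<eta>)" "\<xi> \<star> (c *\<^sub>R \<eta>) = c *\<^sub>R (\<xi> \<star> \<eta>)"
    by (rule H_Ori_eqI; simp add: star_table s; (simp add: algebra_simps)?)+
qed

lemma star_unit:
  assumes "\<xi> \<in> H_Ori" shows "unit_cls \<star> \<xi> = \<xi>" "\<xi> \<star> unit_cls = \<xi>"
  by (rule H_Ori_eqI; simp add: assms star_table)+

lemma assoc_algebra: "assoc_algebra_on H_Ori (\<star>) unit_cls"
  unfolding assoc_algebra_on_def
  by (intro conjI ballI allI H_Ori_subspace unit_in_H star_in_H star_bilinear star_assoc star_unit) assumption+

text \<open>Each monomial of the product pairs coordinates that live in degrees with sum at most 4,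
  so for larger degrees one of its two factors vanishes.\<close>

lemma star_degree_zero:
  assumes "\<xi> \<in> H_Ori \<inter> Hdeg k" "\<eta> \<in> H_Ori \<inter> Hdeg l" and kl: "k + l > 4"
  shows "\<xi> \<star> \<eta> = 0"
proof -
  have x: "\<xi> \<in> H_Ori" "\<xi> \<in> Hdeg k" and y: "\<eta> \<in> H_Ori" "\<eta> \<in> Hdeg l" using assms by blast+
  have c: "k \<noteq> 0 \<longrightarrow> cid \<zeta> [] = 0" "k \<noteq> 2 \<longrightarrow> cid \<zeta> [e1, e4] = 0" "k \<noteq> 4 \<longrightarrow> cid \<zeta> std = 0"
    "k \<noteq> 1 \<longrightarrow> cL 0 \<zeta> [] = 0" "k \<noteq> 2 \<longrightarrow> cL 0 \<zeta> [b1] = 0" "k \<noteq> 2 \<longrightarrow> cL 0 \<zeta> [b2] = 0" "k \<noteq> 3 \<longrightarrow> cL 0 \<zeta> (bs 0) = 0"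
    "p \<in> F \<Longrightarrow> k \<noteq> 2 \<longrightarrow> cpt rot \<zeta> p = 0" "k \<noteq> 2 \<longrightarrow> (\<Sum>p\<in>F. cpt rot \<zeta> p) = 0"
    if "\<zeta> \<in> Hdeg k" for \<zeta> k p
    using Hdeg_coords(1)[OF that, of "[]"] Hdeg_coords(1)[OF that, of "[e1, e4]"] Hdeg_coords(1)[OF that, of std]
      Hdeg_coords(2)[OF that] Hdeg_coords(3)[OF that inner_list_0(1)] Hdeg_coords(3)[OF that inner_list_0(2)]
      Hdeg_coords(3)[OF that inner_list_0(3)] Hdeg_coords(3)[OF that inner_list_0(4)]
    by (simp_all add: std_def bs0 sum.neutral)
  have Z: "u * v = 0" if "k \<noteq> i \<longrightarrow> u = 0" "l \<noteq> j \<longrightarrow> v = 0" "i + j \<le> 4" for u v :: real and i j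
    using that kl by fastforce
  note cx = c[OF x(2)] and cy = c[OF y(2)]
  have z: "cid \<xi> [] * cid \<eta> [] = 0"
    "cid \<xi> [] * cid \<eta> [e1, e4] = 0"
    "cid \<xi> [e1, e4] * cid \<eta> [] = 0"
    "cL 0 \<xi> [] * cL 0 \<eta> [] = 0"
    "cid \<xi> [] * cid \<eta> std = 0"
    "cid \<xi> std * cid \<eta> [] = 0"
    "cid \<xi> [e1, e4] * cid \<eta> [e1, e4] = 0"
    "cL 0 \<xi> [] * cL 0 \<eta> (bs 0) = 0"
    "cL 0 \<xi> (bs 0) * cL 0 \<eta> [] = 0"
    "cL 0 \<xi> [b1] * cL 0 \<eta> [b2] = 0"
    "cL 0 \<xi> [b2] * cL 0 \<eta> [b1] = 0"
    "cid \<xi> [] * cL 0 \<eta> [] = 0"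
    "cL 0 \<xi> [] * cid \<eta> [] = 0"
    "cid \<xi> [] * cL 0 \<eta> [b1] = 0"
    "cL 0 \<xi> [b1] * cid \<eta> [] = 0"
    "cid \<xi> [] * cL 0 \<eta> [b2] = 0"
    "cL 0 \<xi> [b2] * cid \<eta> [] = 0"
    "cid \<xi> [] * cL 0 \<eta> (bs 0) = 0"
    "cL 0 \<xi> (bs 0) * cid \<eta> [] = 0"
    "cid \<xi> [e1, e4] * cL 0 \<eta> [] = 0"
    "cL 0 \<xi> [] * cid \<eta> [e1, e4] = 0"
    "(\<Sum>p\<in>F. cpt rot \<xi> p) * cL 0 \<eta> [] = 0"
    "cL 0 \<xi> [] * (\<Sum>p\<in>F. cpt rot \<eta> p) = 0"
    by (rule Z[OF cx(1) cy(1)] Z[OF cx(1) cy(2)] Z[OF cx(2) cy(1)] Z[OF cx(4) cy(4)] Z[OF cx(1) cy(3)] Z[OF cx(3) cy(1)] Z[OF cx(2) cy(2)] Z[OF cx(4) cy(7)] Z[OF cx(7) cy(4)] Z[OF cx(5) cy(6)] Z[OF cx(6) cy(5)] Z[OF cx(1) cy(4)] Z[OF cx(4) cy(1)] Z[OF cx(1) cy(5)] Z[OF cx(5) cy(1)] Z[OF cx(1) cy(6)] Z[OF cx(6) cy(1)] Z[OF cx(1) cy(7)] Z[OF cx(7) cy(1)] Z[OF cx(2) cy(4)] Z[OF cx(4) cy(2)] Z[OF cx(9) cy(4)] Z[OF cx(4) cy(9)]; simp; fail)+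
  have pu: "cid \<xi> [] * cpt rot \<eta> p = 0" "cpt rot \<xi> p * cid \<eta> [] = 0" "cpt rot \<xi> p * cpt rot \<eta> p = 0" if "p \<in> F" for p
    by (rule Z[OF cx(1) cy(8)[OF that]] Z[OF cx(8)[OF that] cy(1)] Z[OF cx(8)[OF that] cy(8)[OF that]]; simp; fail)+
  have us: "usum \<xi> \<eta> = 0" by (rule sum.neutral) (simp add: pu)
  show ?thesis
    by (rule H_Ori_eqI) (simp_all add: x(1) y(1) star_table pu us mult.assoc z)
qed

section \<open>The basis\<close>

lemma independent_functionals:
  fixes S :: "'a::real_vector set"
  assumes "\<And>b. b \<in> S \<Longrightarrow> \<exists>f :: 'a \<Rightarrow> real. linear f \<and> f b \<noteq> 0 \<and> (\<forall>x\<in>S - {b}. f x = 0)"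
  shows "independent S"
  unfolding dependent_def
proof
  assume "\<exists>a\<in>S. a \<in> span (S - {a})"
  then obtain a where a: "a \<in> S" "a \<in> span (S - {a})" by blast
  then obtain f :: "'a \<Rightarrow> real" where f: "linear f" "f a \<noteq> 0" "\<forall>x\<in>S - {a}. f x = 0" using assms by blast
  then show False using linear_eq_0_on_span[OF f(1), of "S - {a}" a] a(2) by blast
qed

locale oriented_H1 =
  fixes a0 b0 :: form
  assumes ab: "oriented_H1_basis (L 0) a0 b0"
begin

abbreviation "A \<equiv> orbit_cls a0"
abbreviation "B \<equiv> orbit_cls b0"
abbreviation "T \<equiv> T_cls a0 b0"
abbreviation "basis \<equiv> {unit_cls, Theta_cls, q_cls} \<union> U_cls ` F \<union> {E_cls, A, B, T}"

lemma closed: "closed_on (L 0) a0" "closed_on (L 0) b0" "closed_on (L 0) (a0 \<wedge> b0)"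
  and degree: "homogeneous 1 a0" "homogeneous 1 b0"
  using ab by (auto simp: oriented_H1_basis_def integral_H1_def intro: closed_on_wedge)

text \<open>The matrix of periods of \<open>a0\<close> and \<open>b0\<close> along the frame vectors
  of \<open>L 0\<close>. All dependence on the chosen integral basis passes through it, and
  \<open>det\<close> says that its determinant is 1.\<close>

definition "\<alpha>1 = avg (bs 0) a0 [b1]"
definition "\<alpha>2 = avg (bs 0) a0 [b2]"
definition "\<beta>1 = avg (bs 0) b0 [b1]"
definition "\<beta>2 = avg (bs 0) b0 [b2]"

lemma avg_values:
  "avg (bs 0) a0 [] = 0" "avg (bs 0) b0 [] = 0" "avg (bs 0) a0 (bs 0) = 0" "avg (bs 0) b0 (bs 0) = 0"
  "avg (bs 0) a0 [b1, b2] = 0" "avg (bs 0) b0 [b1, b2] = 0"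
  by (simp_all add: avg_homogeneous[OF degree(1)] avg_homogeneous[OF degree(2)] bs0)

lemma det: "\<alpha>1 * \<beta>2 = 1 + \<alpha>2 * \<beta>1"
proof -
  have "integral_over (L 0) (a0 \<wedge> b0) = 1" using ab by (simp add: oriented_H1_basis_def)
  then have "alt_wedge (avg (bs 0) a0) (avg (bs 0) b0) [b1, b2] = 1"
    using integral_wedge_torus[OF torus_s(1)] closed(1,2) by (simp add: L_simps) (simp add: bs0)
  then show ?thesis by (simp add: alt_wedge_pair avg_values \<alpha>1_def \<alpha>2_def \<beta>1_def \<beta>2_def)
qed

lemma avg_ab: "inner_list 0 us \<Longrightarrow> avg (bs 0) (a0 \<wedge> b0) us = alt_wedge (avg (bs 0) a0) (avg (bs 0) b0) us"
  using avg_wedge[OF torusD(2)[OF torus_s(1)]] closed(1,2) inner_listD(2) by (simp add: L_simps)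

lemma in_H [simp]: "A \<in> H_Ori" "B \<in> H_Ori" "T \<in> H_Ori"
  by (simp_all add: T_eq orbit_in_H closed)

lemma A_table [simp]: "cid A us = 0" "p \<in> F \<Longrightarrow> cpt rot A p = 0" "cL 0 A [] = 0" "cL 0 A [b1] = \<alpha>1" "cL 0 A [b2] = \<alpha>2" "cL 0 A (bs 0) = 0"
  and B_table [simp]: "cid B us = 0" "p \<in> F \<Longrightarrow> cpt rot B p = 0" "cL 0 B [] = 0" "cL 0 B [b1] = \<beta>1" "cL 0 B [b2] = \<beta>2" "cL 0 B (bs 0) = 0"
  by (simp_all add: orbit_coords closed avg_values \<alpha>1_def \<alpha>2_def \<beta>1_def \<beta>2_def)

lemma T_table [simp]: "cid T us = 0" "p \<in> F \<Longrightarrow> cpt rot T p = 0" "cL 0 T [] = 0" "cL 0 T [b1] = 0" "cL 0 T [b2] = 0" "cL 0 T (bs 0) = 1"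
proof -
  have "alt_wedge (avg (bs 0) a0) (avg (bs 0) b0) (bs 0) = 1"
    using det unfolding bs0 alt_wedge_pair unfolding bs0[symmetric] by (simp add: avg_values \<alpha>1_def \<alpha>2_def \<beta>1_def \<beta>2_def)
  then show "cid T us = 0" "p \<in> F \<Longrightarrow> cpt rot T p = 0" "cL 0 T [] = 0" "cL 0 T [b1] = 0" "cL 0 T [b2] = 0" "cL 0 T (bs 0) = 1"
    by (simp_all add: T_eq orbit_coords closed avg_ab alt_wedge_single avg_values)
qed

lemma sum_cpt_zero' [simp]:
  "(\<Sum>p\<in>F. cpt rot A p) = 0" "(\<Sum>p\<in>F. cpt rot B p) = 0" "(\<Sum>p\<in>F. cpt rot T p) = 0"
  "(\<Sum>p\<in>F. cpt rot A p * f p) = 0" "(\<Sum>p\<in>F. cpt rot B p * f p) = 0" "(\<Sum>p\<in>F. cpt rot T p * f p) = 0"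
  "(\<Sum>p\<in>F. f p * cpt rot A p) = 0" "(\<Sum>p\<in>F. f p * cpt rot B p) = 0" "(\<Sum>p\<in>F. f p * cpt rot T p) = 0"
  by (rule sum.neutral; simp)+

text \<open>Cramer's rule for the components along \<open>A\<close> and \<open>B\<close>; no
  division occurs, as the period matrix has determinant 1.\<close>

definition "kA \<xi> = \<beta>2 * cL 0 \<xi> [b1] - \<beta>1 * cL 0 \<xi> [b2]"
definition "kB \<xi> = \<alpha>1 * cL 0 \<xi> [b2] - \<alpha>2 * cL 0 \<xi> [b1]"

lemma dual_AB: "kA A = 1" "kA B = 0" "kB A = 0" "kB B = 1"
  using det by (simp_all add: kA_def kB_def mult.commute)

lemma kAB_zero: "kA unit_cls = 0" "kA Theta_cls = 0" "kA q_cls = 0" "p \<in> F \<Longrightarrow> kA (U_cls p) = 0" "kA E_cls = 0" "kA T = 0"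
  "kB unit_cls = 0" "kB Theta_cls = 0" "kB q_cls = 0" "p \<in> F \<Longrightarrow> kB (U_cls p) = 0" "kB E_cls = 0" "kB T = 0"
  by (simp_all add: kA_def kB_def)

text \<open>The dual functionals are stated as naming the only class on which they do not vanish,
  rather than as a Kronecker delta. In this form they serve both independence and the list of
  nonzero pairings.\<close>

lemma basis_dual:
  assumes "x \<in> basis"
  shows "cid x [] \<noteq> 0 \<Longrightarrow> x = unit_cls" "cid x [e1, e4] \<noteq> 0 \<Longrightarrow> x = Theta_cls" "cid x std \<noteq> 0 \<Longrightarrow> x = q_cls"
    "p \<in> F \<Longrightarrow> cpt rot x p \<noteq> 0 \<Longrightarrow> x = U_cls p" "cL 0 x [] \<noteq> 0 \<Longrightarrow> x = E_cls" "kA x \<noteq> 0 \<Longrightarrow> x = A" "kB x \<noteq> 0 \<Longrightarrow> x = B"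
    "cL 0 x (bs 0) \<noteq> 0 \<Longrightarrow> x = T"
  using assms by (auto simp: dual_AB kAB_zero split: if_splits)

lemma linear_kAB: "linear kA" "linear kB"
  by (rule linearI; simp add: kA_def kB_def algebra_simps)+

lemma expansion:
  assumes x [simp]: "\<xi> \<in> H_Ori"
  shows "\<xi> = cid \<xi> [] *\<^sub>R unit_cls + cid \<xi> [e1, e4] *\<^sub>R Theta_cls + cid \<xi> std *\<^sub>R q_cls + Usum (cpt rot \<xi>)
    + cL 0 \<xi> [] *\<^sub>R E_cls + kA \<xi> *\<^sub>R A + kB \<xi> *\<^sub>R B + cL 0 \<xi> (bs 0) *\<^sub>R T" (is "_ = ?r")
proof -
  have "kA \<xi> * \<alpha>1 + kB \<xi> * \<beta>1 = (\<alpha>1 * \<beta>2 - \<alpha>2 * \<beta>1) * cL 0 \<xi> [b1]" "kA \<xi> * \<alpha>2 + kB \<xi> * \<beta>2 = (\<alpha>1 * \<beta>2 - \<alpha>2 * \<beta>1) * cL 0 \<xi> [b2]"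
    by (simp_all add: kA_def kB_def algebra_simps)
  then have k: "kA \<xi> * \<alpha>1 + kB \<xi> * \<beta>1 = cL 0 \<xi> [b1]" "kA \<xi> * \<alpha>2 + kB \<xi> * \<beta>2 = cL 0 \<xi> [b2]"
    by (simp_all add: det)
  show ?thesis by (rule H_Ori_eqI) (simp_all add: k)
qed

lemma basis_in_H: "basis \<subseteq> H_Ori"
  by auto

lemma span_basis: "span basis = H_Ori"
proof
  show "span basis \<subseteq> H_Ori" by (rule span_minimal[OF basis_in_H H_Ori_subspace])
  have U: "Usum c \<in> span basis" for c
    unfolding Usum_def by (intro span_sum span_scale span_base) auto
  show "H_Ori \<subseteq> span basis"
  proof
    fix \<xi> assume x: "\<xi> \<in> H_Ori"
    show "\<xi> \<in> span basis"
      by (subst expansion[OF x]) (intro span_add span_scale U; rule span_base; simp)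
  qed
qed

lemma independent_basis: "independent basis"
proof (rule independent_functionals)
  have D: "\<exists>f :: labelled \<Rightarrow> real. linear f \<and> f b \<noteq> 0 \<and> (\<forall>x\<in>basis - {b}. f x = 0)"
    if "linear f" "f b \<noteq> 0" "\<And>x. x \<in> basis \<Longrightarrow> f x \<noteq> 0 \<Longrightarrow> x = b" for f :: "labelled \<Rightarrow> real" and b
    by (rule exI[of _ f]) (use that in blast)
  fix b assume "b \<in> basis"
  then consider "b = unit_cls" | "b = Theta_cls" | "b = q_cls" | p where "p \<in> F" "b = U_cls p" | "b = E_cls" | "b = A" | "b = B" | "b = T"
    by blast
  then show "\<exists>f :: labelled \<Rightarrow> real. linear f \<and> f b \<noteq> 0 \<and> (\<forall>x\<in>basis - {b}. f x = 0)"
  proof cases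
    case 1 show ?thesis by (rule D[OF linear_coordinates(1)[of "[]"]], simp add: 1 dual_AB, unfold 1, rule basis_dual(1), assumption+)
  next
    case 2 show ?thesis by (rule D[OF linear_coordinates(1)[of "[e1, e4]"]], simp add: 2 dual_AB, unfold 2, rule basis_dual(2), assumption+)
  next
    case 3 show ?thesis by (rule D[OF linear_coordinates(1)[of std]], simp add: 3 dual_AB, unfold 3, rule basis_dual(3), assumption+)
  next
    case 4 show ?thesis by (rule D[OF linear_coordinates(2)[OF 4(1)]], simp add: 4 dual_AB, unfold 4(2), rule basis_dual(4)[OF _ 4(1)], assumption+)
  next
    case 5 show ?thesis by (rule D[OF linear_coordinates(4)[OF inner_list_0(1)]], simp add: 5 dual_AB, unfold 5, rule basis_dual(5), assumption+)
  next
    case 6 show ?thesis by (rule D[OF linear_kAB(1)], simp add: 6 dual_AB, unfold 6, rule basis_dual(6), assumption+)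
  next
    case 7 show ?thesis by (rule D[OF linear_kAB(2)], simp add: 7 dual_AB, unfold 7, rule basis_dual(7), assumption+)
  next
    case 8 show ?thesis by (rule D[OF linear_coordinates(4)[OF inner_list_0(4)]], simp add: 8 dual_AB, unfold 8, rule basis_dual(8), assumption+)
  qed
qed

lemma card_basis: "card basis = 16"
proof -
  \<comment> \<open>Six functionals separate seven classes: \<open>B\<close> is the one on which all
    of them vanish.\<close>
  let ?g = "\<lambda>\<xi>. (cid \<xi> [], cid \<xi> [e1, e4], cid \<xi> std, cL 0 \<xi> [], kA \<xi>, cL 0 \<xi> (bs 0))"
  let ?l = "[unit_cls, Theta_cls, q_cls, E_cls, A, B, T]"
  have "distinct (map ?g ?l)"
    by (simp add: dual_AB)
  then have d: "distinct ?l" unfolding distinct_map by blast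
  have inj: "inj_on U_cls F"
    by (rule inj_onI) (metis U_table(2) zero_neq_one)
  \<comment> \<open>The sum over \<open>F\<close> is 1 on every point class and 0 on the other
    seven, which separates the two groups.\<close>
  have "(\<Sum>p\<in>F. cpt rot x p) = 0" if "x \<in> set ?l" for x using that by auto
  then have disj: "U_cls ` F \<inter> set ?l = {}" by (force dest: sum_cpt_U(1))
  have "basis = U_cls ` F \<union> set ?l" by auto
  then show ?thesis using distinct_card[OF d] disj by (simp add: card_Un_disjoint card_image[OF inj] card_F del: set_simps)
qed

lemma dim_H_Ori: "dim H_Ori = 16"
  using dim_span_eq_card_independent[OF independent_basis] unfolding span_basis card_basis .

section \<open>The multiplication table and the trace\<close>

lemma products:
  "Theta_cls \<star> Theta_cls = 6 *\<^sub>R q_cls" "E_cls \<star> E_cls = 3 *\<^sub>R (W_cls - Theta_cls)"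
  "Theta_cls \<star> E_cls = (-6) *\<^sub>R T" "E_cls \<star> Theta_cls = (-6) *\<^sub>R T"
  "E_cls \<star> T = 3 *\<^sub>R q_cls" "T \<star> E_cls = 3 *\<^sub>R q_cls" "A \<star> B = 3 *\<^sub>R q_cls" "B \<star> A = (-3) *\<^sub>R q_cls"
  "E_cls \<star> A = 0" "A \<star> E_cls = 0" "E_cls \<star> B = 0" "B \<star> E_cls = 0" "A \<star> A = 0" "B \<star> B = 0"
  by (rule H_Ori_eqI; simp add: star_table W_eq det algebra_simps)+

lemma U_products:
  assumes "p \<in> F"
  shows "p' \<in> F \<Longrightarrow> U_cls p \<star> U_cls p' = (if p = p' then 2 *\<^sub>R q_cls else 0)"
    "U_cls p \<star> E_cls = 2 *\<^sub>R T" "E_cls \<star> U_cls p = 2 *\<^sub>R T" "Theta_cls \<star> U_cls p = 0" "U_cls p \<star> Theta_cls = 0"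
  by (rule H_Ori_eqI; simp add: assms star_table)+

lemma zero_products:
  assumes "y \<in> {A, B, T}"
  shows "Theta_cls \<star> y = 0" "y \<star> Theta_cls = 0" "p \<in> F \<Longrightarrow> U_cls p \<star> y = 0" "p \<in> F \<Longrightarrow> y \<star> U_cls p = 0" "T \<star> y = 0" "y \<star> T = 0"
  using assms by (elim insertE emptyE; hypsubst; intro H_Ori_eqI; simp add: star_table)+

text \<open>In each product coordinate, the top value of the untwisted part is multiplied by the
  unit coefficient of the other factor alone, and that coefficient vanishes here.\<close>

lemma q_products:
  assumes "x \<in> basis - {unit_cls}" shows "q_cls \<star> x = 0" "x \<star> q_cls = 0"
proof -
  have x: "x \<in> H_Ori" using assms basis_in_H by blast
  have "cid x [] = 0" using assms by auto
  then show "q_cls \<star> x = 0" "x \<star> q_cls = 0" by (intro H_Ori_eqI; simp add: x star_table)+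
qed

lemma degrees: "A \<in> Hdeg 2" "B \<in> Hdeg 2" "T \<in> Hdeg 3"
  using orbit_Hdeg[OF closed(1) degree(1)] orbit_Hdeg[OF closed(2) degree(2)]
    orbit_Hdeg[OF closed(3) homogeneous_wedge[OF degree]]
  by (simp_all add: T_eq numeral_2_eq_2 numeral_3_eq_3)

text \<open>The value on the standard frame is the coefficient of q, that is, the integral of the
  untwisted part over \<open>X\<close>.\<close>

abbreviation "tr \<equiv> \<lambda>\<xi>. cid \<xi> std"

lemma tr_basis: "tr q_cls = 1" "x \<in> basis - {q_cls} \<Longrightarrow> tr x = 0"
  by auto

lemma tr_unique:
  assumes "linear f \<and> f q_cls = 1 \<and> (\<forall>x\<in>basis - {q_cls}. f x = 0)" "\<xi> \<in> H_Ori"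
  shows "f \<xi> = tr \<xi>"
proof (rule linear_eq_on_span[OF _ linear_coordinates(1), of f basis])
  show "f b = tr b" if "b \<in> basis" for b
    using assms(1) tr_basis that by (cases "b = q_cls") auto
qed (use assms span_basis in auto)

lemma tr_values:
  "tr (unit_cls \<star> q_cls) = 1" "tr (q_cls \<star> unit_cls) = 1" "tr (Theta_cls \<star> Theta_cls) = 6"
  "p \<in> F \<Longrightarrow> p' \<in> F \<Longrightarrow> tr (U_cls p \<star> U_cls p') = (if p = p' then 2 else 0)"
  "tr (E_cls \<star> T) = 3" "tr (T \<star> E_cls) = 3" "tr (A \<star> B) = 3" "tr (B \<star> A) = -3"
  by (simp_all add: products U_products star_unit)

lemma tr_invariant: "invariant_on H_Ori (\<star>) (\<lambda>x y. tr (x \<star> y))"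
  by (simp add: invariant_on_def star_assoc)

lemma tr_nondegenerate: "nondegenerate_on H_Ori (\<lambda>x y. tr (x \<star> y))"
proof -
  \<comment> \<open>The disjunction lets one argument serve for the left and the right
    radical.\<close>
  have Z: "x = 0" if x: "x \<in> H_Ori" and z: "\<And>b. b \<in> basis \<Longrightarrow> tr (x \<star> b) = 0 \<or> tr (b \<star> x) = 0" for x
  proof -
    have u: "cpt rot x p = 0" if "p \<in> F" for p
      using z[of "U_cls p"] that by (simp add: x star_table)
    \<comment> \<open>Pairing with the dual basis element reads off each coordinate up to a nonzero
      factor, whichever side it is taken on.\<close>
    have k: "cid x [] = 0" "cid x [e1, e4] = 0" "cid x std = 0" "cL 0 x [] = 0" "cL 0 x (bs 0) = 0"
      "kA x = 0" "kB x = 0"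
      using z[of q_cls] z[of Theta_cls] z[of unit_cls] z[of T] z[of E_cls] z[of B] z[of A]
      by (auto simp: x star_table kA_def kB_def algebra_simps)
    have "Usum (cpt rot x) = 0" unfolding Usum_def by (rule sum.neutral) (simp add: u)
    then show ?thesis using expansion[OF x] k by simp
  qed
  show ?thesis unfolding nondegenerate_on_def using Z basis_in_H by (intro conjI ballI impI) (blast)+
qed

text \<open>Pairing with a fixed basis element is a nonzero multiple of one dual functional, and
  \<open>basis_dual\<close> names its only partner.\<close>

lemma tr_pairs:
  assumes "x \<in> basis" "y \<in> basis" "tr (x \<star> y) \<noteq> 0"
  shows "(x, y) \<in> {(unit_cls, q_cls), (q_cls, unit_cls), (Theta_cls, Theta_cls),
    (E_cls, T), (T, E_cls), (A, B), (B, A)} \<union> {(U_cls p, U_cls p) | p. p \<in> F}"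
proof -
  have y: "y \<in> H_Ori" using assms(2) basis_in_H by blast
  note D = basis_dual[OF assms(2)]
  consider "x = unit_cls" | "x = Theta_cls" | "x = q_cls" | p where "p \<in> F" "x = U_cls p" | "x = E_cls" | "x = A" | "x = B" | "x = T"
    using assms(1) by blast
  then show ?thesis
  proof cases
    case 1 then have "cid y std \<noteq> 0" using assms(3) by (simp add: star_table y)
    then show ?thesis using D(3) 1 by blast
  next
    case 2 then have "cid y [e1, e4] \<noteq> 0" using assms(3) by (simp add: star_table y)
    then show ?thesis using D(2) 2 by blast
  next
    case 3 then have "cid y [] \<noteq> 0" using assms(3) by (simp add: star_table y)
    then show ?thesis using D(1) 3 by blast
  next
    case 4 then have "cpt rot y p \<noteq> 0" using assms(3) by (simp add: star_table y)
    then show ?thesis using D(4) 4 by blast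
  next
    case 5 then have "cL 0 y (bs 0) \<noteq> 0" using assms(3) by (simp add: star_table y)
    then show ?thesis using D(8) 5 by blast
  next
    case 6 then have "kB y \<noteq> 0" using assms(3) by (simp add: star_table y kB_def)
    then show ?thesis using D(7) 6 by blast
  next
    case 7 then have "kA y \<noteq> 0" using assms(3) by (simp add: star_table y kA_def)
    then show ?thesis using D(6) 7 by blast
  next
    case 8 then have "cL 0 y [] \<noteq> 0" using assms(3) by (simp add: star_table y)
    then show ?thesis using D(5) 8 by blast
  qed
qed

text \<open>\<open>E\<close> and \<open>T\<close> have odd degrees 1 and 3, yet they commute and
  their product is not zero; under the trace the sign rule would give 3 = -3.\<close>

lemma not_graded_commutative: "\<not> graded_commutative_on H_Ori (\<star>)"
proof
  assume "graded_commutative_on H_Ori (\<star>)"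
  then have "E_cls \<star> T = (-1) ^ (1 * 3) *\<^sub>R (T \<star> E_cls)"
    unfolding graded_commutative_on_def using class_degrees(5) degrees(3) E_in_H in_H(3) by blast
  then have "tr (3 *\<^sub>R q_cls) = tr ((-1) ^ (1 * 3) *\<^sub>R 3 *\<^sub>R q_cls)" unfolding products by (rule arg_cong)
  then show False by simp
qed

end

theorem theorem1p5:
  fixes a0 b0 :: form and A B T :: labelled and Basis16 :: "labelled set"
  assumes ab: "oriented_H1_basis (L 0) a0 b0"
    and A: "A = orbit_cls a0"
    and B: "B = orbit_cls b0"
    and T: "T = T_cls a0 b0"
    and Basis16: "Basis16 = {unit_cls, Theta_cls, q_cls} \<union> U_cls ` F \<union> {E_cls, A, B, T}"
  shows
    "card Ghat = 6 \<and> Fix (rot ^^ 2) = F \<and> card F = 9 \<and>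
     \<comment> \<open>basis and dimension\<close>
     Basis16 \<subseteq> H_Ori \<and> independent Basis16 \<and> span Basis16 = H_Ori \<and> dim H_Ori = 16 \<and>
     \<comment> \<open>shifted degrees\<close>
     unit_cls \<in> Hdeg 0 \<and> Theta_cls \<in> Hdeg 2 \<and> (\<forall>p\<in>F. U_cls p \<in> Hdeg 2) \<and>
     A \<in> Hdeg 2 \<and> B \<in> Hdeg 2 \<and> q_cls \<in> Hdeg 4 \<and> E_cls \<in> Hdeg 1 \<and> T \<in> Hdeg 3 \<and>
     \<comment> \<open>algebra structure\<close>
     assoc_algebra_on H_Ori (\<star>) unit_cls \<and>
     \<comment> \<open>multiplication table\<close>
     Theta_cls \<star> Theta_cls = 6 *\<^sub>R q_cls \<and>
     (\<forall>p\<in>F. \<forall>p'\<in>F. U_cls p \<star> U_cls p' = (if p = p' then 2 *\<^sub>R q_cls else 0)) \<and>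
     E_cls \<star> E_cls = 3 *\<^sub>R (W_cls - Theta_cls) \<and>
     Theta_cls \<star> E_cls = (-6) *\<^sub>R T \<and> E_cls \<star> Theta_cls = (-6) *\<^sub>R T \<and>
     (\<forall>p\<in>F. U_cls p \<star> E_cls = 2 *\<^sub>R T \<and> E_cls \<star> U_cls p = 2 *\<^sub>R T) \<and>
     E_cls \<star> T = 3 *\<^sub>R q_cls \<and> T \<star> E_cls = 3 *\<^sub>R q_cls \<and>
     A \<star> B = 3 *\<^sub>R q_cls \<and> B \<star> A = (-3) *\<^sub>R q_cls \<and>
     E_cls \<star> A = 0 \<and> A \<star> E_cls = 0 \<and> E_cls \<star> B = 0 \<and> B \<star> E_cls = 0 \<and>
     A \<star> A = 0 \<and> B \<star> B = 0 \<and>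
     (\<forall>p\<in>F. Theta_cls \<star> U_cls p = 0 \<and> U_cls p \<star> Theta_cls = 0) \<and>
     (\<forall>y\<in>{A, B, T}. Theta_cls \<star> y = 0 \<and> y \<star> Theta_cls = 0 \<and>
        (\<forall>p\<in>F. U_cls p \<star> y = 0 \<and> y \<star> U_cls p = 0)) \<and>
     \<comment> \<open>products that vanish for degree reasons\<close>
     (\<forall>x\<in>Basis16 - {unit_cls}. q_cls \<star> x = 0 \<and> x \<star> q_cls = 0) \<and>
     (\<forall>x\<in>{A, B, T}. T \<star> x = 0 \<and> x \<star> T = 0) \<and>
     (\<forall>k l. \<forall>x \<in> H_Ori \<inter> Hdeg k. \<forall>y \<in> H_Ori \<inter> Hdeg l. k + l > 4 \<longrightarrow> x \<star> y = 0) \<and>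
     \<comment> \<open>trace and Frobenius pairing\<close>
     (\<exists>Tr :: labelled \<Rightarrow> real.
        linear Tr \<and> Tr q_cls = 1 \<and> (\<forall>x\<in>Basis16 - {q_cls}. Tr x = 0) \<and>
        (\<forall>Tr' :: labelled \<Rightarrow> real.
           linear Tr' \<and> Tr' q_cls = 1 \<and> (\<forall>x\<in>Basis16 - {q_cls}. Tr' x = 0) \<longrightarrow>
           (\<forall>x\<in>H_Ori. Tr' x = Tr x)) \<and>
        invariant_on H_Ori (\<star>) (\<lambda>x y. Tr (x \<star> y)) \<and>
        nondegenerate_on H_Ori (\<lambda>x y. Tr (x \<star> y)) \<and>
        Tr (unit_cls \<star> q_cls) = 1 \<and> Tr (q_cls \<star> unit_cls) = 1 \<and>
        Tr (Theta_cls \<star> Theta_cls) = 6 \<and>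
        (\<forall>p\<in>F. \<forall>p'\<in>F. Tr (U_cls p \<star> U_cls p') = (if p = p' then 2 else 0)) \<and>
        Tr (E_cls \<star> T) = 3 \<and> Tr (T \<star> E_cls) = 3 \<and>
        Tr (A \<star> B) = 3 \<and> Tr (B \<star> A) = -3 \<and>
        (\<forall>x\<in>Basis16. \<forall>y\<in>Basis16. Tr (x \<star> y) \<noteq> 0 \<longrightarrow>
           (x, y) \<in> {(unit_cls, q_cls), (q_cls, unit_cls), (Theta_cls, Theta_cls),
                      (E_cls, T), (T, E_cls), (A, B), (B, A)} \<union> {(U_cls p, U_cls p) | p. p \<in> F})) \<and>
     \<not> graded_commutative_on H_Ori (\<star>)"
proof -
  interpret oriented_H1 a0 b0 by (rule oriented_H1.intro[OF ab])
  show ?thesis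
    unfolding A B T Basis16
    by (intro conjI exI[of _ tr] allI impI ballI;
      (rule card_Ghat Fix_rot2 card_F basis_in_H independent_basis span_basis dim_H_Ori class_degrees degrees assoc_algebra
        products U_products zero_products q_products star_degree_zero linear_coordinates(1) tr_basis tr_unique tr_invariant
        tr_nondegenerate tr_values tr_pairs not_graded_commutative; assumption))
qed

end
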